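(* Let $n\ge1$ and consider an $(n+2)$-dimensional static, spherically symmetric, asymptotically flat spacetime with line element $ds^2=-F(r)dt^2+G(r)dr^2+r^2d\ell^2_{S^n}$, solving $G_{ab}+\Lambda g_{ab}=8\pi T_{ab}$ with $T^b_a=\mathrm{diag}\{-\rho,p_r,p_\theta,\dots,p_\theta\}$ satisfying the dominant energy condition $|p_r|,|p_\theta|\le\rho<+\infty$. Let $0<r_m^-<\infty$ be such that $0<F(r),G(r)<+\infty$ on $(r_m^-,+\infty)$, $F,F',G\in C^1((r_m^-,+\infty))$, and $\lim_{r\to+\infty}F=\lim_{r\to+\infty}G=1$. Let $m\ge0$, $\Omega=(r_m^-,+\infty)\times S^n$, and let $A$ be the operator on $C_0^\infty(\Omega)$ $$A\psi=-\frac1{r^n}\sqrt{\tfrac{F}{G}}\Big(\partial_r\big(r^n\sqrt{\tfrac{F}{G}}\,\partial_r\psi\big)+r^{n-2}\sqrt{FG}\,\Delta_{S^n}\psi\Big)+m^2F\psi$$ (the spatial part of the Klein–Gordon equation $\Box\psi=m^2\psi$). Then the following are equivalent: (i) the time $T(r\to r_m^-)=\int_{r_m^-}^{r}\sqrt{G(s)/F(s)}\,ds$ (for $r>r_m^-$) is infinite; (ii) $A$ is quasi essentially selfadjoint; (iii) $A$ is essentially selfadjoint.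
   Context: $\Delta_{S^n}$ is the Laplacian on the unit sphere. Set $a(r)=r^n\sqrt{G/F}$, $b(r)=r^n\sqrt{F/G}$, $c(r)=r^{n-2}\sqrt{FG}$, $d(r)=m^2r^n\sqrt{FG}$, so $A\psi=\frac1a\{-\partial_r(b\partial_r\psi)-c\Delta_{S^n}\psi+d\psi\}$. $A$ acts in $H=L^2(\Omega,a(r)\,d\omega_{S^n}dr)$. Let $\mathfrak b(\varphi,\psi)=\int_\Omega(b\,\partial_r\varphi\overline{\partial_r\psi}+c\nabla_{S^n}\varphi\cdot\overline{\nabla_{S^n}\psi}+d\varphi\overline\psi)\,d\omega_{S^n}dr$ and $\mathcal E=\{\varphi\in H\cap H^1_{loc}(\Omega):\mathfrak b(\varphi,\varphi)<\infty\}$ with $\|\varphi\|_{\mathcal E}^2=\|\varphi\|_H^2+\mathfrak b(\varphi,\varphi)$. $A$ is quasi essentially selfadjoint if it has exactly one selfadjoint extension in $H$ whose domain is continuously included in $\mathcal E$; essentially selfadjoint if it has exactly one selfadjoint extension. *)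

theory Defs
  imports "HOL-Analysis.Analysis"
begin

text \<open>Points of \<Omega> = (r0,\<infinity>) \<times> S^n are pairs (r, \<omega>) with \<omega> in the unit sphere of
  real^'d, where CARD('d) = n + 1.\<close>

definition smooth_on :: "'a::real_normed_vector set \<Rightarrow> ('a \<Rightarrow> 'b::real_normed_vector) \<Rightarrow> bool" where
  "smooth_on S f \<longleftrightarrow> (\<exists>FF. f \<in> FF \<and> (\<forall>g\<in>FF. (\<forall>x\<in>S. g differentiable (at x)) \<and>
      (\<forall>v. \<exists>h\<in>FF. \<forall>x\<in>S. frechet_derivative g (at x) v = h x)))"

definition Omega :: "real \<Rightarrow> (real \<times> (real^'d)) set" where
  "Omega r0 = {r0<..} \<times> sphere 0 1"

definition hom_ext :: "(real \<times> (real^'d) \<Rightarrow> complex) \<Rightarrow> real \<times> (real^'d) \<Rightarrow> complex" where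
  "hom_ext \<psi> = (\<lambda>(r, x). \<psi> (r, x /\<^sub>R norm x))"

definition test_fun :: "real \<Rightarrow> (real \<times> (real^'d) \<Rightarrow> complex) \<Rightarrow> bool" where
  "test_fun r0 \<psi> \<longleftrightarrow> smooth_on ({r0<..} \<times> (UNIV - {0})) (hom_ext \<psi>) \<and>
     (\<exists>a b. r0 < a \<and> a \<le> b \<and> (\<forall>p. \<psi> p \<noteq> 0 \<longrightarrow> p \<in> {a..b} \<times> sphere 0 1))"

definition dr :: "(real \<times> (real^'d) \<Rightarrow> complex) \<Rightarrow> real \<times> (real^'d) \<Rightarrow> complex" where
  "dr \<psi> p = vector_derivative (\<lambda>s. \<psi> (s, snd p)) (at (fst p))"

text \<open>j-th ambient component of the gradient on S^n (tangential gradient).\<close>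
definition dS :: "(real \<times> (real^'d) \<Rightarrow> complex) \<Rightarrow> 'd \<Rightarrow> real \<times> (real^'d) \<Rightarrow> complex" where
  "dS \<psi> j p = frechet_derivative (\<lambda>x. \<psi> (fst p, x /\<^sub>R norm x)) (at (snd p)) (axis j 1)"

text \<open>Laplace-Beltrami operator of S^n (Euclidean Laplacian of the homogeneous extension,
  evaluated on the unit sphere).\<close>
definition lapS :: "(real \<times> (real^'d) \<Rightarrow> complex) \<Rightarrow> real \<times> (real^'d) \<Rightarrow> complex" where
  "lapS \<psi> p = (\<Sum>j\<in>UNIV. frechet_derivative
      (\<lambda>x. frechet_derivative (\<lambda>y. \<psi> (fst p, y /\<^sub>R norm y)) (at x) (axis j 1))
      (at (snd p)) (axis j 1))"

definition coef_a :: "nat \<Rightarrow> (real \<Rightarrow> real) \<Rightarrow> (real \<Rightarrow> real) \<Rightarrow> real \<Rightarrow> real" where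
  "coef_a n F G r = r powr real n * sqrt (G r / F r)"
definition coef_b :: "nat \<Rightarrow> (real \<Rightarrow> real) \<Rightarrow> (real \<Rightarrow> real) \<Rightarrow> real \<Rightarrow> real" where
  "coef_b n F G r = r powr real n * sqrt (F r / G r)"
definition coef_c :: "nat \<Rightarrow> (real \<Rightarrow> real) \<Rightarrow> (real \<Rightarrow> real) \<Rightarrow> real \<Rightarrow> real" where
  "coef_c n F G r = r powr (real n - 2) * sqrt (F r * G r)"
definition coef_d :: "nat \<Rightarrow> real \<Rightarrow> (real \<Rightarrow> real) \<Rightarrow> (real \<Rightarrow> real) \<Rightarrow> real \<Rightarrow> real" where
  "coef_d n m F G r = m\<^sup>2 * r powr real n * sqrt (F r * G r)"

definition A_op :: "real \<Rightarrow> (real \<Rightarrow> real) \<Rightarrow> (real \<Rightarrow> real) \<Rightarrow> real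
     \<Rightarrow> (real \<times> (real^'d) \<Rightarrow> complex) \<Rightarrow> real \<times> (real^'d) \<Rightarrow> complex" where
  "A_op r0 F G m \<psi> p = (if p \<in> Omega r0 then
     (let r = fst p; n = CARD('d) - 1 in
       - complex_of_real (r powr (- real n) * sqrt (F r / G r)) *
         (vector_derivative (\<lambda>s. complex_of_real (s powr real n * sqrt (F s / G s)) * dr \<psi> (s, snd p)) (at r)
          + complex_of_real (r powr (real n - 2) * sqrt (F r * G r)) * lapS \<psi> p)
       + complex_of_real (m\<^sup>2 * F r) * \<psi> p)
     else 0)"

text \<open>Surface measure on S^n (cone measure: (n+1) times the push-forward of Lebesgue
  measure on the unit ball under x \<mapsto> x/|x|).\<close>
definition sphere_measure :: "(real^'d) measure" where
  "sphere_measure = scale_measure (of_nat CARD('d))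
     (distr (density lborel (indicator (cball 0 1))) borel (\<lambda>x. x /\<^sub>R norm x))"

definition base_measure :: "real \<Rightarrow> (real \<times> (real^'d)) measure" where
  "base_measure r0 = density (lborel \<Otimes>\<^sub>M sphere_measure) (indicator (Omega r0))"

definition H_measure :: "real \<Rightarrow> (real \<Rightarrow> real) \<Rightarrow> (real \<Rightarrow> real) \<Rightarrow> (real \<times> (real^'d)) measure" where
  "H_measure r0 F G = density (base_measure r0) (\<lambda>p. ennreal (coef_a (CARD('d) - 1) F G (fst p)))"

definition L2 :: "'a measure \<Rightarrow> ('a \<Rightarrow> complex) \<Rightarrow> bool" where
  "L2 M u \<longleftrightarrow> u \<in> borel_measurable M \<and> integrable M (\<lambda>x. (cmod (u x))\<^sup>2)"

definition Linner :: "'a measure \<Rightarrow> ('a \<Rightarrow> complex) \<Rightarrow> ('a \<Rightarrow> complex) \<Rightarrow> complex" where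
  "Linner M u v = (\<integral>x. u x * cnj (v x) \<partial>M)"

definition Lnorm :: "'a measure \<Rightarrow> ('a \<Rightarrow> complex) \<Rightarrow> real" where
  "Lnorm M u = sqrt (\<integral>x. (cmod (u x))\<^sup>2 \<partial>M)"

section \<open>Operators in L2 (as graphs, i.e. sets of pairs of representatives)\<close>

definition adjoint_rel :: "'a measure \<Rightarrow> (('a \<Rightarrow> complex) \<times> ('a \<Rightarrow> complex)) set
    \<Rightarrow> (('a \<Rightarrow> complex) \<times> ('a \<Rightarrow> complex)) set" where
  "adjoint_rel M T = {(u, v). L2 M u \<and> L2 M v \<and> (\<forall>(f, g)\<in>T. Linner M g u = Linner M f v)}"

definition densely_defined :: "'a measure \<Rightarrow> (('a \<Rightarrow> complex) \<times> ('a \<Rightarrow> complex)) set \<Rightarrow> bool" where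
  "densely_defined M T \<longleftrightarrow>
     (\<forall>f. L2 M f \<longrightarrow> (\<forall>\<epsilon>>0. \<exists>(u, v)\<in>T. Lnorm M (\<lambda>x. f x - u x) < \<epsilon>))"

definition selfadjoint :: "'a measure \<Rightarrow> (('a \<Rightarrow> complex) \<times> ('a \<Rightarrow> complex)) set \<Rightarrow> bool" where
  "selfadjoint M T \<longleftrightarrow> densely_defined M T \<and> adjoint_rel M T = T"

definition L2loc :: "real \<Rightarrow> (real \<times> (real^'d) \<Rightarrow> complex) \<Rightarrow> bool" where
  "L2loc r0 u \<longleftrightarrow> u \<in> borel_measurable (base_measure r0) \<and>
     (\<forall>K. compact K \<and> K \<subseteq> Omega r0 \<longrightarrow>
        (\<integral>\<^sup>+ p. indicator K p * ennreal ((cmod (u p))\<^sup>2) \<partial>base_measure r0) < \<infinity>)"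

definition weak_dr :: "real \<Rightarrow> (real \<times> (real^'d) \<Rightarrow> complex) \<Rightarrow> (real \<times> (real^'d) \<Rightarrow> complex) \<Rightarrow> bool" where
  "weak_dr r0 \<phi> g \<longleftrightarrow> L2loc r0 g \<and> (\<forall>\<eta>. test_fun r0 \<eta> \<longrightarrow>
     (\<integral>p. \<phi> p * dr \<eta> p \<partial>base_measure r0) = - (\<integral>p. g p * \<eta> p \<partial>base_measure r0))"

text \<open>Weak tangential gradient on S^n (componentwise, with the mean-curvature term n\<omega>_j
  of the integration-by-parts formula on the unit sphere).\<close>
definition weak_dS :: "real \<Rightarrow> (real \<times> (real^'d) \<Rightarrow> complex) \<Rightarrow> ('d \<Rightarrow> real \<times> (real^'d) \<Rightarrow> complex) \<Rightarrow> bool" where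
  "weak_dS r0 \<phi> g \<longleftrightarrow> (\<forall>j. L2loc r0 (g j)) \<and> (\<forall>j \<eta>. test_fun r0 \<eta> \<longrightarrow>
     (\<integral>p. \<phi> p * dS \<eta> j p \<partial>base_measure r0) =
       - (\<integral>p. g j p * \<eta> p \<partial>base_measure r0)
       + of_nat (CARD('d) - 1) * (\<integral>p. complex_of_real (snd p $ j) * \<phi> p * \<eta> p \<partial>base_measure r0))"

definition H1loc :: "real \<Rightarrow> (real \<times> (real^'d) \<Rightarrow> complex) \<Rightarrow> bool" where
  "H1loc r0 \<phi> \<longleftrightarrow> L2loc r0 \<phi> \<and> (\<exists>g. weak_dr r0 \<phi> g) \<and> (\<exists>g. weak_dS r0 \<phi> g)"

definition form_b :: "real \<Rightarrow> (real \<Rightarrow> real) \<Rightarrow> (real \<Rightarrow> real) \<Rightarrow> real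
     \<Rightarrow> (real \<times> (real^'d) \<Rightarrow> complex) \<Rightarrow> ennreal" where
  "form_b r0 F G m \<phi> =
     (let n = CARD('d) - 1; gr = (SOME g. weak_dr r0 \<phi> g); gS = (SOME g. weak_dS r0 \<phi> g) in
      \<integral>\<^sup>+ p. ennreal (coef_b n F G (fst p) * (cmod (gr p))\<^sup>2
               + coef_c n F G (fst p) * (\<Sum>j\<in>UNIV. (cmod (gS j p))\<^sup>2)
               + coef_d n m F G (fst p) * (cmod (\<phi> p))\<^sup>2) \<partial>base_measure r0)"

definition energy_space :: "real \<Rightarrow> (real \<Rightarrow> real) \<Rightarrow> (real \<Rightarrow> real) \<Rightarrow> real
     \<Rightarrow> (real \<times> (real^'d) \<Rightarrow> complex) set" where
  "energy_space r0 F G m = {\<phi>. L2 (H_measure r0 F G) \<phi> \<and> H1loc r0 \<phi> \<and> form_b r0 F G m \<phi> < \<infinity>}"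

definition energy_norm :: "real \<Rightarrow> (real \<Rightarrow> real) \<Rightarrow> (real \<Rightarrow> real) \<Rightarrow> real
     \<Rightarrow> (real \<times> (real^'d) \<Rightarrow> complex) \<Rightarrow> real" where
  "energy_norm r0 F G m \<phi> = sqrt ((Lnorm (H_measure r0 F G) \<phi>)\<^sup>2 + enn2real (form_b r0 F G m \<phi>))"

definition sa_extension_of_A :: "real \<Rightarrow> (real \<Rightarrow> real) \<Rightarrow> (real \<Rightarrow> real) \<Rightarrow> real
     \<Rightarrow> ((real \<times> (real^'d) \<Rightarrow> complex) \<times> (real \<times> (real^'d) \<Rightarrow> complex)) set \<Rightarrow> bool" where
  "sa_extension_of_A r0 F G m T \<longleftrightarrow> selfadjoint (H_measure r0 F G) T \<and>
     (\<forall>\<psi>. test_fun r0 \<psi> \<longrightarrow> (\<psi>, A_op r0 F G m \<psi>) \<in> T)"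

definition ess_selfadjoint_A :: "'d::finite itself \<Rightarrow> real \<Rightarrow> (real \<Rightarrow> real) \<Rightarrow> (real \<Rightarrow> real) \<Rightarrow> real \<Rightarrow> bool" where
  "ess_selfadjoint_A _ r0 F G m \<longleftrightarrow>
     (\<exists>!T :: ((real \<times> (real^'d) \<Rightarrow> complex) \<times> (real \<times> (real^'d) \<Rightarrow> complex)) set.
        sa_extension_of_A r0 F G m T)"

definition quasi_ess_selfadjoint_A :: "'d::finite itself \<Rightarrow> real \<Rightarrow> (real \<Rightarrow> real) \<Rightarrow> (real \<Rightarrow> real) \<Rightarrow> real \<Rightarrow> bool" where
  "quasi_ess_selfadjoint_A _ r0 F G m \<longleftrightarrow>
     (\<exists>!T :: ((real \<times> (real^'d) \<Rightarrow> complex) \<times> (real \<times> (real^'d) \<Rightarrow> complex)) set.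
        sa_extension_of_A r0 F G m T \<and>
        fst ` T \<subseteq> energy_space r0 F G m \<and>
        (\<exists>C. \<forall>(u, v)\<in>T. energy_norm r0 F G m u \<le>
              C * sqrt ((Lnorm (H_measure r0 F G) u)\<^sup>2 + (Lnorm (H_measure r0 F G) v)\<^sup>2)))"

section \<open>Einstein tensor of ds^2 = -F dt^2 + G dr^2 + r^2 dl^2_{S^n} (mixed components)\<close>

text \<open>F1, F2 = F', F''; G1 = G'. With F = e^{2\<alpha>}, G = e^{2\<beta>}.\<close>
definition einstein_tt :: "nat \<Rightarrow> (real \<Rightarrow> real) \<Rightarrow> (real \<Rightarrow> real) \<Rightarrow> real \<Rightarrow> real" where
  "einstein_tt n G G1 r = - (real n / 2) *
     ((real n - 1) * (1 - 1 / G r) / r\<^sup>2 + 2 * (G1 r / (2 * G r)) / (G r * r))"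

definition einstein_rr :: "nat \<Rightarrow> (real \<Rightarrow> real) \<Rightarrow> (real \<Rightarrow> real) \<Rightarrow> (real \<Rightarrow> real) \<Rightarrow> real \<Rightarrow> real" where
  "einstein_rr n F F1 G r = (real n / 2) *
     (2 * (F1 r / (2 * F r)) / (G r * r) - (real n - 1) * (1 - 1 / G r) / r\<^sup>2)"

definition einstein_thth :: "nat \<Rightarrow> (real \<Rightarrow> real) \<Rightarrow> (real \<Rightarrow> real) \<Rightarrow> (real \<Rightarrow> real)
     \<Rightarrow> (real \<Rightarrow> real) \<Rightarrow> (real \<Rightarrow> real) \<Rightarrow> real \<Rightarrow> real" where
  "einstein_thth n F F1 F2 G G1 r =
     (let a1 = F1 r / (2 * F r); a2 = F2 r / (2 * F r) - (F1 r)\<^sup>2 / (2 * (F r)\<^sup>2);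
          b1 = G1 r / (2 * G r) in
      (1 / G r) * (a2 + a1\<^sup>2 - a1 * b1 + (real n - 1) * (a1 - b1) / r)
      - (real n - 1) * (real n - 2) * (1 - 1 / G r) / (2 * r\<^sup>2))"

text \<open>G^a_b + \<Lambda> \<delta>^a_b = 8 \<pi> T^a_b with T^a_b = diag(-\<rho>, p_r, p_\<theta>, ..., p_\<theta>).\<close>
definition rho :: "nat \<Rightarrow> real \<Rightarrow> (real \<Rightarrow> real) \<Rightarrow> (real \<Rightarrow> real) \<Rightarrow> real \<Rightarrow> real" where
  "rho n \<Lambda> G G1 r = - (einstein_tt n G G1 r + \<Lambda>) / (8 * pi)"
definition p_rad :: "nat \<Rightarrow> real \<Rightarrow> (real \<Rightarrow> real) \<Rightarrow> (real \<Rightarrow> real) \<Rightarrow> (real \<Rightarrow> real) \<Rightarrow> real \<Rightarrow> real" where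
  "p_rad n \<Lambda> F F1 G r = (einstein_rr n F F1 G r + \<Lambda>) / (8 * pi)"
definition p_ang :: "nat \<Rightarrow> real \<Rightarrow> (real \<Rightarrow> real) \<Rightarrow> (real \<Rightarrow> real) \<Rightarrow> (real \<Rightarrow> real)
     \<Rightarrow> (real \<Rightarrow> real) \<Rightarrow> (real \<Rightarrow> real) \<Rightarrow> real \<Rightarrow> real" where
  "p_ang n \<Lambda> F F1 F2 G G1 r = (einstein_thth n F F1 F2 G G1 r + \<Lambda>) / (8 * pi)"

end

theory Submission
  imports Defs
begin

text \<open>Selfadjoint extensions of \<open>A\<close> with domain in the energy space arise from closed forms: a form
  domain is a closed space of pairs (function, gradient), described as the orthogonal complement of a
  set of \<open>L\<^sup>2\<close> kernels. The kernels of the weak-derivative relations give the maximal form domain.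

  If the travel time is infinite, a function \<open>z\<close> orthogonal to the range of \<open>A + 1\<close> is expanded in
  the moments of its restrictions to spheres against monomials. By induction on the degree, each moment
  \<open>W\<close> solves \<open>(b W')' = \<kappa> W\<close> weakly with \<open>\<kappa> \<ge> 0\<close>. Then \<open>b W W'\<close> is nondecreasing, so a nonzero \<open>W\<close>
  stays away from 0 near one of the two ends, where the weight \<open>a\<close> is not integrable although
  \<open>a W\<^sup>2\<close> is; hence \<open>W = 0\<close>. Vanishing of all moments
  gives \<open>z = 0\<close>, so that every selfadjoint extension is the one of the maximal form.

  If the travel time is finite, the dominant energy condition makes \<open>F G\<close> nondecreasing, hence bounded
  near the horizon. Then a radial cutoff equal to 1 near the horizon has finite energy, and the flux
  \<open>\<integral> \<partial>\<^sub>r(\<theta> u)\<close> through the horizon is a bounded functional on the form domain which kills all test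
  functions but not the cutoff. Its kernel is a smaller form domain (a Dirichlet condition for
  the spherical mean), which yields a second extension.\<close>

text \<open>Selfadjointness is an equality between sets of pairs of functions, not of classes, so
  the operators built here must be closed under changes on null sets. The geometry uses the real
  inner product \<open>ip\<close> on Euclidean-valued functions, so that one projection theorem
  serves scalars and (function, gradient) pairs; complex linearity is restored by an isometry
  \<open>J\<close>, multiplication by \<open>\<i>\<close> on the gradient. The gradient holds
  rescaled derivatives and also the mass term, which turns the energy form into the squared norm of
  the gradient in \<open>H\<close>. As the form is nonnegative, the single point -1 replaces the
  deficiency spaces at \<open>\<i>\<close> and \<open>- \<i>\<close>: one solves
  \<open>(T + 1) u = f\<close> by projecting \<open>(f, 0)\<close>. Monomials replace spherical
  harmonics: they are not eigenfunctions of the Laplacian, but it is triangular in the degree, which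
  is all that the induction needs. The coefficients are only C^1, so their products with test
  functions are not test functions; C^1 approximation by polynomials on radial strips bridges that
  gap.\<close>

lemmas bochner_bound = Bochner_Integration.integrable_bound
  and bochner_cong = Bochner_Integration.integral_cong

section \<open>Square-integrable functions with values in a Euclidean space\<close>

definition sqint :: "'a measure => ('a => 'b::euclidean_space) => bool" where
 "sqint M f \<longleftrightarrow> f : borel_measurable M & integrable M (%x. (norm (f x))\<^sup>2)"

text \<open>For complex-valued functions this is only the real part of \<open>Linner\<close>; the
  imaginary part comes from pairing with \<open>\<i>\<close> times the second argument.\<close>

definition ip :: "'a measure => ('a => 'b::euclidean_space) => ('a => 'b) => real" where
 "ip M f g = (LINT x|M. f x \<bullet> g x)"

definition sqnorm :: "'a measure => ('a => 'b::euclidean_space) => real" where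
 "sqnorm M f = (LINT x|M. (norm (f x))\<^sup>2)"

lemma sqint_meas [measurable_dest]: "sqint M f ==> f : borel_measurable M"
 by (simp add: sqint_def)

lemma sqint_integrable: "sqint M f ==> integrable M (%x. (norm (f x))\<^sup>2)"
 by (simp add: sqint_def)

lemma sqint_bound:
 assumes "f : borel_measurable M" "integrable M g" "!!x. x : space M ==> (norm (f x))\<^sup>2 <= g x"
 shows "sqint M f"
 unfolding sqint_def
proof
 have [measurable]: "f : borel_measurable M" by fact
 show "integrable M (%x. (norm (f x))\<^sup>2)"
  by (rule bochner_bound[OF assms(2)]) (auto intro!: AE_I2 order_trans[OF assms(3)])
qed fact

lemma norm_add_sq: "(norm (x + y :: 'b::real_inner))\<^sup>2 <= 2 * (norm x)\<^sup>2 + 2 * (norm y)\<^sup>2"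
 using zero_le_power2[of "norm (x - y)"]
 by (simp add: power2_norm_eq_inner inner_simps algebra_simps inner_commute)

lemma sqint_scaleR: assumes "sqint M f" shows "sqint M (%x. c *\<^sub>R f x)"
 using assms by (auto simp: sqint_def power_mult_distrib)

lemma sqint_add: assumes "sqint M f" "sqint M g" shows "sqint M (%x. f x + g x)"
proof (rule sqint_bound)
 show "integrable M (%x. 2 * (norm (f x))\<^sup>2 + 2 * (norm (g x))\<^sup>2)"
  using assms by (auto simp: sqint_def)
 show "(%x. f x + g x) : borel_measurable M" using assms[THEN sqint_meas] by simp
qed (rule norm_add_sq)

lemma sqint_zero: "sqint M (%x. 0)" by (simp add: sqint_def)

lemma sqint_uminus: assumes "sqint M f" shows "sqint M (%x. - f x)"
 using sqint_scaleR[OF assms, of "-1"] by simp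

lemma sqint_diff: assumes "sqint M f" "sqint M g" shows "sqint M (%x. f x - g x)"
 using sqint_add[OF assms(1) sqint_uminus[OF assms(2)]] by simp

lemma sqint_inner: assumes "sqint M f" "sqint M g" shows "integrable M (%x. f x \<bullet> g x)"
proof (rule bochner_bound)
 show "integrable M (%x. (norm (f x))\<^sup>2 + (norm (g x))\<^sup>2)" using assms by (auto simp: sqint_def)
 show "(%x. f x \<bullet> g x) : borel_measurable M" using assms[THEN sqint_meas] by simp
 have "\<bar>f x \<bullet> g x\<bar> <= (norm (f x))\<^sup>2 + (norm (g x))\<^sup>2" for x
 proof -
  have "\<bar>f x \<bullet> g x\<bar> <= norm (f x) * norm (g x)" by (rule Cauchy_Schwarz_ineq2)
  also have "... <= (norm (f x))\<^sup>2 + (norm (g x))\<^sup>2"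
   using sum_squares_bound[of "norm (f x)" "norm (g x)"] zero_le_power2[of "norm (f x)"]
    zero_le_power2[of "norm (g x)"] mult_nonneg_nonneg[OF norm_ge_zero[of "f x"] norm_ge_zero[of "g x"]] by linarith
  finally show ?thesis .
 qed
 then show "AE x in M. norm (f x \<bullet> g x) <= norm ((norm (f x))\<^sup>2 + (norm (g x))\<^sup>2)" by simp
qed

lemma sqint_mult: fixes f g :: "'a => complex"
 assumes "sqint M f" "sqint M g" shows "integrable M (%x. f x * g x)"
proof (rule bochner_bound)
 show "integrable M (%x. (norm (f x))\<^sup>2 + (norm (g x))\<^sup>2)" using assms by (auto simp: sqint_def)
 show "(%x. f x * g x) : borel_measurable M" using assms[THEN sqint_meas] by simp
 have "norm (f x * g x) <= (norm (f x))\<^sup>2 + (norm (g x))\<^sup>2" for x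
  using sum_squares_bound[of "norm (f x)" "norm (g x)"] zero_le_power2[of "norm (f x)"]
   zero_le_power2[of "norm (g x)"] mult_nonneg_nonneg[OF norm_ge_zero[of "f x"] norm_ge_zero[of "g x"]]
  unfolding norm_mult by linarith
 then show "AE x in M. norm (f x * g x) <= norm ((norm (f x))\<^sup>2 + (norm (g x))\<^sup>2)" by simp
qed

lemma ip_add_left: "sqint M f ==> sqint M g ==> sqint M h ==> ip M (%x. f x + g x) h = ip M f h + ip M g h"
 by (simp add: ip_def inner_add_left sqint_inner)
lemma ip_diff_left: "sqint M f ==> sqint M g ==> sqint M h ==> ip M (%x. f x - g x) h = ip M f h - ip M g h"
 by (simp add: ip_def inner_diff_left sqint_inner)
lemma ip_scale_left: "ip M (%x. c *\<^sub>R f x) h = c * ip M f h"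
 by (simp add: ip_def)
lemma ip_commute: "ip M f g = ip M g f"
 by (simp add: ip_def inner_commute)
lemma ip_add_right: "sqint M f ==> sqint M g ==> sqint M h ==> ip M h (%x. f x + g x) = ip M h f + ip M h g"
 by (simp add: ip_add_left ip_commute[of M h])
lemma ip_diff_right: "sqint M f ==> sqint M g ==> sqint M h ==> ip M h (%x. f x - g x) = ip M h f - ip M h g"
 by (simp add: ip_diff_left ip_commute[of M h])
lemma ip_scale_right: "ip M h (%x. c *\<^sub>R f x) = c * ip M h f"
 by (simp add: ip_def)
lemma ip_self: "ip M f f = sqnorm M f"
 by (simp add: ip_def sqnorm_def power2_norm_eq_inner)
lemma sqnorm_nonneg: "0 <= sqnorm M f"
 by (simp add: sqnorm_def)

lemma ip_cong_AE:
 assumes "sqint M f" "sqint M f'" "sqint M g" "AE x in M. f x = f' x" shows "ip M f g = ip M f' g"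
 unfolding ip_def using assms by (intro integral_cong_AE) (auto simp: sqint_def)

lemma sqnorm_scale: "sqnorm M (%x. c *\<^sub>R f x) = c\<^sup>2 * sqnorm M f"
 by (simp add: sqnorm_def power_mult_distrib)

lemma sqnorm_add:
 assumes "sqint M f" "sqint M g"
 shows "sqnorm M (%x. f x + g x) = sqnorm M f + 2 * ip M f g + sqnorm M g"
 using assms by (simp add: ip_self[symmetric] ip_add_left ip_add_right sqint_add ip_commute[of M g f])

lemma sqnorm_diff:
 assumes "sqint M f" "sqint M g"
 shows "sqnorm M (%x. f x - g x) = sqnorm M f - 2 * ip M f g + sqnorm M g"
 using assms by (simp add: ip_self[symmetric] ip_diff_left ip_diff_right sqint_diff ip_commute[of M g f])

lemma sqnorm_eq_0:
 assumes "sqint M f" "sqnorm M f = 0" shows "AE x in M. f x = 0"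
 using integral_nonneg_eq_0_iff_AE[OF sqint_integrable[OF assms(1)]] assms(2) by (simp add: sqnorm_def)

text \<open>A nonnegative quadratic has nonpositive discriminant. Besides Cauchy-Schwarz it serves
  the projection theorem, where \<open>a\<close> is the gap left by an almost minimal
  element.\<close>

lemma quadratic_nonneg_disc:
 fixes a b c :: real
 assumes "!!t. 0 <= a + 2 * t * b + t\<^sup>2 * c" "0 <= c"
 shows "b\<^sup>2 <= a * c"
proof (cases "c = 0")
 case True
 then have h: "0 <= a + 2 * t * b" for t using assms(1)[of t] by simp
 have "b = 0"
 proof (rule ccontr)
  assume "b ~= 0"
  \<comment> \<open>At this \<open>t\<close> the affine function \<open>a + 2 * t * b\<close> equals
    -1.\<close>
  then show False using h[of "-(a+1)/(2*b)"] by (simp add: field_simps)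
 qed
 then show ?thesis using True by simp
next
 case False
 then have c: "c > 0" using assms(2) by simp
 have "0 <= a + 2 * (-b/c) * b + (-b/c)\<^sup>2 * c" by (rule assms(1))
 also have "... = a - b\<^sup>2 / c" using c by (simp add: field_simps power2_eq_square)
 finally show ?thesis using c by (simp add: field_simps)
qed

lemma ip_Cauchy_Schwarz:
 assumes "sqint M f" "sqint M g" shows "(ip M f g)\<^sup>2 <= sqnorm M f * sqnorm M g"
proof (rule quadratic_nonneg_disc)
 fix t :: real
 have "0 <= sqnorm M (%x. f x + t *\<^sub>R g x)" by (rule sqnorm_nonneg)
 also have "... = sqnorm M f + 2 * t * ip M f g + t\<^sup>2 * sqnorm M g"
  using assms by (simp add: sqnorm_add sqint_scaleR ip_scale_right sqnorm_scale)
 finally show "0 <= sqnorm M f + 2 * t * ip M f g + t\<^sup>2 * sqnorm M g" .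
qed (rule sqnorm_nonneg)

lemma ip_tendsto:
 assumes f: "!!k. sqint M (e k)" "sqint M u" "sqint M g" and lim: "(%k. sqnorm M (%x. u x - e k x)) \<longlonglongrightarrow> 0"
 shows "(%k. ip M (e k) g) \<longlonglongrightarrow> ip M u g"
proof -
 have "(%k. sqrt (sqnorm M (%x. u x - e k x) * sqnorm M g)) \<longlonglongrightarrow> sqrt (0 * sqnorm M g)"
  by (intro tendsto_intros lim)
 then have l: "(%k. sqrt (sqnorm M (%x. u x - e k x) * sqnorm M g)) \<longlonglongrightarrow> 0" by simp
 have b: "\<bar>ip M u g - ip M (e k) g\<bar> <= sqrt (sqnorm M (%x. u x - e k x) * sqnorm M g)" for k
 proof -
  have "(ip M (%x. u x - e k x) g)\<^sup>2 <= sqnorm M (%x. u x - e k x) * sqnorm M g"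
   by (intro ip_Cauchy_Schwarz sqint_diff f)
  then have "\<bar>ip M (%x. u x - e k x) g\<bar> <= sqrt (sqnorm M (%x. u x - e k x) * sqnorm M g)"
   using real_le_rsqrt by (metis power2_abs)
  then show ?thesis using f by (simp add: ip_diff_left)
 qed
 have "(%k. ip M u g - ip M (e k) g) \<longlonglongrightarrow> 0"
  by (rule Lim_null_comparison[OF _ l]) (simp add: b)
 from tendsto_diff[OF tendsto_const[of "ip M u g"] this] show ?thesis by simp
qed

text \<open>The pointwise series of increments converges absolutely almost everywhere because
 \<open>2 t \<le> 2^-i + 2^i t\<^sup>2\<close> and the squares of the increments sum with weight \<open>2^i\<close>.\<close>
lemma sqint_complete:
 fixes e :: "nat => 'a => 'b::euclidean_space"
 assumes e: "!!k. sqint M (e k)"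
  and cau: "!!i j. i <= j ==> sqnorm M (%x. e j x - e i x) <= C * (1/4)^i"
 obtains u where "sqint M u" "(%k. sqnorm M (%x. u x - e k x)) \<longlonglongrightarrow> 0"
proof -
 have [measurable]: "e k : borel_measurable M" for k using e[of k] by (simp add: sqint_def)
 define d where "d i x = e (Suc i) x - e i x" for i x
 have dm [measurable]: "d i : borel_measurable M" for i unfolding d_def by measurable
 have C: "0 <= C" using cau[of 0 0] sqnorm_nonneg[of M "%x. e 0 x - e 0 x"] by (simp add: order_trans)
 have nn: "(\<integral>\<^sup>+x. ennreal ((norm (e j x - e i x))\<^sup>2) \<partial>M) = ennreal (sqnorm M (%x. e j x - e i x))" for i j
  unfolding sqnorm_def using sqint_integrable[OF sqint_diff[OF e e]] by (intro nn_integral_eq_integral) auto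
 have "(\<integral>\<^sup>+x. (\<Sum>i. ennreal (2^i * (norm (d i x))\<^sup>2)) \<partial>M) = (\<Sum>i. \<integral>\<^sup>+x. ennreal (2^i * (norm (d i x))\<^sup>2) \<partial>M)"
  by (rule nn_integral_suminf) simp
 also have "... <= (\<Sum>i. ennreal (C * (1/2)^i))"
 proof (intro suminf_le summableI)
  fix i
  have "(\<integral>\<^sup>+x. ennreal (2^i * (norm (d i x))\<^sup>2) \<partial>M) = ennreal (2^i) * ennreal (sqnorm M (%x. e (Suc i) x - e i x))"
   unfolding nn[symmetric] by (subst nn_integral_cmult[symmetric]) (auto simp: d_def ennreal_mult)
  also have "... <= ennreal (2^i * (C * (1/4)^i))"
   using cau[of i "Suc i"] by (subst ennreal_mult[symmetric]) (auto intro!: ennreal_leI simp: sqnorm_nonneg)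
  also have "2^i * (C * (1/4)^i) = C * (1/2::real)^i" by (simp add: power_divide power_mult_distrib[symmetric] field_simps)
  finally show "(\<integral>\<^sup>+x. ennreal (2^i * (norm (d i x))\<^sup>2) \<partial>M) <= ennreal (C * (1/2)^i)" .
 qed
 also have "... < \<infinity>"
 proof -
  have "(\<Sum>i. ennreal (C * (1/2)^i)) = ennreal (\<Sum>i. C * (1/2)^i)"
   using C by (intro suminf_ennreal2) (auto intro!: summable_mult summable_geometric)
  then show ?thesis by simp
 qed
 finally have "AE x in M. (\<Sum>i. ennreal (2^i * (norm (d i x))\<^sup>2)) ~= \<infinity>"
  by (intro nn_integral_noteq_infinite) auto
 then have ae: "AE x in M. convergent (%k. e k x)"
 proof eventually_elim
  case (elim x)
  have "summable (%i. 2^i * (norm (d i x))\<^sup>2)"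
   using elim by (intro summable_suminf_not_top) (auto simp: top_unique)
  then have "summable (%i. (1/2)^i + 2^i * (norm (d i x))\<^sup>2)"
   by (intro summable_add summable_geometric) auto
  then have "summable (%i. norm (d i x))"
  proof (rule summable_comparison_test'[where N=0])
   fix i :: nat
   define s where "s = norm (d i x)"
   have "0 <= 2^i * (s - (1/2)^i)\<^sup>2" by simp
   also have "... = 2^i * s\<^sup>2 - 2 * s + (1/2)^i"
    by (simp add: power2_eq_square algebra_simps power_divide)
   finally have "2 * s <= (1/2)^i + 2^i * s\<^sup>2" by simp
   moreover have "0 <= s" by (simp add: s_def)
   ultimately have "s <= (1/2)^i + 2^i * s\<^sup>2" by linarith
   then show "norm (norm (d i x)) <= (1/2)^i + 2^i * (norm (d i x))\<^sup>2" by (simp add: s_def)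
  qed
  then have "summable (%i. d i x)" by (rule summable_norm_cancel)
  then have "convergent (%n. (\<Sum>i<n. d i x))" by (simp add: summable_iff_convergent)
  moreover have "(\<Sum>i<n. d i x) = e n x - e 0 x" for n
   unfolding d_def by (rule sum_lessThan_telescope)
  ultimately have "convergent (%n. e n x - e 0 x)" by simp
  from convergent_add[OF this convergent_const[of "e 0 x"]] show ?case by simp
 qed
 define u where "u x = lim (%k. e k x)" for x
 have um [measurable]: "u : borel_measurable M" unfolding u_def by (rule borel_measurable_lim_metric) simp
 have conv: "AE x in M. (%k. e k x) \<longlonglongrightarrow> u x"
  using ae by eventually_elim (simp add: u_def convergent_LIMSEQ_iff)
 \<comment> \<open>Fatou's lemma, with \<open>j\<close> tending to infinity, passes the Cauchy bound
   on to the distance from the limit.\<close>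
 have est: "(\<integral>\<^sup>+x. ennreal ((norm (u x - e i x))\<^sup>2) \<partial>M) <= ennreal (C * (1/4)^i)" for i
 proof -
  have "(\<integral>\<^sup>+x. ennreal ((norm (u x - e i x))\<^sup>2) \<partial>M) = (\<integral>\<^sup>+x. liminf (%j. ennreal ((norm (e j x - e i x))\<^sup>2)) \<partial>M)"
  proof (rule nn_integral_cong_AE, use conv in eventually_elim)
   fix x assume "(%k. e k x) \<longlonglongrightarrow> u x"
   then have "(%j. ennreal ((norm (e j x - e i x))\<^sup>2)) \<longlonglongrightarrow> ennreal ((norm (u x - e i x))\<^sup>2)"
    by (intro tendsto_intros)
   then show "ennreal ((norm (u x - e i x))\<^sup>2) = liminf (%j. ennreal ((norm (e j x - e i x))\<^sup>2))"
    by (intro lim_imp_Liminf[symmetric]) simp_all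
  qed
  also have "... <= liminf (%j. \<integral>\<^sup>+x. ennreal ((norm (e j x - e i x))\<^sup>2) \<partial>M)"
   by (rule nn_integral_liminf) simp
  also have "... <= liminf (%j. ennreal (C * (1/4)^i))"
   by (rule Liminf_mono) (auto intro!: eventually_sequentiallyI[of i] ennreal_leI cau simp: nn)
  also have "... = ennreal (C * (1/4)^i)" by (simp add: Liminf_const)
  finally show ?thesis .
 qed
 have sq: "sqint M (%x. u x - e i x)" for i
  unfolding sqint_def using est[of i]
  by (auto intro!: integrableI_bounded simp: top_unique less_top[symmetric])
 have "sqint M u" using sqint_add[OF sq[of 0] e[of 0]] by simp
 moreover have "(%k. sqnorm M (%x. u x - e k x)) \<longlonglongrightarrow> 0"
 proof (rule Lim_null_comparison)
  have "(%i. C * (1/4)^i) \<longlonglongrightarrow> C * (0::real)" by (intro tendsto_intros LIMSEQ_power_zero) auto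
  then show "(%i. C * (1/4)^i) \<longlonglongrightarrow> (0::real)" by simp
  have "sqnorm M (%x. u x - e i x) <= C * (1/4)^i" for i
  proof -
   have "ennreal (sqnorm M (%x. u x - e i x)) <= ennreal (C * (1/4)^i)"
    unfolding sqnorm_def using est[of i] sqint_integrable[OF sq]
    by (subst nn_integral_eq_integral[symmetric]) auto
   then show ?thesis using C by (subst (asm) ennreal_le_iff) auto
  qed
  then show "\<forall>\<^sub>F i in sequentially. norm (sqnorm M (%x. u x - e i x)) <= C * (1/4)^i"
   by (simp add: sqnorm_nonneg)
 qed
 ultimately show ?thesis using that by blast
qed

text \<open>\<open>V\<close> need not be closed: the projection \<open>u\<close> only lies in its
  closure, and the approximating sequence is returned with it. A caller with a closed
  \<open>V\<close> then shows that \<open>u\<close> stays inside, and a density proof uses the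
  sequence itself.\<close>

lemma sqint_projection:
 fixes V :: "('a => 'b::euclidean_space) set"
 assumes V: "!!u. u : V ==> sqint M u" and ne: "(%x. 0) : V"
  and add: "!!u v. u : V ==> v : V ==> (%x. u x + v x) : V"
  and scale: "!!c u. u : V ==> (%x. c *\<^sub>R u x) : V"
  and f: "sqint M f"
 obtains u e where "sqint M u" "!!k. e k : V" "(%k. sqnorm M (%x. u x - e k x)) \<longlonglongrightarrow> 0"
  "!!v. v : V ==> ip M (%x. f x - u x) v = 0"
proof -
 define D where "D = (%v. sqnorm M (%x. f x - v x)) ` V"
 define \<delta> where "\<delta> = Inf D"
 have ne': "D ~= {}" using ne by (auto simp: D_def)
 have bb: "bdd_below D" unfolding D_def by (rule bdd_belowI2[of _ 0]) (rule sqnorm_nonneg)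
 have ge: "\<delta> <= sqnorm M (%x. f x - v x)" if "v : V" for v
  unfolding \<delta>_def using that by (intro cInf_lower bb) (auto simp: D_def)
 have "EX v:V. sqnorm M (%x. f x - v x) < \<delta> + (1/4)^k" for k :: nat
 proof -
  have "Inf D < \<delta> + (1/4)^k" by (simp add: \<delta>_def)
  from cInf_lessD[OF ne' this] show ?thesis by (auto simp: D_def)
 qed
 then obtain e where eV: "!!k. e k : V" and ek: "!!k. sqnorm M (%x. f x - e k x) < \<delta> + (1/4)^k" by metis
 \<comment> \<open>Parallelogram law: the midpoint of \<open>e i\<close> and \<open>e j\<close> lies
   in \<open>V\<close>, so its squared distance from \<open>f\<close> is at least \<delta>.\<close>
 have dist: "sqnorm M (%x. e j x - e i x) <= 4 * (1/4)^i" if "i <= j" for i j :: nat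
 proof -
  define p q where "p = (%x. f x - e i x)" and "q = (%x. f x - e j x)"
  have pq: "sqint M p" "sqint M q" unfolding p_def q_def by (intro sqint_diff f V[OF eV])+
  have "(%x. (1/2) *\<^sub>R (e i x + e j x)) : V" by (intro scale add eV)
  from ge[OF this] have "\<delta> <= sqnorm M (%x. (1/2) *\<^sub>R (p x + q x))"
   by (simp add: p_def q_def algebra_simps scaleR_2[symmetric] flip: scaleR_left.add)
  also have "... = (1/4) * sqnorm M (%x. p x + q x)" by (subst sqnorm_scale) (simp add: power2_eq_square)
  finally have "4 * \<delta> <= sqnorm M p + 2 * ip M p q + sqnorm M q" using pq by (simp add: sqnorm_add)
  moreover have "sqnorm M (%x. e j x - e i x) = sqnorm M (%x. p x - q x)" by (simp add: p_def q_def)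
  moreover have "... = sqnorm M p - 2 * ip M p q + sqnorm M q" using pq by (rule sqnorm_diff)
  moreover have "sqnorm M p < \<delta> + (1/4)^i" "sqnorm M q < \<delta> + (1/4)^j" using ek by (auto simp: p_def q_def)
  moreover have "(1/4::real)^j <= (1/4)^i" using that by (intro power_decreasing) auto
  ultimately show ?thesis by linarith
 qed
 obtain u where u: "sqint M u" and lim: "(%k. sqnorm M (%x. u x - e k x)) \<longlonglongrightarrow> 0"
  using sqint_complete[OF V[OF eV] dist] by blast
 have "ip M (%x. f x - u x) v = 0" if v: "v : V" for v
 proof -
  have sv: "sqint M v" by (rule V[OF v])
  \<comment> \<open>Moving \<open>e k\<close> along \<open>v\<close> gains at most
    \<open>(1/4)^k\<close>, because \<open>e k\<close> is minimal up to that amount; the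
    discriminant turns this into near orthogonality.\<close>
  have key: "(ip M (%x. f x - e k x) v)\<^sup>2 <= (1/4)^k * sqnorm M v" for k
  proof (rule quadratic_nonneg_disc)
   fix t :: real
   have "(%x. e k x + (-t) *\<^sub>R v x) : V" by (intro scale add eV v)
   from ge[OF this] have "\<delta> <= sqnorm M (%x. (f x - e k x) + t *\<^sub>R v x)" by (simp add: algebra_simps)
   also have "... = sqnorm M (%x. f x - e k x) + 2 * t * ip M (%x. f x - e k x) v + t\<^sup>2 * sqnorm M v"
    by (simp add: sqnorm_add sqint_diff f V eV sqint_scaleR sv ip_scale_right sqnorm_scale)
   finally show "0 <= (1/4)^k + 2 * t * ip M (%x. f x - e k x) v + t\<^sup>2 * sqnorm M v"
    using ek[of k] by linarith
  qed (rule sqnorm_nonneg)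
  have "(%k. ip M (%x. f x - e k x) v) \<longlonglongrightarrow> ip M (%x. f x - u x) v"
   using ip_tendsto[OF V[OF eV] u sv lim] by (simp add: ip_diff_left f V eV u sv tendsto_diff)
  then have "(%k. (ip M (%x. f x - e k x) v)\<^sup>2) \<longlonglongrightarrow> (ip M (%x. f x - u x) v)\<^sup>2" by (rule tendsto_power)
  moreover have "(%k. (ip M (%x. f x - e k x) v)\<^sup>2) \<longlonglongrightarrow> 0"
  proof (rule Lim_null_comparison)
   have "(%k. (1/4)^k * sqnorm M v) \<longlonglongrightarrow> 0 * sqnorm M v" by (intro tendsto_intros LIMSEQ_power_zero) auto
   then show "(%k. (1/4)^k * sqnorm M v) \<longlonglongrightarrow> 0" by simp
  qed (simp add: key)
  ultimately show ?thesis using LIMSEQ_unique by fastforce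
 qed
 then show ?thesis using that[OF u eV lim] by blast
qed

section \<open>Selfadjoint operators defined by closed forms\<close>

lemma L2_iff_sqint: "L2 M u \<longleftrightarrow> sqint M u"
 by (simp add: L2_def sqint_def)

lemma Lnorm_eq: "Lnorm M u = sqrt (sqnorm M u)"
 by (simp add: Lnorm_def sqnorm_def)

lemma borel_measurable_cnj [measurable]: "f : borel_measurable M ==> (%x. cnj (f x)) : borel_measurable M"
 by (rule borel_measurable_continuous_on[of cnj]) (auto intro: continuous_intros)

lemma sqint_cnj: "sqint M v ==> sqint M (%x. cnj (v x))"
 by (auto simp: sqint_def)

lemma Re_Linner:
 assumes "sqint M u" "sqint M v" shows "Re (Linner M u v) = ip M u v"
proof -
 have "sqint M (%x. cnj (v x))" using assms(2) by (rule sqint_cnj)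
 then have "integrable M (%x. u x * cnj (v x))" by (rule sqint_mult[OF assms(1)])
 then show ?thesis unfolding Linner_def ip_def
  by (subst integral_Re[symmetric]) (auto simp: inner_complex_def)
qed

lemma sqint_imult: "sqint M (u :: 'a => complex) ==> sqint M (%x. c * u x)"
 by (auto simp: sqint_def norm_mult power_mult_distrib)

lemma Im_Linner:
 assumes "sqint M u" "sqint M v" shows "Im (Linner M u v) = ip M u (%x. \<i> * v x)"
proof -
 have "sqint M (%x. cnj (v x))" using assms(2) by (rule sqint_cnj)
 then have "integrable M (%x. u x * cnj (v x))" by (rule sqint_mult[OF assms(1)])
 then show ?thesis unfolding Linner_def ip_def
  by (subst integral_Im[symmetric]) (auto simp: inner_complex_def algebra_simps)
qed

lemma sqint_Pair: "sqint M (%x. (u x, g x)) \<longleftrightarrow> sqint M u & sqint M g"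
proof
 assume h: "sqint M (%x. (u x, g x))"
 have [measurable]: "u : borel_measurable M" "g : borel_measurable M"
  using measurable_compose[OF sqint_meas[OF h] borel_measurable_continuous_onI[OF continuous_on_fst[OF continuous_on_id]]]
   measurable_compose[OF sqint_meas[OF h] borel_measurable_continuous_onI[OF continuous_on_snd[OF continuous_on_id]]]
  by auto
 show "sqint M u & sqint M g"
  using sqint_integrable[OF h] by (auto intro!: sqint_bound simp: norm_Pair)
next
 assume "sqint M u & sqint M g"
 then have h: "sqint M u" "sqint M g" by auto
 show "sqint M (%x. (u x, g x))"
 proof (rule sqint_bound)
  show "integrable M (%x. (norm (u x))\<^sup>2 + (norm (g x))\<^sup>2)" using h by (auto simp: sqint_def)
  show "(%x. (u x, g x)) : borel_measurable M" using h[THEN sqint_meas] by measurable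
 qed (simp add: norm_Pair)
qed

lemma sqint_fst: "sqint M W ==> sqint M (%x. fst (W x))"
 and sqint_snd: "sqint M W ==> sqint M (%x. snd (W x))"
 using sqint_Pair[of M "%x. fst (W x)" "%x. snd (W x)"] by auto

lemma ip_pair:
 assumes "sqint M U" "sqint M W"
 shows "ip M U W = ip M (%x. fst (U x)) (%x. fst (W x)) + ip M (%x. snd (U x)) (%x. snd (W x))"
 unfolding ip_def
 using Bochner_Integration.integral_add[OF sqint_inner[OF assms[THEN sqint_fst]] sqint_inner[OF assms[THEN sqint_snd]]]
 by (simp add: inner_prod_def)

text \<open>Form domains are described by constraints: closedness is then automatic, and a further
  boundary condition is just one more element of \<open>KK\<close>.\<close>

definition perp :: "'a measure => ('a => 'b::euclidean_space) set => ('a => 'b) set" where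
 "perp M KK = {U. sqint M U & (ALL K:KK. ip M U K = 0)}"

text \<open>The operator of the first representation theorem for the form that pairs the gradients
  of two elements of \<Gamma>. Testing with \<open>ip\<close> looks at real parts only, which is
  enough once \<Gamma> is stable under multiplication by \<open>\<i>\<close>.\<close>

definition form_op :: "'a measure => ('a => complex * 'b::euclidean_space) set => (('a => complex) \<times> ('a => complex)) set" where
 "form_op M \<Gamma> = {(u, v). sqint M u & sqint M v & (EX g. (%x. (u x, g x)) : \<Gamma> &
  (ALL W:\<Gamma>. ip M v (%x. fst (W x)) = ip M g (%x. snd (W x))))}"

lemma form_opI:
 assumes "sqint M u" "sqint M v" "(%x. (u x, g x)) : \<Gamma>"
  "!!W. W : \<Gamma> ==> ip M v (%x. fst (W x)) = ip M g (%x. snd (W x))"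
 shows "(u, v) : form_op M \<Gamma>"
 unfolding form_op_def mem_Collect_eq prod.case using assms by (intro conjI exI[of _ g] ballI) simp_all

lemma form_opE:
 assumes "(u, v) : form_op M \<Gamma>"
 obtains g where "(%x. (u x, g x)) : \<Gamma>" "ALL W:\<Gamma>. ip M v (%x. fst (W x)) = ip M g (%x. snd (W x))"
  "sqint M u" "sqint M v"
 using assms unfolding form_op_def mem_Collect_eq prod.case by (elim conjE exE) (rule that, auto)

lemma perp_sqint: "U : perp M KK ==> sqint M U" by (simp add: perp_def)

lemma perp_zero: "(%x. 0) : perp M KK" by (simp add: perp_def sqint_zero ip_def)

lemma perp_scale: "U : perp M KK ==> (%x. c *\<^sub>R U x) : perp M KK"
 by (simp add: perp_def sqint_scaleR ip_scale_left)

context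
 fixes M :: "'a measure" and KK :: "('a => 'b::euclidean_space) set"
 assumes KK: "ALL K:KK. sqint M K"
begin

lemma perp_add: "U : perp M KK ==> V : perp M KK ==> (%x. U x + V x) : perp M KK"
 by (simp add: perp_def sqint_add ip_add_left KK[rule_format])

lemma perp_diff: "U : perp M KK ==> V : perp M KK ==> (%x. U x - V x) : perp M KK"
 by (simp add: perp_def sqint_diff ip_diff_left KK[rule_format])

lemma perp_AE:
 assumes "U : perp M KK" "V : borel_measurable M" "AE x in M. U x = V x" shows "V : perp M KK"
proof -
 have U: "sqint M U" using assms(1) by (rule perp_sqint)
 have V: "sqint M V" unfolding sqint_def
  using assms(2,3) sqint_integrable[OF U] sqint_meas[OF U]
  by (subst integrable_cong_AE[of _ _ "%x. (norm (U x))\<^sup>2"]) auto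
 have "ip M V K = ip M U K" if "K : KK" for K
  using assms(3) by (intro ip_cong_AE[OF V U KK[rule_format, OF that]]) auto
 then show ?thesis using assms(1) V by (auto simp: perp_def)
qed

lemma perp_projection:
 assumes f: "sqint M f"
 shows "EX U:perp M KK. ALL W:perp M KK. ip M (%x. f x - U x) W = 0"
proof -
 have "EX U e. sqint M U & (ALL k. e k : perp M KK) & (%k. sqnorm M (%x. U x - e k x)) \<longlonglongrightarrow> 0 &
   (ALL v:perp M KK. ip M (%x. f x - U x) v = 0)"
 proof (rule sqint_projection[of "perp M KK" M f])
  fix U e assume "sqint M U" "!!k. e k : perp M KK" "(%k. sqnorm M (%x. U x - e k x)) \<longlonglongrightarrow> 0"
   "!!v. v : perp M KK ==> ip M (%x. f x - U x) v = 0"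
  then show ?thesis by (intro exI[of _ U] exI[of _ e]) simp
 next
  show "sqint M u" if "u : perp M KK" for u using that by (rule perp_sqint)
  show "(%x. u x + v x) : perp M KK" if "u : perp M KK" "v : perp M KK" for u v
   using that by (rule perp_add)
  show "(%x. c *\<^sub>R u x) : perp M KK" if "u : perp M KK" for u c
   using that by (rule perp_scale)
 qed (rule perp_zero f)+
 then obtain U e where U: "sqint M U" and e: "!!k. e k : perp M KK" and lim: "(%k. sqnorm M (%x. U x - e k x)) \<longlonglongrightarrow> 0"
  and o: "!!v. v : perp M KK ==> ip M (%x. f x - U x) v = 0" by (elim exE conjE) (rule that, auto)
 have "ip M U K = 0" if K: "K : KK" for K
 proof -
  have "(%k. ip M (e k) K) \<longlonglongrightarrow> ip M U K"
   by (rule ip_tendsto[OF perp_sqint[OF e] U KK[rule_format, OF K] lim])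
  moreover have "ip M (e k) K = 0" for k using e[of k] K by (auto simp: perp_def)
  ultimately have "(%k::nat. 0) \<longlonglongrightarrow> ip M U K" by simp
  then show ?thesis by (simp add: LIMSEQ_const_iff)
 qed
 then have "U : perp M KK" using U by (simp add: perp_def)
 then show ?thesis using o by (intro bexI[of _ U]) auto
qed

end

text \<open>\<open>J\<close> is multiplication by \<open>\<i>\<close> on gradients, so
  \<open>J_perp\<close> says that the form domain is a complex subspace; \<open>dense\<close> says
  that its first components are dense, stated as triviality of their orthogonal complement.\<close>

locale form_space =
 fixes M :: "'a measure" and KK :: "('a => complex * 'b::euclidean_space) set" and J :: "'b => 'b"
 assumes KK: "ALL K:KK. sqint M K"
  and J_perp: "!!W. W : perp M KK ==> (%x. (\<i> * fst (W x), J (snd (W x)))) : perp M KK"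
  and J_inner: "!!x y. J x \<bullet> J y = x \<bullet> y" and J_J: "!!x. J (J x) = - x"
  and dense: "!!h. sqint M h ==> (!!W. W : perp M KK ==> ip M h (%x. fst (W x)) = 0) ==> AE x in M. h x = 0"
begin

abbreviation "\<Gamma> == perp M KK"
abbreviation "T == form_op M \<Gamma>"

text \<open>Surjectivity of \<open>T + 1\<close>. The residue of projecting \<open>(f, 0)\<close>
  onto \<Gamma> is orthogonal to \<Gamma>, and this orthogonality is the defining relation of the
  form operator for the pair of \<open>u\<close> and \<open>f - u\<close>.\<close>

lemma form_op_range:
 assumes f: "sqint M f" obtains u where "(u, %x. f x - u x) : T"
proof -
 have f0: "sqint M (%x. (f x, 0::'b))" using f by (simp add: sqint_Pair sqint_zero)
 obtain U where U: "U : \<Gamma>" and o: "!!W. W : \<Gamma> ==> ip M (%x. (f x, 0) - U x) W = 0"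
  using perp_projection[OF KK f0] by auto
 have sU: "sqint M U" using U by (rule perp_sqint)
 have "(%x. fst (U x), %x. f x - fst (U x)) : T"
  unfolding form_op_def
 proof (safe intro!: exI[of _ "%x. snd (U x)"])
  fix W assume W: "W : \<Gamma>"
  have "ip M (%x. (f x, 0) - U x) W = ip M (%x. f x - fst (U x)) (%x. fst (W x)) + ip M (%x. - snd (U x)) (%x. snd (W x))"
   using ip_pair[OF sqint_diff[OF f0 sU] perp_sqint[OF W]] by simp
  then show "ip M (%x. f x - fst (U x)) (%x. fst (W x)) = ip M (%x. snd (U x)) (%x. snd (W x))"
   using o[OF W] ip_scale_left[of M "-1" "%x. snd (U x)" "%x. snd (W x)"] by simp
 qed (use U f sU in \<open>auto intro!: sqint_diff sqint_fst\<close>)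
 then show ?thesis by (rule that)
qed

text \<open>The real parts agree because each pair may be tested with the graph of the other. For
  the imaginary parts the graphs are first rotated by \<open>J\<close>, which is antisymmetric since
  it is isometric with square -1.\<close>

lemma form_op_symmetric:
 assumes "(u, v) : T" "(u', v') : T" shows "Linner M v u' = Linner M u v'"
proof -
 obtain g where g: "(%x. (u x, g x)) : \<Gamma>" "!!W. W : \<Gamma> ==> ip M v (%x. fst (W x)) = ip M g (%x. snd (W x))"
  and s: "sqint M u" "sqint M v" using assms(1) by (auto simp: form_op_def)
 obtain g' where g': "(%x. (u' x, g' x)) : \<Gamma>" "!!W. W : \<Gamma> ==> ip M v' (%x. fst (W x)) = ip M g' (%x. snd (W x))"
  and s': "sqint M u'" "sqint M v'" using assms(2) by (auto simp: form_op_def)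
 have "ip M v u' = ip M u v'"
  using g(2)[OF g'(1)] g'(2)[OF g(1)] by (simp add: ip_commute)
 moreover have "ip M v (%x. \<i> * u' x) = ip M u (%x. \<i> * v' x)"
 proof -
  have "ip M v (%x. \<i> * u' x) = ip M g (%x. J (g' x))"
   using g(2)[OF J_perp[OF g'(1)]] by simp
  also have "... = - ip M g' (%x. J (g x))"
  proof -
   have "g x \<bullet> J (g' x) = - (g' x \<bullet> J (g x))" for x
    using J_inner[of "J (g x)" "g' x"] by (simp add: J_J inner_commute)
   then show ?thesis by (simp add: ip_def)
  qed
  also have "... = - ip M v' (%x. \<i> * u x)"
   using g'(2)[OF J_perp[OF g(1)]] by simp
  also have "... = ip M u (%x. \<i> * v' x)"
   unfolding ip_def by (subst Bochner_Integration.integral_minus[symmetric], rule bochner_cong)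
    (auto simp: inner_complex_def algebra_simps)
  finally show ?thesis .
 qed
 ultimately show ?thesis using s s' by (simp add: complex_eq_iff Re_Linner Im_Linner)
qed

text \<open>The adjoint sees functions only up to null sets, so this invariance is indispensable for
  an equality \<open>adjoint_rel M T = T\<close> of sets of representatives.\<close>

lemma form_op_AE:
 assumes "(u, v) : T" "sqint M u'" "sqint M v'" "AE x in M. u x = u' x" "AE x in M. v x = v' x"
 shows "(u', v') : T"
proof -
 obtain g where g: "(%x. (u x, g x)) : \<Gamma>" "!!W. W : \<Gamma> ==> ip M v (%x. fst (W x)) = ip M g (%x. snd (W x))"
  and s: "sqint M u" "sqint M v" using assms(1) by (auto simp: form_op_def)
 have "sqint M g" using perp_sqint[OF g(1)] by (simp add: sqint_Pair)
 then have "(%x. (u' x, g x)) : borel_measurable M"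
  using assms(2) by (intro borel_measurable_Pair) (auto simp: sqint_def)
 then have "(%x. (u' x, g x)) : \<Gamma>"
  by (intro perp_AE[OF KK g(1)]) (use assms(4) in auto)
 moreover have "ip M v' (%x. fst (W x)) = ip M v (%x. fst (W x))" if "W : \<Gamma>" for W
  using assms(5) that s assms by (intro ip_cong_AE sqint_fst perp_sqint[OF that]) auto
 ultimately show ?thesis using assms g by (auto simp: form_op_def)
qed

text \<open>Solve \<open>(T + 1) w = u + v\<close>. By symmetry \<open>u - w\<close> is orthogonal
  to the range of \<open>T + 1\<close>, which is everything; solving
  \<open>(T + 1) x = u - w\<close> makes it orthogonal to itself.\<close>

lemma form_op_adjoint_subset: assumes "(u, v) : adjoint_rel M T" shows "(u, v) : T"
proof -
 have s: "sqint M u" "sqint M v" and a: "!!f g. (f, g) : T ==> Linner M g u = Linner M f v"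
  using assms by (auto simp: adjoint_rel_def L2_iff_sqint)
 obtain w where w: "(w, %x. (u x + v x) - w x) : T" by (rule form_op_range[OF sqint_add[OF s]])
 have sw: "sqint M w" "sqint M (%x. (u x + v x) - w x)" using w by (auto simp: form_op_def)
 let ?z = "%x. u x - w x"
 have sz: "sqint M ?z" by (intro sqint_diff s sw)
 obtain x where x: "(x, %p. ?z p - x p) : T" by (rule form_op_range[OF sz])
 have sx: "sqint M x" "sqint M (%p. ?z p - x p)" using x by (auto simp: form_op_def)
 have 1: "ip M (%p. ?z p - x p) u = ip M x v"
  using arg_cong[OF a[OF x], of Re] by (simp only: Re_Linner s sx)
 have 2: "ip M (%p. ?z p - x p) w = ip M x (%p. (u p + v p) - w p)"
  using arg_cong[OF form_op_symmetric[OF x w], of Re] by (simp only: Re_Linner sw sx)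
 have "sqnorm M ?z = 0"
 proof -
  have "ip M ?z ?z - ip M x ?z = ip M (%p. ?z p - x p) u - ip M (%p. ?z p - x p) w"
   using ip_diff_left[OF sz sx(1) sz] ip_diff_right[OF s(1) sw(1) sx(2)] by simp
  also have "... = ip M x v - ip M x (%p. (u p + v p) - w p)" using 1 2 by simp
  also have "... = - ip M x ?z"
   using ip_diff_right[OF sqint_add[OF s] sw(1) sx(1)] ip_add_right[OF s sx(1)]
    ip_diff_right[OF s(1) sw(1) sx(1)] by simp
  finally show ?thesis by (simp add: ip_self)
 qed
 then have "AE p in M. ?z p = 0" by (rule sqnorm_eq_0[OF sz])
 then show ?thesis
  by (intro form_op_AE[OF w s]) auto
qed

text \<open>Project \<open>f\<close> onto the closure of the domain and call the residue
  \<open>h\<close>. It is orthogonal to the domain, in particular to the solution \<open>x\<close>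
  of \<open>(T + 1) x = h\<close>, and this forces \<open>x\<close> and then \<open>h\<close> to
  vanish.\<close>

lemma form_op_dense: "densely_defined M T"
 unfolding densely_defined_def
proof (intro allI impI)
 fix f :: "'a => complex" and \<epsilon> :: real assume f: "L2 M f" and \<epsilon>: "0 < \<epsilon>"
 define V where "V = fst ` T"
 have z: "(%x. 0, %x. 0) : T"
 proof (rule form_opI[where g="%x. 0"])
  show "(%x. (0, 0)) : \<Gamma>" using perp_zero[of M KK] unfolding zero_prod_def .
 qed (simp_all add: sqint_zero ip_def)
 have add: "(%x. u x + u' x) : V" if uV: "u : V" "u' : V" for u u'
 proof -
  obtain v v' where v: "(u, v) : T" "(u', v') : T" using uV unfolding V_def by auto
  obtain g where g: "(%x. (u x, g x)) : \<Gamma>" "ALL W:\<Gamma>. ip M v (%x. fst (W x)) = ip M g (%x. snd (W x))"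
   "sqint M u" "sqint M v" using v(1) by (rule form_opE)
  obtain g' where g': "(%x. (u' x, g' x)) : \<Gamma>" "ALL W:\<Gamma>. ip M v' (%x. fst (W x)) = ip M g' (%x. snd (W x))"
   "sqint M u'" "sqint M v'" using v(2) by (rule form_opE)
  have sg: "sqint M g" "sqint M g'" using perp_sqint[OF g(1)] perp_sqint[OF g'(1)] by (simp_all add: sqint_Pair)
  have "(%x. u x + u' x, %x. v x + v' x) : T"
  proof (rule form_opI[where g="%x. g x + g' x"])
   show "sqint M (%x. u x + u' x)" by (rule sqint_add[OF g(3) g'(3)])
   show "sqint M (%x. v x + v' x)" by (rule sqint_add[OF g(4) g'(4)])
   show "(%x. (u x + u' x, g x + g' x)) : \<Gamma>"
    using perp_add[OF KK g(1) g'(1)] unfolding add_Pair .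
  next
   fix W assume W: "W : \<Gamma>"
   show "ip M (%x. v x + v' x) (%x. fst (W x)) = ip M (%x. g x + g' x) (%x. snd (W x))"
    using ip_add_left[OF g(4) g'(4) sqint_fst[OF perp_sqint[OF W]]]
     ip_add_left[OF sg sqint_snd[OF perp_sqint[OF W]]] g(2)[rule_format, OF W] g'(2)[rule_format, OF W]
    by linarith
  qed
  then show ?thesis unfolding V_def by (rule image_eqI[rotated]) simp
 qed
 have scale: "(%x. c *\<^sub>R u x) : V" if uV: "u : V" for u c
 proof -
  obtain v where v: "(u, v) : T" using uV unfolding V_def by auto
  obtain g where g: "(%x. (u x, g x)) : \<Gamma>" "ALL W:\<Gamma>. ip M v (%x. fst (W x)) = ip M g (%x. snd (W x))"
   "sqint M u" "sqint M v" using v by (rule form_opE)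
  have "(%x. c *\<^sub>R u x, %x. c *\<^sub>R v x) : T"
  proof (rule form_opI[where g="%x. c *\<^sub>R g x"])
   show "sqint M (%x. c *\<^sub>R u x)" by (rule sqint_scaleR[OF g(3)])
   show "sqint M (%x. c *\<^sub>R v x)" by (rule sqint_scaleR[OF g(4)])
   show "(%x. (c *\<^sub>R u x, c *\<^sub>R g x)) : \<Gamma>"
    using perp_scale[OF g(1), of c] unfolding scaleR_Pair .
  next
   fix W assume W: "W : \<Gamma>"
   show "ip M (%x. c *\<^sub>R v x) (%x. fst (W x)) = ip M (%x. c *\<^sub>R g x) (%x. snd (W x))"
    using g(2)[rule_format, OF W] by (simp only: ip_scale_left)
  qed
  then show ?thesis unfolding V_def by (rule image_eqI[rotated]) simp
 qed
 have sV: "sqint M u" if "u : V" for u using that unfolding V_def by (auto elim: form_opE)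
 have z': "(%x. 0) : V" using z unfolding V_def by (rule image_eqI[rotated]) simp
 have "EX u e. sqint M u & (ALL k. e k : V) & (%k. sqnorm M (%x. u x - e k x)) \<longlonglongrightarrow> 0 &
   (ALL v:V. ip M (%x. f x - u x) v = 0)"
 proof (rule sqint_projection[of V M f])
  fix U e assume "sqint M U" "!!k. e k : V" "(%k. sqnorm M (%x. U x - e k x)) \<longlonglongrightarrow> 0"
   "!!v. v : V ==> ip M (%x. f x - U x) v = 0"
  then show ?thesis by (intro exI[of _ U] exI[of _ e]) simp
 next
  show "sqint M u" if "u : V" for u using that by (rule sV)
  show "(%x. u x + v x) : V" if "u : V" "v : V" for u v using that by (rule add)
  show "(%x. c *\<^sub>R u x) : V" if "u : V" for u c using that by (rule scale)
 qed (rule z', rule f[unfolded L2_iff_sqint])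
 then obtain u e where u: "sqint M u" and e: "!!k. e k : V" and lim: "(%k. sqnorm M (%x. u x - e k x)) \<longlonglongrightarrow> 0"
  and o: "!!v. v : V ==> ip M (%x. f x - u x) v = 0" by (elim exE conjE) (rule that, auto)
 let ?h = "%x. f x - u x"
 have sh: "sqint M ?h" using f u by (auto intro: sqint_diff simp: L2_iff_sqint)
 obtain x where x: "(x, %p. ?h p - x p) : T" by (rule form_op_range[OF sh])
 then obtain g where g: "(%p. (x p, g p)) : \<Gamma>" "ALL W:\<Gamma>. ip M (%p. ?h p - x p) (%x. fst (W x)) = ip M g (%x. snd (W x))"
  and sx: "sqint M x" by (rule form_opE) blast
 have sg: "sqint M g" using perp_sqint[OF g(1)] by (simp add: sqint_Pair)
 have "ip M ?h x = 0" using o[of x] image_eqI[OF _ x, of x fst] by (simp add: V_def)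
 \<comment> \<open>The relation for \<open>x\<close> tested with the graph of \<open>x\<close>
   itself; the left side would be the pairing of \<open>h\<close> with \<open>x\<close>, which is
   zero.\<close>
 with g(2)[rule_format, OF g(1)] have "sqnorm M x + sqnorm M g = 0" using sh sx by (simp add: ip_diff_left ip_self)
 then have "sqnorm M x = 0" "sqnorm M g = 0" using sqnorm_nonneg[of M x] sqnorm_nonneg[of M g] by auto
 then have "AE p in M. x p = 0" "AE p in M. g p = 0" using sqnorm_eq_0 sx sg by auto
 then have "ip M x (%x. fst (W x)) = 0" "ip M g (%x. snd (W x)) = 0" if "W : \<Gamma>" for W
  using ip_cong_AE[OF sx sqint_zero sqint_fst[OF perp_sqint[OF that]]]
   ip_cong_AE[OF sg sqint_zero sqint_snd[OF perp_sqint[OF that]]] by (auto simp: ip_def)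
 then have "AE p in M. ?h p = 0"
  using g(2) sh sx by (intro dense sh) (auto simp: ip_diff_left perp_sqint sqint_fst)
 then have "sqnorm M (%x. f x - e k x) = sqnorm M (%x. u x - e k x)" for k
  unfolding sqnorm_def using f u sV[OF e, of k]
  by (intro integral_cong_AE) (auto simp: sqint_def L2_def)
 then have "(%k. sqrt (sqnorm M (%x. f x - e k x))) \<longlonglongrightarrow> sqrt 0" using lim by (intro tendsto_real_sqrt) simp
 then have "\<forall>\<^sub>F k in sequentially. sqrt (sqnorm M (%x. f x - e k x)) < \<epsilon>"
  using \<epsilon> by (intro order_tendstoD) auto
 then obtain k where "sqrt (sqnorm M (%x. f x - e k x)) < \<epsilon>"
  by (auto simp: eventually_sequentially)
 moreover obtain v where "(e k, v) : T" using e[of k] unfolding V_def by auto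
 ultimately show "EX (u, v):T. Lnorm M (%x. f x - u x) < \<epsilon>"
  by (intro bexI[of _ "(e k, v)"]) (simp_all add: Lnorm_eq)
qed

theorem form_op_selfadjoint: "selfadjoint M T"
 unfolding selfadjoint_def
proof
 have "(u, v) : adjoint_rel M T" if uv: "(u, v) : T" for u v
 proof -
  have "sqint M u" "sqint M v" using uv by (auto simp: form_op_def)
  then show ?thesis using form_op_symmetric[OF _ uv] unfolding adjoint_rel_def L2_iff_sqint by blast
 qed
 then show "adjoint_rel M T = T" using form_op_adjoint_subset by auto
qed (rule form_op_dense)

end

text \<open>A closed form is determined by its operator. If \<open>Y\<close> in the larger domain is
  orthogonal to the smaller one, solve \<open>(T + 1) u = fst Y\<close>: the graph of
  \<open>u\<close> lies in the smaller domain because the operators agree and gradients are unique.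
  Comparing orthogonality with the form relation tested by \<open>Y\<close> gives
  \<open>fst Y = 0\<close>, and then its gradient vanishes too.\<close>

lemma form_op_inj:
 fixes KK1 KK2 :: "('a => complex * 'b::euclidean_space) set"
 assumes "form_space M KK1 J" "form_space M KK2 J" and sub: "perp M KK1 \<subseteq> perp M KK2"
  and uniq: "!!u g g'. (%x. (u x, g x)) : perp M KK2 ==> (%x. (u x, g' x)) : perp M KK2 ==> AE x in M. g x = g' x"
  and eq: "form_op M (perp M KK1) = form_op M (perp M KK2)"
 shows "perp M KK2 \<subseteq> perp M KK1"
proof
 interpret A: form_space M KK1 J by fact
 interpret B: form_space M KK2 J by fact
 fix X assume X: "X : perp M KK2"
 obtain X' where X': "X' : perp M KK1" and o: "!!W. W : perp M KK1 ==> ip M (%x. X x - X' x) W = 0"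
  using perp_projection[OF A.KK perp_sqint[OF X]] by auto
 define Y where "Y = (%x. X x - X' x)"
 have Y: "Y : perp M KK2" unfolding Y_def using X X' sub by (intro perp_diff[OF B.KK]) auto
 have sY: "sqint M Y" using Y by (rule perp_sqint)
 define f s where "f = (%x. fst (Y x))" and "s = (%x. snd (Y x))"
 have sf: "sqint M f" "sqint M s" unfolding f_def s_def using sY by (auto intro: sqint_fst sqint_snd)
 obtain u where u: "(u, %x. f x - u x) : form_op M (perp M KK2)" by (rule B.form_op_range[OF sf(1)])
 then obtain g where g: "(%x. (u x, g x)) : perp M KK2" "ALL W:perp M KK2. ip M (%p. f p - u p) (%x. fst (W x)) = ip M g (%x. snd (W x))"
  and su: "sqint M u" by (rule form_opE) blast
 from u eq have "(u, %x. f x - u x) : form_op M (perp M KK1)" by simp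
 then obtain g1 where g1: "(%x. (u x, g1 x)) : perp M KK1" by (rule form_opE) blast
 have sg: "sqint M g" using perp_sqint[OF g(1)] by (simp add: sqint_Pair)
 have "AE x in M. g1 x = g x" using uniq[OF _ g(1)] g1 sub by blast
 then have gG: "(%x. (u x, g x)) : perp M KK1"
  by (intro perp_AE[OF A.KK g1] sqint_meas[OF perp_sqint[OF g(1)]]) auto
 have "ip M f u + ip M s g = 0"
  using o[OF gG] sY unfolding Y_def[symmetric]
  by (subst (asm) ip_pair) (auto simp: perp_sqint[OF gG] f_def s_def)
 moreover have "ip M (%x. f x - u x) f = ip M g s" using g(2)[rule_format, OF Y] by (simp add: f_def s_def)
 ultimately have "sqnorm M f = 0"
  using sf su sg by (simp add: ip_diff_left ip_self[symmetric] ip_commute[of M g s] ip_commute[of M u f])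
 then have f0: "AE x in M. f x = 0" by (rule sqnorm_eq_0[OF sf(1)])
 have "(%x. (0, s x)) : perp M KK2"
 proof (rule perp_AE[OF B.KK Y])
  show "(%x. (0::complex, s x)) : borel_measurable M" using sf by (intro borel_measurable_Pair) (auto simp: sqint_def)
  show "AE x in M. Y x = (0, s x)" using f0 by eventually_elim (simp add: f_def s_def prod_eq_iff)
 qed
 moreover have "(%x. (0, 0)) : perp M KK2" using perp_zero[of M KK2] by (simp add: zero_prod_def)
 ultimately have "AE x in M. s x = 0" by (rule uniq)
 with f0 have "AE x in M. X' x = X x"
  by eventually_elim (auto simp: f_def s_def Y_def prod_eq_iff)
 then show "X : perp M KK1" using perp_AE[OF A.KK X'] sqint_meas[OF perp_sqint[OF X]] by blast
qed

section \<open>Test functions on the line\<close>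

text \<open>The derivatives of exp(-1/x) are polynomials in 1/x times exp(-1/x). With y = 1/x,
  differentiating p(y) exp(-y) in x gives y^2 (p - p')(y) exp(-y), hence the recursion.\<close>

fun bump_poly :: "nat => real poly" where
 "bump_poly 0 = 1"
| "bump_poly (Suc k) = [:0, 0, 1:] * (bump_poly k - pderiv (bump_poly k))"

definition bump :: "nat => real => real" where
 "bump k x = (if x > 0 then poly (bump_poly k) (inverse x) * exp (- inverse x) else 0)"

lemma poly_exp_tendsto_0: "((%y::real. poly p y * exp (- y)) \<longlongrightarrow> 0) at_top"
proof -
 have "((%y::real. \<Sum>i\<le>degree p. coeff p i * (y ^ i / exp y)) \<longlongrightarrow> (\<Sum>i\<le>degree p. coeff p i * 0)) at_top"
  by (intro tendsto_intros tendsto_power_div_exp_0)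
 moreover have "(\<Sum>i\<le>degree p. coeff p i * (y ^ i / exp y)) = poly p y * exp (- y)" for y :: real
  by (simp add: poly_altdef exp_minus sum_distrib_right divide_inverse mult.assoc)
 ultimately show ?thesis by simp
qed

lemma bump_deriv: "(bump k has_real_derivative bump (Suc k) x) (at x)"
proof (cases x "0::real" rule: linorder_cases)
 case less
 have "((%x. 0) has_real_derivative 0) (at x)" by simp
 then have "(bump k has_real_derivative 0) (at x)"
  by (rule has_field_derivative_transform_within_open[of _ _ _ "{..<0}"]) (use less in \<open>auto simp: bump_def\<close>)
 then show ?thesis using less by (simp add: bump_def)
next
 case greater
 have 1: "((%x. poly (bump_poly k) (inverse x)) has_real_derivative
   poly (pderiv (bump_poly k)) (inverse x) * - (inverse x ^ Suc (Suc 0))) (at x)"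
  by (rule DERIV_chain2[OF poly_DERIV DERIV_inverse]) (use greater in simp)
 have 2: "((%x. exp (- inverse x)) has_real_derivative exp (- inverse x) * (- (- (inverse x ^ Suc (Suc 0))))) (at x)"
  by (rule DERIV_chain2[OF DERIV_exp DERIV_minus[OF DERIV_inverse]]) (use greater in simp)
 have "((%x. poly (bump_poly k) (inverse x) * exp (- inverse x)) has_real_derivative bump (Suc k) x) (at x)"
  by (rule DERIV_cong[OF DERIV_mult[OF 1 2]]) (use greater in \<open>simp add: bump_def algebra_simps\<close>)
 then show ?thesis
  by (rule has_field_derivative_transform_within_open[of _ _ _ "{0<..}"]) (use greater in \<open>auto simp: bump_def\<close>)
next
 case equal
 \<comment> \<open>\<open>pCons 0\<close> multiplies by \<open>y = 1 / h\<close>, which is the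
   denominator of the difference quotient at 0.\<close>
 have "((%y. poly (pCons 0 (bump_poly k)) y * exp (- y)) \<longlongrightarrow> 0) at_top" by (rule poly_exp_tendsto_0)
 then have "((%h. poly (pCons 0 (bump_poly k)) (inverse h) * exp (- inverse h)) \<longlongrightarrow> 0) (at_right 0)"
  by (rule filterlim_compose[OF _ filterlim_inverse_at_top_right])
 moreover have "\<forall>\<^sub>F h in at_right 0. poly (pCons 0 (bump_poly k)) (inverse h) * exp (- inverse h) = bump k h / h"
  using eventually_at_right_less[of "0::real"] by eventually_elim (simp add: bump_def divide_inverse)
 ultimately have r: "((%h. bump k h / h) \<longlongrightarrow> 0) (at_right 0)" by (rule Lim_transform_eventually)
 have "\<forall>\<^sub>F h in at_left 0. 0 = bump k h / h"
  by (simp add: eventually_at_filter bump_def)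
 then have "((%h. bump k h / h) \<longlongrightarrow> 0) (at_left 0)" by (rule Lim_transform_eventually[OF tendsto_const])
 with r have "((%h. bump k h / h) \<longlongrightarrow> 0) (at 0)" by (simp add: filterlim_split_at)
 then show ?thesis using equal by (simp add: DERIV_def bump_def)
qed

definition smooth1 :: "(real => real) => bool" where
 "smooth1 f \<longleftrightarrow> (EX D. D 0 = f & (ALL k x. (D k has_real_derivative D (Suc k) x) (at x)))"

definition ctest :: "real => (real => real) => bool" where
 "ctest c f \<longleftrightarrow> smooth1 f & (EX a b. c < a & a <= b & (ALL x. f x ~= 0 --> x : {a..b}))"

lemma smooth1_bump: "smooth1 (bump 0)"
 unfolding smooth1_def using bump_deriv by (intro exI[of _ bump]) auto

lemma smooth1_has_deriv: "smooth1 f ==> (f has_real_derivative deriv f x) (at x)"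
 unfolding smooth1_def by (metis DERIV_imp_deriv)

lemma smooth1_deriv: assumes "smooth1 f" shows "smooth1 (deriv f)"
proof -
 obtain D where D: "D 0 = f" "!!k x. (D k has_real_derivative D (Suc k) x) (at x)"
  using assms by (auto simp: smooth1_def)
 have "D 1 = deriv f" using D(2)[of 0] D(1) by (auto intro!: ext DERIV_imp_deriv[symmetric])
 then show ?thesis unfolding smooth1_def using D by (intro exI[of _ "%k. D (Suc k)"]) auto
qed

lemma smooth1_primitive:
 assumes "!!x. (f has_real_derivative g x) (at x)" "smooth1 g" shows "smooth1 f"
proof -
 obtain D where D: "D 0 = g" "!!k x. (D k has_real_derivative D (Suc k) x) (at x)"
  using assms(2) by (auto simp: smooth1_def)
 show ?thesis unfolding smooth1_def
  using D assms(1) by (intro exI[of _ "case_nat f D"]) (auto split: nat.split)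
qed

lemma smooth1_cont: "smooth1 f ==> continuous_on A f"
 by (meson DERIV_isCont continuous_at_imp_continuous_on smooth1_has_deriv)

text \<open>Coinduction: a family closed under differentiation up to algebra operations.\<close>
inductive_set smalg :: "(real => real) set => (real => real) set" for B where
 base: "f : B ==> f : smalg B"
| const: "(%x. c) : smalg B"
| add: "f : smalg B ==> g : smalg B ==> (%x. f x + g x) : smalg B"
| mult: "f : smalg B ==> g : smalg B ==> (%x. f x * g x) : smalg B"

text \<open>A family in which every member has a derivative inside the family consists of smooth
  functions: choose derivatives and iterate.\<close>

lemma smooth1_coinduct:
 assumes "f : F" and F: "!!f. f : F ==> EX g:F. ALL x. (f has_real_derivative g x) (at x)"
 shows "smooth1 f"
proof -
 obtain d where d: "!!f. f : F ==> d f : F" "!!f x. f : F ==> (f has_real_derivative d f x) (at x)"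
  using F by metis
 have "(d ^^ k) f : F" for k by (induction k) (auto simp: assms d)
 then show ?thesis unfolding smooth1_def using d(2) by (intro exI[of _ "%k. (d ^^ k) f"]) auto
qed

lemma smooth1_smalg:
 assumes "f : smalg B" and B: "!!f. f : B ==> EX g:smalg B. ALL x. (f has_real_derivative g x) (at x)"
 shows "smooth1 f"
proof (rule smooth1_coinduct[OF assms(1)])
 fix f assume "f : smalg B"
 then show "EX g:smalg B. ALL x. (f has_real_derivative g x) (at x)"
 proof induction
  case (const c)
  show ?case by (rule bexI[of _ "%x. 0"]) (auto intro: smalg.const)
 next
  case (add f g)
  then obtain f' g' where "f' : smalg B" "g' : smalg B" "!!x. (f has_real_derivative f' x) (at x)"
   "!!x. (g has_real_derivative g' x) (at x)" by blast
  then show ?case by (intro bexI[of _ "%x. f' x + g' x"]) (auto intro!: derivative_eq_intros smalg.add)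
 next
  case (mult f g)
  then obtain f' g' where "f' : smalg B" "g' : smalg B" "!!x. (f has_real_derivative f' x) (at x)"
   "!!x. (g has_real_derivative g' x) (at x)" by blast
  then show ?case using mult
   by (intro bexI[of _ "%x. f x * g' x + g x * f' x"]) (auto intro!: derivative_eq_intros smalg.add smalg.mult)
 qed (rule B)
qed

lemma smooth1_add: assumes "smooth1 f" "smooth1 g" shows "smooth1 (%x. f x + g x)"
 and smooth1_mult: "smooth1 (%x. f x * g x)"
proof -
 have B: "EX g:smalg (Collect smooth1). ALL x. (f has_real_derivative g x) (at x)" if "f : Collect smooth1" for f
  using that smooth1_has_deriv smooth1_deriv by (intro bexI[of _ "deriv f"]) (auto intro: smalg.base)
 show "smooth1 (%x. f x + g x)" "smooth1 (%x. f x * g x)"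
  by (rule smooth1_smalg[OF _ B]; use assms in \<open>auto intro: smalg.intros\<close>)+
qed

lemma smooth1_const: "smooth1 (%x. c)"
 by (rule smooth1_smalg[of _ "{}"]) (auto intro: smalg.const)

lemma smooth1_affine: assumes "smooth1 f" shows "smooth1 (%x. f (a * x + b))"
proof (rule smooth1_coinduct[of _ "{%x. c * f (a * x + b) | f c. smooth1 f}"])
 show "(%x. f (a * x + b)) : {%x. c * f (a * x + b) |f c. smooth1 f}"
  using assms by (auto intro!: exI[of _ f] exI[of _ 1])
 fix h assume "h : {%x. c * f (a * x + b) |f c. smooth1 f}"
 then obtain f c where h: "h = (%x. c * f (a * x + b))" "smooth1 f" by blast
 have "((%x. c * f (a * x + b)) has_real_derivative (c * a) * deriv f (a * x + b)) (at x)" for x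
  by (auto intro!: derivative_eq_intros DERIV_chain2[OF smooth1_has_deriv[OF h(2)]])
 then show "EX g:{%x. c * f (a * x + b) |f c. smooth1 f}. ALL x. (h has_real_derivative g x) (at x)"
  using smooth1_deriv[OF h(2)] unfolding h(1)
  by (intro bexI[of _ "%x. (c * a) * deriv f (a * x + b)"]) (auto intro!: exI[of _ "deriv f"] exI[of _ "c * a"])
qed

lemma smooth1_poly: "smooth1 (poly p)"
proof (rule smooth1_coinduct[of _ "range poly"])
 show "EX g:range poly. ALL x. (f has_real_derivative g x) (at x)" if "f : range poly" for f :: "real => real"
  using that poly_DERIV by blast
qed simp

lemma ctest_supp:
 assumes "ctest c f" shows "EX a b. c < a & a < b & (ALL x. x ~: {a<..<b} --> f x = 0)"
proof -
 obtain a b where h: "c < a" "a <= b" "ALL x. f x ~= 0 --> x : {a..b}" using assms by (auto simp: ctest_def)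
 have "f x = 0" if x: "x ~: {(a + c)/2<..<b + 1}" for x
 proof (rule ccontr)
  assume "f x ~= 0"
  then have "x : {a..b}" using h(3) by blast
  then show False using x h(1) by auto
 qed
 moreover have "c < (a + c)/2" "(a + c)/2 < b + 1" using h(1,2) by auto
 ultimately show ?thesis by blast
qed

lemma ctestI:
 assumes "smooth1 f" "c < a" "a < b" "!!x. x ~: {a<..<b} ==> f x = 0" shows "ctest c f"
proof -
 have "x : {a..b}" if "f x ~= 0" for x
  using assms(4)[of x] that by (cases "x : {a<..<b}") auto
 then show ?thesis unfolding ctest_def using assms(1-3) by (intro conjI exI[of _ a] exI[of _ b]) auto
qed

lemma ctest_smooth1: "ctest c f ==> smooth1 f" by (simp add: ctest_def)

lemma ctest_mult: assumes "ctest c f" "smooth1 g" shows "ctest c (%x. g x * f x)"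
proof -
 obtain a b where "c < a" "a < b" "ALL x. x ~: {a<..<b} --> f x = 0" using ctest_supp[OF assms(1)] by blast
 then show ?thesis using assms by (intro ctestI[of _ c a b] smooth1_mult) (simp_all add: ctest_smooth1)
qed

lemma ctest_add: assumes "ctest c f" "ctest c g" shows "ctest c (%x. f x + g x)"
proof -
 obtain a b where 1: "c < a" "a < b" "ALL x. x ~: {a<..<b} --> f x = 0" using ctest_supp[OF assms(1)] by blast
 obtain a' b' where 2: "c < a'" "a' < b'" "ALL x. x ~: {a'<..<b'} --> g x = 0" using ctest_supp[OF assms(2)] by blast
 show ?thesis
 proof (rule ctestI[of _ c "min a a'" "max b b'"])
  fix x assume "x ~: {min a a'<..<max b b'}"
  then have "x ~: {a<..<b}" "x ~: {a'<..<b'}" by auto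
  then show "f x + g x = 0" using 1(3) 2(3) by simp
 qed (use 1(1,2) 2(1,2) assms in \<open>auto simp: ctest_smooth1 intro!: smooth1_add\<close>)
qed

lemma ctest_scale: "ctest c f ==> ctest c (%x. k * f x)"
 using ctest_mult[of c f "%x. k"] smooth1_const by simp

lemma ctest_deriv: assumes "ctest c f" shows "ctest c (deriv f)"
proof -
 obtain a b where 1: "c < a" "a <= b" "!!x. f x ~= 0 --> x : {a..b}" using assms by (auto simp: ctest_def)
 have "deriv f x = 0" if "x ~: {a..b}" for x
 proof -
  have "((%x. 0) has_real_derivative 0) (at x)" by simp
  then have "(f has_real_derivative 0) (at x)"
   by (rule has_field_derivative_transform_within_open[of _ _ _ "- {a..b}"]) (use that 1(3) in auto)
  then show ?thesis by (rule DERIV_imp_deriv)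
 qed
 then show ?thesis unfolding ctest_def using 1 smooth1_deriv[OF ctest_smooth1[OF assms]] by blast
qed

lemma ctest_cont: "ctest c f ==> continuous_on A f"
 by (simp add: ctest_smooth1 smooth1_cont)

text \<open>On \<open>(a, b)\<close> the function below equals \<open>exp (- (1/(x-a) + 1/(b-x)) / k)\<close>, which increases to 1.\<close>
lemma ctest_indicator_approx:
 assumes "c < a" "a < b"
 obtains f where "!!k. ctest c (f k)" "!!k x. 0 <= f k x & f k x <= indicator {a<..<b} x"
  "!!x. (%k. f k x) \<longlonglongrightarrow> indicator {a<..<b} x"
proof
 define f where "f k x = bump 0 (real (Suc k) * x + (- real (Suc k) * a)) * bump 0 ((- real (Suc k)) * x + real (Suc k) * b)" for k x
 have f: "f k x = (if x : {a<..<b} then exp (- (inverse (x - a) + inverse (b - x)) / real (Suc k)) else 0)" for k x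
 proof -
  have 1: "real (Suc k) * x + (- real (Suc k) * a) = real (Suc k) * (x - a)"
   and 2: "(- real (Suc k)) * x + real (Suc k) * b = real (Suc k) * (b - x)" by (simp_all add: algebra_simps)
  show ?thesis unfolding f_def bump_def 1 2
   by (auto simp: zero_less_mult_iff exp_add[symmetric] divide_simps simp del: of_nat_Suc)
 qed
 show "ctest c (f k)" for k
 proof (rule ctestI[OF _ assms])
  show "smooth1 (f k)" unfolding f_def by (intro smooth1_mult smooth1_affine smooth1_bump)
 qed (simp add: f)
 show "0 <= f k x & f k x <= indicator {a<..<b} x" for k x
 proof (cases "x : {a<..<b}")
  case True
  then have "0 <= inverse (x - a) + inverse (b - x)" by (intro add_nonneg_nonneg) auto
  then have "- (inverse (x - a) + inverse (b - x)) / real (Suc k) <= 0" by (intro divide_nonpos_pos) auto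
  then show ?thesis using True by (simp add: f del: of_nat_Suc)
 qed (simp add: f)
 show "(%k. f k x) \<longlonglongrightarrow> indicator {a<..<b} x" for x
 proof (cases "x : {a<..<b}")
  case True
  have "(%k. exp (- (inverse (x - a) + inverse (b - x)) / real (Suc k))) \<longlonglongrightarrow> exp 0"
   by (intro tendsto_exp filterlim_compose[OF lim_const_over_n filterlim_Suc])
  then show ?thesis using True by (simp add: f)
 next
  case False
  then have "f k x = 0" for k using f[of k x] by simp
  then show ?thesis using False by simp
 qed
qed

section \<open>Weak solutions on a half-line\<close>

text \<open>Dynkin's argument: the sets over which \<open>f\<close> integrates to 0 are closed under
  complement, as the whole space is among them, and under countable disjoint unions, so they contain
  all sets generated by \<open>E\<close>.\<close>

lemma AE_zero_generator:
 fixes f :: "'a => 'b::{second_countable_topology, banach}"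
 assumes M: "sigma_finite_measure M" and f: "integrable M f"
  and E: "sets M = sigma_sets (space M) E" "Int_stable E" "E \<subseteq> Pow (space M)" "space M : E"
  and zero: "!!A. A : E ==> set_lebesgue_integral M A f = 0"
 shows "AE x in M. f x = 0"
proof -
 interpret sigma_finite_measure M by fact
 have si: "set_integrable M A f" if "A : sets M" for A
  using that f unfolding set_integrable_def by (rule integrable_mult_indicator)
 show ?thesis
 proof (rule density_zero[OF f])
  fix A assume "A : sets M"
  then have "A : sigma_sets (space M) E" by (simp add: E(1))
  from E(2,3) this show "set_lebesgue_integral M A f = 0"
  proof (induction rule: sigma_sets_induct_disjoint)
   case (basic A) then show ?case by (rule zero)
  next
   case empty show ?case by (simp add: set_lebesgue_integral_def)
  next
   case (compl A)
   then have A: "A : sets M" by (simp add: E(1))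
   have "set_lebesgue_integral M (A \<union> (space M - A)) f = set_lebesgue_integral M A f + set_lebesgue_integral M (space M - A) f"
    using A by (intro set_integral_Un si) auto
   moreover have "A \<union> (space M - A) = space M" using A sets.sets_into_space by auto
   ultimately show ?case using compl zero[OF E(4)] by simp
  next
   case (union A)
   then have A: "!!i. A i : sets M" by (auto simp: E(1))
   have "set_lebesgue_integral M (\<Union>i. A i) f = (\<Sum>i. set_lebesgue_integral M (A i) f)"
    using A union(1) by (intro lebesgue_integral_countable_add si) (auto simp: disjoint_family_on_def)
   then show ?case by (simp add: union)
  qed
 qed
qed

lemma bounded_cmult_integrable:
 fixes f :: "'a => 'b::{second_countable_topology, banach}" and g :: "'a => real"
 assumes "set_integrable M A f" "A : sets M" "g : borel_measurable M" "!!x. x : A ==> \<bar>g x\<bar> <= C"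
  "!!x. x ~: A ==> g x = 0"
 shows "integrable M (%x. g x *\<^sub>R f x)"
proof -
 have f: "integrable M (%x. indicator A x *\<^sub>R f x)" using assms(1) by (simp add: set_integrable_def)
 have [measurable]: "g : borel_measurable M" by fact
 have 1: "g x *\<^sub>R f x = g x *\<^sub>R (indicator A x *\<^sub>R f x)" for x using assms(5)[of x] by (auto simp: indicator_def)
 have [measurable]: "(%x. indicator A x *\<^sub>R f x) : borel_measurable M" using f by (rule borel_measurable_integrable)
 show ?thesis
 proof (rule bochner_bound[where f="%x. C *\<^sub>R (indicator A x *\<^sub>R f x)"])
  show "integrable M (%x. C *\<^sub>R (indicator A x *\<^sub>R f x))" using f by (rule integrable_scaleR_right)
  show "(%x. g x *\<^sub>R f x) : borel_measurable M" unfolding 1 by measurable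
  show "AE x in M. norm (g x *\<^sub>R f x) <= norm (C *\<^sub>R indicator A x *\<^sub>R f x)"
  proof (rule AE_I2)
   fix x
   have "\<bar>g x\<bar> <= \<bar>C\<bar>" if "x : A" using assms(4)[OF that] by linarith
   then show "norm (g x *\<^sub>R f x) <= norm (C *\<^sub>R indicator A x *\<^sub>R f x)"
    using assms(5)[of x] by (cases "x : A") (auto intro!: mult_right_mono)
  qed
 qed
qed

definition locint :: "real => (real => 'b::{second_countable_topology, banach}) => bool" where
 "locint c W \<longleftrightarrow> (ALL a b. c < a --> set_integrable lborel {a..b} W)"

lemma ctest_supp': "ctest c f ==> EX a b. c < a & a < b & (ALL x. x ~: {a..b} --> f x = 0)"
proof -
 assume "ctest c f"
 then obtain a b where h: "c < a" "a < b" "ALL x. x ~: {a<..<b} --> f x = 0" using ctest_supp by blast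
 then have "ALL x. x ~: {a..b} --> f x = 0" by auto
 with h show ?thesis by blast
qed

lemma cont_on_compact_bound:
 assumes "continuous_on {a..b::real} (g :: real => real)" shows "EX C. ALL x:{a..b}. \<bar>g x\<bar> <= C"
proof -
 have "bounded (g ` {a..b})" by (intro compact_imp_bounded compact_continuous_image assms) auto
 then show ?thesis by (auto simp: bounded_iff)
qed

lemma borel_ctest [measurable_dest]: "ctest c f ==> f : borel_measurable borel"
 by (intro borel_measurable_continuous_onI ctest_cont)

lemma ctest_integrable:
 assumes "locint c W" "ctest c f" shows "integrable lborel (%x. f x *\<^sub>R W x)"
proof -
 obtain a b where h: "c < a" "a < b" "ALL x. x ~: {a..b} --> f x = 0" using ctest_supp'[OF assms(2)] by blast
 obtain C where C: "ALL x:{a..b}. \<bar>f x\<bar> <= C" using cont_on_compact_bound[OF ctest_cont[OF assms(2)]] by blast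
 show ?thesis using assms(1) h C borel_ctest[OF assms(2)]
  by (intro bounded_cmult_integrable[of _ "{a..b}" _ _ C]) (auto simp: locint_def)
qed

lemma locint_cont_mult:
 fixes W :: "real => 'b::{second_countable_topology, banach}"
 assumes "locint c W" "continuous_on {c<..} g" shows "locint c (%x. g x *\<^sub>R W x)"
 unfolding locint_def
proof (intro allI impI)
 fix a b assume a: "c < a"
 have g: "continuous_on {a..b} g" using a by (auto intro: continuous_on_subset[OF assms(2)])
 obtain C where C: "ALL x:{a..b}. \<bar>g x\<bar> <= C" using cont_on_compact_bound[OF g] by blast
 have "integrable lborel (%x. (indicator {a..b} x * g x) *\<^sub>R W x)"
 proof (rule bounded_cmult_integrable)
  show "set_integrable lborel {a..b} W" using assms(1) a by (auto simp: locint_def)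
  show "(%x. indicator {a..b} x * g x) : borel_measurable lborel"
   using borel_measurable_continuous_on_indicator[OF _ g] by simp
 qed (use C in auto)
 then show "set_integrable lborel {a..b} (%x. g x *\<^sub>R W x)" by (simp add: set_integrable_def)
qed

lemma locint_add:
 assumes "locint c f" "locint c g" shows "locint c (%x. f x + g x)"
 using assms unfolding locint_def by (auto intro: set_integral_add)

lemma locint_cont: fixes g :: "real => real" assumes "continuous_on {c<..} g" shows "locint c g"
 unfolding locint_def set_integrable_def
 by (intro allI impI borel_integrable_compact continuous_on_subset[OF assms]) auto

lemma locint_mono: "locint c f ==> c <= d ==> locint d f"
 by (auto simp: locint_def)

lemma ctest_mono: "ctest d f ==> c <= d ==> ctest c f"
 unfolding ctest_def by (meson order_le_less_trans)

text \<open>The fundamental lemma of the calculus of variations. Test functions approximate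
  indicators of open intervals, so all interval integrals vanish; half-lines form an
  intersection-stable generator.\<close>

lemma locint_AE_eq_0:
 fixes W :: "real => 'b::{second_countable_topology, banach}"
 assumes W: "locint c W" and z: "!!f. ctest c f ==> (LINT x|lborel. f x *\<^sub>R W x) = 0"
 shows "AE x in lborel. c < x --> W x = 0"
proof -
 have ivl: "(LINT x|lborel. indicator {a<..<b} x *\<^sub>R W x) = 0" if ab: "c < a" "a < b" for a b
 proof -
  obtain f where f: "!!k. ctest c (f k)" "!!k x. 0 <= f k x & f k x <= indicator {a<..<b} x"
   "!!x. (%k. f k x) \<longlonglongrightarrow> indicator {a<..<b} x"
   by (rule ctest_indicator_approx[OF ab]) blast
  have int: "integrable lborel (%x. indicator {a..b} x *\<^sub>R W x)" using W ab by (auto simp: locint_def set_integrable_def)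
  have int2: "integrable lborel (%x. indicator {a<..<b} x *\<^sub>R W x)"
   using int unfolding set_integrable_def[symmetric] by (rule set_integrable_subset) auto
  have "(%k. LINT x|lborel. f k x *\<^sub>R W x) \<longlonglongrightarrow> (LINT x|lborel. indicator {a<..<b} x *\<^sub>R W x)"
  proof (rule integral_dominated_convergence[where w="%x. norm (indicator {a<..<b} x *\<^sub>R W x)"])
   show "integrable lborel (%x. norm (indicator {a<..<b} x *\<^sub>R W x))" using int2 by (rule integrable_norm)
   show "(%x. f k x *\<^sub>R W x) : borel_measurable lborel" for k
    using ctest_integrable[OF W f(1)] by (rule borel_measurable_integrable)
   show "AE x in lborel. (%k. f k x *\<^sub>R W x) \<longlonglongrightarrow> indicator {a<..<b} x *\<^sub>R W x"
    by (intro AE_I2 tendsto_intros f(3))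
   show "AE x in lborel. norm (f k x *\<^sub>R W x) <= norm (indicator {a<..<b} x *\<^sub>R W x)" for k
    using f(2)[of k] by (intro AE_I2) (auto intro!: mult_right_mono)
  qed (use int2 in \<open>rule borel_measurable_integrable\<close>)
  then show ?thesis by (simp add: z[OF f(1)] LIMSEQ_const_iff)
 qed
 have ae: "AE x in lborel. indicator {a<..<b} x *\<^sub>R W x = 0" if ab: "c < a" "a < b" for a b
 proof (rule AE_zero_generator[where E="insert UNIV (range lessThan)"])
  show "integrable lborel (%x. indicator {a<..<b} x *\<^sub>R W x)"
  proof -
   have "set_integrable lborel {a..b} W" using W ab by (auto simp: locint_def)
   then have "set_integrable lborel {a<..<b} W" by (rule set_integrable_subset) auto
   then show ?thesis by (simp add: set_integrable_def)
  qed
  have "sets borel = sigma_sets UNIV (range (lessThan :: real => _))"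
   using arg_cong[OF borel_Iio[where 'a=real], of sets] by (simp add: sets_measure_of)
  also have "... = sigma_sets UNIV (insert UNIV (range lessThan))"
   by (intro antisym sigma_sets_mono) (auto intro: sigma_sets_top)
  finally show "sets lborel = sigma_sets (space lborel) (insert UNIV (range (lessThan :: real => _)))" by simp
  show "Int_stable (insert UNIV (range (lessThan :: real => _)))"
  proof -
   have "{..<a} \<inter> {..<b} = {..<min a b}" for a b :: real by auto
   then show ?thesis by (auto simp: Int_stable_def simp del: lessThan_Int_lessThan)
  qed
  fix A :: "real set" assume "A : insert UNIV (range lessThan)"
  then obtain b' where b': "b' <= b" "A \<inter> {a<..<b} = {a<..<b'}"
  proof
   assume "A = UNIV" then show thesis using that[of b] by simp
  next
   assume "A : range lessThan"
   then obtain t where "A = {..<t}" by auto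
   then have "A \<inter> {a<..<b} = {a<..<min b t}" by auto
   then show thesis using that[of "min b t"] by auto
  qed
  have "set_lebesgue_integral lborel A (%x. indicator {a<..<b} x *\<^sub>R W x) = (LINT x|lborel. indicator {a<..<b'} x *\<^sub>R W x)"
   unfolding set_lebesgue_integral_def b'(2)[symmetric] by (simp add: indicator_inter_arith)
  also have "... = 0" using ivl[of a b'] ab by (cases "a < b'") auto
  finally show "set_lebesgue_integral lborel A (%x. indicator {a<..<b} x *\<^sub>R W x) = 0" .
 qed (auto simp: sigma_finite_lborel)
 have "AE x in lborel. ALL n. indicator {c + 1 / real (Suc n)<..<c + 2 + real n} x *\<^sub>R W x = 0"
  unfolding AE_all_countable by (intro allI ae) (auto simp: field_simps intro: add_pos_nonneg)
 then show ?thesis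
 proof eventually_elim
  case (elim x)
  show ?case
  proof
   assume x: "c < x"
   obtain n1 where n1: "1 / real (Suc n1) < x - c" using x nat_approx_posE[of "x - c"] by auto
   obtain n2 where n2: "x - c < real n2" using reals_Archimedean2 by blast
   define n where "n = max n1 n2"
   have "1 / real (Suc n) <= 1 / real (Suc n1)" by (auto simp: n_def field_simps)
   then have "x : {c + 1 / real (Suc n)<..<c + 2 + real n}" using n1 n2 by (auto simp: n_def)
   then show "W x = 0" using elim[rule_format, of n] by simp
  qed
 qed
qed

lemma ctest_unit: "EX f. ctest c f & (LINT x|lborel. f x) = 1"
proof -
 obtain f where f: "!!k. ctest c (f k)" "!!k x. 0 <= f k x & f k x <= indicator {c+1<..<c+2} x"
   "!!x. (%k. f k x) \<longlonglongrightarrow> indicator {c+1<..<c+2} x"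
  by (rule ctest_indicator_approx[of c "c+1" "c+2"]) auto
 have "(%k. LINT x|lborel. f k x) \<longlonglongrightarrow> (LINT x|lborel. indicator {c+1<..<c+2} x)"
  by (rule integral_dominated_convergence[where w="indicator {c+1<..<c+2}"])
   (use f borel_ctest in \<open>auto simp: integrable_indicator_iff\<close>)
 then have "(%k. LINT x|lborel. f k x) \<longlonglongrightarrow> 1" by simp
 then have "\<forall>\<^sub>F k in sequentially. (LINT x|lborel. f k x) > 0" by (rule order_tendstoD) simp
 then obtain k where k: "(LINT x|lborel. f k x) > 0" by (auto simp: eventually_sequentially)
 then show ?thesis
  by (intro exI[of _ "%x. (1 / (LINT x|lborel. f k x)) * f k x"] conjI ctest_scale f(1)) auto
qed

lemma locint_1: "locint c (%x. 1 :: real)" by (intro locint_cont continuous_intros)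

lemma ctest_int: "ctest c f ==> integrable lborel f"
 using ctest_integrable[OF locint_1] by simp

text \<open>The constant value beyond \<open>b\<close> has two uses: if it is 0, the primitive is
  again a test function; if it is 1, one minus the primitive is a cutoff. The integral starts at
  \<open>a - 1\<close> so that \<open>a\<close> is an interior point.\<close>

lemma ctest_antiderivative:
 assumes g: "ctest c g" and h: "a < b" "ALL x. x ~: {a<..<b} --> g x = 0"
 shows "EX f. smooth1 f & deriv f = g & (ALL x<=a. f x = 0) & (ALL x>=b. f x = (LINT x|lborel. g x))"
proof -
 define f where "f x = integral {a-1..x} g" for x
 have gc: "continuous_on A g" for A using g by (rule ctest_cont)
 have g0: "g x = 0" if "x <= a | b <= x" for x using h(2)[rule_format, of x] that by auto
 have fa: "f x = 0" if "x <= a" for x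
 proof -
  have "integral {a-1..x} g = integral {a-1..x} (%x. 0)"
   by (rule Henstock_Kurzweil_Integration.integral_cong) (use that g0 in auto)
  then show ?thesis by (simp add: f_def)
 qed
 have fb: "f x = (LINT x|lborel. g x)" if x: "b <= x" for x
 proof -
  have "set_integrable lborel {a-1..x} g" using ctest_int[OF g] unfolding set_integrable_def by (rule integrable_mult_indicator[rotated]) simp
  then have "f x = set_lebesgue_integral lborel {a-1..x} g" unfolding f_def by (rule set_borel_integral_eq_integral(2)[symmetric])
  also have "... = (LINT x|lborel. g x)" unfolding set_lebesgue_integral_def
  proof (intro bochner_cong refl)
   fix y show "indicat_real {a - 1..x} y *\<^sub>R g y = g y"
    using g0[of y] h(1) x by (cases "y <= a | b <= y") auto
  qed
  finally show ?thesis .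
 qed
 have D: "(f has_real_derivative g x) (at x)" for x
 proof (cases "x >= a")
  case True
  have "((%u. integral {a-1..u} g) has_vector_derivative g x) (at x within {a-1..x+1})"
   by (rule integral_has_vector_derivative[OF gc]) (use True in auto)
  then have "((%u. integral {a-1..u} g) has_vector_derivative g x) (at x)"
   using True by (subst (asm) at_within_interior) auto
  then show ?thesis by (simp add: f_def[abs_def] has_real_derivative_iff_has_vector_derivative)
 next
  case False
  have "((%x. 0) has_real_derivative 0) (at x)" by simp
  then have "(f has_real_derivative 0) (at x)"
   by (rule has_field_derivative_transform_within_open[of _ _ _ "{..<a}"]) (use False fa in auto)
  then show ?thesis using g0[of x] False by simp
 qed
 have "smooth1 f" by (rule smooth1_primitive[OF D ctest_smooth1[OF g]])
 moreover have "deriv f = g" using D by (auto intro!: HOL.ext DERIV_imp_deriv)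
 ultimately show ?thesis using fa fb by blast
qed

lemma ctest_primitive:
 assumes g: "ctest c g" and z: "(LINT x|lborel. g x) = 0"
 shows "EX f. ctest c f & deriv f = g"
proof -
 obtain a b where h: "c < a" "a < b" "ALL x. x ~: {a<..<b} --> g x = 0" using ctest_supp[OF g] by blast
 from ctest_antiderivative[OF g h(2,3)] z
 obtain f where f: "smooth1 f" "deriv f = g" "ALL x<=a. f x = 0" "ALL x>=b. f x = 0" by auto
 have "ctest c f" by (rule ctestI[of _ c a b]) (use f h in auto)
 then show ?thesis using f(2) by blast
qed

lemma ctest_deriv_int0: assumes "ctest c f" shows "(LINT x|lborel. deriv f x) = 0"
proof -
 obtain a b where h: "c < a" "a < b" "ALL x. x ~: {a..b} --> deriv f x = 0" using ctest_supp'[OF ctest_deriv[OF assms]] by blast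
 obtain a' b' where h': "c < a'" "a' < b'" "ALL x. x ~: {a'<..<b'} --> f x = 0" using ctest_supp[OF assms] by blast
 define A B where "A = min a a'" and "B = max b b'"
 have AB: "A <= B" using h h' by (auto simp: A_def B_def)
 have "(LINT x|lborel. deriv f x) = (LINT x|lborel. deriv f x * indicator {A..B} x)"
 proof (intro bochner_cong refl)
  fix x show "deriv f x = deriv f x * indicator {A..B} x"
  proof (cases "x : {a..b}")
   case True
   then have "x : {A..B}" by (auto simp: A_def B_def)
   then show ?thesis by simp
  qed (use h(3) in auto)
 qed
 also have "... = f B - f A"
  by (rule integral_FTC_Icc_real[OF AB smooth1_has_deriv[OF ctest_smooth1[OF assms]]])
   (use ctest_cont[OF ctest_deriv[OF assms], of UNIV] in \<open>simp add: continuous_on_eq_continuous_at\<close>)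
 also have "... = 0" using h' by (auto simp: A_def B_def)
 finally show ?thesis .
qed

text \<open>Subtracting from \<open>f\<close> its integral times a fixed unit-mass \<open>e\<close>
  leaves a test function of mean zero, which is the derivative of another one. So \<open>W\<close>
  pairs with \<open>f\<close> as the constant \<open>K\<close> does.\<close>

lemma du_bois_reymond1:
 fixes W :: "real => real"
 assumes W: "locint c W" and z: "!!f. ctest c f ==> (LINT x|lborel. deriv f x * W x) = 0"
 shows "EX K. AE x in lborel. c < x --> W x = K"
proof -
 obtain e where e: "ctest c e" "(LINT x|lborel. e x) = 1" using ctest_unit by blast
 define K where "K = (LINT x|lborel. e x * W x)"
 have int: "integrable lborel (%x. f x * W x)" if "ctest c f" for f using ctest_integrable[OF W that] by simp
 have "AE x in lborel. c < x --> W x + (- K) = 0"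
 proof (rule locint_AE_eq_0)
  show "locint c (%x. W x + (- K))" by (intro locint_add W locint_cont continuous_intros)
  fix f assume f: "ctest c f"
  define k where "k = (LINT x|lborel. f x)"
  define g where "g = (%x. f x + (- k) * e x)"
  have g: "ctest c g" unfolding g_def by (intro ctest_add ctest_scale f e)
  have "(LINT x|lborel. g x) = 0" unfolding g_def using ctest_int[OF f] ctest_int[OF e(1)] e(2) by (simp add: k_def)
  then obtain h where "ctest c h" "deriv h = g" using ctest_primitive[OF g] by blast
  then have "(LINT x|lborel. g x * W x) = 0" using z[of h] by simp
  then have "(LINT x|lborel. f x * W x - k * (e x * W x)) = 0" by (simp add: g_def algebra_simps)
  then have "(LINT x|lborel. f x * W x) = k * K" using int[OF f] int[OF e(1)] by (simp add: K_def)
  then show "(LINT x|lborel. f x *\<^sub>R (W x + (- K))) = 0"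
   using int[OF f] ctest_int[OF f] by (simp add: algebra_simps k_def)
 qed
 then show ?thesis by (intro exI[of _ K]) auto
qed

text \<open>The first-order version is applied to \<open>W\<close> minus a linear function whose
  slope is read off from one test function.\<close>

lemma du_bois_reymond2:
 fixes W :: "real => real"
 assumes W: "locint c W" and z: "!!f. ctest c f ==> (LINT x|lborel. deriv (deriv f) x * W x) = 0"
 shows "EX K L. AE x in lborel. c < x --> W x = K + L * x"
proof -
 obtain e where e: "ctest c e" "(LINT x|lborel. e x) = 1" using ctest_unit by blast
 \<comment> \<open>For \<open>W x = K + L * x\<close>, integration by parts against \<open>e\<close>
   of mass 1 gives just this value.\<close>
 define L where "L = - (LINT x|lborel. deriv e x * W x)"
 have int: "integrable lborel (%x. f x * W x)" if "ctest c f" for f using ctest_integrable[OF W that] by simp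
 have "EX K. AE x in lborel. c < x --> W x + (- L) * x = K"
 proof (rule du_bois_reymond1)
  show "locint c (%x. W x + (- L) * x)" by (intro locint_add W locint_cont continuous_intros)
  fix f assume f: "ctest c f"
  define k where "k = (LINT x|lborel. f x)"
  define g where "g = (%x. f x + (- k) * e x)"
  have g: "ctest c g" unfolding g_def by (intro ctest_add ctest_scale f e)
  have "(LINT x|lborel. g x) = 0" unfolding g_def using ctest_int[OF f] ctest_int[OF e(1)] e(2) by (simp add: k_def)
  then obtain h where "ctest c h" "deriv h = g" using ctest_primitive[OF g] by blast
  then have "(LINT x|lborel. deriv g x * W x) = 0" using z[of h] by simp
  moreover have "deriv g x = deriv f x + (- k) * deriv e x" for x
   unfolding g_def using smooth1_has_deriv[OF ctest_smooth1[OF f]] smooth1_has_deriv[OF ctest_smooth1[OF e(1)]]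
   by (intro DERIV_imp_deriv derivative_eq_intros) auto
  ultimately have "(LINT x|lborel. deriv f x * W x - k * (deriv e x * W x)) = 0" by (simp add: algebra_simps)
  then have 1: "(LINT x|lborel. deriv f x * W x) = - k * L"
   using int[OF ctest_deriv[OF f]] int[OF ctest_deriv[OF e(1)]] by (simp add: L_def)
  have xf: "ctest c (%x. x * f x)" using ctest_mult[OF f smooth1_poly[of "[:0, 1:]"]] by simp
  have "deriv (%x. x * f x) x = x * deriv f x + f x" for x
   using smooth1_has_deriv[OF ctest_smooth1[OF f]] by (intro DERIV_imp_deriv) (auto intro!: derivative_eq_intros)
  with ctest_deriv_int0[OF xf] have "(LINT x|lborel. x * deriv f x + f x) = 0" by simp
  moreover have xd: "integrable lborel (%x. x * deriv f x)"
   using ctest_int[OF ctest_mult[OF ctest_deriv[OF f] smooth1_poly[of "[:0, 1:]"]]] by simp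
  ultimately have 2: "(LINT x|lborel. x * deriv f x) = - k" using ctest_int[OF f] by (simp add: k_def)
  have "(LINT x|lborel. deriv f x * (W x + (- L) * x)) = (LINT x|lborel. deriv f x * W x - L * (x * deriv f x))"
   by (simp add: algebra_simps)
  also have "... = 0" using 1 2 int[OF ctest_deriv[OF f]] xd by simp
  finally show "(LINT x|lborel. deriv f x * (W x + (- L) * x)) = 0" .
 qed
 then obtain K where "AE x in lborel. c < x --> W x + (- L) * x = K" by blast
 then show ?thesis by (intro exI[of _ K] exI[of _ L]) (auto elim: AE_mp)
qed

lemma integrable_prod_mult:
 fixes u v :: "real => real"
 assumes "integrable lborel u" "integrable lborel v"
 shows "integrable (lborel \<Otimes>\<^sub>M lborel) (%(x, y). u x * v y)"
proof (rule lborel_pair.Fubini_integrable)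
 have [measurable]: "u : borel_measurable lborel" "v : borel_measurable lborel" using assms by auto
 show "(%(x, y). u x * v y) : borel_measurable (lborel \<Otimes>\<^sub>M lborel)" by measurable
qed (use assms in \<open>auto simp: abs_mult\<close>)

text \<open>Integration by parts against the indefinite integral of a merely integrable function,
 via Fubini.\<close>
lemma ctest_parts:
 fixes q :: "real => real"
 assumes q: "!!B. set_integrable lborel {al..B} q" and f: "ctest al f"
 shows "(LINT x|lborel. f x * q x) = - (LINT x|lborel. deriv f x * integral {al..x} q)"
proof -
 obtain a1 b1 where h1: "al < a1" "a1 < b1" "ALL x. x ~: {a1..b1} --> deriv f x = 0" using ctest_supp'[OF ctest_deriv[OF f]] by blast
 obtain a2 b2 where h2: "al < a2" "a2 < b2" "ALL x. x ~: {a2<..<b2} --> f x = 0" using ctest_supp[OF f] by blast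
 define b where "b = max b1 b2"
 have ab: "al < b" using h1 h2 by (auto simp: b_def)
 have f'0: "deriv f x = 0" if "x ~: {al..b}" for x 
 proof -
  have "x ~: {a1..b1}" using that h1(1) by (auto simp: b_def)
  then show ?thesis using h1(3) by blast
 qed
 have f0: "f x = 0" if "x <= al | b <= x" for x
 proof -
  have "x ~: {a2<..<b2}" using that h2(1) by (auto simp: b_def)
  then show ?thesis using h2(3) by blast
 qed
 define u where "u s = indicator {al..b} s * q s" for s
 have u: "integrable lborel u" using q[of b] by (simp add: set_integrable_def u_def[abs_def])
 have f': "integrable lborel (deriv f)" by (rule ctest_int[OF ctest_deriv[OF f]])
 have [measurable]: "u : borel_measurable lborel" "deriv f : borel_measurable lborel" using u f' by auto
 \<comment> \<open>Integrating over \<open>r\<close> first yields \<open>- f s * q s\<close>, over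
   \<open>s\<close> first yields \<open>deriv f r\<close> times the indefinite integral of
   \<open>q\<close>.\<close>
 define H where "H s r = (if s <= r then u s * deriv f r else 0)" for s r
 have H: "integrable (lborel \<Otimes>\<^sub>M lborel) (%(s, r). H s r)"
  by (rule bochner_bound[OF integrable_prod_mult[OF u f']])
   (auto simp: H_def split: prod.split)
 have 1: "(LINT r|lborel. H s r) = - (f s * q s)" for s
 proof (cases "s : {al..b}")
  case True
  have "(LINT r|lborel. H s r) = q s * (LINT r|lborel. deriv f r * indicator {s..b} r)"
   unfolding Bochner_Integration.integral_mult_right_zero[symmetric]
   using True f'0 by (intro bochner_cong) (auto simp: H_def u_def indicator_def)
  also have "(LINT r|lborel. deriv f r * indicator {s..b} r) = f b - f s"
   by (rule integral_FTC_Icc_real[OF _ smooth1_has_deriv[OF ctest_smooth1[OF f]]])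
    (use True ctest_cont[OF ctest_deriv[OF f], of UNIV] in \<open>auto simp add: continuous_on_eq_continuous_at\<close>)
  finally show ?thesis using f0[of b] by simp
 next
  case False
  then have "s <= al | b <= s" by auto
  moreover have "u s = 0" using False by (simp add: u_def)
  then have "H s r = 0" for r by (simp add: H_def)
  ultimately show ?thesis using f0[of s] by simp
 qed
 have 2: "(LINT s|lborel. H s r) = deriv f r * integral {al..r} q" for r
 proof (cases "r : {al..b}")
  case True
  have "(LINT s|lborel. H s r) = deriv f r * set_lebesgue_integral lborel {al..r} q"
   unfolding set_lebesgue_integral_def Bochner_Integration.integral_mult_right_zero[symmetric]
   using True by (intro bochner_cong) (auto simp: H_def u_def indicator_def)
  then show ?thesis using set_borel_integral_eq_integral(2)[OF q[of r]] by simp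
 next
  case False
  then have "deriv f r = 0" by (rule f'0)
  moreover from this have "H s r = 0" for s by (simp add: H_def)
  ultimately show ?thesis by simp
 qed
 show ?thesis using lborel_pair.Fubini_integral[OF H] by (simp add: 1 2)
qed

text \<open>Changing the integrand on a null set does not alter the indefinite integral, so the
  fundamental theorem applies to the continuous representative.\<close>

lemma integral_deriv_AE:
 fixes q g :: "real => real"
 assumes q: "!!B. set_integrable lborel {al..B} q" and ae: "AE x in lborel. al < x --> q x = g x"
  and g: "continuous_on {al<..} g" and x: "al < x"
 shows "((%u. integral {al..u} q) has_real_derivative g x) (at x)"
proof -
 \<comment> \<open>\<open>g\<close> is controlled only to the right of \<open>al\<close>; the
   truncation is Borel on the whole line.\<close>
 define g' where "g' x = (if x <= al then 0 else g x)" for x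
 have gm: "g' : borel_measurable borel"
  using borel_measurable_continuous_on_indicator[OF _ g] 
  by (rule back_subst[of "%h. h : borel_measurable borel"]) (auto simp: g'_def indicator_def)
 have ae': "AE x in lborel. indicator {al..u} x *\<^sub>R q x = indicator {al..u} x *\<^sub>R g' x" for u
  using ae AE_lborel_singleton[of al] by eventually_elim (auto simp: g'_def indicator_def)
 have i: "set_integrable lborel {al..u} g'" for u
  using q[of u] unfolding set_integrable_def
  by (rule integrable_cong_AE_imp) (use gm ae' in auto)
 have eq: "integral {al..u} q = integral {al..u} g'" for u
  unfolding set_borel_integral_eq_integral(2)[OF q, symmetric] set_borel_integral_eq_integral(2)[OF i, symmetric]
  unfolding set_lebesgue_integral_def using q[of u] i[of u] unfolding set_integrable_def
  by (intro integral_cong_AE ae') auto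
 have "continuous (at x) g" using g x by (simp add: continuous_on_eq_continuous_at)
 then have "continuous (at x) g'"
  by (rule continuous_transform_within[where \<delta>="x - al"])
   (use x in \<open>auto simp: g'_def dist_real_def\<close>)
 then have "((%u. integral {al..u} g') has_vector_derivative g' x) (at x within {al..x+1} - {})"
  using x set_borel_integral_eq_integral(1)[OF i]
  by (intro integral_has_vector_derivative_continuous_at) (auto intro: continuous_within_subset)
 then have "((%u. integral {al..u} g') has_vector_derivative g' x) (at x)"
  using x by (simp, subst (asm) at_within_interior) auto
 then show ?thesis using x by (simp add: eq g'_def has_real_derivative_iff_has_vector_derivative)
qed

text \<open>Two integrations of the weak equation \<open>(b W')' = ka W\<close>. With
  \<open>Q\<close> the integral of \<open>ka W\<close> and \<open>S\<close> that of
  \<open>b' W + Q\<close>, the function \<open>b W - S\<close> has vanishing second weak derivative,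
  so it is affine. The integrals start at \<open>al > c\<close> since nothing is known up to
  \<open>c\<close>.\<close>

lemma weak_ode_regular:
 fixes b b' ka W :: "real => real"
 assumes b: "!!x. c < x ==> (b has_real_derivative b' x) (at x)" and bpos: "!!x. c < x ==> 0 < b x"
  and cb': "continuous_on {c<..} b'" and ck: "continuous_on {c<..} ka"
  and W: "locint c W"
  and weak: "!!f. ctest c f ==> (LINT x|lborel. W x * (ka x * f x - b x * deriv (deriv f) x - b' x * deriv f x)) = 0"
  and al: "c < al"
 obtains f p where "AE x in lborel. al < x --> W x = f x"
  "ALL x>al. (f has_real_derivative p x / b x) (at x) & (p has_real_derivative ka x * f x) (at x)"
proof -
 have cb: "continuous_on {c<..} b"
  by (intro continuous_at_imp_continuous_on ballI DERIV_isCont[OF b]) simp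
 have loc: "locint c (%x. g x * W x)" if "continuous_on {c<..} g" for g
  using locint_cont_mult[OF W that] by simp
 have sub: "continuous_on {al..B} h" if "continuous_on {c<..} h" for h :: "real => real" and B
  using al by (intro continuous_on_subset[OF that]) auto
 have ib: "set_integrable lborel {al..B} h" if "locint c h" for h :: "real => real" and B
  using that al by (auto simp: locint_def)
 define Q where "Q x = integral {al..x} (%x. ka x * W x)" for x
 have qi: "set_integrable lborel {al..B} (%x. ka x * W x)" for B by (rule ib[OF loc[OF ck]])
 have cQ: "continuous_on {al..B} Q" for B
  unfolding Q_def by (rule indefinite_integral_continuous_1[OF set_borel_integral_eq_integral(1)[OF qi]])
 have cQ': "continuous_on {al<..} Q"
 proof (intro continuous_at_imp_continuous_on ballI)
  fix x assume "x : {al<..}"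
  then show "isCont Q x" using cQ[of "x+1"] by (intro continuous_on_interior[of "{al..x+1}"]) auto
 qed
 have Qi: "set_integrable lborel {al..B} Q" for B
  unfolding set_integrable_def by (rule borel_integrable_compact[OF _ cQ]) auto
 have bW: "set_integrable lborel {al..B} (%x. b' x * W x)" for B by (rule ib[OF loc[OF cb']])
 have si: "set_integrable lborel {al..B} (%x. b' x * W x + Q x)" for B
  by (intro set_integral_add bW Qi)
 define S where "S x = integral {al..x} (%x. b' x * W x + Q x)" for x
 have cS: "continuous_on {al..B} S" for B
  unfolding S_def by (rule indefinite_integral_continuous_1[OF set_borel_integral_eq_integral(1)[OF si]])
 have cS': "continuous_on {al<..} S"
 proof (intro continuous_at_imp_continuous_on ballI)
  fix x assume "x : {al<..}"
  then show "isCont S x" using cS[of "x+1"] by (intro continuous_on_interior[of "{al..x+1}"]) auto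
 qed
 have locm: "locint al (%x. b x * W x)" by (rule locint_mono[OF loc[OF cb]]) (use al in simp)
 have "EX K L. AE x in lborel. al < x --> b x * W x + (- 1) * S x = K + L * x"
 proof (rule du_bois_reymond2)
  show "locint al (%x. b x * W x + (- 1) * S x)" by (intro locint_add locm locint_cont continuous_intros cS')
  fix f assume f: "ctest al f"
  have f1: "ctest al (deriv f)" and f2: "ctest al (deriv (deriv f))" using f by (auto intro: ctest_deriv)
  have fc: "ctest c f" "ctest c (deriv f)" "ctest c (deriv (deriv f))" using ctest_mono[OF _ less_imp_le[OF al]] f f1 f2 by auto
  have i1: "integrable lborel (%x. f x * (ka x * W x))" using ctest_integrable[OF loc[OF ck] fc(1)] by simp
  have i2: "integrable lborel (%x. deriv f x * (b' x * W x))" using ctest_integrable[OF loc[OF cb'] fc(2)] by simp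
  have i3: "integrable lborel (%x. deriv (deriv f) x * (b x * W x))" using ctest_integrable[OF loc[OF cb] fc(3)] by simp
  have i4: "integrable lborel (%x. deriv f x * Q x)" using ctest_integrable[OF locint_cont[OF cQ'] f1] by simp
  have i5: "integrable lborel (%x. deriv (deriv f) x * S x)" using ctest_integrable[OF locint_cont[OF cS'] f2] by simp
  have e0: "(LINT x|lborel. f x * (ka x * W x) - deriv (deriv f) x * (b x * W x) - deriv f x * (b' x * W x)) = 0"
   using weak[OF fc(1)] by (simp add: algebra_simps)
  have e1: "(LINT x|lborel. f x * (ka x * W x)) = - (LINT x|lborel. deriv f x * Q x)"
   unfolding Q_def by (rule ctest_parts[OF qi f])
  have e2: "(LINT x|lborel. deriv f x * (b' x * W x + Q x)) = - (LINT x|lborel. deriv (deriv f) x * S x)"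
   unfolding S_def by (rule ctest_parts[OF si f1])
  have "(LINT x|lborel. deriv (deriv f) x * (b x * W x + (- 1) * S x)) =
    (LINT x|lborel. deriv (deriv f) x * (b x * W x) - deriv (deriv f) x * S x)" by (simp add: algebra_simps)
  also have "... = 0" using e0 e1 e2 i1 i2 i3 i4 i5 by (simp add: distrib_left)
  finally show "(LINT x|lborel. deriv (deriv f) x * (b x * W x + (- 1) * S x)) = 0" .
 qed
 then obtain K L where KL: "AE x in lborel. al < x --> b x * W x + (- 1) * S x = K + L * x" by blast
 define f where "f x = (S x + K + L * x) / b x" for x
 define p where "p x = Q x + L" for x
 have cf: "continuous_on {al<..} f"
  unfolding f_def
 proof (intro continuous_intros cS')
  show "continuous_on {al<..} b" by (rule continuous_on_subset[OF cb]) (use al in auto)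
  show "ALL x:{al<..}. b x ~= 0" using al bpos by (auto intro!: less_imp_neq[symmetric])
 qed
 have ae: "AE x in lborel. al < x --> W x = f x"
  using KL
 proof eventually_elim
  case (elim x)
  show ?case
  proof
   assume x: "al < x"
   then have "b x * W x = S x + K + L * x" using elim by simp
   moreover have "b x > 0" using x al bpos by simp
   ultimately show "W x = f x" by (simp add: f_def field_simps)
  qed
 qed
 have dQ: "(Q has_real_derivative ka x * f x) (at x)" if x: "al < x" for x
  unfolding Q_def
 proof (rule integral_deriv_AE[OF qi _ _ x])
  show "AE x in lborel. al < x --> ka x * W x = ka x * f x" using ae by eventually_elim auto
  show "continuous_on {al<..} (%x. ka x * f x)" using al by (intro continuous_intros cf continuous_on_subset[OF ck]) auto
 qed
 have dS: "(S has_real_derivative b' x * f x + Q x) (at x)" if x: "al < x" for x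
  unfolding S_def
 proof (rule integral_deriv_AE[OF si _ _ x])
  show "AE x in lborel. al < x --> b' x * W x + Q x = b' x * f x + Q x" using ae by eventually_elim auto
  show "continuous_on {al<..} (%x. b' x * f x + Q x)" using al by (intro continuous_intros cf cQ' continuous_on_subset[OF cb']) auto
 qed
 have df: "(f has_real_derivative p x / b x) (at x)" if x: "al < x" for x
 proof -
  have bx: "b x > 0" "c < x" using x al bpos by auto
  have e: "f x * b x = S x + K + L * x" using bx by (simp add: f_def)
  have "(f has_real_derivative ((b' x * f x + Q x + L) * b x - (S x + K + L * x) * b' x) / (b x * b x)) (at x)"
  proof -
   have "((%x. S x + K + L * x) has_real_derivative b' x * f x + Q x + L) (at x)"
    using dS[OF x] by (auto intro!: derivative_eq_intros)
   then show ?thesis unfolding f_def[abs_def] using bx by (intro DERIV_divide b) auto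
  qed
  also have "((b' x * f x + Q x + L) * b x - (S x + K + L * x) * b' x) / (b x * b x) = p x / b x"
   unfolding e[symmetric] p_def using bx by (simp add: field_simps)
  finally show ?thesis .
 qed
 have dp: "(p has_real_derivative ka x * f x) (at x)" if x: "al < x" for x
  unfolding p_def using dQ[OF x] by (auto intro!: derivative_eq_intros)
 show ?thesis using that[OF ae] df dp by blast
qed

text \<open>On a compact interval the weight has a positive minimum, and
  \<open>\<bar>W\<bar>\<close> is at most \<open>1 + W^2\<close>.\<close>

lemma locint_of_weighted_square:
 fixes W w :: "real => real"
 assumes [measurable]: "W : borel_measurable borel" and cw: "continuous_on {c<..} w" and w: "!!x. c < x ==> 0 < w x"
  and sq: "(\<integral>\<^sup>+x. indicator {c<..} x * ennreal (w x * (W x)\<^sup>2) \<partial>lborel) < \<infinity>"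
 shows "locint c W"
 unfolding locint_def
proof (intro allI impI)
 fix a b assume a: "c < a"
 show "set_integrable lborel {a..b} W"
 proof (cases "a <= b")
  case True
  have "continuous_on {a..b} w" by (rule continuous_on_subset[OF cw]) (use a in auto)
  then have "EX z:{a..b}. ALL x:{a..b}. w z <= w x" by (intro continuous_attains_inf) (use True in auto)
  then obtain z where z: "z : {a..b}" "!!x. x : {a..b} ==> w z <= w x" by blast
  define \<delta> where "\<delta> = w z"
  have \<delta>: "\<delta> > 0" using w z(1) a by (auto simp: \<delta>_def)
  have "(\<integral>\<^sup>+x. ennreal (norm (indicator {a..b} x *\<^sub>R W x)) \<partial>lborel) <=
    (\<integral>\<^sup>+x. indicator {a..b} x + ennreal (1/\<delta>) * (indicator {c<..} x * ennreal (w x * (W x)\<^sup>2)) \<partial>lborel)"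
  proof (rule nn_integral_mono)
   fix x
   show "ennreal (norm (indicator {a..b} x *\<^sub>R W x)) <= indicator {a..b} x + ennreal (1/\<delta>) * (indicator {c<..} x * ennreal (w x * (W x)\<^sup>2))"
   proof (cases "x : {a..b}")
    case x: True
    have "\<bar>W x\<bar> <= 1 + (W x)\<^sup>2" using sum_squares_bound[of 1 "\<bar>W x\<bar>"] by (auto simp: power2_eq_square)
    also have "(W x)\<^sup>2 <= 1/\<delta> * (w x * (W x)\<^sup>2)"
     using mult_right_mono[OF z(2)[OF x], of "(W x)\<^sup>2"] \<delta> by (simp add: \<delta>_def[symmetric] field_simps)
    finally have "ennreal \<bar>W x\<bar> <= ennreal (1 + 1/\<delta> * (w x * (W x)\<^sup>2))" by (intro ennreal_leI) simp
    also have "... = 1 + ennreal (1/\<delta>) * ennreal (w x * (W x)\<^sup>2)"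
     using \<delta> w[of x] x a by (subst ennreal_plus) (auto simp: ennreal_mult[symmetric])
    finally show ?thesis using x a by simp
   qed simp
  qed
  also have "... = (\<integral>\<^sup>+x. indicator {a..b} x \<partial>lborel) + ennreal (1/\<delta>) * (\<integral>\<^sup>+x. indicator {c<..} x * ennreal (w x * (W x)\<^sup>2) \<partial>lborel)"
  proof -
   have "(%x. indicator {c<..} x * w x) : borel_measurable borel"
    using borel_measurable_continuous_on_indicator[OF _ cw] by simp
   then have "(%x. ennreal ((indicator {c<..} x * w x) * (W x)\<^sup>2)) : borel_measurable borel" by measurable
   then have [measurable]: "(%x. indicator {c<..} x * ennreal (w x * (W x)\<^sup>2)) : borel_measurable borel"
    by (rule back_subst[of "%h. h : borel_measurable borel"]) (auto simp: indicator_def)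
   show ?thesis by (subst nn_integral_add) (auto simp: nn_integral_cmult)
  qed
  also have "... < \<infinity>" using sq True by (auto simp: ennreal_mult_less_top emeasure_lborel_Icc)
  finally show ?thesis unfolding set_integrable_def by (intro integrableI_bounded) auto
 qed (simp add: set_integrable_def)
qed

text \<open>\<open>f p\<close> is nondecreasing. If it is positive somewhere, \<open>f\<^sup>2\<close> stays away from 0 near infinity;
 otherwise \<open>f\<^sup>2\<close> is nonincreasing and stays away from 0 near \<open>c\<close>. Either contradicts the
 divergence of the weight.\<close>
lemma weak_ode_zero:
 fixes b b' ka w W :: "real => real"
 assumes b: "!!x. c < x ==> (b has_real_derivative b' x) (at x)" and bpos: "!!x. c < x ==> 0 < b x"
  and cb': "continuous_on {c<..} b'" and ck: "continuous_on {c<..} ka" and kpos: "!!x. c < x ==> 0 <= ka x"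
  and cw: "continuous_on {c<..} w" and w: "!!x. c < x ==> 0 < w x"
  and inf0: "!!r. c < r ==> (\<integral>\<^sup>+x. indicator {c<..r} x * ennreal (w x) \<partial>lborel) = \<infinity>"
  and inf1: "!!r. c < r ==> (\<integral>\<^sup>+x. indicator {r..} x * ennreal (w x) \<partial>lborel) = \<infinity>"
  and Wm [measurable]: "W : borel_measurable borel"
  and sq: "(\<integral>\<^sup>+x. indicator {c<..} x * ennreal (w x * (W x)\<^sup>2) \<partial>lborel) < \<infinity>"
  and weak: "!!f. ctest c f ==> (LINT x|lborel. W x * (ka x * f x - b x * deriv (deriv f) x - b' x * deriv f x)) = 0"
 shows "AE x in lborel. c < x --> W x = 0"
proof -
 have loc: "locint c W" by (rule locint_of_weighted_square[OF Wm cw w sq])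
 \<comment> \<open>The only use of divergence of the weight: on a set of infinite weight,
   \<open>W^2\<close> has no positive lower bound.\<close>
 have key: "\<delta> <= 0" if ae: "AE x in lborel. x : A --> \<delta> <= (W x)\<^sup>2" and A: "A \<subseteq> {c<..}" "A : sets borel"
  and inf: "(\<integral>\<^sup>+x. indicator A x * ennreal (w x) \<partial>lborel) = \<infinity>" for A \<delta>
 proof (rule ccontr)
  assume "~ \<delta> <= 0"
  then have \<delta>: "\<delta> > 0" by simp
  have "(%x. indicator {c<..} x * w x) : borel_measurable borel"
   using borel_measurable_continuous_on_indicator[OF _ cw] by simp
  then have "(%x. indicator A x * ennreal (indicator {c<..} x * w x)) : borel_measurable borel" using A(2) by measurable
  then have m: "(%x. indicator A x * ennreal (w x)) : borel_measurable borel"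
   by (rule back_subst[of "%h. h : borel_measurable borel"]) (use A(1) in \<open>auto simp: indicator_def fun_eq_iff\<close>)
  have "\<infinity> = ennreal \<delta> * (\<integral>\<^sup>+x. indicator A x * ennreal (w x) \<partial>lborel)"
   using \<delta> inf by (simp add: ennreal_mult_top)
  also have "... = (\<integral>\<^sup>+x. ennreal \<delta> * (indicator A x * ennreal (w x)) \<partial>lborel)"
   using m by (simp add: nn_integral_cmult)
  also have "... <= (\<integral>\<^sup>+x. indicator {c<..} x * ennreal (w x * (W x)\<^sup>2) \<partial>lborel)"
  proof (rule nn_integral_mono_AE, use ae in eventually_elim)
   fix x assume h: "x : A --> \<delta> <= (W x)\<^sup>2"
   show "ennreal \<delta> * (indicator A x * ennreal (w x)) <= indicator {c<..} x * ennreal (w x * (W x)\<^sup>2)"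
   proof (cases "x : A")
    case True
    then have "c < x" using A by auto
    then have "ennreal (\<delta> * w x) <= ennreal (w x * (W x)\<^sup>2)"
     using h True w[of x] by (intro ennreal_leI) (auto simp: mult.commute intro: mult_left_mono)
    then show ?thesis using True \<open>c < x\<close> \<delta> w[of x] by (simp add: ennreal_mult)
   qed simp
  qed
  also have "... < \<infinity>" by (rule sq)
  finally show False by simp
 qed
 have decr: "EX f. (AE x in lborel. al < x --> W x = f x) & continuous_on {al<..} f &
   (ALL x y. al < x --> x <= y --> (f y)\<^sup>2 <= (f x)\<^sup>2)" if al: "c < al" for al
 proof -
  obtain f p where ae: "AE x in lborel. al < x --> W x = f x"
   and D: "ALL x>al. (f has_real_derivative p x / b x) (at x) & (p has_real_derivative ka x * f x) (at x)"
   by (rule weak_ode_regular[OF b bpos cb' ck loc weak al]) auto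
  have D1: "(f has_real_derivative p x / b x) (at x)" "(p has_real_derivative ka x * f x) (at x)" if "al < x" for x
   using D that by auto
  have bp: "b x > 0" if "al < x" for x using that al bpos by simp
  \<comment> \<open>The derivative of \<open>f p\<close> is \<open>p^2 / b + ka f^2\<close>; here
    the sign of \<open>ka\<close> enters.\<close>
  have mono: "f x * p x <= f y * p y" if "al < x" "x <= y" for x y
  proof (rule DERIV_nonneg_imp_nondecreasing[OF that(2)])
   fix t assume t: "x <= t" "t <= y"
   then have "al < t" using that by simp
   then have "((%t. f t * p t) has_real_derivative (p t)\<^sup>2 / b t + ka t * (f t)\<^sup>2) (at t)"
    using D1[of t] by (auto intro!: derivative_eq_intros simp: power2_eq_square algebra_simps)
   moreover have "0 <= (p t)\<^sup>2 / b t + ka t * (f t)\<^sup>2"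
    using bp[OF \<open>al < t\<close>] kpos[of t] \<open>al < t\<close> al by (intro add_nonneg_nonneg mult_nonneg_nonneg divide_nonneg_pos) auto
   ultimately show "EX d. ((%t. f t * p t) has_real_derivative d) (at t) & 0 <= d" by blast
  qed
  have Dsq: "((%t. (f t)\<^sup>2) has_real_derivative 2 * (f t * p t) / b t) (at t)" if "al < t" for t
   using D1[OF that] by (auto intro!: derivative_eq_intros)
  have le0: "f r * p r <= 0" if r: "al < r" for r
  proof (rule ccontr)
   assume "~ f r * p r <= 0"
   then have pos: "f r * p r > 0" by simp
   have "(f r)\<^sup>2 <= (f y)\<^sup>2" if "r <= y" for y
   proof (rule DERIV_nonneg_imp_nondecreasing[OF that])
    fix t assume t: "r <= t" "t <= y"
    then have "0 <= 2 * (f t * p t) / b t" using mono[of r t] r pos bp[of t] by (intro divide_nonneg_pos) auto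
    then show "EX d. ((%t. (f t)\<^sup>2) has_real_derivative d) (at t) & 0 <= d" using Dsq[of t] t r by auto
   qed
   then have "AE x in lborel. x : {r..} --> (f r)\<^sup>2 <= (W x)\<^sup>2" using ae r by (auto elim!: AE_mp)
   then have "(f r)\<^sup>2 <= 0" by (rule key) (use r al inf1 in auto)
   then show False using pos by simp
  qed
  have "(f y)\<^sup>2 <= (f x)\<^sup>2" if "al < x" "x <= y" for x y
  proof (rule DERIV_nonpos_imp_nonincreasing[OF that(2)])
   fix t assume t: "x <= t" "t <= y"
   then have "2 * (f t * p t) / b t <= 0" using le0[of t] that bp[of t] by (intro divide_nonpos_pos) auto
   then show "EX d. ((%t. (f t)\<^sup>2) has_real_derivative d) (at t) & d <= 0" using Dsq[of t] t that by auto
  qed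
  moreover have "continuous_on {al<..} f"
   by (intro continuous_at_imp_continuous_on ballI DERIV_isCont[OF D1(1)]) simp
  ultimately show ?thesis using ae by blast
 qed
 \<comment> \<open>The representative \<open>f\<close> exists only on the right of
   \<open>al\<close>. Those belonging to smaller left ends \<open>be\<close> agree with it, being
   continuous and almost everywhere equal to \<open>W\<close>; so the lower bound
   \<open>(f r)^2\<close> of \<open>W^2\<close> extends down to every \<open>be\<close>, and hence
   to \<open>c\<close>.\<close>
 have zero: "f r = 0" if al: "c < al" and r: "al < r" and f: "AE x in lborel. al < x --> W x = f x" "continuous_on {al<..} f"
  "ALL x y. al < x --> x <= y --> (f y)\<^sup>2 <= (f x)\<^sup>2" for f al r
 proof -
  have le: "AE x in lborel. x : {be<..r} --> (f r)\<^sup>2 <= (W x)\<^sup>2" if be: "c < be" "be < al" for be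
  proof -
   obtain g where g: "AE x in lborel. be < x --> W x = g x" "continuous_on {be<..} g"
    "ALL x y. be < x --> x <= y --> (g y)\<^sup>2 <= (g x)\<^sup>2" using decr[OF be(1)] by blast
   have "(f r)\<^sup>2 = (g r)\<^sup>2"
   proof -
    have eq: "f x = g x" if "x : {al<..}" for x
    proof -
     have cg: "continuous_on {al<..} (%x. f x - g x)"
      using be by (intro continuous_intros f(2) continuous_on_subset[OF g(2)]) auto
     have "AE x in lborel. al < x --> f x - g x = 0"
      using f(1) g(1) by eventually_elim (use be in auto)
     then have 0: "AE x in lborel. indicator {al<..} x * (f x - g x) = 0"
      by eventually_elim (auto simp: indicator_def)
     show ?thesis
     proof (rule ccontr)
      assume ne: "f x ~= g x"
      have "open ({al<..} \<inter> (%x. f x - g x) -` (- {0}))"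
       by (rule continuous_open_preimage[OF cg]) auto
      moreover have "x : {al<..} \<inter> (%x. f x - g x) -` (- {0})" using ne that by auto
      ultimately obtain e where e: "e > 0" "ball x e \<subseteq> {al<..} \<inter> (%x. f x - g x) -` (- {0})"
       using open_contains_ball by blast
      have "AE y in lborel. y ~: ball x e"
       using 0 by eventually_elim (use e(2) in auto)
      then have "emeasure lborel (ball x e) = 0"
       by (subst (asm) AE_iff_measurable[of "ball x e"]) auto
      then show False using e(1) by (simp add: ball_eq_greaterThanLessThan)
     qed
    qed
    show ?thesis using eq[of r] r by simp
   qed
   moreover have "AE x in lborel. x : {be<..r} --> (g r)\<^sup>2 <= (W x)\<^sup>2"
    using g(1) by eventually_elim (use g(3) in auto)
   ultimately show ?thesis by simp
  qed
  have "AE x in lborel. ALL n. x : {c + (al - c) / real (n + 2)<..r} --> (f r)\<^sup>2 <= (W x)\<^sup>2"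
   unfolding AE_all_countable
  proof (intro allI le)
   fix n :: nat
   show "c < c + (al - c) / real (n + 2)" using al by simp
   have "(al - c) / real (n + 2) < (al - c) / 1" using al by (intro divide_strict_left_mono) auto
   then show "c + (al - c) / real (n + 2) < al" by simp
  qed
  then have "AE x in lborel. x : {c<..r} --> (f r)\<^sup>2 <= (W x)\<^sup>2"
  proof eventually_elim
   case (elim x)
   show ?case
   proof
    assume x: "x : {c<..r}"
    obtain n where n: "(al - c) / (x - c) < real n" using reals_Archimedean2 by blast
    then have "(al - c) < real (n + 2) * (x - c)" using x by (auto simp: field_simps)
    then have "c + (al - c) / real (n + 2) < x" by (simp add: field_simps)
    then show "(f r)\<^sup>2 <= (W x)\<^sup>2" using elim x by auto
   qed
  qed
  then have "(f r)\<^sup>2 <= 0" by (rule key) (use r al inf0 in auto)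
  then show ?thesis by simp
 qed
 have "AE x in lborel. ALL n. c + 1 / real (Suc n) < x --> W x = 0"
  unfolding AE_all_countable
 proof
  fix n
  have al: "c < c + 1 / real (Suc n)" by simp
  obtain f where f: "AE x in lborel. c + 1 / real (Suc n) < x --> W x = f x" "continuous_on {c + 1 / real (Suc n)<..} f"
   "ALL x y. c + 1 / real (Suc n) < x --> x <= y --> (f y)\<^sup>2 <= (f x)\<^sup>2" using decr[OF al] by blast
  show "AE x in lborel. c + 1 / real (Suc n) < x --> W x = 0"
   using f(1) by eventually_elim (use zero[OF al _ f] in auto)
 qed
 then show ?thesis
 proof eventually_elim
  case (elim x)
  show ?case
  proof
   assume "c < x"
   then obtain n where "1 / real (Suc n) < x - c" using nat_approx_posE[of "x - c"] by auto
   then show "W x = 0" using elim by (auto simp: algebra_simps)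
  qed
 qed
qed

section \<open>Smooth functions and test functions\<close>

text \<open>Smoothness is witnessed by a family closed under directional derivatives; the algebra
  generated by elementary functions is the family that is easiest to exhibit.\<close>

inductive_set calg :: "('a => 'b::real_normed_algebra_1) set => ('a => 'b) set" for F where
 base: "f : F ==> f : calg F"
| const: "(%x. c) : calg F"
| add: "f : calg F ==> g : calg F ==> (%x. f x + g x) : calg F"
| mult: "f : calg F ==> g : calg F ==> (%x. f x * g x) : calg F"

lemma calg_sum: "finite A ==> (!!i. i : A ==> f i : calg F) ==> (%x. SUM i:A. f i x) : calg F"
 by (induction rule: finite_induct) (auto intro: calg.const calg.add)

lemma smooth_onI:
 assumes "f : FF" "!!g x. g : FF ==> x : S ==> g differentiable (at x)"
  "!!g v. g : FF ==> EX h:FF. ALL x:S. frechet_derivative g (at x) v = h x"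
 shows "smooth_on S f"
 unfolding smooth_on_def using assms by (intro exI[of _ FF]) auto

lemma smooth_on_differentiable: "smooth_on S f ==> x : S ==> f differentiable (at x)"
 unfolding smooth_on_def by blast

lemma smooth_on_deriv_ex:
 assumes "smooth_on S f" shows "EX h. smooth_on S h & (ALL x:S. frechet_derivative f (at x) v = h x)"
proof -
 obtain FF where FF: "f : FF" "ALL g:FF. (ALL x:S. g differentiable (at x)) &
   (ALL v. EX h:FF. ALL x:S. frechet_derivative g (at x) v = h x)" using assms unfolding smooth_on_def by blast
 then obtain h where h: "h : FF" "ALL x:S. frechet_derivative f (at x) v = h x" by blast
 have "smooth_on S h" unfolding smooth_on_def by (rule exI[of _ FF]) (use h(1) FF(2) in simp)
 then show ?thesis using h(2) by blast
qed

lemma smooth_on_has_derivative: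
 "smooth_on S f ==> x : S ==> (f has_derivative frechet_derivative f (at x)) (at x)"
 using smooth_on_differentiable frechet_derivative_works by blast

lemma frechet_derivative_eqI: "(f has_derivative f') (at x) ==> frechet_derivative f (at x) = f'"
 by (metis frechet_derivative_at)

text \<open>By the sum and product rules the algebra is closed under derivatives as soon as the
  derivatives of the generators lie in it. All identities are required on \<open>S\<close> only,
  since elsewhere the derivative may be an unspecified value.\<close>

lemma smooth_on_calg:
 fixes F :: "('a::real_normed_vector => 'b::real_normed_algebra_1) set"
 assumes f: "f : calg F" and D: "!!g x. g : F ==> x : S ==> g differentiable (at x)"
  and F: "!!g v. g : F ==> EX h:calg F. ALL x:S. frechet_derivative g (at x) v = h x"
 shows "smooth_on S f"
proof (rule smooth_onI[OF f])
 have *: "(ALL x:S. g differentiable (at x)) & (ALL v. EX h:calg F. ALL x:S. frechet_derivative g (at x) v = h x)"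
  if "g : calg F" for g
  using that
 proof induction
  case (base f)
  then show ?case using D F by blast
 next
  case (const c)
  show ?case by (auto intro!: bexI[of _ "%x. 0"] calg.const)
 next
  case (add f g)
  show ?case
  proof (intro conjI allI)
   show "ALL x:S. (%x. f x + g x) differentiable at x" using add by auto
   fix v
   obtain f' g' where "f' : calg F" "g' : calg F" "ALL x:S. frechet_derivative f (at x) v = f' x"
    "ALL x:S. frechet_derivative g (at x) v = g' x" using add by blast
   moreover have "frechet_derivative (%x. f x + g x) (at x) v = frechet_derivative f (at x) v + frechet_derivative g (at x) v" if "x : S" for x
    using add that by (subst frechet_derivative_eqI[OF has_derivative_add]) (auto simp: frechet_derivative_works[symmetric])
   ultimately show "EX h:calg F. ALL x:S. frechet_derivative (%x. f x + g x) (at x) v = h x"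
    by (intro bexI[of _ "%x. f' x + g' x"]) (auto intro: calg.add)
  qed
 next
  case (mult f g)
  show ?case
  proof (intro conjI allI)
   show "ALL x:S. (%x. f x * g x) differentiable at x" using mult by auto
   fix v
   obtain f' g' where "f' : calg F" "g' : calg F" "ALL x:S. frechet_derivative f (at x) v = f' x"
    "ALL x:S. frechet_derivative g (at x) v = g' x" using mult by blast
   moreover have "frechet_derivative (%x. f x * g x) (at x) v = f x * frechet_derivative g (at x) v + frechet_derivative f (at x) v * g x" if "x : S" for x
    using mult that by (subst frechet_derivative_eqI[OF has_derivative_mult]) (auto simp: frechet_derivative_works[symmetric])
   ultimately show "EX h:calg F. ALL x:S. frechet_derivative (%x. f x * g x) (at x) v = h x"
    using mult by (intro bexI[of _ "%x. f x * g' x + f' x * g x"]) (auto intro: calg.add calg.mult)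
  qed
 qed
 show "g differentiable (at x)" if "g : calg F" "x : S" for g x using *[OF that(1)] that(2) by blast
 show "EX h:calg F. ALL x:S. frechet_derivative g (at x) v = h x" if "g : calg F" for g v using *[OF that(1)] by blast
qed

lemma smooth_on_alg:
 fixes f g :: "'a::real_normed_vector => 'b::real_normed_algebra_1"
 assumes "smooth_on S f" "smooth_on S g"
 shows smooth_on_add: "smooth_on S (%x. f x + g x)" and smooth_on_mult: "smooth_on S (%x. f x * g x)"
proof -
 have *: "smooth_on S h" if "h : calg (Collect (smooth_on S))" for h :: "'a => 'b"
  using that
 proof (rule smooth_on_calg)
  fix g :: "'a => 'b" and v :: 'a assume "g : Collect (smooth_on S)"
  then show "EX h:calg (Collect (smooth_on S)). ALL x:S. frechet_derivative g (at x) v = h x"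
   using smooth_on_deriv_ex[of S g v] calg.base by blast
 qed (auto intro: smooth_on_differentiable)
 show "smooth_on S (%x. f x + g x)" "smooth_on S (%x. f x * g x)"
  by (intro * calg.add calg.mult calg.base; use assms in simp)+
qed

text \<open>On an open set equal functions have equal derivatives, so the witnessing family of
  \<open>f\<close> needs just the one additional member \<open>g\<close>.\<close>

lemma smooth_on_cong:
 assumes f: "smooth_on S f" and S: "open S" and eq: "!!x. x : S ==> f x = g x" shows "smooth_on S g"
proof -
 obtain FF where FF: "f : FF" "ALL g:FF. (ALL x:S. g differentiable (at x)) &
   (ALL v. EX h:FF. ALL x:S. frechet_derivative g (at x) v = h x)" using f unfolding smooth_on_def by blast
 have d: "(g has_derivative frechet_derivative f (at x)) (at x)" if "x : S" for x
  by (rule has_derivative_transform_within_open[OF smooth_on_has_derivative[OF f that] S that]) (simp add: eq)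
 show ?thesis
 proof (rule smooth_onI[of g "insert g FF"])
  fix h x assume "h : insert g FF" "x : S"
  then show "h differentiable (at x)" using FF d[of x] by (auto simp: differentiable_def)
 next
  fix h v assume h: "h : insert g FF"
  have g: "EX h:FF. ALL x:S. frechet_derivative g (at x) v = h x"
  proof -
   obtain h where "h : FF" "ALL x:S. frechet_derivative f (at x) v = h x" using FF by blast
   then show ?thesis using frechet_derivative_eqI[OF d] by (intro bexI[of _ h]) auto
  qed
  show "EX h':insert g FF. ALL x:S. frechet_derivative h (at x) v = h' x"
  proof (cases "h = g")
   case True
   then show ?thesis using g by simp
  next
   case False
   then show ?thesis using h FF(2) by simp
  qed
 qed simp
qed

lemma smooth_on_deriv:
 assumes "smooth_on S f" "open S" shows "smooth_on S (%x. frechet_derivative f (at x) v)"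
proof -
 obtain h where h: "smooth_on S h" "ALL x:S. frechet_derivative f (at x) v = h x"
  using smooth_on_deriv_ex[OF assms(1)] by blast
 show ?thesis by (rule smooth_on_cong[OF h(1) assms(2)]) (simp add: h(2))
qed

lemma smooth_on_const: "smooth_on S (%x. c)"
 by (rule smooth_onI[of _ "range (%c x. c)"]) auto

lemma smooth_on_linear:
 assumes f: "smooth_on S f" and L: "bounded_linear L" shows "smooth_on S (%x. L (f x))"
proof -
 obtain FF where FF: "f : FF" "ALL g:FF. (ALL x:S. g differentiable (at x)) &
   (ALL v. EX h:FF. ALL x:S. frechet_derivative g (at x) v = h x)" using f unfolding smooth_on_def by blast
 have d: "((%x. L (g x)) has_derivative (%v. L (frechet_derivative g (at x) v))) (at x)" if "g : FF" "x : S" for g x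
  using FF that by (intro bounded_linear.has_derivative[OF L]) (auto simp: frechet_derivative_works[symmetric])
 show ?thesis
 proof (rule smooth_onI[of _ "(%g x. L (g x)) ` FF"])
  fix h x assume "h : (%g x. L (g x)) ` FF" "x : S"
  then show "h differentiable (at x)" using d by (auto simp: differentiable_def)
 next
  fix h v assume "h : (%g x. L (g x)) ` FF"
  then obtain g where g: "g : FF" "h = (%x. L (g x))" by blast
  then obtain g' where "g' : FF" "ALL x:S. frechet_derivative g (at x) v = g' x" using FF by blast
  then show "EX h':(%g x. L (g x)) ` FF. ALL x:S. frechet_derivative h (at x) v = h' x"
   using frechet_derivative_eqI[OF d[OF g(1)]] g(2) by (intro bexI[of _ "%x. L (g' x)"]) auto
 qed (use FF in blast)
qed

lemma smooth_on_sum: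
 fixes f :: "'i => 'a::real_normed_vector => 'b::real_normed_algebra_1"
 shows "finite A ==> (!!i. i : A ==> smooth_on S (f i)) ==> smooth_on S (%x. SUM i:A. f i x)"
 by (induction rule: finite_induct) (auto intro: smooth_on_const smooth_on_add)

section \<open>Smooth functions on the half-line times punctured space\<close>

definition punct :: "real => (real * (real^'d)) set" where
 "punct r0 = {r0<..} \<times> (UNIV - {0})"

lemma open_punct: "open (punct r0)"
 unfolding punct_def by (intro open_Times) auto

text \<open>Enough generators for radial factors and for polynomials in \<open>x / norm x\<close>:
  the derivative of \<open>inverse (norm x)\<close> along \<open>v\<close> is minus its cube times
  \<open>x \<bullet> v\<close>, so the generated algebra is closed under derivatives.\<close>

definition elem_funs :: "(real * (real^'d) => complex) set" where
 "elem_funs = {%p. of_real (th (fst p)) | th. smooth1 th} \<union> {%p. of_real (snd p $ j) | j. True} \<union>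
  {%p. of_real (inverse (norm (snd p)))}"

lemma elem_theta_deriv:
 assumes "smooth1 th"
 shows "((%p::real * (real^'d). complex_of_real (th (fst p))) has_derivative
  (%v. of_real (fst v) * of_real (deriv th (fst x)))) (at x)"
proof -
 have "(th has_derivative (%h. deriv th (fst x) * h)) (at (fst x))"
  using smooth1_has_deriv[OF assms] by (simp add: has_field_derivative_def)
 then have "((%p::real * (real^'d). th (fst p)) has_derivative (%v. deriv th (fst x) * fst v)) (at x)"
  by (rule has_derivative_compose[OF has_derivative_fst[OF has_derivative_ident]])
 then have "((%p::real * (real^'d). complex_of_real (th (fst p))) has_derivative
  (%v. complex_of_real (deriv th (fst x) * fst v))) (at x)"
  by (rule bounded_linear.has_derivative[OF bounded_linear_of_real])
 then show ?thesis by (simp add: mult.commute)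
qed

lemma elem_coord_deriv:
 "((%p::real * (real^'d). complex_of_real (snd p $ j)) has_derivative (%v. of_real (snd v $ j))) (at x)"
 by (intro bounded_linear.has_derivative[OF bounded_linear_of_real] bounded_linear.has_derivative[OF bounded_linear_vec_nth]
   has_derivative_snd has_derivative_ident)

lemma inverse_norm_deriv:
 assumes "x ~= (0::real^'d)"
 shows "((%y::real^'d. inverse (norm y)) has_derivative (%v. - (inverse (norm x) ^ 3 * (x \<bullet> v)))) (at x)"
proof -
 have "((%y::real^'d. inverse (norm y)) has_derivative (%v. - (inverse (norm x) * (v \<bullet> sgn x) * inverse (norm x)))) (at x)"
  using Deriv.has_derivative_inverse[OF _ has_derivative_norm[OF assms]] assms by simp
 moreover have "inverse (norm x) * (v \<bullet> sgn x) * inverse (norm x) = inverse (norm x) ^ 3 * (x \<bullet> v)" for v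
  by (simp add: sgn_div_norm inner_commute power3_eq_cube)
 ultimately show ?thesis by simp
qed

lemma elem_inv_deriv:
 assumes "snd x ~= (0::real^'d)"
 shows "((%p::real * (real^'d). complex_of_real (inverse (norm (snd p)))) has_derivative
  (%v. of_real (- (inverse (norm (snd x)) ^ 3 * (snd x \<bullet> snd v))))) (at x)"
 by (intro bounded_linear.has_derivative[OF bounded_linear_of_real]
  has_derivative_compose[OF has_derivative_snd[OF has_derivative_ident] inverse_norm_deriv[OF assms]])

lemma smooth_on_elem:
 assumes "f : calg elem_funs" shows "smooth_on (punct r0 :: (real * (real^'d)) set) f"
 using assms
proof (rule smooth_on_calg)
 fix g :: "real * (real^'d) => complex" and x :: "real * (real^'d)" assume g: "g : elem_funs" and x: "x : punct r0"
 have "snd x ~= 0" using x by (auto simp: punct_def)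
 from g consider (a) th where "smooth1 th" "g = (%p. of_real (th (fst p)))" | (b) j where "g = (%p. of_real (snd p $ j))"
  | (c) "g = (%p. of_real (inverse (norm (snd p))))" by (auto simp: elem_funs_def)
 then show "g differentiable (at x)"
 proof cases
  case a
  show ?thesis unfolding a(2) differentiable_def by (rule exI, rule elem_theta_deriv[OF a(1)])
 next
  case b
  show ?thesis unfolding b differentiable_def by (rule exI, rule elem_coord_deriv)
 next
  case c
  show ?thesis unfolding c differentiable_def by (rule exI, rule elem_inv_deriv[OF \<open>snd x ~= 0\<close>])
 qed
next
 fix g :: "real * (real^'d) => complex" and v :: "real * (real^'d)" assume "g : elem_funs"
 then consider (a) th where "smooth1 th" "g = (%p. of_real (th (fst p)))" | (b) j where "g = (%p. of_real (snd p $ j))"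
  | (c) "g = (%p. of_real (inverse (norm (snd p))))" by (auto simp: elem_funs_def)
 then show "EX h:calg elem_funs. ALL x:punct r0. frechet_derivative g (at x) v = h x"
 proof cases
  case a
  have "(%x. complex_of_real (fst v) * of_real (deriv th (fst x))) : calg elem_funs"
   using smooth1_deriv[OF a(1)] by (intro calg.mult calg.const calg.base) (auto simp: elem_funs_def)
  then show ?thesis
   by (rule bexI[rotated]) (simp add: frechet_derivative_eqI[OF elem_theta_deriv[OF a(1)]] a(2))
 next
  case b
  show ?thesis unfolding b
   by (rule bexI[of _ "%x. of_real (snd v $ j)"]) (simp_all add: frechet_derivative_eqI[OF elem_coord_deriv] calg.const)
 next
  case c
  let ?i = "%x::real * (real^'d). complex_of_real (inverse (norm (snd x)))"
  let ?h = "%x::real * (real^'d). complex_of_real (-1) * (?i x * (?i x * (?i x * (SUM j:UNIV. complex_of_real (snd x $ j) * complex_of_real (snd v $ j)))))"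
  have "?h : calg elem_funs"
   by (intro calg.mult calg.const calg_sum) (auto intro!: calg.base simp: elem_funs_def)
  moreover have "frechet_derivative g (at x) v = ?h x" if "x : punct r0" for x
  proof -
   have "snd x ~= 0" using that by (auto simp: punct_def)
   then show ?thesis unfolding c frechet_derivative_eqI[OF elem_inv_deriv[OF \<open>snd x ~= 0\<close>]]
    by (simp add: power3_eq_cube inner_vec_def)
  qed
  ultimately show ?thesis by (intro bexI[of _ ?h] ballI)
 qed
qed

lemma smooth_on_theta: "smooth1 th ==> smooth_on (punct r0) (%p::real * (real^'d). complex_of_real (th (fst p)))"
 and smooth_on_coord: "smooth_on (punct r0) (%p::real * (real^'d). complex_of_real (snd p $ j))"
 and smooth_on_inv: "smooth_on (punct r0) (%p::real * (real^'d). complex_of_real (inverse (norm (snd p))))"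
 by (intro smooth_on_elem calg.base; auto simp: elem_funs_def)+

lemma smooth_on_norm: "smooth_on (punct r0) (%p::real * (real^'d). complex_of_real (norm (snd p)))"
proof (rule smooth_on_cong[OF _ open_punct])
 show "smooth_on (punct r0) (%p::real * (real^'d). (SUM j:UNIV. complex_of_real (snd p $ j) * complex_of_real (snd p $ j)) * complex_of_real (inverse (norm (snd p))))"
  by (intro smooth_on_mult smooth_on_sum smooth_on_coord smooth_on_inv) auto
 fix p :: "real * (real^'d)" assume "p : punct r0"
 then have "snd p ~= 0" by (auto simp: punct_def)
 have "(SUM j:UNIV. complex_of_real (snd p $ j) * complex_of_real (snd p $ j)) = complex_of_real (snd p \<bullet> snd p)"
  by (simp add: inner_vec_def)
 then show "(SUM j:UNIV. complex_of_real (snd p $ j) * complex_of_real (snd p $ j)) * complex_of_real (inverse (norm (snd p))) = complex_of_real (norm (snd p))"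
  using \<open>snd p ~= 0\<close> by (simp add: dot_square_norm power2_eq_square field_simps)
qed

section \<open>Test functions on the exterior region\<close>

lemma test_fun_iff:
 "test_fun r0 ps \<longleftrightarrow> smooth_on (punct r0) (hom_ext ps) &
  (EX a b. r0 < a & a <= b & (ALL p. ps p ~= 0 --> p : {a..b} \<times> sphere 0 1))"
 by (simp add: test_fun_def punct_def)

lemma test_fun_smooth: "test_fun r0 ps ==> smooth_on (punct r0) (hom_ext ps)"
 by (simp add: test_fun_iff)

lemma test_fun_supp:
 assumes "test_fun r0 ps" shows "EX a b. r0 < a & a <= b & (ALL p. p ~: {a..b} \<times> sphere 0 1 --> ps p = 0)"
proof -
 obtain a b where ab: "r0 < a" "a <= b" and h: "ALL p. ps p ~= 0 --> p : {a..b} \<times> sphere 0 1"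
  using assms unfolding test_fun_iff by blast
 have "ps p = 0" if "p ~: {a..b} \<times> sphere 0 1" for p using h[rule_format, of p] that by blast
 then show ?thesis using ab by (intro exI[of _ a] exI[of _ b]) simp
qed

lemma test_funI:
 assumes "smooth_on (punct r0) f" "!!p. p : punct r0 ==> f p = hom_ext ps p"
  "r0 < a" "a <= b" "!!p. p ~: {a..b} \<times> sphere 0 1 ==> ps p = 0"
 shows "test_fun r0 ps"
proof -
 have "smooth_on (punct r0) (hom_ext ps)" by (rule smooth_on_cong[OF assms(1) open_punct assms(2)])
 moreover have "p : {a..b} \<times> sphere 0 1" if "ps p ~= 0" for p using assms(5)[of p] that by argo
 ultimately show ?thesis unfolding test_fun_iff using assms(3,4) by (intro conjI exI[of _ a] exI[of _ b]) simp_all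
qed

text \<open>Assumption \<open>z\<close> only asks \<open>ph\<close> to vanish on those spheres where
  \<open>ps\<close> vanishes identically. That suffices to inherit the radial support, and unlike a
  pointwise condition it holds for tangential derivatives.\<close>

lemma test_fun_transform:
 fixes ps ph :: "real * (real^'d) => complex"
 assumes "test_fun r0 ps" "smooth_on (punct r0) f" "!!p. p : punct r0 ==> f p = hom_ext ph p"
  and z: "!!r x. r0 < r ==> norm x = 1 ==> (ALL s y. r0 < s --> norm y = 1 --> s = r --> ps (s, y) = 0) ==> ph (r, x) = 0"
  and z': "!!r x. ~ (r0 < r & norm x = 1) ==> ph (r, x) = 0"
 shows "test_fun r0 ph"
proof -
 obtain a b where ab: "r0 < a" "a <= b" and h: "ALL p. p ~: {a..b} \<times> sphere 0 1 --> ps p = 0"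
  using test_fun_supp[OF assms(1)] by blast
 show ?thesis
 proof (rule test_funI[OF assms(2,3) ab])
  fix p :: "real * (real^'d)" assume p: "p ~: {a..b} \<times> sphere 0 1"
  obtain r x where rx: "p = (r, x)" by (cases p)
  show "ph p = 0"
  proof (cases "r0 < r & norm x = 1")
   case True
   then have "r ~: {a..b}" using p rx by auto
   then have "(r, y) ~: {a..b} \<times> sphere 0 1" for y :: "real^'d" by auto
   then have "ps (r, y) = 0" for y using h by blast
   then show ?thesis using True z[of r x] rx by blast
  qed (use z' rx in simp)
 qed
qed

lemma test_fun_outside: "test_fun r0 ps ==> ~ (r0 < r & norm x = 1) ==> ps (r, x) = 0"
proof -
 assume "test_fun r0 ps" and n: "~ (r0 < r & norm x = 1)"
 then obtain a b where ab: "r0 < a" "a <= b" and h: "ALL p. p ~: {a..b} \<times> sphere 0 1 --> ps p = 0"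
  using test_fun_supp by blast
 have "(r, x) ~: {a..b} \<times> sphere 0 1" using n ab by auto
 then show ?thesis using h by blast
qed

lemma test_fun_mult:
 assumes "test_fun r0 ps" "test_fun r0 et" shows "test_fun r0 (%p. ps p * et p)"
 by (rule test_fun_transform[OF assms(1) smooth_on_mult[OF assms[THEN test_fun_smooth]]])
  (simp_all add: hom_ext_def test_fun_outside[OF assms(1)] split: prod.split)

lemma test_fun_add:
 assumes "test_fun r0 ps" "test_fun r0 et" shows "test_fun r0 (%p. ps p + et p)"
proof -
 obtain a b where ab: "r0 < a" "a <= b" and h: "ALL p. p ~: {a..b} \<times> sphere 0 1 --> ps p = 0"
  using test_fun_supp[OF assms(1)] by blast
 obtain a' b' where ab': "r0 < a'" "a' <= b'" and h': "ALL p. p ~: {a'..b'} \<times> sphere 0 1 --> et p = 0"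
  using test_fun_supp[OF assms(2)] by blast
 show ?thesis
 proof (rule test_funI[OF smooth_on_add[OF assms[THEN test_fun_smooth]], of _ "min a a'" "max b b'"])
  fix p :: "real \<times> (real^'a)" assume p: "p ~: {min a a'..max b b'} \<times> sphere 0 1"
  have "p ~: {a..b} \<times> sphere 0 1" "p ~: {a'..b'} \<times> sphere 0 1" using p by (cases p; auto)+
  then show "ps p + et p = 0" using h[rule_format, of p] h'[rule_format, of p] by simp
 qed (use ab ab' in \<open>auto simp: hom_ext_def\<close>)
qed

lemma test_fun_smooth_mult:
 assumes "test_fun r0 ps" "smooth1 th" shows "test_fun r0 (%p. of_real (th (fst p)) * ps p)"
 by (rule test_fun_transform[OF assms(1) smooth_on_mult[OF smooth_on_theta[OF assms(2)] test_fun_smooth[OF assms(1)]]])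
  (simp_all add: hom_ext_def test_fun_outside[OF assms(1)] split: prod.split)

lemma test_fun_scale:
 assumes "test_fun r0 ps" shows "test_fun r0 (%p. c * ps p)"
 by (rule test_fun_transform[OF assms(1) smooth_on_mult[OF smooth_on_const[of _ c] test_fun_smooth[OF assms(1)]]])
  (simp_all add: hom_ext_def test_fun_outside[OF assms(1)] split: prod.split)

lemma test_fun_cnj:
 assumes "test_fun r0 ps" shows "test_fun r0 (%p. cnj (ps p))"
 by (rule test_fun_transform[OF assms(1) smooth_on_linear[OF test_fun_smooth[OF assms(1)] bounded_linear_cnj]])
  (simp_all add: hom_ext_def test_fun_outside[OF assms(1)] split: prod.split)

text \<open>Monomials are indexed by words in the coordinates. Different words may give the same
  monomial; in exchange, induction over lists raises the degree one coordinate at a time.\<close>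

definition word_fun :: "'d list => (real^'d) => real" where
 "word_fun w x = (\<Prod>j\<leftarrow>w. x $ j)"

text \<open>Cut off outside the unit sphere because a test function must vanish there.\<close>

definition sep_fun :: "(real => real) => ((real^'d) => real) => real * (real^'d) => complex" where
 "sep_fun th h p = (if snd p : sphere 0 1 then of_real (th (fst p) * h (snd p)) else 0)"

lemma test_fun_sep: assumes "ctest r0 th" shows "test_fun r0 (sep_fun th (word_fun (w :: 'd::finite list)))"
proof -
 obtain a b where ab: "r0 < a" "a < b" "ALL x. x ~: {a<..<b} --> th x = 0" using ctest_supp[OF assms] by blast
 have "smooth_on (punct r0) (%p::real * (real^'d). complex_of_real (word_fun w (snd p /\<^sub>R norm (snd p))))"
 proof (induction w)
  case Nil
  show ?case by (simp add: word_fun_def smooth_on_const)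
 next
  case (Cons j w)
  have "smooth_on (punct r0) (%p::real * (real^'d). (complex_of_real (inverse (norm (snd p))) * complex_of_real (snd p $ j)) * complex_of_real (word_fun w (snd p /\<^sub>R norm (snd p))))"
   by (intro smooth_on_mult smooth_on_inv smooth_on_coord Cons)
  then show ?case by (simp add: word_fun_def)
 qed
 from smooth_on_mult[OF smooth_on_theta[OF ctest_smooth1[OF assms]] this] show ?thesis
 proof (rule test_funI[of _ _ _ a b])
  fix p :: "real * (real^'d)" assume "p : punct r0"
  then have "snd p ~= 0" by (auto simp: punct_def)
  then show "complex_of_real (th (fst p)) * complex_of_real (word_fun w (snd p /\<^sub>R norm (snd p))) = hom_ext (sep_fun th (word_fun w)) p"
   by (cases p) (simp add: hom_ext_def sep_fun_def)
 next
  fix p :: "real * (real^'d)" assume "p ~: {a..b} \<times> sphere 0 1"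
  then have "snd p ~: sphere 0 1 | fst p ~: {a<..<b}" by (cases p) auto
  then show "sep_fun th (word_fun w) p = 0" using ab(3) by (auto simp: sep_fun_def)
 qed (use ab in auto)
qed

section \<open>Radial and tangential derivatives of test functions\<close>

lemma has_derivative_vector_deriv:
 assumes "(f has_derivative D) (at (r, x))"
 shows "((%s. f (s, x)) has_vector_derivative D (1, 0)) (at r)"
proof -
 have "((%s. f (s, x)) has_derivative (%h. D (h, 0))) (at r)"
  by (rule has_derivative_compose[where f="%s. (s, x)" and f'="%h. (h, 0)" and g=f])
   (rule has_derivative_Pair[OF has_derivative_ident has_derivative_const], rule assms)
 moreover have "(%h. D (h, 0)) = (%h. h *\<^sub>R D (1, 0))"
 proof
  fix h
  have "D (h *\<^sub>R (1, 0)) = h *\<^sub>R D (1, 0)" by (rule linear_scale[OF has_derivative_linear[OF assms]])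
  then show "D (h, 0) = h *\<^sub>R D (1, 0)" by (simp only: scaleR_Pair scaleR_zero_right real_scaleR_def mult_1_right)
 qed
 ultimately show ?thesis unfolding has_vector_derivative_def by (simp only:)
qed

lemma has_derivative_snd_slice:
 assumes "(f has_derivative D) (at (r, x))"
 shows "((%y. f (r, y)) has_derivative (%v. D (0, v))) (at x)"
 by (rule has_derivative_compose[where f="%y. (r, y)" and f'="%v. (0, v)" and g=f])
  (rule has_derivative_Pair[OF has_derivative_const has_derivative_ident], rule assms)

lemma hom_ext_unit: "norm x = 1 ==> hom_ext ps (r, x) = ps (r, x)"
 by (simp add: hom_ext_def)

lemma punct_mem: "(r, x) : punct r0 \<longleftrightarrow> r0 < r & x ~= 0"
 by (auto simp: punct_def)

context
 fixes r0 :: real and ps :: "real * (real^'d) => complex"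
 assumes ps: "test_fun r0 ps"
begin

lemma test_fun_has_derivative:
 assumes "r0 < r" "x ~= 0"
 shows "(hom_ext ps has_derivative frechet_derivative (hom_ext ps) (at (r, x))) (at (r, x))"
 by (rule smooth_on_has_derivative[OF test_fun_smooth[OF ps]]) (simp add: punct_mem assms)

lemma test_fun_supp_slices:
 obtains a b where "r0 < a" "a <= b" "ALL r x. r ~: {a..b} --> ps (r, x) = 0"
proof -
 obtain a b where ab: "r0 < a" "a <= b" and h: "ALL p. p ~: {a..b} \<times> sphere 0 1 --> ps p = 0"
  using test_fun_supp[OF ps] by blast
 have "ps (r, x) = 0" if "r ~: {a..b}" for r x using h[rule_format, of "(r, x)"] that by auto
 then show ?thesis using that[OF ab] by blast
qed

lemma dr_zero:
 assumes "open U" "r : U" "!!s. s : U ==> ps (s, x) = 0"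
 shows "((%s. ps (s, x)) has_vector_derivative 0) (at r)"
 by (rule has_vector_derivative_transform_within_open[OF has_vector_derivative_const assms(1,2)]) (simp add: assms(3))

text \<open>True at every point, also outside \<open>Omega r0\<close>: there the function vanishes
  on a radial neighbourhood.\<close>

lemma test_fun_dr: "((%s. ps (s, x)) has_vector_derivative dr ps (r, x)) (at r)"
proof -
 have "EX d. ((%s. ps (s, x)) has_vector_derivative d) (at r)"
 proof (cases "norm x = 1 & r0 < r")
  case True
  then have "x ~= 0" by auto
  then have "((%s. hom_ext ps (s, x)) has_vector_derivative frechet_derivative (hom_ext ps) (at (r, x)) (1, 0)) (at r)"
   using True by (intro has_derivative_vector_deriv test_fun_has_derivative) auto
  then show ?thesis using True by (auto simp: hom_ext_unit)
 next
  case False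
  obtain a b where ab: "r0 < a" "a <= b" "ALL r x. r ~: {a..b} --> ps (r, x) = 0" by (rule test_fun_supp_slices)
  show ?thesis
  proof (cases "norm x = 1")
   case True
   then have "r < a" using False ab by auto
   have "((%s. ps (s, x)) has_vector_derivative 0) (at r)"
    by (rule dr_zero[of "{..<a}"]) (use \<open>r < a\<close> ab in auto)
   then show ?thesis by blast
  next
   case False
   then have "((%s. ps (s, x)) has_vector_derivative 0) (at r)"
    by (intro dr_zero[of UNIV]) (auto intro: test_fun_outside[OF ps])
   then show ?thesis by blast
  qed
 qed
 then obtain d where d: "((%s. ps (s, x)) has_vector_derivative d) (at r)" by blast
 then have "dr ps (r, x) = d" by (simp add: dr_def vector_derivative_at)
 then show ?thesis using d by simp
qed

lemma hom_ext_dr: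
 assumes "r0 < r" "x ~= 0" shows "hom_ext (dr ps) (r, x) = frechet_derivative (hom_ext ps) (at (r, x)) (1, 0)"
proof -
 have "((%s. hom_ext ps (s, x)) has_vector_derivative frechet_derivative (hom_ext ps) (at (r, x)) (1, 0)) (at r)"
  by (intro has_derivative_vector_deriv test_fun_has_derivative assms)
 moreover have "((%s. hom_ext ps (s, x)) has_vector_derivative hom_ext (dr ps) (r, x)) (at r)"
  using test_fun_dr[of "x /\<^sub>R norm x" r] by (simp add: hom_ext_def)
 ultimately show ?thesis using vector_derivative_unique_at by blast
qed

lemma test_fun_dr_test: "test_fun r0 (dr ps)"
proof -
 obtain a b where ab: "r0 < a" "a <= b" "ALL r x. r ~: {a..b} --> ps (r, x) = 0" by (rule test_fun_supp_slices)
 show ?thesis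
 proof (rule test_funI[OF smooth_on_deriv[OF test_fun_smooth[OF ps] open_punct, of "(1, 0)"] _ ab(1,2)])
  fix p :: "real * (real^'d)" assume "p : punct r0"
  then show "frechet_derivative (hom_ext ps) (at p) (1, 0) = hom_ext (dr ps) p"
   by (cases p) (simp add: punct_mem hom_ext_dr)
 next
  fix p :: "real * (real^'d)" assume p: "p ~: {a..b} \<times> sphere 0 1"
  obtain r x where rx: "p = (r, x)" by (cases p)
  have "((%s. ps (s, x)) has_vector_derivative 0) (at r)"
  proof (cases "norm x = 1")
   case True
   then have "r : - {a..b}" using p rx by auto
   then show ?thesis by (intro dr_zero[of "- {a..b}"]) (use ab in auto)
  next
   case False
   then show ?thesis by (intro dr_zero[of UNIV]) (auto intro: test_fun_outside[OF ps])
  qed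
  then show "dr ps p = 0" using vector_derivative_unique_at[OF test_fun_dr] rx by blast
 qed
qed

lemma test_fun_sphere_derivative:
 assumes "r0 < r" "x ~= 0"
 shows "((%y. ps (r, y /\<^sub>R norm y)) has_derivative (%v. frechet_derivative (hom_ext ps) (at (r, x)) (0, v))) (at x)"
 using has_derivative_snd_slice[OF test_fun_has_derivative[OF assms]] by (simp add: hom_ext_def)

lemma dS_eq:
 assumes "r0 < r" "x ~= 0"
 shows "dS ps j (r, x) = frechet_derivative (hom_ext ps) (at (r, x)) (0, axis j 1)"
 unfolding dS_def using frechet_derivative_eqI[OF test_fun_sphere_derivative[OF assms]] by simp

lemma sphere_derivative_sum:
 assumes "r0 < r" "x ~= 0"
 shows "((%y. ps (r, y /\<^sub>R norm y)) has_derivative (%v. SUM j:UNIV. (v $ j) *\<^sub>R dS ps j (r, x))) (at x)"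
proof -
 let ?D = "%v. frechet_derivative (hom_ext ps) (at (r, x)) (0, v)"
 have L: "linear ?D" using has_derivative_linear[OF test_fun_sphere_derivative[OF assms]] .
 have "?D v = (SUM j:UNIV. (v $ j) *\<^sub>R dS ps j (r, x))" for v
 proof -
  have "v = (SUM j:UNIV. (v $ j) *\<^sub>R axis j 1)" by (simp add: vec_eq_iff axis_def if_distrib cong: if_cong)
  then have "?D v = ?D (SUM j:UNIV. (v $ j) *\<^sub>R axis j 1)" by simp
  also have "... = (SUM j:UNIV. (v $ j) *\<^sub>R ?D (axis j 1))"
   using linear_sum[OF L, of "%j. (v $ j) *\<^sub>R axis j 1" UNIV] linear_scale[OF L] by simp
  finally show ?thesis by (simp add: dS_eq[OF assms])
 qed
 then have "?D = (%v. SUM j:UNIV. (v $ j) *\<^sub>R dS ps j (r, x))" by (rule ext)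
 then show ?thesis using test_fun_sphere_derivative[OF assms] by simp
qed

text \<open>\<open>dS\<close> differentiates an extension that is constant along rays, that is,
  homogeneous of degree 0; its derivative is homogeneous of degree -1. The proof compares the
  derivatives before and after rescaling by \<open>1 / norm x\<close>.\<close>

lemma dS_homogeneous:
 assumes "r0 < r" "x ~= 0" shows "dS ps j (r, x /\<^sub>R norm x) = of_real (norm x) * dS ps j (r, x)"
proof -
 define c where "c = inverse (norm x)"
 have c: "c > 0" using assms by (simp add: c_def)
 have cx: "c *\<^sub>R x ~= 0" using c assms by simp
 have "((%y. ps (r, (c *\<^sub>R y) /\<^sub>R norm (c *\<^sub>R y))) has_derivative (%v. SUM j:UNIV. ((c *\<^sub>R v) $ j) *\<^sub>R dS ps j (r, c *\<^sub>R x))) (at x)"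
  by (rule has_derivative_compose[where f="%y. c *\<^sub>R y" and f'="%v. c *\<^sub>R v" and g="%y. ps (r, y /\<^sub>R norm y)"
     and g'="%v. SUM j:UNIV. (v $ j) *\<^sub>R dS ps j (r, c *\<^sub>R x)"])
   (rule has_derivative_scaleR_right has_derivative_ident sphere_derivative_sum[OF assms(1) cx])+
 moreover have "(c *\<^sub>R y) /\<^sub>R norm (c *\<^sub>R y) = y /\<^sub>R norm y" for y :: "real^'d" using c by (cases "y = 0") auto
 ultimately have "((%y. ps (r, y /\<^sub>R norm y)) has_derivative (%v. SUM j:UNIV. ((c *\<^sub>R v) $ j) *\<^sub>R dS ps j (r, c *\<^sub>R x))) (at x)"
  by (simp only:)
 from has_derivative_unique[OF this sphere_derivative_sum[OF assms]]
 have "(SUM i:UNIV. ((c *\<^sub>R axis j 1) $ i) *\<^sub>R dS ps i (r, c *\<^sub>R x)) = (SUM i:UNIV. (axis j 1 $ i) *\<^sub>R dS ps i (r, x))"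
  by meson
 then have "c *\<^sub>R dS ps j (r, c *\<^sub>R x) = dS ps j (r, x)"
  by (simp add: axis_def if_distrib[of "%t. t *\<^sub>R _"] if_distrib[of "%t. _ * t"] cong: if_cong)
 then show ?thesis using assms by (simp add: c_def scaleR_conv_of_real field_simps)
qed

text \<open>The extension is constant along rays, so the gradient has no radial component.\<close>

lemma dS_radial:
 assumes "r0 < r" "norm x = 1" shows "(SUM j:UNIV. (x $ j) *\<^sub>R dS ps j (r, x)) = 0"
proof -
 have x: "x ~= 0" using assms by auto
 have l: "((%t::real. (1 + t) *\<^sub>R x) has_derivative (%t. t *\<^sub>R x)) (at 0)"
  by (auto intro!: derivative_eq_intros)
 have "((%t::real. ps (r, ((1 + t) *\<^sub>R x) /\<^sub>R norm ((1 + t) *\<^sub>R x))) has_derivative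
   (%t. SUM j:UNIV. ((t *\<^sub>R x) $ j) *\<^sub>R dS ps j (r, x))) (at 0)"
  by (rule has_derivative_compose[OF l, of "%y. ps (r, y /\<^sub>R norm y)"]) (use sphere_derivative_sum[OF assms(1) x] in simp)
 then have "((%t::real. ps (r, x)) has_derivative (%t. SUM j:UNIV. ((t *\<^sub>R x) $ j) *\<^sub>R dS ps j (r, x))) (at 0)"
  by (rule has_derivative_transform_within_open[of _ _ _ _ "{-1<..<1}"]) (use assms(2) x in auto)
 from has_derivative_unique[OF this has_derivative_const[of "ps (r, x)"]]
 have "(SUM j:UNIV. ((1 *\<^sub>R x) $ j) *\<^sub>R dS ps j (r, x)) = 0" by meson
 then show ?thesis by simp
qed

text \<open>\<open>dS ps j\<close> also has values away from the unit sphere and so is no test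
  function; truncated, it becomes one and can be differentiated again.\<close>

definition dSt :: "'d => real * (real^'d) => complex" where
 "dSt j p = (if r0 < fst p & norm (snd p) = 1 then dS ps j p else 0)"

text \<open>The factor \<open>norm (snd p)\<close> raises the degree of homogeneity of the
  derivative from -1 to 0, giving the radially constant extension of \<open>dSt j\<close>.\<close>

lemma test_fun_dSt: "test_fun r0 (dSt j)"
proof (rule test_fun_transform[OF ps smooth_on_mult[OF smooth_on_norm smooth_on_deriv[OF test_fun_smooth[OF ps] open_punct, of "(0, axis j 1)"]]])
 fix p :: "real * (real^'d)" assume p: "p : punct r0"
 obtain r x where rx: "p = (r, x)" by (cases p)
 have h: "r0 < r" "x ~= 0" using p by (auto simp: rx punct_mem)
 then show "complex_of_real (norm (snd p)) * frechet_derivative (hom_ext ps) (at p) (0, axis j 1) = hom_ext (dSt j) p"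
  using dS_homogeneous[OF h, of j] dS_eq[OF h, of j] by (simp add: rx hom_ext_def dSt_def)
next
 fix r and x :: "real^'d" assume r: "r0 < r" "norm x = 1" and z: "ALL s y. r0 < s --> norm y = 1 --> s = r --> ps (s, y) = 0"
 have "(%y. ps (r, y /\<^sub>R norm y)) = (%y. 0)"
 proof
  fix y show "ps (r, y /\<^sub>R norm y) = 0"
   using z r test_fun_outside[OF ps] by (cases "norm (y /\<^sub>R norm y) = 1") auto
 qed
 then show "dSt j (r, x) = 0" by (simp add: dSt_def dS_def)
qed (auto simp: dSt_def)

end

text \<open>\<open>dSt\<close> corresponds to \<open>norm y\<close> times the ambient derivative.
  Differentiating that factor adds \<open>x $ j\<close> times the j-th derivative, and these terms
  sum to 0 by \<open>dS_radial\<close>.\<close>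

lemma lapS_eq:
 assumes ps: "test_fun r0 ps" and h: "r0 < r" "norm x = 1"
 shows "lapS ps (r, x) = (SUM j:UNIV. dS (dSt r0 ps j) j (r, x))"
proof -
 have x: "x ~= 0" using h by auto
 have "EX K. ((%y. dS ps j (r, y)) has_derivative K) (at x)" for j
 proof -
  have sm: "smooth_on (punct r0) (%p. frechet_derivative (hom_ext ps) (at p) (0, axis j 1))"
   by (rule smooth_on_deriv[OF test_fun_smooth[OF ps] open_punct])
  have "((%p. frechet_derivative (hom_ext ps) (at p) (0, axis j 1)) has_derivative
    frechet_derivative (%p. frechet_derivative (hom_ext ps) (at p) (0, axis j 1)) (at (r, x))) (at (r, x))"
   by (rule smooth_on_has_derivative[OF sm]) (use h x in \<open>simp add: punct_mem\<close>)
  from has_derivative_snd_slice[OF this]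
  have "((%y. dS ps j (r, y)) has_derivative (%v. frechet_derivative (%p. frechet_derivative (hom_ext ps) (at p) (0, axis j 1)) (at (r, x)) (0, v))) (at x)"
   by (rule has_derivative_transform_within_open[of _ _ _ _ "- {0}"]) (use x dS_eq[OF ps h(1)] in auto)
  then show ?thesis by blast
 qed
 then obtain K where K: "!!j. ((%y. dS ps j (r, y)) has_derivative K j) (at x)" by metis
 have "lapS ps (r, x) = (SUM j:UNIV. K j (axis j 1))"
  unfolding lapS_def using frechet_derivative_eqI[OF K] by (simp add: dS_def)
 moreover have "dS (dSt r0 ps j) j (r, x) = K j (axis j 1) + (x $ j) *\<^sub>R dS ps j (r, x)" for j
 proof -
  have "((%y. norm y *\<^sub>R dS ps j (r, y)) has_derivative (%v. norm x *\<^sub>R K j v + (v \<bullet> sgn x) *\<^sub>R dS ps j (r, x))) (at x)"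
   by (rule has_derivative_scaleR[OF has_derivative_norm[OF x] K])
  then have "((%y. dSt r0 ps j (r, y /\<^sub>R norm y)) has_derivative (%v. norm x *\<^sub>R K j v + (v \<bullet> sgn x) *\<^sub>R dS ps j (r, x))) (at x)"
   by (rule has_derivative_transform_within_open[of _ _ _ _ "- {0}"])
    (use x h dS_homogeneous[OF ps h(1)] in \<open>auto simp: dSt_def[OF ps] scaleR_conv_of_real[where 'a=complex]\<close>)
  from frechet_derivative_eqI[OF this] show ?thesis
   using h x by (simp add: dS_def sgn_div_norm inner_axis' )
 qed
 ultimately show ?thesis using dS_radial[OF ps h] by (simp add: sum.distrib)
qed

lemma test_fun_continuous_on: assumes "test_fun r0 ps" shows "continuous_on (Omega r0) ps"
proof -
 have "continuous_on (punct r0) (hom_ext ps)"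
  using smooth_on_differentiable[OF test_fun_smooth[OF assms]]
  by (intro continuous_at_imp_continuous_on ballI differentiable_imp_continuous_within)
 then have "continuous_on (Omega r0) (hom_ext ps)"
  by (rule continuous_on_subset) (auto simp: Omega_def punct_def)
 then show ?thesis by (rule continuous_on_eq) (auto simp: Omega_def hom_ext_def)
qed

lemma Omega_borel [measurable]: "Omega r0 : sets borel"
 unfolding Omega_def by (intro borel_Times) auto

lemma Omega_mem: "(r, x) : Omega r0 \<longleftrightarrow> r0 < r & norm x = 1"
 by (auto simp: Omega_def)

lemma test_fun_Omega: "test_fun r0 ps ==> p ~: Omega r0 ==> ps p = 0"
 using test_fun_outside by (cases p) (auto simp: Omega_mem)

lemma test_fun_borel: assumes "test_fun r0 ps" shows "ps : borel_measurable borel"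
proof -
 have "(%p. indicator (Omega r0) p *\<^sub>R ps p) : borel_measurable borel"
  by (rule borel_measurable_continuous_on_indicator[OF Omega_borel test_fun_continuous_on[OF assms]])
 also have "(%p. indicator (Omega r0) p *\<^sub>R ps p) = ps"
  using test_fun_Omega[OF assms] by (auto simp: indicator_def)
 finally show ?thesis .
qed

lemma test_fun_bounded: assumes "test_fun r0 ps" shows "EX C>=0. ALL p. norm (ps p) <= C"
proof -
 obtain a b where ab: "r0 < a" "a <= b" and h: "ALL p. p ~: {a..b} \<times> sphere 0 1 --> ps p = 0"
  using test_fun_supp[OF assms] by blast
 have "compact (ps ` ({a..b} \<times> sphere 0 1))"
  by (intro compact_continuous_image continuous_on_subset[OF test_fun_continuous_on[OF assms]] compact_Times)
   (use ab in \<open>auto simp: Omega_def\<close>)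
 then obtain C where C: "ALL z:ps ` ({a..b} \<times> sphere 0 1). norm z <= C" using compact_imp_bounded bounded_iff by metis
 have "norm (ps p) <= max C 0" for p
 proof (cases "p : {a..b} \<times> sphere 0 1")
  case True
  then have "norm (ps p) <= C" using C by blast
  then show ?thesis by simp
 next
  case False
  then show ?thesis using h[rule_format, of p] by simp
 qed
 then show ?thesis by (intro exI[of _ "max C 0"]) simp
qed

lemma dr_mult:
 assumes "test_fun r0 ps" "test_fun r0 et"
 shows "dr (%p. ps p * et p) p = dr ps p * et p + ps p * dr et p"
proof -
 obtain r x where p: "p = (r, x)" by (cases p)
 have "((%s. ps (s, x) * et (s, x)) has_vector_derivative ps (r, x) * dr et (r, x) + dr ps (r, x) * et (r, x)) (at r)"
  by (rule has_vector_derivative_mult[OF test_fun_dr[OF assms(1)] test_fun_dr[OF assms(2)]])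
 then show ?thesis unfolding p dr_def[of "%p. ps p * et p"] by (simp add: vector_derivative_at add.commute)
qed

lemma dS_mult:
 assumes "test_fun r0 ps" "test_fun r0 et" "r0 < r" "norm x = 1"
 shows "dS (%p. ps p * et p) j (r, x) = dS ps j (r, x) * et (r, x) + ps (r, x) * dS et j (r, x)"
proof -
 have x: "x ~= 0" using assms by auto
 have "frechet_derivative (%y. ps (r, y /\<^sub>R norm y) * et (r, y /\<^sub>R norm y)) (at x) =
  (%v. ps (r, x /\<^sub>R norm x) * (SUM j:UNIV. (v $ j) *\<^sub>R dS et j (r, x)) + (SUM j:UNIV. (v $ j) *\<^sub>R dS ps j (r, x)) * et (r, x /\<^sub>R norm x))"
  by (rule frechet_derivative_eqI[OF has_derivative_mult[OF sphere_derivative_sum[OF assms(1,3) x] sphere_derivative_sum[OF assms(2,3) x]]])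
 then show ?thesis unfolding dS_def[of "%p. ps p * et p"] using assms(4)
  by (simp add: axis_def if_distrib[of "%t. t *\<^sub>R _"] cong: if_cong)
qed

section \<open>Laplacian of monomials on the sphere\<close>

text \<open>At unit vectors \<open>D\<close> is the tangential gradient of \<open>h\<close>; the
  division by \<open>norm y\<close> is the homogeneity of degree -1. Relating functions of unit
  vectors in this way makes second derivatives an iteration.\<close>

definition sph :: "((real^'d) => real) => ('d => (real^'d) => real) => bool" where
 "sph h D \<longleftrightarrow> (ALL y. y ~= 0 --> ((%y. h (y /\<^sub>R norm y)) has_derivative
  (%v. SUM i:UNIV. v $ i * (D i (y /\<^sub>R norm y) / norm y))) (at y))"

lemma sph_const: "sph (%x. c) (%i x. 0)"
 by (simp add: sph_def)

lemma sph_add: "sph h D ==> sph k E ==> sph (%x. h x + k x) (%i x. D i x + E i x)"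
 unfolding sph_def
proof (intro allI impI)
 fix y :: "real^'a" assume h: "ALL y. y ~= 0 --> ((%y. h (y /\<^sub>R norm y)) has_derivative (%v. SUM i:UNIV. v $ i * (D i (y /\<^sub>R norm y) / norm y))) (at y)"
  "ALL y. y ~= 0 --> ((%y. k (y /\<^sub>R norm y)) has_derivative (%v. SUM i:UNIV. v $ i * (E i (y /\<^sub>R norm y) / norm y))) (at y)" and y: "y ~= 0"
 from has_derivative_add[OF h(1)[rule_format, OF y] h(2)[rule_format, OF y]]
 show "((%y. h (y /\<^sub>R norm y) + k (y /\<^sub>R norm y)) has_derivative
  (%v. SUM i:UNIV. v $ i * ((D i (y /\<^sub>R norm y) + E i (y /\<^sub>R norm y)) / norm y))) (at y)"
  by (simp add: sum.distrib[symmetric] add_divide_distrib distrib_left)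
qed

lemma sph_mult: "sph h D ==> sph k E ==> sph (%x. h x * k x) (%i x. h x * E i x + D i x * k x)"
 unfolding sph_def
proof (intro allI impI)
 fix y :: "real^'a" assume h: "ALL y. y ~= 0 --> ((%y. h (y /\<^sub>R norm y)) has_derivative (%v. SUM i:UNIV. v $ i * (D i (y /\<^sub>R norm y) / norm y))) (at y)"
  "ALL y. y ~= 0 --> ((%y. k (y /\<^sub>R norm y)) has_derivative (%v. SUM i:UNIV. v $ i * (E i (y /\<^sub>R norm y) / norm y))) (at y)" and y: "y ~= 0"
 have *: "h z * (SUM i:UNIV. v $ i * (E i z / norm y)) + (SUM i:UNIV. v $ i * (D i z / norm y)) * k z =
  (SUM i:UNIV. v $ i * ((h z * E i z + D i z * k z) / norm y))" for v z
  by (simp add: sum_distrib_left sum_distrib_right sum.distrib[symmetric] add_divide_distrib algebra_simps)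
 from has_derivative_mult[OF h(1)[rule_format, OF y] h(2)[rule_format, OF y]]
 show "((%y. h (y /\<^sub>R norm y) * k (y /\<^sub>R norm y)) has_derivative
  (%v. SUM i:UNIV. v $ i * ((h (y /\<^sub>R norm y) * E i (y /\<^sub>R norm y) + D i (y /\<^sub>R norm y) * k (y /\<^sub>R norm y)) / norm y))) (at y)"
  unfolding * .
qed

lemma sph_coord: "sph (%x. x $ j) (%i x. (if i = j then 1 else 0) - x $ i * x $ j)"
 unfolding sph_def
proof (intro allI impI)
 fix y :: "real^'a" assume y: "y ~= 0"
 have "((%y. inverse (norm y) * (y $ j)) has_derivative
  (%v. inverse (norm y) * (v $ j) + - (inverse (norm y) ^ 3 * (y \<bullet> v)) * (y $ j))) (at y)"
  by (rule has_derivative_mult[OF inverse_norm_deriv[OF y] bounded_linear.has_derivative[OF bounded_linear_vec_nth has_derivative_ident]])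
 moreover have "inverse (norm y) * (v $ j) + - (inverse (norm y) ^ 3 * (y \<bullet> v)) * (y $ j) =
  (SUM i:UNIV. v $ i * (((if i = j then 1 else 0) - (y /\<^sub>R norm y) $ i * (y /\<^sub>R norm y) $ j) / norm y))" for v
 proof -
  have "(SUM i:UNIV. v $ i * (((if i = j then 1 else 0) - (y /\<^sub>R norm y) $ i * (y /\<^sub>R norm y) $ j) / norm y)) =
   (SUM i:UNIV. (if i = j then v $ i / norm y else 0) - (inverse (norm y) ^ 3 * y $ j) * (y $ i * v $ i))"
   by (rule sum.cong) (auto simp: power3_eq_cube divide_inverse algebra_simps)
  also have "... = v $ j / norm y - (inverse (norm y) ^ 3 * y $ j) * (y \<bullet> v)"
   by (simp add: sum_subtractf sum_distrib_left[symmetric] inner_vec_def)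
  finally show ?thesis by (simp add: divide_inverse algebra_simps)
 qed
 ultimately show "((%y. (y /\<^sub>R norm y) $ j) has_derivative
  (%v. SUM i:UNIV. v $ i * (((if i = j then 1 else 0) - (y /\<^sub>R norm y) $ i * (y /\<^sub>R norm y) $ j) / norm y))) (at y)"
  by simp
qed

text \<open>The span of the monomials of degree less than \<open>k\<close>. On the sphere it absorbs
  every remainder, so no normal form of polynomials modulo \<open>norm x = 1\<close> is
  needed.\<close>

definition low :: "nat => ((real^'d) => real) set" where
 "low k = {%x. \<Sum>(c, w)\<leftarrow>L. c * word_fun w x | L. ALL (c, w):set L. length w < k}"

lemma low_zero: "(%x. 0) : low k" by (auto simp: low_def intro!: exI[of _ "[]"])

lemma low_word: "length w < k ==> word_fun w : low k"
 by (auto simp: low_def intro!: exI[of _ "[(1, w)]"])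

lemma low_mono: "k <= l ==> low k \<subseteq> low l"
 by (force simp: low_def)

lemma low_add: "f : low k ==> g : low k ==> (%x. f x + g x) : low k"
proof -
 assume "f : low k" "g : low k"
 then obtain L L' where "f = (%x. \<Sum>(c, w)\<leftarrow>L. c * word_fun w x)" "ALL (c, w):set L. length w < k"
  "g = (%x. \<Sum>(c, w)\<leftarrow>L'. c * word_fun w x)" "ALL (c, w):set L'. length w < k" by (auto simp: low_def)
 then show ?thesis by (auto simp: low_def intro!: exI[of _ "L @ L'"])
qed

lemma low_scale: assumes "f : low k" shows "(%x. a * f x) : low k"
proof -
 obtain L where L: "f = (%x. \<Sum>(c, w)\<leftarrow>L. c * word_fun w x)" "ALL (c, w):set L. length w < k"
  using assms by (auto simp: low_def)
 have "a * f x = (\<Sum>(c, w)\<leftarrow>map (%(c, w). (a * c, w)) L. c * word_fun w x)" for x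
  unfolding L(1) by (induction L) (auto simp: algebra_simps)
 then show ?thesis using L(2) unfolding low_def by (intro CollectI exI[of _ "map (%(c, w). (a * c, w)) L"]) auto
qed

lemma low_coord: assumes "f : low k" shows "(%x. x $ j * f x) : low (Suc k)"
proof -
 obtain L where L: "f = (%x. \<Sum>(c, w)\<leftarrow>L. c * word_fun w x)" "ALL (c, w):set L. length w < k"
  using assms by (auto simp: low_def)
 have "x $ j * f x = (\<Sum>(c, w)\<leftarrow>map (%(c, w). (c, j # w)) L. c * word_fun w x)" for x
  unfolding L(1) by (induction L) (auto simp: algebra_simps word_fun_def)
 then show ?thesis using L(2) unfolding low_def by (intro CollectI exI[of _ "map (%(c, w). (c, j # w)) L"]) auto
qed

lemma word_fun_Cons: "word_fun (j # w) x = x $ j * word_fun w x"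
 by (simp add: word_fun_def)

text \<open>With \<open>k = length w\<close>: the Laplacian of the monomial is \<open>-k (k + n - 1)\<close> times the monomial,
 up to monomials of lower degree.\<close>
lemma word_fun_harmonic:
 fixes w :: "'d::finite list"
 defines "k == real (length w)"
 shows "EX D DD. sph (word_fun w) D & (ALL i. sph (D i) (DD i)) &
  (ALL x. norm x = 1 --> (SUM i:UNIV. x $ i * D i x) = 0) &
  (ALL j. EX q:low (length w). ALL x. D j x = q x - k * x $ j * word_fun w x) &
  (EX q:low (length w). ALL x. norm x = 1 --> (SUM i:UNIV. DD i i x) = q x - k * (k + real CARD('d) - 2) * word_fun w x)"
 unfolding k_def
proof (induction w)
 case Nil
 have 1: "sph (word_fun []) (%(i::'d) x. 0)" using sph_const[of 1] by (simp add: word_fun_def[abs_def])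
 show ?case
  by (intro exI[of _ "%i x. 0"] exI[of _ "%i j x. 0"] conjI 1 allI sph_const) (auto intro!: bexI[of _ "%x. 0"] low_zero)
next
 case (Cons j w)
 define k where "k = real (length w)"
 define n where "n = real CARD('d)"
 from Cons[folded k_def n_def] obtain D DD where D: "sph (word_fun w) D" "ALL i. sph (D i) (DD i)"
  "ALL x. norm x = 1 --> (SUM i:UNIV. x $ i * D i x) = 0"
  and ex1: "ALL j. EX q:low (length w). ALL x. D j x = q x - k * x $ j * word_fun w x"
  and ex2: "EX q:low (length w). ALL x. norm x = 1 --> (SUM i:UNIV. DD i i x) = q x - k * (k + n - 2) * word_fun w x"
  by (elim exE conjE) (rule that)
 from ex2 obtain q2 where q2: "q2 : low (length w)"
  "ALL x. norm x = 1 --> (SUM i:UNIV. DD i i x) = q2 x - k * (k + n - 2) * word_fun w x" by (rule bexE)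
 \<comment> \<open>The remainder of the gradient after its top-degree part; the claim about the
   gradient says that it has degree below \<open>length w\<close>.\<close>
 define q1 where "q1 j x = D j x + k * x $ j * word_fun w x" for j x
 have q1: "q1 j : low (length w)" for j
 proof -
  from ex1 obtain q where q: "q : low (length w)" "ALL x. D j x = q x - k * x $ j * word_fun w x" by (elim allE[of _ j] bexE)
  have "q1 j = q" using q(2) by (simp add: q1_def fun_eq_iff)
  then show ?thesis using q(1) by simp
 qed
 have qD: "D j x = q1 j x - k * x $ j * word_fun w x" for j x by (simp add: q1_def)
 define C :: "'d => (real^'d) => real" where "C i x = (if i = j then 1 else 0) - x $ i * x $ j" for i x
 define CC :: "'d => 'd => (real^'d) => real" where
  "CC i l x = - (x $ i * ((if l = j then 1 else 0) - x $ l * x $ j) + ((if l = i then 1 else 0) - x $ l * x $ i) * x $ j)" for i l x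
 have C: "sph (%x. x $ j) C" using sph_coord[of j] by (simp add: C_def[abs_def])
 have CC: "sph (C i) (CC i)" for i
 proof -
  have "sph (%x. (if i = j then 1 else 0) + (- 1) * (x $ i * x $ j))
   (%l x. 0 + ((- 1) * (x $ i * ((if l = j then 1 else 0) - x $ l * x $ j) + ((if l = i then 1 else 0) - x $ l * x $ i) * x $ j) + 0 * (x $ i * x $ j)))"
   by (intro sph_add sph_mult sph_const sph_coord)
  then show ?thesis by (simp add: C_def[abs_def] CC_def[abs_def])
 qed
 define D' where "D' i x = x $ j * D i x + C i x * word_fun w x" for i x
 define DD' where "DD' i l x = (x $ j * DD i l x + C l x * D i x) + (C i x * D l x + CC i l x * word_fun w x)" for i l x
 have w: "word_fun (j # w) = (%x. x $ j * word_fun w x)" by (simp add: word_fun_Cons fun_eq_iff)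
 have s1: "sph (word_fun (j # w)) D'" unfolding w D'_def by (rule sph_mult[OF C D(1)])
 have s2: "sph (D' i) (DD' i)" for i
  unfolding D'_def DD'_def by (intro sph_add sph_mult C CC D(1) D(2)[rule_format])
 have CS: "(SUM i:UNIV. x $ i * C i x) = 0" if "norm x = 1" for x
 proof -
  have "(SUM i:UNIV. x $ i * C i x) = (SUM i:UNIV. (if i = j then x $ i else 0) - x $ j * (x $ i * x $ i))"
   by (rule sum.cong) (auto simp: C_def algebra_simps)
  also have "... = x $ j - x $ j * (x \<bullet> x)" by (simp add: sum_subtractf sum_distrib_left[symmetric] inner_vec_def)
  finally show ?thesis using that by (simp add: dot_square_norm)
 qed
 have s3: "(SUM i:UNIV. x $ i * D' i x) = 0" if x: "norm x = 1" for x
 proof -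
  have "(SUM i:UNIV. x $ i * D' i x) = x $ j * (SUM i:UNIV. x $ i * D i x) + (SUM i:UNIV. x $ i * C i x) * word_fun w x"
   by (simp add: D'_def sum_distrib_left sum_distrib_right sum.distrib[symmetric] algebra_simps)
  then show ?thesis using D(3) CS[OF x] x by simp
 qed
 have s4: "EX q:low (length (j # w)). ALL x. D' i x = q x - real (length (j # w)) * x $ i * word_fun (j # w) x" for i
 proof (rule bexI[of _ "%x. x $ j * q1 i x + (if i = j then 1 else 0) * word_fun w x"])
  show "(%x. x $ j * q1 i x + (if i = j then 1 else 0) * word_fun w x) : low (length (j # w))"
   using q1 by (auto intro!: low_add low_coord low_scale low_word low_zero)
  show "ALL x. D' i x = x $ j * q1 i x + (if i = j then 1 else 0) * word_fun w x - real (length (j # w)) * x $ i * word_fun (j # w) x"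
   unfolding D'_def C_def w qD by (simp add: k_def algebra_simps)
 qed
 have s5: "EX q:low (length (j # w)). ALL x. norm x = 1 --> (SUM i:UNIV. DD' i i x) =
   q x - real (length (j # w)) * (real (length (j # w)) + n - 2) * word_fun (j # w) x"
 proof (rule bexI[of _ "%x. x $ j * q2 x + 2 * q1 j x"])
  show "(%x. x $ j * q2 x + 2 * q1 j x) : low (length (j # w))"
   using q1 q2 low_mono[of "length w" "Suc (length w)"] by (auto intro!: low_add low_coord low_scale)
  show "ALL x. norm x = 1 --> (SUM i:UNIV. DD' i i x) = x $ j * q2 x + 2 * q1 j x - real (length (j # w)) * (real (length (j # w)) + n - 2) * word_fun (j # w) x"
  proof (intro allI impI)
   fix x :: "real^'d" assume x: "norm x = 1"
   have CC': "(SUM i:UNIV. CC i i x) = - (n - 1) * x $ j"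
   proof -
    have "(SUM i:UNIV. CC i i x) = (SUM i:UNIV. (- (if i = j then x $ i else 0)) + 2 * x $ j * (x $ i * x $ i) - x $ j)"
     by (rule sum.cong) (auto simp: CC_def algebra_simps)
    also have "... = - x $ j + 2 * x $ j * (x \<bullet> x) - n * x $ j"
     by (simp add: sum.distrib sum_subtractf sum_distrib_left[symmetric] inner_vec_def n_def sum_negf)
    finally show ?thesis using x by (simp add: dot_square_norm algebra_simps)
   qed
   have CD: "(SUM i:UNIV. C i x * D i x) = D j x"
   proof -
    have "(SUM i:UNIV. C i x * D i x) = (SUM i:UNIV. (if i = j then D i x else 0) - x $ j * (x $ i * D i x))"
     by (rule sum.cong) (auto simp: C_def algebra_simps)
    also have "... = D j x - x $ j * (SUM i:UNIV. x $ i * D i x)" by (simp add: sum_subtractf sum_distrib_left[symmetric])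
    finally show ?thesis using D(3) x by simp
   qed
   have "(SUM i:UNIV. DD' i i x) = x $ j * (SUM i:UNIV. DD i i x) + 2 * (SUM i:UNIV. C i x * D i x) + (SUM i:UNIV. CC i i x) * word_fun w x"
    by (simp add: DD'_def sum_distrib_left sum_distrib_right sum.distrib[symmetric] algebra_simps)
   also have "... = x $ j * (q2 x - k * (k + n - 2) * word_fun w x) + 2 * (q1 j x - k * x $ j * word_fun w x) + - (n - 1) * x $ j * word_fun w x"
    unfolding CC' CD q2(2)[rule_format, OF x] qD[symmetric] ..
   \<comment> \<open>The eigenvalue recursion
     \<open>k (k + n - 2) + 2 k + (n - 1) = (k + 1) (k + n - 1)\<close>, where \<open>n\<close> is
     the dimension of the ambient space.\<close>
   also have "... = x $ j * q2 x + 2 * q1 j x - real (length (j # w)) * (real (length (j # w)) + n - 2) * word_fun (j # w) x"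
    by (simp add: w k_def algebra_simps)
   finally show "(SUM i:UNIV. DD' i i x) = x $ j * q2 x + 2 * q1 j x - real (length (j # w)) * (real (length (j # w)) + n - 2) * word_fun (j # w) x" .
  qed
 qed
 show ?case
  unfolding n_def[symmetric]
  by (rule exI[of _ D'], rule exI[of _ DD'], intro conjI allI impI) (fact s1, fact s2, erule s3, fact s4, fact s5)
qed

lemma sep_fun_unit: "norm x = 1 ==> sep_fun th h (r, x) = of_real (th r * h x)"
 by (simp add: sep_fun_def)

lemma dr_sep_fun:
 assumes "smooth1 th" "norm x = 1" shows "dr (sep_fun th h) (r, x) = of_real (deriv th r * h x)"
proof -
 have "((%s. of_real (th s * h x) :: complex) has_vector_derivative of_real (deriv th r * h x)) (at r)"
  using smooth1_has_deriv[OF assms(1)]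
  by (intro has_vector_derivative_of_real) (auto intro!: DERIV_cmult_right simp: has_real_derivative_iff_has_vector_derivative[symmetric])
 then show ?thesis using assms(2) by (simp add: dr_def sep_fun_def vector_derivative_at)
qed

text \<open>The first derivatives carry the factor \<open>inverse (norm z)\<close>; differentiating
  it contributes \<open>- x $ i * D i x\<close>, and the sum of these terms vanishes by
  \<open>rad\<close>.\<close>

lemma lapS_sep_fun:
 assumes h: "sph h D" "ALL i. sph (D i) (DD i)" and x: "norm x = 1" and rad: "(SUM i:UNIV. x $ i * D i x) = 0"
 shows "lapS (sep_fun th h) (r, x) = of_real (th r * (SUM i:UNIV. DD i i x))"
proof -
 have x0: "x ~= 0" using x by auto
 have inner: "frechet_derivative (%y. sep_fun th h (r, y /\<^sub>R norm y)) (at z) (axis i 1) = of_real (th r * (inverse (norm z) * D i (z /\<^sub>R norm z)))"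
  if z: "z ~= 0" for z i
 proof -
  have "((%y. complex_of_real (th r * h (y /\<^sub>R norm y))) has_derivative (%v. complex_of_real (th r * (SUM i:UNIV. v $ i * (D i (z /\<^sub>R norm z) / norm z))))) (at z)"
   using h(1) z unfolding sph_def
   by (intro bounded_linear.has_derivative[OF bounded_linear_of_real] has_derivative_mult_right) simp
  then have "((%y. sep_fun th h (r, y /\<^sub>R norm y)) has_derivative (%v. complex_of_real (th r * (SUM i:UNIV. v $ i * (D i (z /\<^sub>R norm z) / norm z))))) (at z)"
   by (rule has_derivative_transform_within_open[of _ _ _ _ "- {0}"]) (use z in \<open>auto simp: sep_fun_def\<close>)
  moreover have "(SUM l:UNIV. axis i 1 $ l * (D l (z /\<^sub>R norm z) / norm z)) = inverse (norm z) * D i (z /\<^sub>R norm z)"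
   by (simp add: axis_def if_distrib[of "%t. t * _"] divide_inverse mult.commute cong: if_cong)
  ultimately show ?thesis by (simp only: frechet_derivative_eqI)
 qed
 have outer: "frechet_derivative (%z. frechet_derivative (%y. sep_fun th h (r, y /\<^sub>R norm y)) (at z) (axis i 1)) (at x) (axis i 1)
  = of_real (th r * (DD i i x - x $ i * D i x))" for i
 proof -
  have "((%z. inverse (norm z) * D i (z /\<^sub>R norm z)) has_derivative
   (%v. inverse (norm x) * (SUM l:UNIV. v $ l * (DD i l (x /\<^sub>R norm x) / norm x)) + - (inverse (norm x) ^ 3 * (x \<bullet> v)) * D i (x /\<^sub>R norm x))) (at x)"
   using h(2)[rule_format, of i] x0 unfolding sph_def by (intro has_derivative_mult[OF inverse_norm_deriv[OF x0]]) simp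
  then have "((%z. complex_of_real (th r * (inverse (norm z) * D i (z /\<^sub>R norm z)))) has_derivative
   (%v. complex_of_real (th r * (inverse (norm x) * (SUM l:UNIV. v $ l * (DD i l (x /\<^sub>R norm x) / norm x)) + - (inverse (norm x) ^ 3 * (x \<bullet> v)) * D i (x /\<^sub>R norm x))))) (at x)"
   by (intro bounded_linear.has_derivative[OF bounded_linear_of_real] has_derivative_mult_right)
  then have "((%z. frechet_derivative (%y. sep_fun th h (r, y /\<^sub>R norm y)) (at z) (axis i 1)) has_derivative
   (%v. complex_of_real (th r * (inverse (norm x) * (SUM l:UNIV. v $ l * (DD i l (x /\<^sub>R norm x) / norm x)) + - (inverse (norm x) ^ 3 * (x \<bullet> v)) * D i (x /\<^sub>R norm x))))) (at x)"
   by (rule has_derivative_transform_within_open[of _ _ _ _ "- {0}"]) (use x0 in \<open>auto simp: inner\<close>)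
  moreover have "inverse (norm x) * (SUM l:UNIV. axis i 1 $ l * (DD i l (x /\<^sub>R norm x) / norm x)) + - (inverse (norm x) ^ 3 * (x \<bullet> axis i 1)) * D i (x /\<^sub>R norm x)
    = DD i i x - x $ i * D i x"
  proof -
   have "(SUM l:UNIV. axis i 1 $ l * DD i l x) = DD i i x"
    by (simp add: axis_def if_distrib[of "%t. t * _"] cong: if_cong)
   then show ?thesis using x by (simp add: inner_axis)
  qed
  ultimately show ?thesis by (simp only: frechet_derivative_eqI)
 qed
 have "lapS (sep_fun th h) (r, x) = (SUM i:UNIV. of_real (th r * (DD i i x - x $ i * D i x)))"
  unfolding lapS_def using outer by simp
 also have "... = of_real (th r * ((SUM i:UNIV. DD i i x) - (SUM i:UNIV. x $ i * D i x)))"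
  by (simp add: sum_subtractf[symmetric] sum_distrib_left)
 finally show ?thesis using rad by simp
qed

lemma lapS_word:
 fixes w :: "'d::finite list"
 obtains q where "q : low (length w)"
  "!!th r x. norm x = 1 ==> lapS (sep_fun th (word_fun w)) (r, x) =
   of_real (th r * (q x - real (length w) * (real (length w) + real CARD('d) - 2) * word_fun w x))"
proof -
 obtain D DD q where *: "sph (word_fun w) D" "ALL i. sph (D i) (DD i)"
  "ALL x. norm x = 1 --> (SUM i:UNIV. x $ i * D i x) = 0"
  "q : low (length w)" "ALL x. norm x = 1 --> (SUM i:UNIV. DD i i x) = q x - real (length w) * (real (length w) + real CARD('d) - 2) * word_fun w x"
  using word_fun_harmonic[of w] by (elim exE conjE bexE) (rule that)
 show ?thesis
  by (rule that[OF *(4)]) (simp add: lapS_sep_fun[OF *(1,2)] *(3,5))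
qed

section \<open>The surface measure on the sphere\<close>

lemma sets_sphere_measure [simp, measurable_cong]: "sets (sphere_measure :: (real^'d) measure) = sets borel"
 and space_sphere_measure [simp]: "space (sphere_measure :: (real^'d) measure) = UNIV"
 by (simp_all add: sphere_measure_def space_scale_measure)

lemma cball_borel [measurable]: "cball (c::real^'d) r : sets borel"
 by (intro borel_closed closed_cball)

lemma measurable_normalize [measurable]: "(%x::real^'d. x /\<^sub>R norm x) : borel_measurable borel"
 by measurable

lemma nn_integral_sphere:
 assumes [measurable]: "f : borel_measurable borel"
 shows "(\<integral>\<^sup>+x. f x \<partial>(sphere_measure :: (real^'d) measure)) =
  of_nat CARD('d) * (\<integral>\<^sup>+x. indicator (cball 0 1) x * f (x /\<^sub>R norm x) \<partial>lborel)"
 unfolding sphere_measure_def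
proof (subst nn_integral_scale_measure)
 have "(\<integral>\<^sup>+x. f x \<partial>distr (density lborel (indicator (cball 0 1))) borel (%x. x /\<^sub>R norm x)) =
  (\<integral>\<^sup>+x. f (x /\<^sub>R norm x) \<partial>density lborel (indicator (cball 0 1)))" by (rule nn_integral_distr) measurable
 also have "... = (\<integral>\<^sup>+x. indicator (cball 0 1) x * f (x /\<^sub>R norm x) \<partial>lborel)" by (rule nn_integral_density) measurable
 finally show "of_nat CARD('d) * (\<integral>\<^sup>+x. f x \<partial>distr (density lborel (indicator (cball 0 1))) borel (%x. x /\<^sub>R norm x)) =
  of_nat CARD('d) * (\<integral>\<^sup>+x. indicator (cball 0 1) x * f (x /\<^sub>R norm x) \<partial>lborel)" by simp
qed measurable

lemma finite_sphere_measure: "finite_measure (sphere_measure :: (real^'d) measure)"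
proof (rule finite_measureI)
 have "emeasure (sphere_measure :: (real^'d) measure) UNIV = (\<integral>\<^sup>+x. 1 \<partial>(sphere_measure :: (real^'d) measure))" by simp
 also have "... = of_nat CARD('d) * (\<integral>\<^sup>+x. indicator (cball 0 1) x * 1 \<partial>(lborel :: (real^'d) measure))"
  by (rule nn_integral_sphere) simp
 also have "... < \<infinity>" using emeasure_lborel_cball_finite[of "0::real^'d" 1] by (simp add: ennreal_mult_less_top of_nat_less_top)
 finally show "emeasure (sphere_measure :: (real^'d) measure) (space sphere_measure) ~= \<infinity>" by simp
qed

interpretation sphere: finite_measure "sphere_measure :: (real^'d) measure" by (rule finite_sphere_measure)

lemma AE_sphere_norm: "AE x in (sphere_measure :: (real^'d) measure). norm x = 1"
proof -
 have "emeasure (sphere_measure :: (real^'d) measure) {x. norm x ~= 1} = (\<integral>\<^sup>+x. indicator {x. norm x ~= 1} x \<partial>(sphere_measure :: (real^'d) measure))" by simp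
 also have "... = of_nat CARD('d) * (\<integral>\<^sup>+x. indicator (cball 0 1) x * indicator {x. norm x ~= 1} (x /\<^sub>R norm x) \<partial>(lborel :: (real^'d) measure))"
  by (rule nn_integral_sphere) simp
 also have "(\<integral>\<^sup>+x. indicator (cball 0 1) x * indicator {x. norm x ~= 1} (x /\<^sub>R norm x) \<partial>(lborel :: (real^'d) measure)) = (\<integral>\<^sup>+x. 0 \<partial>(lborel :: (real^'d) measure))"
 proof (rule nn_integral_cong_AE)
  show "AE x in (lborel :: (real^'d) measure). indicator (cball 0 1) x * indicator {x. norm x ~= 1} (x /\<^sub>R norm x) = (0::ennreal)"
   using AE_lborel_singleton[of "0::real^'d"] by eventually_elim auto
 qed
 finally show ?thesis by (subst AE_iff_measurable[of "{x. norm x ~= 1}"]) auto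
qed

text \<open>Writing the scaling as a real density makes the transformation rules of Bochner
  integrals applicable.\<close>

lemma sphere_measure_eq:
 "(sphere_measure :: (real^'d) measure) = distr (density lborel (%x. ennreal (real CARD('d) * indicator (cball 0 1) x))) borel (%x. x /\<^sub>R norm x)"
  (is "_ = ?N")
proof (rule measure_eqI)
 fix A assume "A : sets (sphere_measure :: (real^'d) measure)"
 then have A: "A : sets borel" by simp
 have [measurable]: "(%x::real^'d. indicator A (x /\<^sub>R norm x) :: ennreal) : borel_measurable borel"
  by (rule measurable_compose[OF measurable_normalize borel_measurable_indicator[OF A]])
 have [measurable]: "(%x::real^'d. indicator (cball 0 1) x :: ennreal) : borel_measurable borel"
  "(%x::real^'d. indicator (cball 0 1) x :: real) : borel_measurable borel"
  by (intro borel_measurable_indicator cball_borel)+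
 note A [measurable]
 have "emeasure (sphere_measure :: (real^'d) measure) A = (\<integral>\<^sup>+x. indicator A x \<partial>(sphere_measure :: (real^'d) measure))" by simp
 also have "... = of_nat CARD('d) * (\<integral>\<^sup>+x. indicator (cball 0 1) x * indicator A (x /\<^sub>R norm x) \<partial>lborel)"
  by (rule nn_integral_sphere) simp
 also have "... = (\<integral>\<^sup>+x. ennreal (real CARD('d) * indicator (cball 0 1) x) * indicator A (x /\<^sub>R norm x) \<partial>lborel)"
 proof (subst nn_integral_cmult[symmetric])
  show "(%x. indicator (cball 0 1) x * indicator A (x /\<^sub>R norm x) :: ennreal) : borel_measurable lborel" by measurable
  show "(\<integral>\<^sup>+x. of_nat CARD('d) * (indicator (cball 0 1) x * indicator A (x /\<^sub>R norm x)) \<partial>lborel) =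
   (\<integral>\<^sup>+x. ennreal (real CARD('d) * indicator (cball 0 1) x) * indicator A (x /\<^sub>R norm x) \<partial>lborel)"
   by (rule nn_integral_cong) (simp add: indicator_def ennreal_of_nat_eq_real_of_nat)
 qed
 also have "... = (\<integral>\<^sup>+x. indicator A x \<partial>?N)"
  by (subst nn_integral_distr, simp, simp, subst nn_integral_density) measurable
 also have "... = emeasure ?N A" by (subst nn_integral_indicator) simp_all
 finally show "emeasure sphere_measure A = emeasure ?N A" .
qed simp

lemma integral_sphere:
 fixes f :: "real^'d => complex"
 assumes [measurable]: "f : borel_measurable borel"
 shows "(LINT x|sphere_measure. f x) = real CARD('d) *\<^sub>R (LINT x|lborel. indicator (cball 0 1) x *\<^sub>R f (x /\<^sub>R norm x))"
 unfolding sphere_measure_eq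
proof -
 have "(\<integral>x. f x \<partial>distr (density lborel (%x. ennreal (real CARD('d) * indicator (cball 0 1) x))) borel (%x. x /\<^sub>R norm x)) =
  (\<integral>x. f (x /\<^sub>R norm x) \<partial>density lborel (%x. ennreal (real CARD('d) * indicator (cball 0 1) x)))"
  by (rule integral_distr) measurable
 also have "... = (LINT x|lborel. (real CARD('d) * indicator (cball 0 1) x) *\<^sub>R f (x /\<^sub>R norm x))"
 proof (rule integral_density)
  show "(%x::real^'d. real CARD('d) * indicat_real (cball 0 1) x) : borel_measurable lborel" by measurable
 qed auto
 also have "... = (LINT x|lborel. real CARD('d) *\<^sub>R (indicator (cball 0 1) x *\<^sub>R f (x /\<^sub>R norm x)))" by simp
 also have "... = real CARD('d) *\<^sub>R (LINT x|lborel. indicator (cball 0 1) x *\<^sub>R f (x /\<^sub>R norm x))"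
  by (rule Bochner_Integration.integral_scaleR_right)
 finally show "(\<integral>x. f x \<partial>distr (density lborel (%x. ennreal (real CARD('d) * indicator (cball 0 1) x))) borel (%x. x /\<^sub>R norm x)) =
  real CARD('d) *\<^sub>R (LINT x|lborel. indicator (cball 0 1) x *\<^sub>R f (x /\<^sub>R norm x))" .
qed

section \<open>Integration in polar coordinates\<close>

lemma integral_scale_ball:
 fixes f :: "real^'d => complex"
 assumes [measurable]: "f : borel_measurable borel" and t: "t > 0"
 shows "(LINT x|lborel. indicator (cball 0 t) x *\<^sub>R f (x /\<^sub>R norm x)) =
  t ^ CARD('d) *\<^sub>R (LINT x|lborel. indicator (cball 0 1) x *\<^sub>R f (x /\<^sub>R norm x))"
proof -
 have "(LINT x|lborel. indicator (cball 0 t) x *\<^sub>R f (x /\<^sub>R norm x)) =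
  (\<integral>x. indicator (cball 0 t) x *\<^sub>R f (x /\<^sub>R norm x) \<partial>density (distr lborel borel (%x. 0 + t *\<^sub>R x)) (%x. ennreal (\<bar>t\<bar> ^ DIM(real^'d))))"
  using lborel_affine[of t "0::real^'d"] t by simp
 also have "... = (LINT x|lborel. t ^ CARD('d) *\<^sub>R (indicator (cball 0 t) (t *\<^sub>R x) *\<^sub>R f ((t *\<^sub>R x) /\<^sub>R norm (t *\<^sub>R x))))"
 proof (subst integral_density)
  show "(\<integral>x. (\<bar>t\<bar> ^ DIM(real^'d)) *\<^sub>R (indicator (cball 0 t) x *\<^sub>R f (x /\<^sub>R norm x)) \<partial>distr lborel borel (%x. 0 + t *\<^sub>R x)) =
   (LINT x|lborel. t ^ CARD('d) *\<^sub>R (indicator (cball 0 t) (t *\<^sub>R x) *\<^sub>R f ((t *\<^sub>R x) /\<^sub>R norm (t *\<^sub>R x))))"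
   using t by (subst integral_distr) simp_all
 qed simp_all
 also have "... = t ^ CARD('d) *\<^sub>R (LINT x|lborel. indicator (cball 0 t) (t *\<^sub>R x) *\<^sub>R f ((t *\<^sub>R x) /\<^sub>R norm (t *\<^sub>R x)))"
  by (rule Bochner_Integration.integral_scaleR_right)
 also have "(%x. indicator (cball 0 t) (t *\<^sub>R x) *\<^sub>R f ((t *\<^sub>R x) /\<^sub>R norm (t *\<^sub>R x))) = (%x. indicator (cball 0 1) x *\<^sub>R f (x /\<^sub>R norm x))"
  using t by (auto simp: fun_eq_iff indicator_def field_simps)
 finally show ?thesis .
qed

text \<open>Integration in polar coordinates, by the layer-cake formula for the radial factor and the
 homogeneity of Lebesgue measure.\<close>
lemma polar_factorization:
 fixes f :: "real^'d => complex"
 assumes [measurable]: "f : borel_measurable borel" and C: "!!x. norm (f x) <= C" and g: "ctest 0 g"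
 shows "(LINT x|lborel. g (norm x) *\<^sub>R f (x /\<^sub>R norm x)) =
  (- (LINT t|lborel. deriv g t * t ^ CARD('d)) / real CARD('d)) *\<^sub>R (LINT x|sphere_measure. f x)"
proof -
 obtain a1 b1 where h1: "0 < a1" "a1 < b1" "ALL x. x ~: {a1..b1} --> deriv g x = 0" using ctest_supp'[OF ctest_deriv[OF g]] by blast
 obtain a2 b2 where h2: "0 < a2" "a2 < b2" "ALL x. x ~: {a2<..<b2} --> g x = 0" using ctest_supp[OF g] by blast
 define b where "b = max b1 b2"
 have g'0: "deriv g t = 0" if "t <= 0 | b < t" for t
 proof -
  have "t ~: {a1..b1}" using that h1(1) by (auto simp: b_def)
  then show ?thesis using h1(3) by blast
 qed
 have g0: "g t = 0" if "b <= t" for t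
 proof -
  have "t ~: {a2<..<b2}" using that by (auto simp: b_def)
  then show ?thesis using h2(3) by blast
 qed
 have [measurable]: "deriv g : borel_measurable borel" by (rule borel_ctest[OF ctest_deriv[OF g]])
 \<comment> \<open>Layer cake: \<open>g (norm x)\<close> is the integral of
   \<open>- deriv g t\<close> over \<open>t >= norm x\<close>. For fixed \<open>t\<close>, the
   \<open>x\<close>-integral runs over a ball of radius \<open>t\<close> and scales like
   \<open>t ^ CARD('d)\<close>.\<close>
 define H :: "real^'d => real => complex" where
  "H x t = (if norm x <= t then - deriv g t else 0) *\<^sub>R f (x /\<^sub>R norm x)" for x t
 have [measurable]: "(%(x, t). H x t) : borel_measurable (lborel \<Otimes>\<^sub>M lborel)" unfolding H_def by measurable
 have g'i: "integrable lborel (deriv g)" by (rule ctest_int[OF ctest_deriv[OF g]])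
 have C0: "C >= 0" using norm_ge_zero[of "f 0"] C[of 0] by linarith
 have i1: "integrable (lborel \<Otimes>\<^sub>M lborel) (%(x::real^'d, t::real). indicator (cball 0 b) x * (C * \<bar>deriv g t\<bar>))"
 proof (rule lborel_pair.Fubini_integrable)
  show "(%(x::real^'d, t::real). indicator (cball 0 b) x * (C * \<bar>deriv g t\<bar>)) : borel_measurable (lborel \<Otimes>\<^sub>M lborel)"
  proof -
   have "(%x::real^'d. indicator (cball 0 b) x :: real) : borel_measurable lborel" "(%t. C * \<bar>deriv g t\<bar>) : borel_measurable lborel" by measurable
   then show ?thesis by measurable
  qed
  have "integrable lborel (%x::real^'d. indicator (cball 0 b) x :: real)"
   using emeasure_lborel_cball_finite[of "0::real^'d" b] by (simp add: integrable_indicator_iff)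
  then show "integrable lborel (%x::real^'d. LINT t|lborel. norm (case (x, t) of (x, t) => indicator (cball 0 b) x * (C * \<bar>deriv g t\<bar>)))"
   using C0 by (simp add: abs_mult)
  show "AE x::real^'d in lborel. integrable lborel (%t. case (x, t) of (x, t) => indicator (cball 0 b) x * (C * \<bar>deriv g t\<bar>))"
   using g'i by simp
 qed
 have Hi: "integrable (lborel \<Otimes>\<^sub>M lborel) (%(x, t). H x t)"
 proof (rule bochner_bound[OF i1])
  have "norm (H x t) <= norm (indicator (cball 0 b) x * (C * \<bar>deriv g t\<bar>))" for x t
  proof (cases "norm x <= t & t <= b")
   case True
   then have "norm x <= b" by simp
   then show ?thesis using True mult_right_mono[OF C[of "x /\<^sub>R norm x"], of "\<bar>deriv g t\<bar>"] C0
    by (simp add: H_def abs_mult mult.commute)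
  next
   case False
   then have "H x t = 0" using g'0[of t] by (auto simp: H_def)
   then show ?thesis by simp
  qed
  then show "AE p in lborel \<Otimes>\<^sub>M lborel. norm (case p of (x, t) => H x t) <= norm (case p of (x::real^'d, t::real) => indicator (cball 0 b) x * (C * \<bar>deriv g t\<bar>))"
   by (intro AE_I2) (auto split: prod.split)
 qed measurable
 have 1: "(LINT t|lborel. H x t) = g (norm x) *\<^sub>R f (x /\<^sub>R norm x)" for x
 proof -
  have "(LINT t|lborel. (if norm x <= t then - deriv g t else 0)) = g (norm x)"
  proof (cases "norm x <= b")
   case True
   have "(LINT t|lborel. (if norm x <= t then - deriv g t else 0)) = (LINT t|lborel. - (deriv g t * indicator {norm x..b} t))"
    using g'0 by (intro bochner_cong) (auto simp: indicator_def)
   also have "... = - (LINT t|lborel. deriv g t * indicator {norm x..b} t)" by simp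
   also have "(LINT t|lborel. deriv g t * indicator {norm x..b} t) = g b - g (norm x)"
    by (rule integral_FTC_Icc_real[OF True smooth1_has_deriv[OF ctest_smooth1[OF g]]])
     (use ctest_cont[OF ctest_deriv[OF g], of UNIV] in \<open>simp add: continuous_on_eq_continuous_at\<close>)
   finally show ?thesis using g0[of b] by simp
  next
   case False
   then have "(if norm x <= t then - deriv g t else 0) = 0" for t using g'0[of t] by auto
   then show ?thesis using g0[of "norm x"] False by (simp del: if_split_asm)
  qed
  moreover have "integrable lborel (%t. if norm x <= t then - deriv g t else 0)"
   by (rule bochner_bound[OF g'i]) auto
  ultimately show ?thesis unfolding H_def by simp
 qed
 have 2: "(LINT x|lborel. H x t) = (- deriv g t * t ^ CARD('d)) *\<^sub>R (LINT x|lborel. indicator (cball 0 1) x *\<^sub>R f (x /\<^sub>R norm x))" for t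
 proof (cases "t > 0")
  case True
  have "(LINT x|lborel. H x t) = (LINT x|lborel. (- deriv g t) *\<^sub>R (indicator (cball 0 t) x *\<^sub>R f (x /\<^sub>R norm x)))"
   by (rule bochner_cong) (auto simp: H_def indicator_def)
  also have "... = (- deriv g t) *\<^sub>R (t ^ CARD('d) *\<^sub>R (LINT x|lborel. indicator (cball 0 1) x *\<^sub>R f (x /\<^sub>R norm x)))"
   using integral_scale_ball[OF assms(1) True] by (simp only: Bochner_Integration.integral_scaleR_right)
  finally show ?thesis by simp
 next
  case False
  then have "deriv g t = 0" using g'0 by auto
  moreover from this have "H x t = 0" for x by (simp add: H_def)
  ultimately show ?thesis by simp
 qed
 have "(LINT x|lborel. g (norm x) *\<^sub>R f (x /\<^sub>R norm x)) = (LINT x|lborel. LINT t|lborel. H x t)" by (simp add: 1)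
 also have "... = (LINT t|lborel. LINT x|lborel. H x t)" by (rule lborel_pair.Fubini_integral[OF Hi, symmetric])
 also have "... = (LINT t|lborel. - deriv g t * t ^ CARD('d)) *\<^sub>R (LINT x|lborel. indicator (cball 0 1) x *\<^sub>R f (x /\<^sub>R norm x))"
 proof -
  have "ctest 0 (%t. t ^ CARD('d) * deriv g t)"
   using ctest_mult[OF ctest_deriv[OF g] smooth1_poly[of "monom 1 CARD('d)"]] by (simp add: poly_monom)
  from ctest_int[OF this] have "integrable lborel (%t. - deriv g t * t ^ CARD('d))" by (simp add: mult.commute)
  then show ?thesis unfolding 2 by (rule Bochner_Integration.integral_scaleR_left)
 qed
 also have "... = (- (LINT t|lborel. deriv g t * t ^ CARD('d)) / real CARD('d)) *\<^sub>R (LINT x|sphere_measure. f x)"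
  unfolding integral_sphere[OF assms(1)] by simp
 finally show ?thesis .
qed

section \<open>Towards the divergence theorem on the sphere\<close>

lemma ctest_deriv_power:
 assumes g: "ctest 0 g" shows "(LINT t|lborel. deriv g t * t ^ Suc m) = - real (Suc m) * (LINT t|lborel. g t * t ^ m)"
proof -
 have p: "ctest 0 (%t. t ^ k * f t)" if "ctest 0 f" for f k
  using ctest_mult[OF that smooth1_poly[of "monom 1 k"]] by (simp add: poly_monom)
 have "deriv (%t. t ^ Suc m * g t) t = t ^ Suc m * deriv g t + real (Suc m) * (t ^ m * g t)" for t
  using smooth1_has_deriv[OF ctest_smooth1[OF g], of t]
  by (intro DERIV_imp_deriv derivative_eq_intros) (auto simp: algebra_simps simp del: of_nat_Suc)
 with ctest_deriv_int0[OF p[OF g, of "Suc m"]]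
 have "(LINT t|lborel. t ^ Suc m * deriv g t + real (Suc m) * (t ^ m * g t)) = 0" by simp
 moreover have "integrable lborel (%t. t ^ Suc m * deriv g t)" "integrable lborel (%t. t ^ m * g t)"
  using ctest_int[OF p[OF ctest_deriv[OF g], of "Suc m"]] ctest_int[OF p[OF g, of m]] by auto
 ultimately have "(LINT t|lborel. t ^ Suc m * deriv g t) + real (Suc m) * (LINT t|lborel. t ^ m * g t) = 0"
  by (subst (asm) Bochner_Integration.integral_add) auto
 moreover have "(%t. deriv g t * t ^ Suc m) = (%t. t ^ Suc m * deriv g t)" "(%t. g t * t ^ m) = (%t. t ^ m * g t)"
  by (simp_all add: fun_eq_iff mult.commute)
 ultimately show ?thesis by (simp only:)
qed

text \<open>Identities on the sphere will be derived with a common radial factor, which must be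
  nonzero in order to be cancelled.\<close>

lemma ctest_moment_ex: "EX g. ctest 0 g & (LINT t|lborel. g t * t ^ m) ~= 0"
proof (rule ccontr)
 assume "~ ?thesis"
 then have z: "(LINT t|lborel. g t *\<^sub>R t ^ m) = 0" if "ctest 0 g" for g using that by auto
 have "AE x in lborel. 0 < x --> (x::real) ^ m = 0"
  by (rule locint_AE_eq_0[OF locint_cont z]) (auto intro!: continuous_intros)
 then have "AE x in lborel. x ~: {0<..<1::real}" by eventually_elim auto
 then have "emeasure lborel {0<..<1::real} = 0" by (subst (asm) AE_iff_measurable[of "{0<..<1}"]) auto
 then show False by simp
qed

text \<open>By translation invariance every difference quotient integrates to 0; the Lipschitz bound
  and the bounded support permit dominated convergence.\<close>

lemma integral_partial_derivative_0:
 fixes u :: "real^'d => complex"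
 assumes D: "!!x. (u has_derivative D x) (at x)" and L: "!!x v. norm (D x v) <= L * norm v"
  and supp: "!!x. R < norm x ==> u x = 0" and mD: "(%x. D x e) : borel_measurable borel"
  and e: "norm e = 1"
 shows "(LINT x|lborel. D x e) = 0"
proof -
 have uc: "continuous_on UNIV u" using D by (intro continuous_at_imp_continuous_on ballI has_derivative_continuous)
 then have [measurable]: "u : borel_measurable borel" by (rule borel_measurable_continuous_onI)
 have L0: "L >= 0" using order_trans[OF norm_ge_zero L[of 0 e]] e by simp
 have Lip: "norm (u x - u y) <= L * norm (x - y)" for x y
  by (rule differentiable_bound[of UNIV u D]) (auto intro!: D onorm_bound L L0)
 define h where "h k = inverse (real (Suc k))" for k
 have h: "h k > 0" "h k <= 1" for k by (auto simp: h_def field_simps)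
 define ph where "ph k x = inverse (h k) *\<^sub>R (u (h k *\<^sub>R e + x) - u x)" for k x
 \<comment> \<open>The shifts \<open>h k\<close> are at most 1, so all difference quotients live in
   one ball.\<close>
 have supp1: "ph k x = 0" if "R + 1 < norm x" for k x
 proof -
  have "norm (h k *\<^sub>R e) <= 1" using h[of k] e by simp
  then have "R < norm (h k *\<^sub>R e + x)" using norm_diff_ineq[of x "h k *\<^sub>R e"] that by (simp add: add.commute)
  then show ?thesis using supp[of x] supp[of "h k *\<^sub>R e + x"] that by (simp add: ph_def)
 qed
 have ball: "integrable lborel (%x::real^'d. C * indicator (cball 0 r) x :: real)" for C r
  using emeasure_lborel_cball_finite[of "0::real^'d" r] by (simp add: integrable_indicator_iff)
 have ui: "integrable lborel u"
 proof (rule bochner_bound[OF ball[of "norm (u 0) + L * R" R]])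
  have "norm (u x) <= norm ((norm (u 0) + L * R) * indicator (cball 0 R) x)" for x
  proof (cases "norm x <= R")
   case True
   have "norm (u x) <= norm (u 0) + norm (u x - u 0)" by (metis add.commute diff_add_cancel norm_triangle_ineq)
   also have "... <= norm (u 0) + L * norm x" using Lip[of x 0] by simp
   also have "... <= norm (u 0) + L * R" using True L0 by (simp add: mult_left_mono)
   finally show ?thesis using True by simp
  qed (use supp[of x] in simp)
  then show "AE x in lborel. norm (u x) <= norm ((norm (u 0) + L * R) * indicator (cball 0 R) x)" by simp
 qed simp
 have tr: "integrable lborel (%x. u (c + x))" "(LINT x|lborel. u (c + x)) = (LINT x|lborel. u x)" for c
 proof -
  have "integrable (distr lborel borel ((+) c)) u" using ui by (simp add: lborel_distr_plus)
  then show "integrable lborel (%x. u (c + x))" by (subst (asm) integrable_distr_eq) auto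
  have "(LINT x|lborel. u x) = (\<integral>x. u x \<partial>distr lborel borel ((+) c))" by (simp add: lborel_distr_plus)
  also have "... = (LINT x|lborel. u (c + x))" by (rule integral_distr) auto
  finally show "(LINT x|lborel. u (c + x)) = (LINT x|lborel. u x)" by simp
 qed
 have z: "(LINT x|lborel. ph k x) = 0" for k
  unfolding ph_def using tr[of "h k *\<^sub>R e"] ui by simp
 have "(%k. LINT x|lborel. ph k x) \<longlonglongrightarrow> (LINT x|lborel. D x e)"
 proof (rule integral_dominated_convergence[where w="%x. L * indicator (cball 0 (R + 1)) x"])
  show "(%x. D x e) : borel_measurable lborel" using mD by simp
  show "ph k : borel_measurable lborel" for k unfolding ph_def by measurable
  show "integrable lborel (%x::real^'d. L * indicator (cball 0 (R + 1)) x)" by (rule ball)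
  show "AE x in lborel. norm (ph k x) <= L * indicator (cball 0 (R + 1)) x" for k
  proof (rule AE_I2)
   fix x
   show "norm (ph k x) <= L * indicator (cball 0 (R + 1)) x"
   proof (cases "norm x <= R + 1")
    case True
    have "norm (u (h k *\<^sub>R e + x) - u x) <= L * h k"
     using Lip[of "h k *\<^sub>R e + x" x] h(1)[of k] e by simp
    then have "inverse (h k) * norm (u (h k *\<^sub>R e + x) - u x) <= inverse (h k) * (L * h k)"
     using h(1)[of k] by (intro mult_left_mono) auto
    also have "... = L" using h(1)[of k] by simp
    finally show ?thesis using True h(1)[of k] by (simp add: ph_def)
   qed (use supp1 in simp)
  qed
  show "AE x in lborel. (%k. ph k x) \<longlonglongrightarrow> D x e"
  proof (rule AE_I2)
   fix x
   have Dx: "(u has_derivative D x) (at (x + 0 *\<^sub>R e))" using D[of x] by simp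
   have "((%t::real. x + t *\<^sub>R e) has_derivative (%t. t *\<^sub>R e)) (at 0)"
    by (auto intro!: derivative_eq_intros)
   from has_derivative_compose[OF this, of u "D x"] Dx
   have "((%t. u (x + t *\<^sub>R e)) has_derivative (%t. D x (t *\<^sub>R e))) (at 0)" by simp
   then have lim: "((%t. norm (u (x + (0 + t) *\<^sub>R e) - u (x + 0 *\<^sub>R e) - D x (t *\<^sub>R e)) / norm t) \<longlongrightarrow> 0) (at 0)"
    unfolding has_derivative_at by (rule conjunct2)
   have "\<forall>\<^sub>F t in at 0. norm (u (x + (0 + t) *\<^sub>R e) - u (x + 0 *\<^sub>R e) - D x (t *\<^sub>R e)) / norm t = norm ((u (x + t *\<^sub>R e) - u x) /\<^sub>R t - D x e)"
   proof (rule eventually_mono[OF eventually_neq_at_within[of 0]])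
    fix t :: real assume t: "t ~= 0"
    have "D x (t *\<^sub>R e) = t *\<^sub>R D x e" by (rule linear_scale[OF has_derivative_linear[OF D]])
    then have "(u (x + t *\<^sub>R e) - u x) /\<^sub>R t - D x e = (u (x + t *\<^sub>R e) - u x - D x (t *\<^sub>R e)) /\<^sub>R t"
     using t by (simp add: scaleR_diff_right)
    then show "norm (u (x + (0 + t) *\<^sub>R e) - u (x + 0 *\<^sub>R e) - D x (t *\<^sub>R e)) / norm t = norm ((u (x + t *\<^sub>R e) - u x) /\<^sub>R t - D x e)"
     by (simp add: divide_inverse mult.commute)
   qed
   from Lim_transform_eventually[OF lim this]
   have "((%t. (u (x + t *\<^sub>R e) - u x) /\<^sub>R t) \<longlongrightarrow> D x e) (at 0)"
    by (simp add: tendsto_norm_zero_iff LIM_zero_iff)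
   moreover have "filterlim h (at 0) sequentially"
    unfolding h_def filterlim_at using LIMSEQ_inverse_real_of_nat by (simp del: of_nat_Suc)
   ultimately have "(%k. (u (x + h k *\<^sub>R e) - u x) /\<^sub>R h k) \<longlonglongrightarrow> D x e" by (rule filterlim_compose)
   then show "(%k. ph k x) \<longlonglongrightarrow> D x e" by (simp add: ph_def add.commute)
  qed
 qed
 then show ?thesis by (simp add: z LIMSEQ_const_iff)
qed

lemma ctest_bounded: assumes "ctest c g" shows "EX C>=0. ALL x. \<bar>g x\<bar> <= C"
proof -
 obtain a b where h: "c < a" "a < b" "ALL x. x ~: {a..b} --> g x = 0" using ctest_supp'[OF assms] by blast
 obtain C where C: "ALL x:{a..b}. \<bar>g x\<bar> <= C" using cont_on_compact_bound[OF ctest_cont[OF assms]] by blast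
 have "\<bar>g x\<bar> <= max C 0" for x
 proof (cases "x : {a..b}")
  case True then have "\<bar>g x\<bar> <= C" using C by blast
  then show ?thesis by simp
 next
  case False then show ?thesis using h(3) by simp
 qed
 then show ?thesis by (intro exI[of _ "max C 0"]) simp
qed

lemma ctest_left: assumes "ctest c f" "x <= c" shows "f x = 0"
proof -
 obtain a b where h: "c < a" "ALL x. x ~: {a..b} --> f x = 0" using ctest_supp'[OF assms(1)] by blast
 have "x ~: {a..b}" using h(1) assms(2) by auto
 then show ?thesis using h(2) by blast
qed

lemma sum_axis_scaleR: "(SUM i:UNIV. (axis j (1::real) $ i) *\<^sub>R f i) = (f j :: 'b::real_vector)"
proof -
 have "(SUM i:UNIV. (axis j (1::real) $ i) *\<^sub>R f i) = (SUM i:UNIV. if i = j then f i else 0)"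
  by (rule sum.cong) (auto simp: axis_def)
 then show ?thesis by simp
qed

lemma polar_integrable:
 fixes f :: "real^'d => complex"
 assumes [measurable]: "f : borel_measurable borel" and C: "!!x. norm (f x) <= C" and g: "ctest 0 g"
 shows "integrable lborel (%x. g (norm x) *\<^sub>R f (x /\<^sub>R norm x))"
proof -
 obtain a b where h: "0 < a" "a < b" "ALL x. x ~: {a..b} --> g x = 0" using ctest_supp'[OF g] by blast
 obtain B where B: "B >= 0" "ALL x. \<bar>g x\<bar> <= B" using ctest_bounded[OF g] by blast
 have [measurable]: "g : borel_measurable borel" by (rule borel_ctest[OF g])
 show ?thesis
 proof (rule bochner_bound[where f="%x::real^'d. (B * C) * indicator (cball 0 b) x"])
  show "integrable lborel (%x::real^'d. (B * C) * indicator (cball 0 b) x)"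
   using emeasure_lborel_cball_finite[of "0::real^'d" b] by (simp add: integrable_indicator_iff)
  have "norm (g (norm x) *\<^sub>R f (x /\<^sub>R norm x)) <= norm ((B * C) * indicator (cball 0 b) x)" for x
  proof (cases "norm x <= b")
   case True
   have "\<bar>g (norm x)\<bar> * norm (f (x /\<^sub>R norm x)) <= B * C" using B C by (intro mult_mono) auto
   then show ?thesis using True by simp
  next
   case False
   then have "g (norm x) = 0" using h(3) by simp
   then show ?thesis by simp
  qed
  then show "AE x in lborel. norm (g (norm x) *\<^sub>R f (x /\<^sub>R norm x)) <= norm ((B * C) * indicator (cball 0 b) x)" by simp
 qed measurable
qed

lemma test_fun_slice_borel: "test_fun r0 ps ==> (%x. ps (r, x)) : borel_measurable borel"
 by (rule measurable_compose[OF _ test_fun_borel]) (auto intro!: borel_measurable_continuous_onI continuous_intros)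

text \<open>The divergence theorem on the sphere, obtained by integrating the partial derivative of
 \<open>t * rh t\<close> (with \<open>t = |x|\<close>) times the radial extension over the whole space.\<close>
lemma sphere_divergence:
 fixes ps :: "real * (real^'d) => complex"
 assumes ps: "test_fun r0 ps" and r: "r0 < r" and dim: "CARD('d) >= 2"
 shows "(LINT x|sphere_measure. dSt r0 ps j (r, x)) = of_real (real CARD('d) - 1) * (LINT x|sphere_measure. of_real (x $ j) * ps (r, x))"
proof -
 define d where "d = CARD('d)"
 obtain rh where rh: "ctest 0 rh" and m0: "(LINT t|lborel. rh t * t ^ (d - 1)) ~= 0" using ctest_moment_ex by blast
 \<comment> \<open>The additional factor \<open>t\<close> cancels the homogeneity of degree -1:
   \<open>ta (norm x)\<close> times \<open>dS\<close> is \<open>rh (norm x)\<close> times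
   \<open>dSt\<close> at the normalized point, so that polar factorization applies.\<close>
 define ta where "ta t = t * rh t" for t
 have ta: "ctest 0 ta" using ctest_mult[OF rh smooth1_poly[of "[:0, 1:]"]] by (simp add: ta_def[abs_def])
 have ta': "ctest 0 (deriv ta)" by (rule ctest_deriv[OF ta])
 obtain a b where h: "0 < a" "a < b" "ALL x. x ~: {a<..<b} --> ta x = 0" using ctest_supp[OF ta] by blast
 obtain C1 where C1: "C1 >= 0" "ALL p. norm (ps p) <= C1" using test_fun_bounded[OF ps] by blast
 have "ALL i. EX C>=0. ALL p. norm (dSt r0 ps i p) <= C" using test_fun_bounded[OF test_fun_dSt[OF ps]] by blast
 then obtain C2 where C2: "!!i. C2 i >= 0" "!!i p. norm (dSt r0 ps i p) <= C2 i" by metis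
 obtain B1 where B1: "B1 >= 0" "ALL x. \<bar>rh x\<bar> <= B1" using ctest_bounded[OF rh] by blast
 obtain B2 where B2: "B2 >= 0" "ALL x. \<bar>deriv ta x\<bar> <= B2" using ctest_bounded[OF ta'] by blast
 define u where "u x = ta (norm x) *\<^sub>R ps (r, x /\<^sub>R norm x)" for x
 define D where "D x v = (if x = 0 then 0 else ta (norm x) *\<^sub>R (SUM i:UNIV. (v $ i) *\<^sub>R dS ps i (r, x)) +
   (deriv ta (norm x) * (v \<bullet> sgn x)) *\<^sub>R ps (r, x /\<^sub>R norm x))" for x v
 have scaled: "ta (norm x) *\<^sub>R dS ps i (r, x) = rh (norm x) *\<^sub>R dSt r0 ps i (r, x /\<^sub>R norm x)" if "x ~= 0" for x i
  using dS_homogeneous[OF ps r that, of i] that r by (simp add: dSt_def[OF ps] ta_def scaleR_conv_of_real[where 'a=complex])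
 have Dsum: "D x v = (SUM i:UNIV. (v $ i) *\<^sub>R (rh (norm x) *\<^sub>R dSt r0 ps i (r, x /\<^sub>R norm x))) +
   (deriv ta (norm x) * (v \<bullet> sgn x)) *\<^sub>R ps (r, x /\<^sub>R norm x)" if "x ~= 0" for x v
 proof -
  have "ta (norm x) *\<^sub>R (SUM i:UNIV. (v $ i) *\<^sub>R dS ps i (r, x)) = (SUM i:UNIV. (v $ i) *\<^sub>R (ta (norm x) *\<^sub>R dS ps i (r, x)))"
   by (simp add: scaleR_sum_right mult.commute)
  then show ?thesis using that by (simp only: D_def scaled[OF that] if_False)
 qed
 have "(LINT x|lborel. D x (axis j 1)) = 0"
 proof (rule integral_partial_derivative_0)
  fix x
  show "(u has_derivative D x) (at x)"
  proof (cases "x = 0")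
   case True
   have "((%x. 0) has_derivative (%v. 0)) (at x)" by simp
   then have "(u has_derivative (%v. 0)) (at x)"
    by (rule has_derivative_transform_within_open[of _ _ _ _ "ball 0 a"]) (use True h in \<open>auto simp: u_def\<close>)
   then show ?thesis using True by (simp add: D_def[abs_def])
  next
   case False
   have "(ta has_derivative (%t. deriv ta (norm x) * t)) (at (norm x))"
    using smooth1_has_deriv[OF ctest_smooth1[OF ta]] by (simp add: has_field_derivative_def)
   then have "((%x. ta (norm x)) has_derivative (%v. deriv ta (norm x) * (v \<bullet> sgn x))) (at x)"
    by (rule has_derivative_compose[OF has_derivative_norm[OF False]])
   from has_derivative_scaleR[OF this sphere_derivative_sum[OF ps r False]]
   show ?thesis using False by (simp add: u_def[abs_def] D_def[abs_def])
  qed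
  fix v :: "real^'d"
  show "norm (D x v) <= (B1 * (SUM i:UNIV. C2 i) + B2 * C1) * norm v"
  proof (cases "x = 0")
   case True
   then show ?thesis using B1 B2 C1 C2 by (auto simp: D_def intro!: mult_nonneg_nonneg add_nonneg_nonneg sum_nonneg)
  next
   case False
   have "norm (SUM i:UNIV. (v $ i) *\<^sub>R (rh (norm x) *\<^sub>R dSt r0 ps i (r, x /\<^sub>R norm x))) <= (SUM i:UNIV. norm v * (B1 * C2 i))"
   proof (rule sum_norm_le)
    fix i
    have "norm (rh (norm x) *\<^sub>R dSt r0 ps i (r, x /\<^sub>R norm x)) <= B1 * C2 i"
     using B1 C2 by (auto intro!: mult_mono)
    then show "norm ((v $ i) *\<^sub>R (rh (norm x) *\<^sub>R dSt r0 ps i (r, x /\<^sub>R norm x))) <= norm v * (B1 * C2 i)"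
     unfolding norm_scaleR[of "v $ i"] using component_le_norm_cart[of v i] by (intro mult_mono) auto
   qed
   also have "... = B1 * (SUM i:UNIV. C2 i) * norm v" by (simp add: sum_distrib_left sum_distrib_right mult_ac)
   finally have 1: "norm (SUM i:UNIV. (v $ i) *\<^sub>R (rh (norm x) *\<^sub>R dSt r0 ps i (r, x /\<^sub>R norm x))) <= B1 * (SUM i:UNIV. C2 i) * norm v" .
   have "\<bar>v \<bullet> sgn x\<bar> <= norm v" using Cauchy_Schwarz_ineq2[of v "sgn x"] False by (simp add: norm_sgn)
   then have "\<bar>deriv ta (norm x) * (v \<bullet> sgn x)\<bar> <= B2 * norm v" using B2 by (auto simp: abs_mult intro!: mult_mono)
   then have "norm ((deriv ta (norm x) * (v \<bullet> sgn x)) *\<^sub>R ps (r, x /\<^sub>R norm x)) <= (B2 * norm v) * C1"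
    using C1 B2 by (auto simp: norm_scaleR simp del: abs_mult intro!: mult_mono)
   with 1 show ?thesis unfolding Dsum[OF False]
    by (intro order_trans[OF norm_triangle_ineq]) (simp add: algebra_simps)
  qed
 next
  fix x :: "real^'d" assume "b < norm x"
  then show "u x = 0" using h(3) by (simp add: u_def)
 next
  show "norm (axis j 1 :: real^'d) = 1" by simp
  have [measurable]: "(%x. dSt r0 ps j (r, x)) : borel_measurable borel" "(%x. ps (r, x)) : borel_measurable borel"
   "rh : borel_measurable borel" "deriv ta : borel_measurable borel"
   using test_fun_slice_borel[OF ps] test_fun_slice_borel[OF test_fun_dSt[OF ps]] borel_ctest[OF rh] borel_ctest[OF ta'] by auto
  have "(%x. D x (axis j 1)) = (%x::real^'d. rh (norm x) *\<^sub>R dSt r0 ps j (r, x /\<^sub>R norm x) +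
   (deriv ta (norm x) * (x /\<^sub>R norm x) $ j) *\<^sub>R ps (r, x /\<^sub>R norm x))"
  proof
   fix x :: "real^'d"
   have e: "deriv ta 0 = 0" "rh 0 = 0"
   using ctest_left[OF ta'] ctest_left[OF rh] by auto
   show "D x (axis j 1) = rh (norm x) *\<^sub>R dSt r0 ps j (r, x /\<^sub>R norm x) + (deriv ta (norm x) * (x /\<^sub>R norm x) $ j) *\<^sub>R ps (r, x /\<^sub>R norm x)"
   proof (cases "x = 0")
    case True then show ?thesis by (simp add: D_def e)
   next
    case False
    have "(SUM i:UNIV. (axis j 1 $ i) *\<^sub>R (rh (norm x) *\<^sub>R dSt r0 ps i (r, x /\<^sub>R norm x))) = rh (norm x) *\<^sub>R dSt r0 ps j (r, x /\<^sub>R norm x)"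
     by (rule sum_axis_scaleR)
    moreover have "axis j 1 \<bullet> sgn x = (x /\<^sub>R norm x) $ j" by (simp add: inner_axis' sgn_div_norm)
    ultimately show ?thesis unfolding Dsum[OF False] by simp
   qed
  qed
  note Dj = this
  have [measurable]: "(%x. ps (r, x /\<^sub>R norm x)) : borel_measurable borel" "(%x. dSt r0 ps j (r, x /\<^sub>R norm x)) : borel_measurable borel"
   "(%x::real^'d. (x /\<^sub>R norm x) $ j) : borel_measurable borel"
   using measurable_compose[OF measurable_normalize test_fun_slice_borel[OF ps]]
    measurable_compose[OF measurable_normalize test_fun_slice_borel[OF test_fun_dSt[OF ps]]]
    borel_measurable_continuous_on[of "%x. x $ j", OF _ measurable_normalize] by (auto intro!: continuous_intros)
  show "(%x. D x (axis j 1)) : borel_measurable borel" unfolding Dj by measurable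
 qed
 moreover have "D x (axis j 1) = rh (norm x) *\<^sub>R dSt r0 ps j (r, x /\<^sub>R norm x) + deriv ta (norm x) *\<^sub>R (of_real ((x /\<^sub>R norm x) $ j) * ps (r, x /\<^sub>R norm x))" for x
 proof (cases "x = 0")
  case True
  have e: "deriv ta 0 = 0" "rh 0 = 0"
   using ctest_left[OF ta'] ctest_left[OF rh] by auto
  then show ?thesis using True by (simp add: D_def)
 next
  case False
  have "(SUM i:UNIV. (axis j 1 $ i) *\<^sub>R (rh (norm x) *\<^sub>R dSt r0 ps i (r, x /\<^sub>R norm x))) = rh (norm x) *\<^sub>R dSt r0 ps j (r, x /\<^sub>R norm x)"
   by (rule sum_axis_scaleR)
  moreover have "axis j 1 \<bullet> sgn x = (x /\<^sub>R norm x) $ j" by (simp add: inner_axis' sgn_div_norm)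
  ultimately show ?thesis unfolding Dsum[OF False] by (simp add: scaleR_conv_of_real)
 qed
 ultimately have int0: "(LINT x|lborel. rh (norm x) *\<^sub>R dSt r0 ps j (r, x /\<^sub>R norm x) + deriv ta (norm x) *\<^sub>R (of_real ((x /\<^sub>R norm x) $ j) * ps (r, x /\<^sub>R norm x))) = 0"
  by simp
 have m1: "(%x. dSt r0 ps j (r, x)) : borel_measurable borel" by (rule test_fun_slice_borel[OF test_fun_dSt[OF ps]])
 have m2: "(%x. complex_of_real (x $ j) * ps (r, x)) : borel_measurable borel"
  using test_fun_slice_borel[OF ps, of r] by (intro borel_measurable_times) (auto intro!: borel_measurable_continuous_onI continuous_intros)
 have b2: "norm (complex_of_real (x $ j) * ps (r, x)) <= C1" for x
 proof (cases "norm x = 1")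
  case True
  have "\<bar>x $ j\<bar> * norm (ps (r, x)) <= 1 * C1"
   using component_le_norm_cart[of x j] True C1 by (intro mult_mono) auto
  then show ?thesis by (simp add: norm_mult)
 next
  case False
  then show ?thesis using test_fun_outside[OF ps, of r x] C1(1) by simp
 qed
 note P1 = polar_factorization[OF m1 C2(2) rh] polar_integrable[OF m1 C2(2) rh]
 note P2 = polar_factorization[OF m2 b2 ta'] polar_integrable[OF m2 b2 ta']
 have d2: "d = Suc (Suc (d - 2))" "d - 1 = Suc (d - 2)" using dim by (auto simp: d_def)
 have k1: "(LINT t|lborel. deriv rh t * t ^ d) = - real d * (LINT t|lborel. rh t * t ^ (d - 1))"
  using ctest_deriv_power[OF rh, of "d - 1"] d2 by simp
 have k2: "(LINT t|lborel. deriv (deriv ta) t * t ^ d) = real d * (real d - 1) * (LINT t|lborel. rh t * t ^ (d - 1))"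
 proof -
  have "(LINT t|lborel. deriv (deriv ta) t * t ^ d) = - real d * (LINT t|lborel. deriv ta t * t ^ (d - 1))"
   using ctest_deriv_power[OF ta', of "d - 1"] d2 by simp
  also have "(LINT t|lborel. deriv ta t * t ^ (d - 1)) = - real (d - 1) * (LINT t|lborel. ta t * t ^ (d - 2))"
   using ctest_deriv_power[OF ta, of "d - 2"] d2(2) by simp
  also have "(%t. ta t * t ^ (d - 2)) = (%t. rh t * t ^ (d - 1))" unfolding d2(2) by (simp add: ta_def fun_eq_iff)
  finally have "(LINT t|lborel. deriv (deriv ta) t * t ^ d) = - real d * (- real (d - 1) * (LINT t|lborel. rh t * t ^ (d - 1)))" .
  moreover have "real (d - 1) = real d - 1" using dim by (simp add: d_def of_nat_diff)
  ultimately have "(LINT t|lborel. deriv (deriv ta) t * t ^ d) = - real d * (- (real d - 1) * (LINT t|lborel. rh t * t ^ (d - 1)))"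
   by (simp only:)
  also have "... = real d * (real d - 1) * (LINT t|lborel. rh t * t ^ (d - 1))" by (simp add: algebra_simps)
  finally show ?thesis .
 qed
 \<comment> \<open>After integrating by parts once and twice, both radial factors are multiples of
   this moment, with ratio \<open>- (d - 1)\<close>; cancelling it leaves the identity on the
   sphere.\<close>
 define m where "m = (LINT t|lborel. rh t * t ^ (d - 1))"
 have c: "- (- real d * m) / real d = m" "- (real d * (real d - 1) * m) / real d = - (real d - 1) * m"
  using d2(1) by (simp_all add: field_simps)
 have "0 = (LINT x|lborel. rh (norm x) *\<^sub>R dSt r0 ps j (r, x /\<^sub>R norm x)) +
   (LINT x|lborel. deriv ta (norm x) *\<^sub>R (of_real ((x /\<^sub>R norm x) $ j) * ps (r, x /\<^sub>R norm x)))"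
  unfolding int0[symmetric] by (rule Bochner_Integration.integral_add[OF P1(2) P2(2)])
 also have "... = m *\<^sub>R (LINT x|sphere_measure. dSt r0 ps j (r, x)) + (- (real d - 1) * m) *\<^sub>R (LINT x|sphere_measure. of_real (x $ j) * ps (r, x))"
  unfolding P1(1) P2(1) d_def[symmetric] k1 k2 m_def[symmetric] c ..
 finally have "0 = m *\<^sub>R (LINT x|sphere_measure. dSt r0 ps j (r, x)) + (- (real d - 1) * m) *\<^sub>R (LINT x|sphere_measure. of_real (x $ j) * ps (r, x))" .
 then have "m *\<^sub>R ((LINT x|sphere_measure. dSt r0 ps j (r, x)) - of_real (real d - 1) * (LINT x|sphere_measure. of_real (x $ j) * ps (r, x))) = 0"
  by (simp add: scaleR_conv_of_real algebra_simps)
 then show ?thesis using m0 by (simp add: m_def d_def)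
qed

section \<open>Completeness of the monomials on the sphere\<close>

lemma word_fun_continuous: "continuous_on A (word_fun w)"
 unfolding word_fun_def[abs_def] by (induction w) (auto intro!: continuous_intros)

lemma word_fun_borel [measurable]: "word_fun w : borel_measurable borel"
 by (rule borel_measurable_continuous_onI[OF word_fun_continuous])

lemma sphere_cont_mult_integrable:
 fixes z :: "real^'d => complex"
 assumes z: "integrable sphere_measure z" and p: "continuous_on UNIV p"
 shows "integrable sphere_measure (%x. p x *\<^sub>R z x)"
proof -
 have "compact (p ` sphere 0 1)" by (intro compact_continuous_image continuous_on_subset[OF p]) auto
 then obtain C where C: "ALL y:p ` sphere 0 1. norm y <= C" using compact_imp_bounded bounded_iff by metis
 have [measurable]: "p : borel_measurable borel" by (rule borel_measurable_continuous_onI[OF p])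
 show ?thesis
 proof (rule bochner_bound[where f="%x. C *\<^sub>R z x"])
  show "integrable sphere_measure (%x. C *\<^sub>R z x)" using z by simp
  show "(%x. p x *\<^sub>R z x) : borel_measurable sphere_measure" using z by measurable
  show "AE x in sphere_measure. norm (p x *\<^sub>R z x) <= norm (C *\<^sub>R z x)"
   using AE_sphere_norm
  proof eventually_elim
   case (elim x)
   then have "\<bar>p x\<bar> <= C" using C by auto
   then show ?case by (auto intro!: mult_right_mono)
  qed
 qed
qed

text \<open>Vanishing moments pass from monomials to polynomials, by Stone-Weierstrass to continuous
  functions, and by dominated convergence to indicators of closed sets, which generate the Borel
  sets.\<close>

lemma sphere_moments_zero:
 fixes z :: "real^'d => complex"
 assumes z: "integrable sphere_measure z" and m: "!!w. (LINT x|sphere_measure. word_fun w x *\<^sub>R z x) = 0"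
 shows "AE x in sphere_measure. z x = 0"
proof -
 \<comment> \<open>\<open>N\<close> is stable under multiplication by coordinates, as this only
   lengthens the word. Hence it is stable under multiplication by polynomials, proved along their
   inductive definition without ever expanding one into monomials.\<close>
 define N where "N = {y::real^'d => complex. integrable sphere_measure y & (ALL w. (LINT x|sphere_measure. word_fun w x *\<^sub>R y x) = 0)}"
 have cp: "continuous_on UNIV p" if "real_polynomial_function p" for p :: "real^'d => real"
  using continuous_real_polymonial_function[OF that] by (simp add: continuous_at_imp_continuous_on)
 have wint: "integrable sphere_measure (%x. word_fun w x *\<^sub>R y x)" if "integrable sphere_measure y" for w and y :: "real^'d => complex"
  by (rule sphere_cont_mult_integrable[OF that word_fun_continuous])
 have addN: "(%x. f x + g x) : N" if "f : N" "g : N" for f g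
  using that wint by (simp add: N_def scaleR_add_right)
 have scale: "(%x. (c::real) *\<^sub>R f x) : N" if "f : N" for f c
 proof -
  have "(LINT x|sphere_measure. word_fun w x *\<^sub>R (c *\<^sub>R f x)) = c *\<^sub>R (LINT x|sphere_measure. word_fun w x *\<^sub>R f x)" for w
   by (subst Bochner_Integration.integral_scaleR_right[symmetric]) (simp add: mult.commute)
  then show ?thesis using that by (simp add: N_def)
 qed
 have coord: "(%x. x $ j *\<^sub>R f x) : N" if "f : N" for f j
 proof -
  have "(LINT x|sphere_measure. word_fun w x *\<^sub>R (x $ j *\<^sub>R f x)) = (LINT x|sphere_measure. word_fun (j # w) x *\<^sub>R f x)" for w
   by (simp add: word_fun_Cons mult.commute)
  then show ?thesis using that sphere_cont_mult_integrable[of f "%x. x $ j"] by (simp add: N_def continuous_intros)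
 qed
 have sumN: "(%x. SUM j:A. f j x) : N" if "finite A" "!!j. j : A ==> f j : N" for A and f :: "'d => _"
  using that
 proof (induction rule: finite_induct)
  case empty show ?case by (simp add: N_def)
 next
  case (insert a A) then show ?case using addN[of "f a" "%x. SUM j:A. f j x"] by simp
 qed
 have poly: "ALL f:N. (%x. p x *\<^sub>R f x) : N" if "real_polynomial_function p" for p
  using that
 proof induction
  case (linear p)
  show ?case
  proof
   fix f assume f: "f : N"
   define c where "c j = p (axis j 1)" for j
   have "p x = (SUM j:UNIV. c j * x $ j)" for x
   proof -
    interpret bounded_linear p by fact
    have "x = (SUM j:UNIV. (x $ j) *\<^sub>R axis j 1)" by (simp add: vec_eq_iff axis_def if_distrib cong: if_cong)
    then have "p x = p (SUM j:UNIV. (x $ j) *\<^sub>R axis j 1)" by (rule arg_cong)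
    also have "... = (SUM j:UNIV. c j * x $ j)" by (simp add: sum scaleR c_def mult.commute)
    finally show ?thesis .
   qed
   then have "(%x. p x *\<^sub>R f x) = (%x. SUM j:UNIV. c j *\<^sub>R (x $ j *\<^sub>R f x))"
    by (simp add: scaleR_sum_left fun_eq_iff)
   moreover have "(%x. SUM j:UNIV. c j *\<^sub>R (x $ j *\<^sub>R f x)) : N"
    by (intro sumN scale coord f) auto
   ultimately show "(%x. p x *\<^sub>R f x) : N" by (simp only:)
  qed
 next
  case (const c) show ?case by (intro ballI scale)
 next
  case (add p q)
  show ?case
  proof
   fix f assume f: "f : N"
   have "(%x. p x *\<^sub>R f x + q x *\<^sub>R f x) : N"
    by (rule addN[OF bspec[OF add(3) f] bspec[OF add(4) f]])
   then show "(%x. (p x + q x) *\<^sub>R f x) : N" by (simp only: scaleR_add_left)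
  qed
 next
  case (mult p q)
  show ?case
  proof
   fix f assume "f : N"
   then have "(%x. q x *\<^sub>R f x) : N" using mult(4) by (rule bspec[rotated])
   from bspec[OF mult(3) this] have "(%x. p x *\<^sub>R (q x *\<^sub>R f x)) : N" .
   then show "(%x. (p x * q x) *\<^sub>R f x) : N" by simp
  qed
 qed
 have zN: "z : N" using z m by (simp add: N_def)
 have poly0: "(LINT x|sphere_measure. p x *\<^sub>R z x) = 0" if "real_polynomial_function p" for p
 proof -
  have "(%x. p x *\<^sub>R z x) : N" using poly[OF that] zN by (rule bspec)
  then have "(LINT x|sphere_measure. word_fun [] x *\<^sub>R (p x *\<^sub>R z x)) = 0" unfolding N_def by simp
  then show ?thesis by (simp add: word_fun_def)
 qed
 have cont0: "(LINT x|sphere_measure. g x *\<^sub>R z x) = 0" if g: "continuous_on UNIV g" for g :: "real^'d => real"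
 proof -
  define I where "I = (LINT x|sphere_measure. norm (z x))"
  have I0: "I >= 0" by (simp add: I_def)
  have "norm (LINT x|sphere_measure. g x *\<^sub>R z x) <= e * I" if e: "e > 0" for e
  proof -
   have "EX p. real_polynomial_function p & (ALL x:sphere (0::real^'d) 1. \<bar>g x - p x\<bar> < e)"
    by (rule Stone_Weierstrass_real_polynomial_function[OF compact_sphere[of "0::real^'d" 1] continuous_on_subset[OF g subset_UNIV] e]) blast
   then obtain p where p: "real_polynomial_function p" "ALL x:sphere (0::real^'d) 1. \<bar>g x - p x\<bar> < e" by (elim exE conjE)
   have "(LINT x|sphere_measure. g x *\<^sub>R z x) = (LINT x|sphere_measure. g x *\<^sub>R z x - p x *\<^sub>R z x)"
    using sphere_cont_mult_integrable[OF z g] sphere_cont_mult_integrable[OF z cp[OF p(1)]] poly0[OF p(1)] by simp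
   also have "norm ... <= (LINT x|sphere_measure. e * norm (z x))"
   proof (rule order_trans[OF integral_norm_bound], rule integral_mono_AE)
    show "AE x in sphere_measure. norm (g x *\<^sub>R z x - p x *\<^sub>R z x) <= e * norm (z x)"
     using AE_sphere_norm
    proof eventually_elim
     case (elim x)
     then have "\<bar>g x - p x\<bar> <= e" using p(2)[rule_format, of x] by simp
     then show ?case by (simp add: scaleR_diff_left[symmetric] mult_right_mono)
    qed
   qed (use z sphere_cont_mult_integrable[OF z g] sphere_cont_mult_integrable[OF z cp[OF p(1)]] in auto)
   finally show ?thesis by (simp add: I_def)
  qed
  then have *: "norm (LINT x|sphere_measure. g x *\<^sub>R z x) <= e * I" if "e > 0" for e using that by blast
  show ?thesis
  proof (rule ccontr)
   assume "~ ?thesis"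
   then have pos: "norm (LINT x|sphere_measure. g x *\<^sub>R z x) > 0" (is "?n > 0") by simp
   \<comment> \<open>Chosen so that the integral has norm \<open>e * I + e\<close>, exceeding the
     bound \<open>e * I\<close>; the added 1 covers \<open>I = 0\<close>.\<close>
   define e where "e = ?n / (I + 1)"
   have "e > 0" using pos I0 by (simp add: e_def)
   moreover have "?n = e * I + e" using I0 
   proof -
    have "e * (I + 1) = ?n" using I0 by (simp add: e_def)
    then show ?thesis by (simp add: distrib_left)
   qed
   ultimately show False using *[of e] by linarith
  qed
 qed
 show ?thesis
 proof (rule AE_zero_generator[where E="Collect closed"])
  show "sigma_finite_measure (sphere_measure :: (real^'d) measure)" by (rule sphere.sigma_finite_measure_axioms)
  show "sets (sphere_measure :: (real^'d) measure) = sigma_sets (space sphere_measure) (Collect closed)"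
   using arg_cong[OF borel_eq_closed[where 'a="real^'d"], of sets] by (simp add: sets_measure_of)
  show "Int_stable (Collect closed :: (real^'d) set set)" by (auto simp: Int_stable_def)
  fix A :: "(real^'d) set" assume "A : Collect closed"
  then have A: "closed A" by simp
  show "set_lebesgue_integral sphere_measure A z = 0"
  proof (cases "A = {}")
   case True then show ?thesis by (simp add: set_lebesgue_integral_def)
  next
   case False
   \<comment> \<open>Continuous functions with limit the indicator of the closed set
     \<open>A\<close>.\<close>
   define g where "g k x = max 0 (1 - real k * setdist {x} A)" for k :: nat and x
   have gc: "continuous_on UNIV (g k)" for k unfolding g_def by (intro continuous_intros continuous_on_setdist)
   have [measurable]: "g k : borel_measurable borel" for k by (rule borel_measurable_continuous_onI[OF gc])
   have "(%k. LINT x|sphere_measure. g k x *\<^sub>R z x) \<longlonglongrightarrow> (LINT x|sphere_measure. indicator A x *\<^sub>R z x)"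
   proof (rule integral_dominated_convergence[where w="%x. norm (z x)"])
    show "(%x. indicator A x *\<^sub>R z x) : borel_measurable sphere_measure"
     using z A by (intro borel_measurable_scaleR borel_measurable_indicator) auto
    show "(%x. g k x *\<^sub>R z x) : borel_measurable sphere_measure" for k
     using sphere_cont_mult_integrable[OF z gc] by (rule borel_measurable_integrable)
    show "AE x in sphere_measure. (%k. g k x *\<^sub>R z x) \<longlonglongrightarrow> indicator A x *\<^sub>R z x"
    proof (intro AE_I2 tendsto_scaleR tendsto_const)
     fix x
     show "(%k. g k x) \<longlonglongrightarrow> indicator A x"
     proof (cases "x : A")
      case True then show ?thesis by (simp add: g_def setdist_sing_in_set)
     next
      case x: False
      then have s: "setdist {x} A > 0"
       using setdist_eq_0_closed[OF A, of x] False setdist_pos_le[of "{x}" A] by (simp add: less_le)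
      obtain K where K: "1 / setdist {x} A < real K" using reals_Archimedean2 by blast
      have "\<forall>\<^sub>F k in sequentially. 0 = g k x"
      proof (rule eventually_sequentiallyI[of K])
       fix k assume "K <= k"
       then have "1 / setdist {x} A <= real k" using K by simp
       then show "0 = g k x" using s by (simp add: g_def field_simps)
      qed
      from Lim_transform_eventually[OF tendsto_const this] show ?thesis using x by simp
     qed
    qed
    show "AE x in sphere_measure. norm (g k x *\<^sub>R z x) <= norm (z x)" for k
    proof (rule AE_I2)
     fix x
     have "0 <= real k * setdist {x} A" by (simp add: setdist_pos_le)
     then have "\<bar>g k x\<bar> <= 1" by (simp add: g_def)
     then show "norm (g k x *\<^sub>R z x) <= norm (z x)" using mult_right_mono[of "\<bar>g k x\<bar>" 1 "norm (z x)"] by simp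
    qed
   qed (use z in auto)
   then show ?thesis by (simp add: cont0[OF gc] LIMSEQ_const_iff set_lebesgue_integral_def)
  qed
 qed (use z in auto)
qed

section \<open>The weighted spaces over the exterior region\<close>

text \<open>Stated without measurability, because \<open>density\<close> depends only on the
  integrals over sets; the original weight may fail to be measurable off the exterior
  region.\<close>

lemma density_cong_AE:
 assumes "AE x in M. f x = g x" shows "density M f = density M g"
proof -
 have "(\<integral>\<^sup>+x. f x * indicator A x \<partial>M) = (\<integral>\<^sup>+x. g x * indicator A x \<partial>M)" for A
  by (rule nn_integral_cong_AE) (use assms in eventually_elim, simp)
 then show ?thesis unfolding density_def by simp
qed

locale exterior =
 fixes r0 m :: real and F F1 G G1 :: "real => real" and n :: nat and ty :: "'d::finite itself"
 assumes dim: "CARD('d) >= 2" and n: "n = CARD('d) - 1" and r0: "0 < r0"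
  and Fpos: "!!r. r0 < r ==> 0 < F r" and Gpos: "!!r. r0 < r ==> 0 < G r"
  and dF: "!!r. r0 < r ==> (F has_real_derivative F1 r) (at r)" and cF1: "continuous_on {r0<..} F1"
  and dG: "!!r. r0 < r ==> (G has_real_derivative G1 r) (at r)" and cG1: "continuous_on {r0<..} G1"
  and m: "0 <= m"
begin

abbreviation "ca == coef_a n F G"
abbreviation "cb == coef_b n F G"
abbreviation "cc == coef_c n F G"
abbreviation "cd == coef_d n m F G"
abbreviation N :: "(real * (real^'d)) measure" where "N == lborel \<Otimes>\<^sub>M sphere_measure"
abbreviation B :: "(real * (real^'d)) measure" where "B == base_measure r0"
abbreviation H :: "(real * (real^'d)) measure" where "H == H_measure r0 F G"

text \<open>Nothing is assumed about \<open>F\<close> and \<open>G\<close> to the left of \<open>r0\<close>, not even measurability.\<close>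
definition ext :: "(real => real) => real => real" where
 "ext g r = (if r0 < r then g r else 1)"

lemma ext_eq [simp]: "r0 < r ==> ext g r = g r"
 by (simp add: ext_def)

lemma ext_borel: assumes "continuous_on {r0<..} g" shows "ext g : borel_measurable borel"
proof -
 have "(%r. indicator {r0<..} r *\<^sub>R g r) : borel_measurable borel"
  by (rule borel_measurable_continuous_on_indicator[OF _ assms]) simp
 then have "(%r. indicator {r0<..} r *\<^sub>R g r + indicator {..r0} r) : borel_measurable borel" by measurable
 also have "(%r. indicator {r0<..} r *\<^sub>R g r + indicator {..r0} r) = ext g"
  by (auto simp: ext_def fun_eq_iff indicator_def)
 finally show ?thesis .
qed

lemma cF: "continuous_on {r0<..} F" and cG: "continuous_on {r0<..} G"
 by (intro continuous_at_imp_continuous_on ballI DERIV_isCont[OF dF] DERIV_isCont[OF dG]; simp)+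

lemma Gne: "r0 < r ==> G r ~= 0" and Fne: "r0 < r ==> F r ~= 0"
 using Gpos[of r] Fpos[of r] by auto

lemma cpow: "continuous_on {r0<..} (%r. r powr k)"
 using r0 by (intro continuous_intros) auto

lemma cca: "continuous_on {r0<..} ca" and ccb: "continuous_on {r0<..} cb"
 and ccc: "continuous_on {r0<..} cc" and ccd: "continuous_on {r0<..} cd"
 unfolding coef_a_def[abs_def] coef_b_def[abs_def] coef_c_def[abs_def] coef_d_def[abs_def]
 by (intro continuous_on_mult continuous_on_const continuous_on_real_sqrt continuous_on_divide cpow cF cG ballI; use Fne Gne in simp)+

lemma ca_pos: "r0 < r ==> 0 < ca r" and cb_pos: "r0 < r ==> 0 < cb r"
 and cc_pos: "r0 < r ==> 0 < cc r" and cd_nonneg: "r0 < r ==> 0 <= cd r"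
 using Fpos[of r] Gpos[of r] r0 by (auto simp: coef_a_def coef_b_def coef_c_def coef_d_def intro!: mult_nonneg_nonneg)

text \<open>The density of \<open>H\<close> with respect to the product measure \<open>N\<close>:
  both the restriction to \<open>Omega r0\<close> and the weight in one Borel function.\<close>

definition wt :: "real * (real^'d) => real" where
 "wt p = indicator (Omega r0) p * ext ca (fst p)"

lemma wt_borel [measurable]: "wt : borel_measurable borel"
proof -
 have "(%p::real * (real^'d). ext ca (fst p)) : borel_measurable borel"
  by (rule measurable_compose[OF _ ext_borel[OF cca]]) (auto intro!: borel_measurable_continuous_onI continuous_intros)
 then show ?thesis unfolding wt_def[abs_def] by measurable
qed

lemma wt_nonneg: "0 <= wt p"
 using ca_pos by (cases p) (auto simp: wt_def Omega_mem indicator_def less_imp_le)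

lemma wt_eq: "r0 < r ==> norm x = 1 ==> wt (r, x) = ca r"
 by (simp add: wt_def Omega_mem)

lemma wt_zero: "p ~: Omega r0 ==> wt p = 0"
 by (simp add: wt_def)

lemma sets_N [simp, measurable_cong]: "sets N = sets borel"
proof -
 have "sets N = sets (borel \<Otimes>\<^sub>M borel)" by (intro sets_pair_measure_cong) simp_all
 then show ?thesis by (simp only: borel_prod)
qed

lemma space_N [simp]: "space N = UNIV" by (simp add: space_pair_measure)

sublocale P: pair_sigma_finite lborel "sphere_measure :: (real^'d) measure"
 by (intro pair_sigma_finite.intro sigma_finite_lborel sphere.sigma_finite_measure_axioms)

lemma AE_N_unit: "AE p in N. norm (snd p) = 1"
proof (rule P.AE_pair_measure)
 show "{x : space N. norm (snd x) = 1} : sets N"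
 proof -
  have "closed {x::real * (real^'d). norm (snd x) = 1}" by (intro closed_Collect_eq continuous_intros)
  then have "{x::real * (real^'d). norm (snd x) = 1} : sets borel" by (rule borel_closed)
  then show ?thesis unfolding sets_N space_N by simp
 qed
 show "AE x in lborel. AE y in (sphere_measure :: (real^'d) measure). norm (snd (x, y)) = 1"
  by (rule AE_I2) (simp add: AE_sphere_norm)
qed

lemma B_eq: "B = density N (%p. ennreal (indicator (Omega r0) p))"
 by (simp add: base_measure_def ennreal_indicator)

lemma sets_B [simp, measurable_cong]: "sets B = sets borel"
 unfolding B_eq sets_density sets_N ..

lemma space_B [simp]: "space B = UNIV"
 unfolding B_eq space_density space_N ..

lemma AE_B_Omega: "AE p in B. p : Omega r0"
 unfolding B_eq by (subst AE_density) (auto simp: indicator_def intro!: AE_I2 split: if_splits)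

lemma H_eq: "H = density N (%p. ennreal (wt p))"
proof -
 have "H = density B (%p. ennreal (wt p))"
  unfolding H_measure_def n[symmetric]
  by (rule density_cong_AE) (use AE_B_Omega in eventually_elim, auto simp: wt_def Omega_def)
 also have "... = density N (%p. ennreal (indicator (Omega r0) p) * ennreal (wt p))"
  unfolding B_eq by (rule density_density_eq) measurable
 also have "(%p. ennreal (indicator (Omega r0) p) * ennreal (wt p)) = (%p. ennreal (wt p))"
  by (auto simp: fun_eq_iff indicator_def wt_zero)
 finally show ?thesis .
qed

lemma sets_H [simp, measurable_cong]: "sets H = sets borel"
 unfolding H_eq sets_density sets_N ..

lemma space_H [simp]: "space H = UNIV"
 unfolding H_eq space_density space_N ..

lemma measurable_B_iff: "f : borel_measurable B \<longleftrightarrow> f : borel_measurable borel"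
 and measurable_H_iff: "f : borel_measurable H \<longleftrightarrow> f : borel_measurable borel"
 and measurable_N_iff: "f : borel_measurable N \<longleftrightarrow> f : borel_measurable borel"
 by (rule arg_cong[of _ _ "%A. f : A"], rule measurable_cong_sets, rule sets_B sets_H sets_N, rule refl)+

lemma AE_B_iff: "(AE p in B. P p) \<longleftrightarrow> (AE p in N. p : Omega r0 --> P p)"
proof -
 have "(AE p in B. P p) \<longleftrightarrow> (AE p in N. 0 < ennreal (indicator (Omega r0) p) --> P p)"
  unfolding B_eq by (rule AE_density) measurable
 also have "... \<longleftrightarrow> (AE p in N. p : Omega r0 --> P p)" by (intro AE_cong) (auto simp: indicator_def)
 finally show ?thesis .
qed

lemma AE_H_iff: "(AE p in H. P p) \<longleftrightarrow> (AE p in N. p : Omega r0 --> P p)"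
proof -
 have "(AE p in H. P p) \<longleftrightarrow> (AE p in N. 0 < ennreal (wt p) --> P p)"
  unfolding H_eq by (rule AE_density) measurable
 also have "... \<longleftrightarrow> (AE p in N. p : Omega r0 --> P p)"
  using ca_pos by (intro AE_cong) (auto simp: wt_def indicator_def Omega_def)
 finally show ?thesis .
qed

lemma integral_B:
 fixes f :: "real * (real^'d) => 'b::{second_countable_topology, banach}"
 assumes "f : borel_measurable borel"
 shows "(LINT p|B. f p) = (LINT p|N. indicator (Omega r0) p *\<^sub>R f p)"
 unfolding B_eq using assms by (intro integral_density) auto

lemma integral_B_Omega:
 fixes f :: "real * (real^'d) => 'b::{second_countable_topology, banach}"
 assumes "f : borel_measurable borel" "!!p. p ~: Omega r0 ==> f p = 0"
 shows "(LINT p|B. f p) = (LINT p|N. f p)"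
proof -
 have "(%p. indicator (Omega r0) p *\<^sub>R f p) = f" using assms(2) by (auto simp: fun_eq_iff indicator_def)
 then show ?thesis using integral_B[OF assms(1)] by simp
qed

lemma integral_H:
 fixes f :: "real * (real^'d) => 'b::{second_countable_topology, banach}"
 assumes "f : borel_measurable borel"
 shows "(LINT p|H. f p) = (LINT p|N. wt p *\<^sub>R f p)"
 unfolding H_eq using assms wt_nonneg by (intro integral_density) auto

lemma integrable_H_iff:
 fixes f :: "real * (real^'d) => 'b::{second_countable_topology, banach}"
 assumes "f : borel_measurable borel"
 shows "integrable H f \<longleftrightarrow> integrable N (%p. wt p *\<^sub>R f p)"
 unfolding H_eq using assms wt_nonneg by (intro integrable_density) auto

text \<open>Local integrability up to, but excluding, the horizon. Strips in the radius suffice,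
  since \<open>N\<close> is carried by unit vectors and the sphere is compact.\<close>

definition lint :: "(real * (real^'d) => complex) => bool" where
 "lint g \<longleftrightarrow> g : borel_measurable borel & (ALL a b. r0 < a --> integrable N (%p. indicator {a..b} (fst p) *\<^sub>R g p))"

lemma lint_borel: "lint g ==> g : borel_measurable borel" by (simp add: lint_def)

lemma fst_borel [measurable]: "(fst :: real * (real^'d) => real) : borel_measurable borel"
 and snd_borel [measurable]: "(snd :: real * (real^'d) => real^'d) : borel_measurable borel"
 by (auto intro!: borel_measurable_continuous_onI continuous_intros)

lemma fst_compose_borel: "be : borel_measurable borel ==> (%p::real * (real^'d). be (fst p)) : borel_measurable borel"
 by (rule measurable_compose[OF fst_borel])

lemma coord_borel [measurable]: "(%p::real * (real^'d). snd p $ j) : borel_measurable borel"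
 by (auto intro!: borel_measurable_continuous_onI continuous_intros)

lemma strip_integrable: "integrable N (%p. indicator {a..b} (fst p) :: real)"
proof -
 have [measurable]: "{a..b} \<times> (UNIV :: (real^'d) set) : sets borel" by (intro borel_Times) auto
 have "emeasure N ({a..b} \<times> UNIV) = emeasure lborel {a..b} * emeasure (sphere_measure :: (real^'d) measure) UNIV"
  by (rule sphere.emeasure_pair_measure_Times) auto
 also have "... < \<infinity>"
 proof -
  have "emeasure (sphere_measure :: (real^'d) measure) UNIV < \<infinity>"
   using sphere.emeasure_finite[of "UNIV :: (real^'d) set"] unfolding less_top infinity_ennreal_def .
  moreover have "emeasure lborel {a..b} < \<infinity>" by (simp add: emeasure_lborel_Icc_eq)
  ultimately show ?thesis by (simp add: ennreal_mult_less_top)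
 qed
 finally have "integrable N (indicator ({a..b} \<times> UNIV) :: _ => real)" by (simp add: integrable_indicator_iff)
 moreover have "indicator ({a..b} \<times> UNIV) = (%p::real * (real^'d). indicator {a..b} (fst p) :: real)"
  by (auto simp: fun_eq_iff indicator_def)
 ultimately show ?thesis by simp
qed

lemma lint_bound:
 assumes g: "lint g" and h: "h : borel_measurable borel"
  and b: "!!a b. r0 < a ==> EX C. AE p in N. fst p : {a..b} --> norm (h p) <= C * norm (g p)"
 shows "lint h"
 unfolding lint_def
proof (intro conjI allI impI h)
 fix a b assume a: "r0 < a"
 obtain C where C: "AE p in N. fst p : {a..b} --> norm (h p) <= C * norm (g p)" using b[OF a] by blast
 have [measurable]: "h : borel_measurable borel" by (rule h)
 show "integrable N (%p. indicator {a..b} (fst p) *\<^sub>R h p)"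
 proof (rule bochner_bound)
  show "integrable N (%p. C *\<^sub>R (indicator {a..b} (fst p) *\<^sub>R g p))"
   by (rule integrable_scaleR_right) (use g a in \<open>simp add: lint_def\<close>)
  show "AE p in N. norm (indicator {a..b} (fst p) *\<^sub>R h p) <= norm (C *\<^sub>R (indicator {a..b} (fst p) *\<^sub>R g p))"
   using C
  proof eventually_elim
   case (elim p)
   show ?case
   proof (cases "fst p : {a..b}")
    case True
    then have "norm (h p) <= C * norm (g p)" using elim by blast
    also have "... <= \<bar>C\<bar> * norm (g p)" by (intro mult_right_mono) auto
    finally show ?thesis using True by simp
   qed simp
  qed
 qed measurable
qed

lemma cont_bounded: "continuous_on {r0<..} be ==> r0 < a ==> EX C>=0. ALL r:{a..b}. \<bar>be r\<bar> <= (C::real)"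
proof -
 assume "continuous_on {r0<..} be" "r0 < a"
 then have "continuous_on {a..b} be" by (auto intro: continuous_on_subset)
 then obtain C where C: "ALL r:{a..b}. \<bar>be r\<bar> <= C" using cont_on_compact_bound by blast
 have "\<bar>be r\<bar> <= max C 0" if "r : {a..b}" for r using C that by (simp add: le_max_iff_disj)
 then show ?thesis by (intro exI[of _ "max C 0"]) simp
qed

lemma lint_radial: assumes "lint g" "continuous_on {r0<..} be" shows "lint (%p. of_real (ext be (fst p)) * g p)"
proof (rule lint_bound[OF assms(1)])
 show "(%p. of_real (ext be (fst p)) * g p) : borel_measurable borel"
  using fst_compose_borel[OF ext_borel[OF assms(2)]] lint_borel[OF assms(1)] by measurable
 fix a b assume a: "r0 < a"
 obtain C where C: "ALL r:{a..b}. \<bar>be r\<bar> <= C" using cont_bounded[OF assms(2) a] by blast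
 have "norm (of_real (ext be (fst p)) * g p) <= C * norm (g p)" if "fst p : {a..b}" for p
 proof -
  have "\<bar>ext be (fst p)\<bar> <= C" using C that a by simp
  then show ?thesis by (simp add: norm_mult mult_right_mono)
 qed
 then show "EX C. AE p in N. fst p : {a..b} --> norm (of_real (ext be (fst p)) * g p) <= C * norm (g p)" by blast
qed

lemma lint_scale: assumes "lint g" shows "lint (%p. c * g p)"
 by (rule lint_bound[OF assms]) (use lint_borel[OF assms] in \<open>auto intro!: exI[of _ "norm c"] simp: norm_mult\<close>)

lemma lint_word: assumes "lint g" shows "lint (%p. of_real (word_fun w (snd p)) * g p)"
proof (rule lint_bound[OF assms])
 have "(%p::real * (real^'d). word_fun w (snd p)) : borel_measurable borel" by (rule measurable_compose[OF snd_borel word_fun_borel])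
 then show "(%p. of_real (word_fun w (snd p)) * g p) : borel_measurable borel" using lint_borel[OF assms] by measurable
 fix a b assume "r0 < a"
 have le1: "\<bar>word_fun w x\<bar> <= 1" if "norm x = 1" for x :: "real^'d"
 proof (induction w)
  case Nil show ?case by (simp add: word_fun_def)
 next
  case (Cons j w)
  have "\<bar>x $ j\<bar> * \<bar>word_fun w x\<bar> <= 1 * 1" using component_le_norm_cart[of x j] that Cons by (intro mult_mono) auto
  then show ?case by (simp add: word_fun_Cons abs_mult)
 qed
 have "AE p in N. fst p : {a..b} --> norm (of_real (word_fun w (snd p)) * g p) <= 1 * norm (g p)"
  using AE_N_unit by eventually_elim (auto simp: norm_mult intro!: mult_left_le_one_le le1)
 then show "EX C. AE p in N. fst p : {a..b} --> norm (of_real (word_fun w (snd p)) * g p) <= C * norm (g p)" by blast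
qed

lemma lint_add: assumes "lint f" "lint g" shows "lint (%p. f p + g p)"
 using assms unfolding lint_def by (auto simp: scaleR_add_right)

lemma lint_of_sqint:
 assumes "sqint H u" shows "lint u"
 unfolding lint_def
proof (intro conjI allI impI)
 show um: "u : borel_measurable borel" using sqint_meas[OF assms] measurable_H_iff by blast
 fix a b assume a: "r0 < a"
 have "EX C>=0. ALL r:{a..b}. \<bar>inverse (ca r)\<bar> <= C"
  using ca_pos a by (intro cont_bounded continuous_intros cca) (auto simp: less_le)
 then obtain C where C: "C >= 0" "ALL r:{a..b}. \<bar>inverse (ca r)\<bar> <= C" by blast
 have w2: "integrable N (%p. wt p * (norm (u p))\<^sup>2)"
  using sqint_integrable[OF assms] um by (subst (asm) integrable_H_iff) auto
 show "integrable N (%p. indicator {a..b} (fst p) *\<^sub>R u p)"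
 proof (rule bochner_bound)
  show "integrable N (%p. indicator {a..b} (fst p) + C * (wt p * (norm (u p))\<^sup>2))"
   using w2 strip_integrable by auto
  show "(%p. indicator {a..b} (fst p) *\<^sub>R u p) : borel_measurable N" using um by measurable
  show "AE p in N. norm (indicator {a..b} (fst p) *\<^sub>R u p) <= norm (indicator {a..b} (fst p) + C * (wt p * (norm (u p))\<^sup>2))"
   using AE_N_unit
  proof eventually_elim
   case (elim p)
   show ?case
   proof (cases "fst p : {a..b}")
    case True
    then have r: "r0 < fst p" using a by auto
    then have w: "wt p = ca (fst p)" using elim wt_eq[of "fst p" "snd p"] by simp
    have "norm (u p) <= 1 + (norm (u p))\<^sup>2"
    proof -
     have "0 <= (norm (u p) - 1)\<^sup>2" by simp
     then have "2 * norm (u p) <= 1 + (norm (u p))\<^sup>2" by (simp add: power2_eq_square algebra_simps)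
     then show ?thesis using norm_ge_zero[of "u p"] by linarith
    qed
    also have "(norm (u p))\<^sup>2 = inverse (ca (fst p)) * (wt p * (norm (u p))\<^sup>2)" using ca_pos[OF r] by (simp add: w)
    also have "... <= C * (wt p * (norm (u p))\<^sup>2)"
     using C(2)[rule_format, OF True] wt_nonneg[of p] abs_ge_self[of "inverse (ca (fst p))"] by (intro mult_right_mono mult_nonneg_nonneg) auto
    finally show ?thesis using True C(1) wt_nonneg[of p] by simp
   qed (use C(1) wt_nonneg[of p] in simp)
  qed
 qed
qed

lemma test_fun_supp_N: "test_fun r0 et ==> EX a b. r0 < a & a <= b & (ALL p. fst p ~: {a..b} --> et p = 0)"
proof -
 assume "test_fun r0 et"
 then obtain a b where ab: "r0 < a" "a <= b" and h: "ALL p. p ~: {a..b} \<times> sphere 0 1 --> et p = 0"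
  using test_fun_supp by blast
 have "et p = 0" if "fst p ~: {a..b}" for p using h[rule_format, of p] that by (cases p) auto
 then show ?thesis using ab by blast
qed

lemma lint_test_integrable:
 assumes "lint g" "test_fun r0 et" shows "integrable N (%p. g p * et p)"
proof -
 obtain a b where ab: "r0 < a" "a <= b" and h: "ALL p. fst p ~: {a..b} --> et p = 0" using test_fun_supp_N[OF assms(2)] by blast
 obtain C where C: "C >= 0" "ALL p. norm (et p) <= C" using test_fun_bounded[OF assms(2)] by blast
 show ?thesis
 proof (rule bochner_bound)
  show "integrable N (%p. C *\<^sub>R (indicator {a..b} (fst p) *\<^sub>R g p))"
   by (rule integrable_scaleR_right) (use assms(1) ab in \<open>simp add: lint_def\<close>)
  show "(%p. g p * et p) : borel_measurable N" using lint_borel[OF assms(1)] test_fun_borel[OF assms(2)] by measurable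
  have "norm (g p * et p) <= norm (C *\<^sub>R (indicator {a..b} (fst p) *\<^sub>R g p))" for p
  proof (cases "fst p : {a..b}")
   case True
   have "norm (g p) * norm (et p) <= norm (g p) * C" using C(2)[rule_format, of p] by (intro mult_left_mono) auto
   then show ?thesis using True C(1) by (simp add: norm_mult mult.commute)
  next
   case False
   then show ?thesis using h[rule_format, of p] by simp
  qed
  then show "AE p in N. norm (g p * et p) <= norm (C *\<^sub>R (indicator {a..b} (fst p) *\<^sub>R g p))" by simp
 qed
qed

section \<open>Spherical moments and the fundamental lemma\<close>

lemma countable_words: "countable (UNIV :: 'd list set)"
proof -
 have "countable (lists (UNIV :: 'd set))" by (intro countable_lists countable_finite) simp
 then show ?thesis by simp
qed

definition mom :: "(real * (real^'d) => complex) => 'd list => real => complex" where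
 "mom g w r = (LINT x|sphere_measure. word_fun w x *\<^sub>R g (r, x))"

lemma strip_moments:
 assumes g: "lint g" and a: "r0 < a"
 shows "integrable lborel (%r. indicator {a..b} r *\<^sub>R mom g w r)"
  and "AE r in lborel. r : {a..b} --> integrable sphere_measure (%x. g (r, x))"
proof -
 have i: "integrable N (%(r, x). indicator {a..b} r *\<^sub>R g (r, x))"
  using g a by (simp add: lint_def case_prod_beta')
 from P.AE_integrable_fst[OF i] show "AE r in lborel. r : {a..b} --> integrable sphere_measure (%x. g (r, x))"
  by eventually_elim auto
 have i': "integrable N (%(r, x). indicator {a..b} r *\<^sub>R (word_fun w x *\<^sub>R g (r, x)))"
  using lint_word[OF g, of w] a by (simp add: lint_def case_prod_beta' scaleR_conv_of_real)
 from P.integrable_fst[OF i'] show "integrable lborel (%r. indicator {a..b} r *\<^sub>R mom g w r)"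
  by (simp only: mom_def Bochner_Integration.integral_scaleR_right)
qed

lemma mom_borel: assumes g: "lint g" shows "mom g w : borel_measurable borel"
proof -
 have "(%(r, x). word_fun w x *\<^sub>R g (r, x)) : borel_measurable N"
  using lint_borel[OF lint_word[OF g, of w]] measurable_N_iff by (simp add: case_prod_beta' scaleR_conv_of_real)
 then have "(%r. LINT x|sphere_measure. word_fun w x *\<^sub>R g (r, x)) : borel_measurable lborel"
  by (intro sphere.borel_measurable_lebesgue_integral) simp
 then show ?thesis by (simp add: mom_def[abs_def])
qed

lemma mom_locint: "lint g ==> locint r0 (mom g w)"
 unfolding locint_def set_integrable_def using strip_moments(1) by blast

lemma Omega_exhaust_AE:
 assumes "!!k. AE r in lborel. r : {r0 + 1 / real (Suc k)..r0 + real (Suc k)} --> Q r"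
 shows "AE r in lborel. r0 < r --> Q r"
proof -
 have "AE r in lborel. ALL k. r : {r0 + 1 / real (Suc k)..r0 + real (Suc k)} --> Q r"
  unfolding AE_all_countable using assms by blast
 then show ?thesis
 proof eventually_elim
  case (elim r)
  show ?case
  proof
   assume r: "r0 < r"
   obtain k1 where k1: "1 / real (Suc k1) < r - r0" using r nat_approx_posE[of "r - r0"] by auto
   obtain k2 where k2: "r - r0 < real k2" using reals_Archimedean2 by blast
   define k where "k = max k1 k2"
   have "1 / real (Suc k) <= 1 / real (Suc k1)" by (auto simp: k_def field_simps)
   moreover have "real k2 <= real (Suc k)" by (simp add: k_def)
   ultimately have "r : {r0 + 1 / real (Suc k)..r0 + real (Suc k)}" using k1 k2 by auto
   then show "Q r" using elim by blast
  qed
 qed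
qed

text \<open>There are only countably many words, so outside one null set of radii all moments vanish
  together and completeness on the sphere applies.\<close>

lemma moments_zero_AE:
 assumes g: "lint g" and z: "!!w. AE r in lborel. r0 < r --> mom g w r = 0"
 shows "AE p in N. p : Omega r0 --> g p = 0"
proof (rule P.AE_pair_measure)
 have gm: "g : borel_measurable borel" by (rule lint_borel[OF g])
 then have "g -` {0} \<inter> space borel : sets borel" by (rule measurable_sets) simp
 then have "- Omega r0 \<union> g -` {0} : sets borel" using Omega_borel by (intro sets.Un borel_comp) auto
 moreover have "{p : space N. p : Omega r0 --> g p = 0} = - Omega r0 \<union> g -` {0}" by auto
 ultimately show "{p : space N. p : Omega r0 --> g p = 0} : sets N" unfolding sets_N by (simp only:)
 have "AE r in lborel. ALL w:(UNIV :: 'd list set). r0 < r --> mom g w r = 0"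
  using z by (subst AE_ball_countable[OF countable_words]) auto
 moreover have "AE r in lborel. r0 < r --> integrable sphere_measure (%x. g (r, x))"
  by (rule Omega_exhaust_AE) (rule strip_moments(2)[OF g], simp)
 ultimately show "AE r in lborel. AE x in sphere_measure. (r, x) : Omega r0 --> g (r, x) = 0"
 proof eventually_elim
  case (elim r)
  show ?case
  proof (cases "r0 < r")
   case True
   have "AE x in sphere_measure. g (r, x) = 0"
    using elim True by (intro sphere_moments_zero) (auto simp: mom_def)
   then show ?thesis by eventually_elim simp
  next
   case False
   then show ?thesis by (auto simp: Omega_mem)
  qed
 qed
qed

lemma sep_integral:
 assumes g: "lint g" and th: "ctest r0 th"
 shows "(LINT p|N. g p * sep_fun th (word_fun w) p) = (LINT r|lborel. th r *\<^sub>R mom g w r)"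
proof -
 have "(LINT p|N. g p * sep_fun th (word_fun w) p) = (LINT r|lborel. LINT x|sphere_measure. g (r, x) * sep_fun th (word_fun w) (r, x))"
  using P.integral_fst'[OF lint_test_integrable[OF g test_fun_sep[OF th]]] by simp
 also have "... = (LINT r|lborel. th r *\<^sub>R mom g w r)"
 proof (rule bochner_cong[OF refl])
  fix r
  have "(LINT x|sphere_measure. g (r, x) * sep_fun th (word_fun w) (r, x)) = (LINT x|sphere_measure. th r *\<^sub>R (word_fun w x *\<^sub>R g (r, x)))"
  proof (rule integral_cong_AE)
   have gr: "(%x. g (r, x)) : borel_measurable borel"
    by (rule measurable_compose[OF _ lint_borel[OF g]]) (auto intro!: borel_measurable_continuous_onI continuous_intros)
   then show "(%x. g (r, x) * sep_fun th (word_fun w) (r, x)) : borel_measurable sphere_measure"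
    using test_fun_slice_borel[OF test_fun_sep[OF th], of w r] by measurable
   show "(%x. th r *\<^sub>R (word_fun w x *\<^sub>R g (r, x))) : borel_measurable sphere_measure" using gr by measurable
   show "AE x in sphere_measure. g (r, x) * sep_fun th (word_fun w) (r, x) = th r *\<^sub>R (word_fun w x *\<^sub>R g (r, x))"
    using AE_sphere_norm by eventually_elim (simp add: sep_fun_unit scaleR_conv_of_real)
  qed
  then show "(LINT x|sphere_measure. g (r, x) * sep_fun th (word_fun w) (r, x)) = th r *\<^sub>R mom g w r"
   by (simp only: mom_def Bochner_Integration.integral_scaleR_right)
 qed
 finally show ?thesis .
qed

text \<open>Products of a radial test function and a monomial suffice: they reduce the claim to the
  one-dimensional lemma for each moment.\<close>

lemma fundamental_lemma:
 assumes g: "lint g" and z: "!!et. test_fun r0 et ==> (LINT p|N. g p * et p) = 0"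
 shows "AE p in N. p : Omega r0 --> g p = 0"
proof (rule moments_zero_AE[OF g])
 fix w
 show "AE r in lborel. r0 < r --> mom g w r = 0"
  by (rule locint_AE_eq_0[OF mom_locint[OF g]]) (simp add: sep_integral[OF g, symmetric] z test_fun_sep)
qed

end

section \<open>Calculus rules for derivatives of test functions\<close>

lemma test_fun_coord:
 fixes ps :: "real * (real^'d) => complex"
 assumes "test_fun r0 ps" shows "test_fun r0 (%p. of_real (snd p $ j) * ps p)"
proof (rule test_fun_transform[OF assms smooth_on_mult[OF smooth_on_mult[OF smooth_on_inv smooth_on_coord[of _ j]] test_fun_smooth[OF assms]]])
 fix p :: "real * (real^'d)" assume "p : punct r0"
 then show "complex_of_real (inverse (norm (snd p))) * complex_of_real (snd p $ j) * hom_ext ps p = hom_ext (%p. of_real (snd p $ j) * ps p) p"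
  by (cases p) (simp add: hom_ext_def)
qed (simp_all add: test_fun_outside[OF assms])

lemma dr_scale:
 assumes "test_fun r0 ps" shows "dr (%p. c * ps p) p = c * dr ps p"
proof -
 obtain r x where p: "p = (r, x)" by (cases p)
 have "((%s. c * ps (s, x)) has_vector_derivative c * dr ps (r, x)) (at r)"
  by (rule bounded_linear.has_vector_derivative[OF bounded_linear_mult_right test_fun_dr[OF assms]])
 then show ?thesis unfolding p dr_def[of "%p. c * ps p"] by (simp add: vector_derivative_at)
qed

lemma dr_cnj:
 assumes "test_fun r0 ps" shows "dr (%p. cnj (ps p)) p = cnj (dr ps p)"
proof -
 obtain r x where p: "p = (r, x)" by (cases p)
 have "((%s. cnj (ps (s, x))) has_vector_derivative cnj (dr ps (r, x))) (at r)"
  by (rule bounded_linear.has_vector_derivative[OF bounded_linear_cnj test_fun_dr[OF assms]])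
 then show ?thesis unfolding p dr_def[of "%p. cnj (ps p)"] by (simp add: vector_derivative_at)
qed

lemma dr_radial_mult:
 assumes "test_fun r0 ps" "smooth1 th"
 shows "dr (%p. of_real (th (fst p)) * ps p) p = of_real (deriv th (fst p)) * ps p + of_real (th (fst p)) * dr ps p"
proof -
 obtain r x where p: "p = (r, x)" by (cases p)
 have "((%s. complex_of_real (th s)) has_vector_derivative of_real (deriv th r)) (at r)"
  using smooth1_has_deriv[OF assms(2)] by (intro has_vector_derivative_of_real) (simp add: has_real_derivative_iff_has_vector_derivative)
 from has_vector_derivative_mult[OF this test_fun_dr[OF assms(1)]]
 have "((%s. complex_of_real (th s) * ps (s, x)) has_vector_derivative of_real (th r) * dr ps (r, x) + of_real (deriv th r) * ps (r, x)) (at r)" .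
 then show ?thesis unfolding p dr_def[of "%p. of_real (th (fst p)) * ps p"] by (simp add: vector_derivative_at add.commute)
qed

lemma dSt_linear:
 assumes ps: "test_fun r0 ps" and L: "bounded_linear L" and Lps: "test_fun r0 (%p. L (ps p))"
 shows "dSt r0 (%p. L (ps p)) j p = L (dSt r0 ps j p)"
proof (cases "r0 < fst p & norm (snd p) = 1")
 case True
 obtain r x where p: "p = (r, x)" by (cases p)
 have h: "r0 < r" "x ~= 0" using True p by auto
 from frechet_derivative_eqI[OF bounded_linear.has_derivative[OF L sphere_derivative_sum[OF ps h]]]
 have "dS (%p. L (ps p)) j (r, x) = L (dS ps j (r, x))"
  unfolding dS_def[of "%p. L (ps p)"] by (simp add: sum_axis_scaleR)
 then show ?thesis using True by (simp add: dSt_def[OF ps] dSt_def[OF Lps] p)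
next
 case False
 then show ?thesis using linear_0[OF bounded_linear.linear[OF L]] by (auto simp: dSt_def[OF ps] dSt_def[OF Lps])
qed

lemma dSt_scale: "test_fun r0 ps ==> dSt r0 (%p. c * ps p) j p = c * dSt r0 ps j p"
 by (rule dSt_linear[OF _ bounded_linear_mult_right test_fun_scale])

lemma dSt_cnj: "test_fun r0 ps ==> dSt r0 (%p. cnj (ps p)) j p = cnj (dSt r0 ps j p)"
 by (rule dSt_linear[OF _ bounded_linear_cnj test_fun_cnj])

lemma dSt_radial_mult:
 assumes ps: "test_fun r0 ps" and th: "smooth1 th"
 shows "dSt r0 (%p. of_real (th (fst p)) * ps p) j p = of_real (th (fst p)) * dSt r0 ps j p"
proof (cases "r0 < fst p & norm (snd p) = 1")
 case True
 obtain r x where p: "p = (r, x)" by (cases p)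
 have h: "r0 < r" "x ~= 0" using True p by auto
 from frechet_derivative_eqI[OF bounded_linear.has_derivative[OF bounded_linear_mult_right sphere_derivative_sum[OF ps h], of "of_real (th r)"]]
 have "dS (%p. of_real (th (fst p)) * ps p) j (r, x) = of_real (th r) * dS ps j (r, x)"
  unfolding dS_def[of "%p. of_real (th (fst p)) * ps p"] by (simp add: sum_axis_scaleR)
 then show ?thesis using True by (simp add: dSt_def[OF ps] dSt_def[OF test_fun_smooth_mult[OF ps th]] p)
next
 case False
 then show ?thesis by (auto simp: dSt_def[OF ps] dSt_def[OF test_fun_smooth_mult[OF ps th]])
qed

lemma dSt_mult:
 assumes "test_fun r0 ps" "test_fun r0 et"
 shows "dSt r0 (%p. ps p * et p) j p = dSt r0 ps j p * et p + ps p * dSt r0 et j p"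
 using dS_mult[OF assms, of "fst p" "snd p" j]
 by (cases p) (simp add: dSt_def[OF assms(1)] dSt_def[OF assms(2)] dSt_def[OF test_fun_mult[OF assms]])

text \<open>At \<open>x = 0\<close> the radially constant extension is differentiable only if it vanishes; otherwise
 the derivative there is the arbitrary value of an unspecified function.\<close>
lemma dS_borel:
 fixes et :: "real * (real^'d) => complex"
 assumes et: "test_fun r0 et" shows "dS et j : borel_measurable borel"
proof -
 define Z where "Z = {r. ALL x. et (r, x) = 0}"
 \<comment> \<open>The value that \<open>frechet_derivative\<close> takes where no derivative
   exists; it is the same constant at all such points.\<close>
 define c :: complex where "c = (SOME f' :: (real^'d) => complex. False) (axis j 1)"
 have "- Z = (\<Union>x. (%r. et (r, x)) -` (- {0}))" by (auto simp: Z_def)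
 also have "open ..."
 proof (intro open_UN ballI open_vimage)
  fix x show "continuous_on UNIV (%r. et (r, x))"
   using test_fun_dr[OF et] by (intro continuous_at_imp_continuous_on ballI has_vector_derivative_continuous)
 qed auto
 finally have Z: "Z : sets borel" using borel_comp[OF borel_open, of "- Z"] by simp
 have eq: "dS et j p = (if snd p = 0 then (if fst p : Z then 0 else c) else (1 / norm (snd p)) *\<^sub>R dSt r0 et j (fst p, snd p /\<^sub>R norm (snd p)))" for p
 proof -
  obtain r x where p: "p = (r, x)" by (cases p)
  have zero: "dS et j (r, y) = 0" if "r : Z" for y using that by (simp add: dS_def Z_def)
  show ?thesis
  proof (cases "x = 0")
   case True
   show ?thesis
   proof (cases "r : Z")
    case False
    \<comment> \<open>Along the ray through a unit vector \<open>y\<close> the function is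
      constantly \<open>et (r, y)\<close>, while its value at 0 is 0; continuity would make
      \<open>et\<close> vanish on the whole sphere of radius \<open>r\<close>.\<close>
    have "~ (%y. et (r, y /\<^sub>R norm y)) differentiable (at 0)"
    proof
     assume "(%y. et (r, y /\<^sub>R norm y)) differentiable (at 0)"
     then have c0: "isCont (%y. et (r, y /\<^sub>R norm y)) 0" by (rule differentiable_imp_continuous_within)
     have "et (r, y) = 0" for y
     proof (cases "norm y = 1")
      case True
      have "(%k. inverse (real (Suc k)) *\<^sub>R y) \<longlonglongrightarrow> 0 *\<^sub>R y" by (intro tendsto_scaleR LIMSEQ_inverse_real_of_nat tendsto_const)
      then have "(%k. inverse (real (Suc k)) *\<^sub>R y) \<longlonglongrightarrow> 0" by simp
      from isCont_tendsto_compose[OF c0 this]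
      have "(%k. et (r, (inverse (real (Suc k)) *\<^sub>R y) /\<^sub>R norm (inverse (real (Suc k)) *\<^sub>R y))) \<longlonglongrightarrow> et (r, 0 /\<^sub>R norm (0::real^'d))" .
      moreover have "(inverse (real (Suc k)) *\<^sub>R y) /\<^sub>R norm (inverse (real (Suc k)) *\<^sub>R y) = y" for k
       using True by (simp del: of_nat_Suc)
      moreover have "et (r, 0 /\<^sub>R norm (0::real^'d)) = 0" by (simp add: test_fun_outside[OF et])
      ultimately have "(%k::nat. et (r, y)) \<longlonglongrightarrow> 0" by (simp only:)
      then show ?thesis by (simp add: LIMSEQ_const_iff)
     qed (simp add: test_fun_outside[OF et])
     then show False using False by (simp add: Z_def)
    qed
    then have "~ ((%y. et (r, y /\<^sub>R norm y)) has_derivative f') (at 0)" for f' by (auto simp: differentiable_def)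
    then show ?thesis using True False by (simp add: p dS_def frechet_derivative_def c_def)
   qed (use True zero p in simp)
  next
   case False
   show ?thesis
   proof (cases "r0 < r")
    case True
    then show ?thesis using dS_homogeneous[OF et True False, of j] False
     by (simp add: p dSt_def[OF et] scaleR_conv_of_real[where 'a=complex])
   next
    case r: False
    then have "r : Z" by (simp add: Z_def test_fun_outside[OF et])
    then show ?thesis using zero r False by (simp add: p dSt_def[OF et])
   qed
  qed
 qed
 have fs [measurable]: "(fst :: real * (real^'d) => real) : borel_measurable borel" "(snd :: real * (real^'d) => real^'d) : borel_measurable borel"
  by (auto intro!: borel_measurable_continuous_onI continuous_intros)
 have m1: "(%p::real * (real^'d). (fst p, snd p /\<^sub>R norm (snd p))) : borel_measurable borel" by measurable
 have [measurable]: "(%p. dSt r0 et j (fst p, snd p /\<^sub>R norm (snd p))) : borel_measurable borel"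
  by (rule measurable_compose[OF m1 test_fun_borel[OF test_fun_dSt[OF et]]])
 have [measurable]: "Measurable.pred borel (%p::real * (real^'d). fst p : Z)"
  using Z by measurable
 show ?thesis unfolding eq[abs_def] by measurable
qed

section \<open>Weak derivatives over the exterior region\<close>

context exterior
begin

text \<open>The radii occurring in a compact subset of \<open>Omega r0\<close> have a minimum above
  \<open>r0\<close> and a maximum, so the subset lies in a closed strip.\<close>

lemma L2loc_iff:
 "L2loc r0 g \<longleftrightarrow> g : borel_measurable borel &
  (ALL a b. r0 < a --> (\<integral>\<^sup>+p. indicator {a..b} (fst p) * ennreal ((norm (g p))\<^sup>2) \<partial>N) < \<infinity>)"
proof -
 have conv: "(\<integral>\<^sup>+p. f p \<partial>B) = (\<integral>\<^sup>+p. indicator (Omega r0) p * f p \<partial>N)" if "f : borel_measurable borel" for f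
  unfolding B_eq ennreal_indicator using that by (intro nn_integral_density) auto
 have 1: "(\<integral>\<^sup>+p. indicator {a..b} (fst p) * ennreal ((norm (g p))\<^sup>2) \<partial>N) = (\<integral>\<^sup>+p. indicator ({a..b} \<times> sphere 0 1) p * ennreal ((norm (g p))\<^sup>2) \<partial>B)"
  if g: "g : borel_measurable borel" and a: "r0 < a" for a b
 proof -
  have [measurable]: "{a..b} \<times> sphere (0::real^'d) 1 : sets borel" by (intro borel_Times) auto
  have "(\<integral>\<^sup>+p. indicator ({a..b} \<times> sphere 0 1) p * ennreal ((norm (g p))\<^sup>2) \<partial>B) =
    (\<integral>\<^sup>+p. indicator (Omega r0) p * (indicator ({a..b} \<times> sphere 0 1) p * ennreal ((norm (g p))\<^sup>2)) \<partial>N)"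
   using g by (intro conv) measurable
  also have "... = (\<integral>\<^sup>+p. indicator {a..b} (fst p) * ennreal ((norm (g p))\<^sup>2) \<partial>N)"
  proof (rule nn_integral_cong_AE, use AE_N_unit in eventually_elim)
   fix p :: "real * (real^'d)" assume "norm (snd p) = 1"
   then show "indicator (Omega r0) p * (indicator ({a..b} \<times> sphere 0 1) p * ennreal ((norm (g p))\<^sup>2)) = indicator {a..b} (fst p) * ennreal ((norm (g p))\<^sup>2)"
    using a by (cases p) (auto simp: indicator_def Omega_mem)
  qed
  finally show ?thesis by simp
 qed
 show ?thesis
 proof
  assume h: "L2loc r0 g"
  then have g: "g : borel_measurable borel" unfolding L2loc_def using measurable_B_iff by blast
  have "(\<integral>\<^sup>+p. indicator {a..b} (fst p) * ennreal ((norm (g p))\<^sup>2) \<partial>N) < \<infinity>" if a: "r0 < a" for a b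
  proof -
   have "compact ({a..b} \<times> sphere (0::real^'d) 1)" "{a..b} \<times> sphere (0::real^'d) 1 \<subseteq> Omega r0"
    using a by (auto intro!: compact_Times simp: Omega_def)
   then show ?thesis unfolding 1[OF g a] using h unfolding L2loc_def by blast
  qed
  then show "g : borel_measurable borel & (ALL a b. r0 < a --> (\<integral>\<^sup>+p. indicator {a..b} (fst p) * ennreal ((norm (g p))\<^sup>2) \<partial>N) < \<infinity>)"
   using g by simp
 next
  assume h: "g : borel_measurable borel & (ALL a b. r0 < a --> (\<integral>\<^sup>+p. indicator {a..b} (fst p) * ennreal ((norm (g p))\<^sup>2) \<partial>N) < \<infinity>)"
  show "L2loc r0 g"
   unfolding L2loc_def
  proof (intro conjI allI impI)
   show "g : borel_measurable B" using h measurable_B_iff by blast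
   fix K :: "(real * (real^'d)) set" assume K: "compact K & K \<subseteq> Omega r0"
   show "(\<integral>\<^sup>+p. indicator K p * ennreal ((norm (g p))\<^sup>2) \<partial>B) < \<infinity>"
   proof (cases "K = {}")
    case False
    have cf: "compact (fst ` K)" using K by (intro compact_continuous_image continuous_intros) auto
    obtain a where a: "a : fst ` K" "ALL r:fst ` K. a <= r" using compact_attains_inf[OF cf] False by auto
    obtain b where b: "b : fst ` K" "ALL r:fst ` K. r <= b" using compact_attains_sup[OF cf] False by auto
    have "r0 < a" using a(1) K by (auto simp: Omega_def)
    have sub: "K \<subseteq> {a..b} \<times> sphere 0 1" using a(2) b(2) K by (force simp: Omega_def)
    have "(\<integral>\<^sup>+p. indicator K p * ennreal ((norm (g p))\<^sup>2) \<partial>B) <= (\<integral>\<^sup>+p. indicator ({a..b} \<times> sphere 0 1) p * ennreal ((norm (g p))\<^sup>2) \<partial>B)"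
     using sub by (intro nn_integral_mono mult_right_mono) (auto simp: indicator_def)
    also have "... < \<infinity>" unfolding 1[OF conjunct1[OF h] \<open>r0 < a\<close>, symmetric] using conjunct2[OF h] \<open>r0 < a\<close> by blast
    finally show ?thesis .
   qed simp
  qed
 qed
qed

lemma L2loc_lint: assumes "L2loc r0 g" shows "lint g"
 unfolding lint_def
proof (intro conjI allI impI)
 show g: "g : borel_measurable borel" using assms L2loc_iff by blast
 fix a b assume a: "r0 < a"
 have fin: "(\<integral>\<^sup>+p. indicator {a..b} (fst p) * ennreal ((norm (g p))\<^sup>2) \<partial>N) < \<infinity>" using assms a L2loc_iff by blast
 have i2: "integrable N (%p. indicator {a..b} (fst p) * (norm (g p))\<^sup>2)"
 proof (rule integrableI_bounded)
  show "(%p. indicator {a..b} (fst p) * (norm (g p))\<^sup>2) : borel_measurable N" using g by measurable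
  have "(\<integral>\<^sup>+p. ennreal (norm (indicator {a..b} (fst p) * (norm (g p))\<^sup>2)) \<partial>N) = (\<integral>\<^sup>+p. indicator {a..b} (fst p) * ennreal ((norm (g p))\<^sup>2) \<partial>N)"
   by (intro nn_integral_cong) (simp add: indicator_def)
  then show "(\<integral>\<^sup>+p. ennreal (norm (indicator {a..b} (fst p) * (norm (g p))\<^sup>2)) \<partial>N) < \<infinity>" using fin by simp
 qed
 show "integrable N (%p. indicator {a..b} (fst p) *\<^sub>R g p)"
 proof (rule bochner_bound)
  show "integrable N (%p. indicator {a..b} (fst p) + indicator {a..b} (fst p) * (norm (g p))\<^sup>2)"
   by (intro Bochner_Integration.integrable_add strip_integrable i2)
  show "(%p. indicator {a..b} (fst p) *\<^sub>R g p) : borel_measurable N" using g by measurable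
  have "t <= 1 + t\<^sup>2" if "0 <= t" for t :: real
  proof -
   have "0 <= (t - 1)\<^sup>2" by simp
   then have "2 * t <= 1 + t\<^sup>2" by (simp add: power2_eq_square algebra_simps)
   then show ?thesis using that by linarith
  qed
  then show "AE p in N. norm (indicator {a..b} (fst p) *\<^sub>R g p) <= norm (indicator {a..b} (fst p) + indicator {a..b} (fst p) * (norm (g p))\<^sup>2)"
   by (intro AE_I2) (simp add: indicator_def)
 qed
qed

lemma sqint_H_borel: "sqint H u ==> u : borel_measurable borel"
 using sqint_meas measurable_H_iff by blast

lemma sqint_H_nn:
 assumes "sqint H u" shows "(\<integral>\<^sup>+p. ennreal (wt p * (norm (u p))\<^sup>2) \<partial>N) < \<infinity>"
proof -
 have "integrable N (%p. wt p * (norm (u p))\<^sup>2)"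
  using sqint_integrable[OF assms] sqint_H_borel[OF assms] by (subst (asm) integrable_H_iff) auto
 then show ?thesis using wt_nonneg by (subst nn_integral_eq_integral) auto
qed

lemma sqint_HI:
 assumes "u : borel_measurable borel" "(\<integral>\<^sup>+p. ennreal (wt p * (norm (u p))\<^sup>2) \<partial>N) < \<infinity>" shows "sqint H u"
 unfolding sqint_def
proof
 show "u : borel_measurable H" using assms(1) measurable_H_iff by blast
 have "integrable N (%p. wt p * (norm (u p))\<^sup>2)"
  using assms wt_nonneg by (intro integrableI_bounded) auto
 then show "integrable H (%p. (norm (u p))\<^sup>2)" using assms(1) by (subst integrable_H_iff) auto
qed

lemma L2loc_radial:
 assumes u: "sqint H u" and be: "continuous_on {r0<..} be"
 shows "L2loc r0 (%p. of_real (ext be (fst p)) * u p)"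
 unfolding L2loc_iff
proof (intro conjI allI impI)
 show "(%p. of_real (ext be (fst p)) * u p) : borel_measurable borel"
  using lint_borel[OF lint_radial[OF lint_of_sqint[OF u] be]] .
 fix a b assume a: "r0 < a"
 have "continuous_on {r0<..} (%r. (be r)\<^sup>2 / ca r)" by (intro continuous_intros be cca) (use ca_pos in \<open>auto simp: less_le\<close>)
 then obtain C where C: "C >= 0" "ALL r:{a..b}. \<bar>(be r)\<^sup>2 / ca r\<bar> <= C" using cont_bounded[OF _ a] by blast
 have "(\<integral>\<^sup>+p. indicator {a..b} (fst p) * ennreal ((norm (of_real (ext be (fst p)) * u p))\<^sup>2) \<partial>N) <= (\<integral>\<^sup>+p. ennreal C * ennreal (wt p * (norm (u p))\<^sup>2) \<partial>N)"
 proof (rule nn_integral_mono_AE, use AE_N_unit in eventually_elim)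
  fix p :: "real * (real^'d)" assume 1: "norm (snd p) = 1"
  show "indicator {a..b} (fst p) * ennreal ((norm (of_real (ext be (fst p)) * u p))\<^sup>2) <= ennreal C * ennreal (wt p * (norm (u p))\<^sup>2)"
  proof (cases "fst p : {a..b}")
   case True
   then have r: "r0 < fst p" using a by auto
   have w: "wt p = ca (fst p)" using wt_eq[OF r 1] by simp
   have "(norm (of_real (ext be (fst p)) * u p))\<^sup>2 = ((be (fst p))\<^sup>2 / ca (fst p)) * (wt p * (norm (u p))\<^sup>2)"
    using r ca_pos[OF r] by (simp add: w norm_mult power_mult_distrib)
   also have "... <= C * (wt p * (norm (u p))\<^sup>2)"
    using C(2)[rule_format, OF True] wt_nonneg[of p] abs_ge_self[of "(be (fst p))\<^sup>2 / ca (fst p)"]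
    by (intro mult_right_mono mult_nonneg_nonneg) auto
   finally show ?thesis using True C(1) wt_nonneg[of p] by (simp add: ennreal_mult[symmetric] ennreal_leI)
  qed simp
 qed
 also have "... = ennreal C * (\<integral>\<^sup>+p. ennreal (wt p * (norm (u p))\<^sup>2) \<partial>N)"
  using sqint_H_borel[OF u] by (intro nn_integral_cmult) measurable
 also have "... < \<infinity>" using sqint_H_nn[OF u] by (simp add: ennreal_mult_less_top)
 finally show "(\<integral>\<^sup>+p. indicator {a..b} (fst p) * ennreal ((norm (of_real (ext be (fst p)) * u p))\<^sup>2) \<partial>N) < \<infinity>" .
qed

text \<open>The integral identity of \<open>weak_dr\<close> alone, over \<open>N\<close> instead of
  \<open>base_measure\<close>. Separated from local square integrability, it can be read as an
  orthogonality relation.\<close>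

definition wr :: "(real * (real^'d) => complex) => (real * (real^'d) => complex) => bool" where
 "wr ph g \<longleftrightarrow> (ALL et. test_fun r0 et --> (LINT p|N. ph p * dr et p) = - (LINT p|N. g p * et p))"

definition ws :: "(real * (real^'d) => complex) => ('d => real * (real^'d) => complex) => bool" where
 "ws ph g \<longleftrightarrow> (ALL j et. test_fun r0 et --> (LINT p|N. ph p * dSt r0 et j p) = - (LINT p|N. g j p * et p)
   + of_nat n * (LINT p|N. of_real (snd p $ j) * ph p * et p))"

lemma weak_dr_iff:
 assumes "ph : borel_measurable borel" shows "weak_dr r0 ph g \<longleftrightarrow> L2loc r0 g & wr ph g"
proof (cases "L2loc r0 g")
 case True
 then have [measurable]: "g : borel_measurable borel" using L2loc_iff by blast
 note assms [measurable]
 have "(LINT p|B. ph p * dr et p) = (LINT p|N. ph p * dr et p)" "(LINT p|B. g p * et p) = (LINT p|N. g p * et p)"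
  if "test_fun r0 et" for et
 proof -
  note [measurable] = test_fun_borel[OF that] test_fun_borel[OF test_fun_dr_test[OF that]]
  show "(LINT p|B. ph p * dr et p) = (LINT p|N. ph p * dr et p)"
   by (rule integral_B_Omega) (measurable, simp add: test_fun_Omega[OF test_fun_dr_test[OF that]])
  show "(LINT p|B. g p * et p) = (LINT p|N. g p * et p)"
   by (rule integral_B_Omega) (measurable, simp add: test_fun_Omega[OF that])
 qed
 then show ?thesis using True by (simp add: weak_dr_def wr_def)
qed (simp add: weak_dr_def)

lemma weak_dS_iff:
 assumes "ph : borel_measurable borel" shows "weak_dS r0 ph g \<longleftrightarrow> (ALL j. L2loc r0 (g j)) & ws ph g"
proof (cases "ALL j. L2loc r0 (g j)")
 case True
 then have [measurable]: "g j : borel_measurable borel" for j using L2loc_iff by blast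
 note assms [measurable]
 have "(LINT p|B. ph p * dS et j p) = (LINT p|N. ph p * dSt r0 et j p)" "(LINT p|B. g j p * et p) = (LINT p|N. g j p * et p)"
  "(LINT p|B. of_real (snd p $ j) * ph p * et p) = (LINT p|N. of_real (snd p $ j) * ph p * et p)"
  if "test_fun r0 et" for et j
 proof -
  note [measurable] = test_fun_borel[OF that] dS_borel[OF that]
  have "(LINT p|B. ph p * dS et j p) = (LINT p|N. indicator (Omega r0) p *\<^sub>R (ph p * dS et j p))"
   by (rule integral_B) measurable
  also have "(%p. indicator (Omega r0) p *\<^sub>R (ph p * dS et j p)) = (%p. ph p * dSt r0 et j p)"
   by (auto simp: fun_eq_iff dSt_def[OF that] Omega_mem indicator_def)
  finally show "(LINT p|B. ph p * dS et j p) = (LINT p|N. ph p * dSt r0 et j p)" .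
  show "(LINT p|B. g j p * et p) = (LINT p|N. g j p * et p)"
   by (rule integral_B_Omega) (measurable, simp add: test_fun_Omega[OF that])
  show "(LINT p|B. of_real (snd p $ j) * ph p * et p) = (LINT p|N. of_real (snd p $ j) * ph p * et p)"
   by (rule integral_B_Omega) (measurable, simp add: test_fun_Omega[OF that])
 qed
 then show ?thesis using True unfolding weak_dS_def ws_def n[symmetric] by simp
next
 case False
 then show ?thesis unfolding weak_dS_def by blast
qed

lemma test_lint: "test_fun r0 et ==> lint et"
proof -
 assume et: "test_fun r0 et"
 obtain C where C: "C >= 0" "ALL p. norm (et p) <= C" using test_fun_bounded[OF et] by blast
 note [measurable] = test_fun_borel[OF et]
 have "integrable N (%p. indicator {a..b} (fst p) *\<^sub>R et p)" for a b
 proof (rule bochner_bound)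
  show "integrable N (%p. C * indicator {a..b} (fst p))" using strip_integrable by (rule integrable_mult_right)
  show "AE p in N. norm (indicator {a..b} (fst p) *\<^sub>R et p) <= norm (C * indicator {a..b} (fst p))"
  proof (rule AE_I2)
   fix p show "norm (indicator {a..b} (fst p) *\<^sub>R et p) <= norm (C * indicator {a..b} (fst p))"
    using C(1) C(2)[rule_format, of p] by (cases "fst p : {a..b}") auto
  qed
 qed measurable
 then show ?thesis using test_fun_borel[OF et] unfolding lint_def by blast
qed

lemma test_fun_integrable_N: assumes et: "test_fun r0 et" shows "integrable N et"
proof -
 obtain a b where ab: "r0 < a" "ALL p. fst p ~: {a..b} --> et p = 0" using test_fun_supp_N[OF et] by blast
 have e: "(%p. indicator {a..b} (fst p) *\<^sub>R et p) = et" using ab(2) by (force simp: fun_eq_iff indicator_def)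
 have "integrable N (%p. indicator {a..b} (fst p) *\<^sub>R et p)" using test_lint[OF et] ab(1) unfolding lint_def by blast
 then show ?thesis unfolding e .
qed

lemma test_dr_integral_0:
 assumes et: "test_fun r0 et" shows "(LINT p|N. dr et p) = 0"
proof -
 have i: "integrable N (%(r, x). dr et (r, x))"
  using test_fun_integrable_N[OF test_fun_dr_test[OF et]] by (simp add: case_prod_beta')
 have "(LINT r|lborel. dr et (r, x)) = 0" for x
 proof -
  obtain a b where ab: "r0 < a" "a <= b" "ALL p. fst p ~: {a..b} --> et p = 0" using test_fun_supp_N[OF et] by blast
  obtain a' b' where ab': "r0 < a'" "a' <= b'" "ALL p. fst p ~: {a'..b'} --> dr et p = 0" using test_fun_supp_N[OF test_fun_dr_test[OF et]] by blast
  define A1 B1 where "A1 = min a a' - 1" and "B1 = max b b' + 1"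
  have c: "continuous_on {A1..B1} (%r. dr et (r, x))"
   using test_fun_dr[OF test_fun_dr_test[OF et]] by (intro continuous_at_imp_continuous_on ballI has_vector_derivative_continuous)
  have "(LINT r|lborel. dr et (r, x)) = (LINT r|lborel. indicator {A1..B1} r *\<^sub>R dr et (r, x))"
  proof (rule bochner_cong[OF refl])
   fix r show "dr et (r, x) = indicator {A1..B1} r *\<^sub>R dr et (r, x)"
   proof (cases "r : {a'..b'}")
    case True then have "r : {A1..B1}" by (auto simp: A1_def B1_def)
    then show ?thesis by simp
   next
    case False then show ?thesis using ab'(3)[rule_format, of "(r, x)"] by simp
   qed
  qed
  also have "... = et (B1, x) - et (A1, x)"
  proof (rule integral_FTC_Icc[OF _ _ c])
   show "A1 <= B1" using ab by (auto simp: A1_def B1_def)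
   show "((%r. et (r, x)) has_vector_derivative dr et (r, x)) (at r within {A1..B1})" for r
    by (rule has_vector_derivative_at_within[OF test_fun_dr[OF et]])
  qed
  also have "... = 0"
  proof -
   have "B1 ~: {a..b}" "A1 ~: {a..b}" by (auto simp: A1_def B1_def)
   then show ?thesis using ab(3)[rule_format, of "(B1, x)"] ab(3)[rule_format, of "(A1, x)"] by simp
  qed
  finally show ?thesis .
 qed
 then show ?thesis using P.integral_snd[OF i] by simp
qed

lemma test_dSt_integral:
 assumes et: "test_fun r0 et" shows "(LINT p|N. dSt r0 et j p) = of_nat n * (LINT p|N. of_real (snd p $ j) * et p)"
proof -
 note i1 = test_fun_integrable_N[OF test_fun_dSt[OF et], of j]
 note i2 = test_fun_integrable_N[OF test_fun_coord[OF et], of j]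
 have "(LINT p|N. dSt r0 et j p) = (LINT r|lborel. LINT x|sphere_measure. dSt r0 et j (r, x))"
  by (rule P.integral_fst'[OF i1, symmetric])
 also have "... = (LINT r|lborel. of_nat n * (LINT x|sphere_measure. of_real (x $ j) * et (r, x)))"
 proof (rule bochner_cong[OF refl])
  fix r
  show "(LINT x|sphere_measure. dSt r0 et j (r, x)) = of_nat n * (LINT x|sphere_measure. of_real (x $ j) * et (r, x))"
  proof (cases "r0 < r")
   case True
   have "complex_of_real (real CARD('d) - 1) = of_nat n" using dim by (simp add: n of_nat_diff)
   then show ?thesis using sphere_divergence[OF et True dim, of j] by simp
  next
   case False
   then show ?thesis by (simp add: dSt_def[OF et] test_fun_outside[OF et])
  qed
 qed
 also have "... = of_nat n * (LINT r|lborel. LINT x|sphere_measure. of_real (x $ j) * et (r, x))"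
  by (rule Bochner_Integration.integral_mult_right_zero)
 also have "(LINT r|lborel. LINT x|sphere_measure. of_real (x $ j) * et (r, x)) = (LINT p|N. of_real (snd p $ j) * et p)"
  using P.integral_fst'[OF i2] by simp
 finally show ?thesis .
qed

text \<open>The radial derivative of the product of two test functions integrates to 0.\<close>

lemma test_wr: assumes et: "test_fun r0 et" shows "wr et (dr et)"
 unfolding wr_def
proof (intro allI impI)
 fix ze :: "real * (real^'d) => complex" assume ze: "test_fun r0 ze"
 have "(LINT p|N. dr et p * ze p + et p * dr ze p) = 0"
  using test_dr_integral_0[OF test_fun_mult[OF et ze]] dr_mult[OF et ze] by simp
 moreover have "integrable N (%p. dr et p * ze p)" "integrable N (%p. et p * dr ze p)"
  using test_fun_integrable_N[OF test_fun_mult[OF test_fun_dr_test[OF et] ze]]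
   test_fun_integrable_N[OF test_fun_mult[OF et test_fun_dr_test[OF ze]]] by auto
 ultimately show "(LINT p|N. et p * dr ze p) = - (LINT p|N. dr et p * ze p)"
  by (simp add: add_eq_0_iff)
qed

lemma test_ws: assumes et: "test_fun r0 et" shows "ws et (%j. dSt r0 et j)"
 unfolding ws_def
proof (intro allI impI)
 fix j and ze :: "real * (real^'d) => complex" assume ze: "test_fun r0 ze"
 have "(LINT p|N. dSt r0 et j p * ze p + et p * dSt r0 ze j p) = of_nat n * (LINT p|N. of_real (snd p $ j) * (et p * ze p))"
  using test_dSt_integral[OF test_fun_mult[OF et ze], of j] dSt_mult[OF et ze] by simp
 moreover have "integrable N (%p. dSt r0 et j p * ze p)" "integrable N (%p. et p * dSt r0 ze j p)"
  using test_fun_integrable_N[OF test_fun_mult[OF test_fun_dSt[OF et] ze]]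
   test_fun_integrable_N[OF test_fun_mult[OF et test_fun_dSt[OF ze]]] by auto
 ultimately have "(LINT p|N. dSt r0 et j p * ze p) + (LINT p|N. et p * dSt r0 ze j p) = of_nat n * (LINT p|N. of_real (snd p $ j) * et p * ze p)"
  by (simp add: mult.assoc)
 then show "(LINT p|N. et p * dSt r0 ze j p) = - (LINT p|N. dSt r0 et j p * ze p) + of_nat n * (LINT p|N. of_real (snd p $ j) * et p * ze p)"
  by (simp add: algebra_simps eq_neg_iff_add_eq_0)
qed

end

section \<open>Gradients and the closed form\<close>

lemma norm_vec_sq: "(norm (v :: complex^'d))\<^sup>2 = (SUM j:UNIV. (norm (v $ j))\<^sup>2)"
 by (simp add: norm_vec_def L2_set_def sum_nonneg)

lemma vec_borel_iff:
 fixes f :: "'a => complex^'d"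
 shows "f : borel_measurable M \<longleftrightarrow> (ALL j. (%x. f x $ j) : borel_measurable M)"
proof
 assume f: "f : borel_measurable M"
 have "continuous_on UNIV (%v :: complex^'d. v $ j)" for j by (intro continuous_intros)
 from measurable_compose[OF f borel_measurable_continuous_onI[OF this]]
 show "ALL j. (%x. f x $ j) : borel_measurable M" by blast
next
 assume f: "ALL j. (%x. f x $ j) : borel_measurable M"
 have "bounded_linear (axis j :: complex => complex^'d)" for j
  by (rule linear_conv_bounded_linear[THEN iffD1]) (auto simp: linear_iff axis_def vec_eq_iff)
 then have "continuous_on UNIV (axis j :: complex => complex^'d)" for j
  by (rule linear_continuous_on)
 then have 1: "(%x. axis j (f x $ j) :: complex^'d) : borel_measurable M" for j
  using measurable_compose[OF f[rule_format] borel_measurable_continuous_onI] by blast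
 have "f = (%x. SUM j:UNIV. axis j (f x $ j))"
  by (auto simp: fun_eq_iff vec_eq_iff axis_def if_distrib cong: if_cong)
 also have "... : borel_measurable M" using 1 by (intro borel_measurable_sum) blast
 finally show "f : borel_measurable M" .
qed

lemma sqint_vec:
 fixes f :: "'a => complex^'d"
 shows "sqint M f \<longleftrightarrow> (ALL j. sqint M (%x. f x $ j))"
proof
 assume f: "sqint M f"
 show "ALL j. sqint M (%x. f x $ j)"
 proof
  fix j
  show "sqint M (%x. f x $ j)"
  proof (rule sqint_bound[OF _ sqint_integrable[OF f]])
   show "(%x. f x $ j) : borel_measurable M" using sqint_meas[OF f] vec_borel_iff by blast
   show "(norm (f x $ j))\<^sup>2 <= (norm (f x))\<^sup>2" for x by (intro power_mono norm_ge_zero Finite_Cartesian_Product.norm_nth_le)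
  qed
 qed
next
 assume f: "ALL j. sqint M (%x. f x $ j)"
 then have "f : borel_measurable M" unfolding vec_borel_iff using sqint_meas by blast
 moreover have "integrable M (%x. SUM j:UNIV. (norm (f x $ j))\<^sup>2)"
  using f sqint_integrable by (intro Bochner_Integration.integrable_sum) blast
 ultimately show "sqint M f" unfolding sqint_def norm_vec_sq by blast
qed

context exterior
begin

text \<open>A class like that of test functions but without smoothness: it is closed under
  multiplication by continuous radial coefficients, and \<open>H\<close> and local integrability
  demand no more.\<close>

definition strip_bounded :: "(real * (real^'d) => complex) => bool" where
 "strip_bounded f \<longleftrightarrow> f : borel_measurable borel &
  (EX a b C. r0 < a & 0 <= C & (ALL p. fst p ~: {a..b} --> f p = 0) & (ALL p. norm (f p) <= C))"

lemma strip_boundedE: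
 assumes "strip_bounded f"
 shows "EX a b C. r0 < a & 0 <= C & (ALL p. norm (f p) <= C * indicator {a..b} (fst p))"
proof -
 obtain a b C where ab: "r0 < a" "0 <= C" and z: "ALL p. fst p ~: {a..b} --> f p = 0" and C: "ALL p. norm (f p) <= C"
  using assms unfolding strip_bounded_def by blast
 have "norm (f p) <= C * indicator {a..b} (fst p)" for p
  using z[rule_format, of p] C[rule_format, of p] by (cases "fst p : {a..b}") auto
 with ab show ?thesis by blast
qed

lemma strip_bounded_borel: "strip_bounded f ==> f : borel_measurable borel"
 unfolding strip_bounded_def by blast

lemma strip_bounded_left: assumes "strip_bounded f" "fst p <= r0" shows "f p = 0"
proof -
 obtain a b C where "r0 < a" "ALL p. fst p ~: {a..b} --> f p = 0" using assms(1) unfolding strip_bounded_def by blast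
 with assms(2) show ?thesis by (metis atLeastAtMost_iff dual_order.strict_trans2 not_le)
qed

lemma strip_bounded_test: assumes "test_fun r0 et" shows "strip_bounded et"
 using test_fun_borel[OF assms] test_fun_supp_N[OF assms] test_fun_bounded[OF assms] unfolding strip_bounded_def by blast

lemma strip_bounded_zero: "strip_bounded (%p. 0)"
 unfolding strip_bounded_def by (intro conjI exI[of _ "r0 + 1"] exI[of _ "0::real"]) auto

lemma strip_bounded_radial:
 assumes f: "strip_bounded f" and be: "continuous_on {r0<..} be"
 shows "strip_bounded (%p. of_real (ext be (fst p)) * f p)"
proof -
 obtain a b C where ab: "r0 < a" "0 <= C" and z: "ALL p. fst p ~: {a..b} --> f p = 0" and C: "ALL p. norm (f p) <= C"
  using f unfolding strip_bounded_def by blast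
 obtain D where D: "D >= 0" "ALL r:{a..b}. \<bar>be r\<bar> <= D" using cont_bounded[OF be ab(1)] by blast
 have "norm (of_real (ext be (fst p)) * f p) <= D * C" for p
 proof (cases "fst p : {a..b}")
  case True
  then show ?thesis using D(2)[rule_format, OF True] C[rule_format, of p] D(1) ab(1)
   by (auto simp: norm_mult intro!: mult_mono)
 next
  case False
  then show ?thesis using z[rule_format, of p] D(1) ab(2) by simp
 qed
 moreover have "(%p. of_real (ext be (fst p)) * f p) : borel_measurable borel"
  using fst_compose_borel[OF ext_borel[OF be]] strip_bounded_borel[OF f] by measurable
 moreover have "ALL p. fst p ~: {a..b} --> of_real (ext be (fst p)) * f p = 0" using z by simp
 moreover have "0 <= D * C" using D(1) ab(2) by simp
 ultimately show ?thesis using ab(1) unfolding strip_bounded_def by blast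
qed

lemma strip_bounded_cnj: "strip_bounded f ==> strip_bounded (%p. cnj (f p))"
 unfolding strip_bounded_def by (simp add: borel_measurable_cnj)

lemma lint_strip_integrable:
 assumes g: "lint g" and f: "strip_bounded f" shows "integrable N (%p. g p * f p)"
proof -
 obtain a b C where ab: "r0 < a" "0 <= C" and C': "ALL p. norm (f p) <= C * indicator {a..b} (fst p)"
  using strip_boundedE[OF f] by blast
 note C = C'[rule_format]
 show ?thesis
 proof (rule bochner_bound)
  show "integrable N (%p. C *\<^sub>R (indicator {a..b} (fst p) *\<^sub>R g p))"
   by (rule integrable_scaleR_right) (use g ab in \<open>simp add: lint_def\<close>)
  show "(%p. g p * f p) : borel_measurable N" using lint_borel[OF g] strip_bounded_borel[OF f] by measurable
  show "AE p in N. norm (g p * f p) <= norm (C *\<^sub>R (indicator {a..b} (fst p) *\<^sub>R g p))"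
  proof (rule AE_I2)
   fix p
   have "norm (g p) * norm (f p) <= norm (g p) * (C * indicator {a..b} (fst p))" by (intro mult_left_mono C norm_ge_zero)
   then show "norm (g p * f p) <= norm (C *\<^sub>R (indicator {a..b} (fst p) *\<^sub>R g p))" using ab(2) by (simp add: norm_mult mult_ac)
  qed
 qed
qed

lemma sqint_strip: assumes f: "strip_bounded f" shows "sqint H f"
proof -
 obtain a b C where ab: "r0 < a" "0 <= C" and C': "ALL p. norm (f p) <= C * indicator {a..b} (fst p)"
  using strip_boundedE[OF f] by blast
 note C = C'[rule_format]
 obtain D where D: "D >= 0" "ALL r:{a..b}. \<bar>ca r\<bar> <= D" using cont_bounded[OF cca ab(1)] by blast
 have "integrable N (%p. wt p *\<^sub>R (C\<^sup>2 * indicator {a..b} (fst p)))"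
 proof (rule bochner_bound)
  show "integrable N (%p. (D * C\<^sup>2) * indicator {a..b} (fst p))" using strip_integrable by (rule integrable_mult_right)
  show "AE p in N. norm (wt p *\<^sub>R (C\<^sup>2 * indicator {a..b} (fst p))) <= norm ((D * C\<^sup>2) * indicator {a..b} (fst p) :: real)"
  proof (rule AE_I2)
   fix p :: "real * (real^'d)"
   show "norm (wt p *\<^sub>R (C\<^sup>2 * indicator {a..b} (fst p))) <= norm ((D * C\<^sup>2) * indicator {a..b} (fst p) :: real)"
   proof (cases "fst p : {a..b}")
    case True
    then have "\<bar>wt p\<bar> <= D" using D(2)[rule_format, OF True] D(1) ab(1) by (auto simp: wt_def indicator_def)
    then show ?thesis using True D(1) by (simp add: abs_mult mult_right_mono)
   qed simp
  qed
 qed measurable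
 then have i: "integrable H (%p. C\<^sup>2 * indicator {a..b} (fst p))" by (subst integrable_H_iff) auto
 show ?thesis
 proof (rule sqint_bound[OF _ i])
  show "f : borel_measurable H" using strip_bounded_borel[OF f] measurable_H_iff by blast
  show "(norm (f p))\<^sup>2 <= C\<^sup>2 * indicator {a..b} (fst p)" for p
   using power_mono[OF C[of p] norm_ge_zero, of 2] by (cases "fst p : {a..b}") auto
 qed
qed

abbreviation q0 :: "(real * (real^'d) => complex * complex * complex * (complex^'d)) => real * (real^'d) => complex"
 where "q0 U == %p. fst (U p)"
abbreviation q1 :: "(real * (real^'d) => complex * complex * complex * (complex^'d)) => real * (real^'d) => complex"
 where "q1 U == %p. fst (snd (U p))"
abbreviation q2 :: "(real * (real^'d) => complex * complex * complex * (complex^'d)) => real * (real^'d) => complex"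
 where "q2 U == %p. fst (snd (snd (U p)))"
abbreviation qS :: "(real * (real^'d) => complex * complex * complex * (complex^'d)) => 'd => real * (real^'d) => complex"
 where "qS U j == %p. snd (snd (snd (U p))) $ j"

lemma sqint_graph_iff:
 "sqint M U \<longleftrightarrow> sqint M (q0 U) & sqint M (q1 U) & sqint M (q2 U) & (ALL j. sqint M (qS U j))"
 using sqint_Pair[of M "q0 U" "%p. snd (U p)"] sqint_Pair[of M "q1 U" "%p. snd (snd (U p))"]
  sqint_Pair[of M "q2 U" "%p. snd (snd (snd (U p)))"] sqint_vec[of M "%p. snd (snd (snd (U p)))"] by simp

definition ia :: "real * (real^'d) => complex" where "ia p = of_real (ext (%r. inverse (ca r)) (fst p))"

text \<open>Pairing with \<open>kern\<close> in \<open>H\<close> removes the weight and the conjugation, so that the weak relations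
 between a function and its gradient become orthogonality relations.\<close>
definition kern :: "(real * (real^'d) => complex) => (real * (real^'d) => complex) => (real * (real^'d) => complex)
  => ('d => real * (real^'d) => complex) => real * (real^'d) => complex * complex * complex * (complex^'d)" where
 "kern A b1 b2 bS p = (ia p * cnj (A p), ia p * cnj (b1 p), ia p * cnj (b2 p), \<chi> j. ia p * cnj (bS j p))"

lemma cia: "continuous_on {r0<..} (%r. inverse (ca r))"
 by (intro continuous_intros cca) (use ca_pos in \<open>auto simp: less_le\<close>)

lemma sqint_ia: "strip_bounded f ==> sqint H (%p. ia p * cnj (f p))"
 unfolding ia_def by (rule sqint_strip[OF strip_bounded_radial[OF strip_bounded_cnj cia]])

lemma sqint_kern:
 assumes "strip_bounded A" "strip_bounded b1" "strip_bounded b2" "ALL j. strip_bounded (bS j)"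
 shows "sqint H (kern A b1 b2 bS)"
 unfolding sqint_graph_iff kern_def using assms by (simp add: sqint_ia)

text \<open>On the exterior region \<open>wt\<close> cancels \<open>ia\<close>, and the real inner
  product of \<open>x\<close> with \<open>cnj y\<close> is the real part of \<open>x y\<close>; what
  remains is a bilinear integral over \<open>N\<close>.\<close>

lemma ip_kern:
 assumes U: "sqint H U" and s: "strip_bounded A" "strip_bounded b1" "strip_bounded b2" "ALL j. strip_bounded (bS j)"
 shows "ip H U (kern A b1 b2 bS) = Re ((LINT p|N. q0 U p * A p) + (LINT p|N. q1 U p * b1 p) + (LINT p|N. q2 U p * b2 p)
  + (SUM j:UNIV. LINT p|N. qS U j p * bS j p))"
proof -
 have sU: "sqint H (q0 U)" "sqint H (q1 U)" "sqint H (q2 U)" "!!j. sqint H (qS U j)" using U unfolding sqint_graph_iff by auto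
 note i = lint_strip_integrable[OF lint_of_sqint[OF sU(1)] s(1)] lint_strip_integrable[OF lint_of_sqint[OF sU(2)] s(2)]
  lint_strip_integrable[OF lint_of_sqint[OF sU(3)] s(3)] lint_strip_integrable[OF lint_of_sqint[OF sU(4)] s(4)[rule_format]]
 note [measurable] = sqint_H_borel[OF U] 
 have bm: "kern A b1 b2 bS : borel_measurable borel" using sqint_H_borel[OF sqint_kern[OF s]] .
 note bm [measurable]
 define Z where "Z p = q0 U p * A p + q1 U p * b1 p + q2 U p * b2 p + (SUM j:UNIV. qS U j p * bS j p)" for p
 have iZ: "integrable N Z" unfolding Z_def using i by (intro Bochner_Integration.integrable_add Bochner_Integration.integrable_sum) auto
 have "ip H U (kern A b1 b2 bS) = (LINT p|N. wt p *\<^sub>R (U p \<bullet> kern A b1 b2 bS p))"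
  unfolding ip_def by (rule integral_H) measurable
 also have "... = (LINT p|N. Re (Z p))"
 proof (rule integral_cong_AE)
  show "(%p. Re (Z p)) : borel_measurable N" using iZ by measurable
  show "AE p in N. wt p *\<^sub>R (U p \<bullet> kern A b1 b2 bS p) = Re (Z p)"
  proof (use AE_N_unit in eventually_elim)
   fix p :: "real * (real^'d)" assume 1: "norm (snd p) = 1"
   show "wt p *\<^sub>R (U p \<bullet> kern A b1 b2 bS p) = Re (Z p)"
   proof (cases "r0 < fst p")
    case True
    have w: "wt p = ca (fst p)" using wt_eq[OF True 1] by simp
    have ia: "ia p = of_real (inverse (ca (fst p)))" using True by (simp add: ia_def)
    have "x \<bullet> (of_real t * cnj y) = t * Re (x * y)" for t and x y :: complex
     by (simp add: inner_complex_def algebra_simps)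
    then have c: "x \<bullet> (ia p * cnj y) = inverse (ca (fst p)) * Re (x * y)" for x y :: complex
     unfolding ia by blast
    have "U p \<bullet> kern A b1 b2 bS p = inverse (ca (fst p)) * Re (Z p)"
     by (simp only: kern_def inner_prod_def fst_conv snd_conv inner_vec_def vec_lambda_beta c Z_def plus_complex.sel Re_sum distrib_left sum_distrib_left add.assoc)
    then show ?thesis using ca_pos[OF True] by (simp add: w)
   next
    case False
    then have "wt p = 0" by (simp add: wt_def Omega_def indicator_def mem_Times_iff)
    moreover have "Z p = 0" unfolding Z_def
     using False strip_bounded_left[OF s(1), of p] strip_bounded_left[OF s(2), of p] strip_bounded_left[OF s(3), of p] strip_bounded_left[OF s(4)[rule_format], of p]
     by simp
    ultimately show ?thesis by simp
   qed
  qed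
 qed measurable
 also have "... = Re (LINT p|N. Z p)" using iZ by (rule integral_Re)
 also have "(LINT p|N. Z p) = (LINT p|N. q0 U p * A p) + (LINT p|N. q1 U p * b1 p) + (LINT p|N. q2 U p * b2 p)
  + (SUM j:UNIV. LINT p|N. qS U j p * bS j p)"
  unfolding Z_def using i by simp
 finally show ?thesis .
qed

text \<open>The scalings sqrt(a/b), sqrt(d/a) and sqrt(a/c). If the weak derivatives are
  \<open>E1\<close> and \<open>E3\<close> times the gradient components and the mass component is
  \<open>E2\<close> times the function, then every term of the energy density becomes
  \<open>a\<close> times a squared component.\<close>

definition E1 :: "real * (real^'d) => complex" where "E1 p = of_real (ext (%r. sqrt (G r / F r)) (fst p))"
definition E2 :: "real * (real^'d) => complex" where "E2 p = of_real (ext (%r. m * sqrt (F r)) (fst p))"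
definition E3 :: "real * (real^'d) => complex" where "E3 p = of_real (ext (%r. r / sqrt (F r)) (fst p))"

lemma cE: "continuous_on {r0<..} (%r. sqrt (G r / F r))" "continuous_on {r0<..} (%r. m * sqrt (F r))"
  "continuous_on {r0<..} (%r. r / sqrt (F r))" "continuous_on {r0<..} (%r. inverse (sqrt (G r / F r)))"
  "continuous_on {r0<..} (%r. inverse (r / sqrt (F r)))"
 using r0 Fne Gne by (auto intro!: continuous_intros cF cG)

text \<open>One family of kernels per relation: the first component has radial derivative
  \<open>E1\<close> times the second; the third component is \<open>E2\<close> times the first; the
  tangential derivatives are \<open>E3\<close> times the rest, with the curvature term of
  \<open>weak_dS\<close>.\<close>

definition KE :: "(real * (real^'d) => complex * complex * complex * (complex^'d)) set" where
 "KE = {K. EX et. test_fun r0 et & (K = kern (dr et) (%p. E1 p * et p) (%p. 0) (%i p. 0) |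
  K = kern (%p. E2 p * et p) (%p. 0) (%p. - et p) (%i p. 0) |
  (EX j. K = kern (%p. dSt r0 et j p - of_nat n * (of_real (snd p $ j) * et p)) (%p. 0) (%p. 0) (%i p. if i = j then E3 p * et p else 0)))}"

lemma strip_bounded_E:
 assumes et: "test_fun r0 et"
 shows "strip_bounded (%p. E1 p * et p)" "strip_bounded (%p. E2 p * et p)" "strip_bounded (%p. E3 p * et p)"
  "strip_bounded (%p. - et p)" "strip_bounded (%p. dSt r0 et j p - of_nat n * (of_real (snd p $ j) * et p))"
proof -
 show "strip_bounded (%p. E1 p * et p)" "strip_bounded (%p. E2 p * et p)" "strip_bounded (%p. E3 p * et p)"
  unfolding E1_def E2_def E3_def by (intro strip_bounded_radial[OF strip_bounded_test[OF et]] cE)+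
 show "strip_bounded (%p. - et p)" using strip_bounded_test[OF test_fun_scale[OF et, of "-1"]] by simp
 show "strip_bounded (%p. dSt r0 et j p - of_nat n * (of_real (snd p $ j) * et p))"
  using strip_bounded_test[OF test_fun_add[OF test_fun_dSt[OF et] test_fun_scale[OF test_fun_coord[OF et], of "- of_nat n"]]] by simp
qed

lemma KE_sqint: "ALL K:KE. sqint H K"
proof
 fix K assume "K : KE"
 then obtain et where et: "test_fun r0 et" and K: "K = kern (dr et) (%p. E1 p * et p) (%p. 0) (%i p. 0) |
  K = kern (%p. E2 p * et p) (%p. 0) (%p. - et p) (%i p. 0) |
  (EX j. K = kern (%p. dSt r0 et j p - of_nat n * (of_real (snd p $ j) * et p)) (%p. 0) (%p. 0) (%i p. if i = j then E3 p * et p else 0))"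
  unfolding KE_def by blast
 have "strip_bounded (%p. if i = j then E3 p * et p else 0)" for i j :: 'd
  using strip_bounded_E(3)[OF et] strip_bounded_zero by (cases "i = j") simp_all
 note ks = sqint_kern[OF strip_bounded_test[OF test_fun_dr_test[OF et]] strip_bounded_E(1)[OF et] strip_bounded_zero allI[OF strip_bounded_zero]]
  sqint_kern[OF strip_bounded_E(2)[OF et] strip_bounded_zero strip_bounded_E(4)[OF et] allI[OF strip_bounded_zero]]
  sqint_kern[OF strip_bounded_E(5)[OF et] strip_bounded_zero strip_bounded_zero allI[OF this]]
 from K show "sqint H K" by (elim disjE exE) (simp_all only: ks)
qed

lemma Ball_param3:
 "(ALL K:{K. EX et. P et & (K = a et | K = b et | (EX j. K = c et j))}. Q K) \<longleftrightarrow>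
 (ALL et. P et --> Q (a et) & Q (b et) & (ALL j. Q (c et j)))"
 by blast

lemma complex_zero_Re: "Re z = 0 ==> Re (\<i> * z) = 0 ==> z = 0"
 by (simp add: complex_eq_iff)

text \<open>Orthogonality yields only real parts of the weak relations; the test function
  \<open>\<i> * et\<close> supplies the imaginary parts.\<close>

lemma perp_KE:
 "U : perp H KE \<longleftrightarrow> sqint H U & wr (q0 U) (%p. E1 p * q1 U p) & ws (q0 U) (%j p. E3 p * qS U j p) &
  (ALL et. test_fun r0 et --> (LINT p|N. E2 p * q0 U p * et p) = (LINT p|N. q2 U p * et p))"
proof (cases "sqint H U")
 case U: True
 have sU: "sqint H (q0 U)" "sqint H (q1 U)" "sqint H (q2 U)" "!!j. sqint H (qS U j)" using U unfolding sqint_graph_iff by auto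
 define zr zm zs where "zr et = (LINT p|N. q0 U p * dr et p) + (LINT p|N. E1 p * q1 U p * et p)"
  and "zm et = (LINT p|N. E2 p * q0 U p * et p) - (LINT p|N. q2 U p * et p)"
  and "zs j et = (LINT p|N. q0 U p * dSt r0 et j p) - of_nat n * (LINT p|N. of_real (snd p $ j) * q0 U p * et p) + (LINT p|N. E3 p * qS U j p * et p)" for et j
 have ipr: "ip H U (kern (dr et) (%p. E1 p * et p) (%p. 0) (%i p. 0)) = Re (zr et)" if et: "test_fun r0 et" for et
  unfolding zr_def ip_kern[OF U strip_bounded_test[OF test_fun_dr_test[OF et]] strip_bounded_E(1)[OF et] strip_bounded_zero allI[OF strip_bounded_zero]]
  by (simp add: mult_ac)
 have ipm: "ip H U (kern (%p. E2 p * et p) (%p. 0) (%p. - et p) (%i p. 0)) = Re (zm et)" if et: "test_fun r0 et" for et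
  unfolding zm_def ip_kern[OF U strip_bounded_E(2)[OF et] strip_bounded_zero strip_bounded_E(4)[OF et] allI[OF strip_bounded_zero]]
  by (simp add: mult_ac)
 have ips: "ip H U (kern (%p. dSt r0 et j p - of_nat n * (of_real (snd p $ j) * et p)) (%p. 0) (%p. 0) (%i p. if i = j then E3 p * et p else 0)) = Re (zs j et)"
  if et: "test_fun r0 et" for et j
 proof -
  have 1: "ALL i. strip_bounded (%p. if i = j then E3 p * et p else 0)"
  proof
   fix i show "strip_bounded (%p. if i = j then E3 p * et p else 0)"
    using strip_bounded_E(3)[OF et] strip_bounded_zero by (cases "i = j") simp_all
  qed
  have "(SUM i:UNIV. LINT p|N. qS U i p * (if i = j then E3 p * et p else 0)) = (SUM i:UNIV. if i = j then LINT p|N. qS U j p * (E3 p * et p) else 0)"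
   by (rule sum.cong) auto
  also have "... = (LINT p|N. E3 p * qS U j p * et p)" by (simp add: mult_ac)
  finally have 2: "(SUM i:UNIV. LINT p|N. qS U i p * (if i = j then E3 p * et p else 0)) = (LINT p|N. E3 p * qS U j p * et p)" .
  have i1: "integrable N (%p. q0 U p * dSt r0 et j p)" by (rule lint_test_integrable[OF lint_of_sqint[OF sU(1)] test_fun_dSt[OF et]])
  have i2: "integrable N (%p. of_nat n * (q0 U p * (of_real (snd p $ j) * et p)))"
   by (rule integrable_mult_right[OF lint_test_integrable[OF lint_of_sqint[OF sU(1)] test_fun_coord[OF et]]])
  have "(LINT p|N. q0 U p * (dSt r0 et j p - of_nat n * (of_real (snd p $ j) * et p))) =
    (LINT p|N. q0 U p * dSt r0 et j p - of_nat n * (q0 U p * (of_real (snd p $ j) * et p)))"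
   by (simp add: algebra_simps)
  also have "... = (LINT p|N. q0 U p * dSt r0 et j p) - of_nat n * (LINT p|N. q0 U p * (of_real (snd p $ j) * et p))"
   by (subst Bochner_Integration.integral_diff[OF i1 i2]) simp
  finally have 3: "(LINT p|N. q0 U p * (dSt r0 et j p - of_nat n * (of_real (snd p $ j) * et p))) =
   (LINT p|N. q0 U p * dSt r0 et j p) - of_nat n * (LINT p|N. of_real (snd p $ j) * q0 U p * et p)" by (simp add: mult_ac)
  show ?thesis unfolding zs_def ip_kern[OF U strip_bounded_E(5)[OF et] strip_bounded_zero strip_bounded_zero 1] 2 3 by simp
 qed
 have iz: "zr (%p. \<i> * et p) = \<i> * zr et" "zm (%p. \<i> * et p) = \<i> * zm et" "zs j (%p. \<i> * et p) = \<i> * zs j et" if et: "test_fun r0 et" for et j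
 proof -
  have e: "f * (\<i> * h) = \<i> * (f * h)" for f h :: complex by (simp add: mult_ac)
  show "zr (%p. \<i> * et p) = \<i> * zr et" "zm (%p. \<i> * et p) = \<i> * zm et" "zs j (%p. \<i> * et p) = \<i> * zs j et"
   unfolding zr_def zm_def zs_def dr_scale[OF et] dSt_scale[OF et] e integral_mult_right_zero
   by (simp_all add: algebra_simps)
 qed
 have "U : perp H KE \<longleftrightarrow> (ALL et. test_fun r0 et --> Re (zr et) = 0 & Re (zm et) = 0 & (ALL j. Re (zs j et) = 0))"
 proof -
  have "U : perp H KE \<longleftrightarrow> (ALL K:KE. ip H U K = 0)" unfolding perp_def using U by simp
  also have "... \<longleftrightarrow> (ALL et. test_fun r0 et --> ip H U (kern (dr et) (%p. E1 p * et p) (%p. 0) (%i p. 0)) = 0 &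
    ip H U (kern (%p. E2 p * et p) (%p. 0) (%p. - et p) (%i p. 0)) = 0 &
    (ALL j. ip H U (kern (%p. dSt r0 et j p - of_nat n * (of_real (snd p $ j) * et p)) (%p. 0) (%p. 0) (%i p. if i = j then E3 p * et p else 0)) = 0))"
   unfolding KE_def by (rule Ball_param3)
  also have "... \<longleftrightarrow> (ALL et. test_fun r0 et --> Re (zr et) = 0 & Re (zm et) = 0 & (ALL j. Re (zs j et) = 0))"
   by (intro all_cong1 imp_cong refl) (simp only: ipr ipm ips)
  finally show ?thesis .
 qed
 also have "... \<longleftrightarrow> (ALL et. test_fun r0 et --> zr et = 0 & zm et = 0 & (ALL j. zs j et = 0))"
 proof (intro iffI allI impI)
  fix et :: "real * (real^'d) => complex"
  assume h: "ALL et. test_fun r0 et --> Re (zr et) = 0 & Re (zm et) = 0 & (ALL j. Re (zs j et) = 0)" and et: "test_fun r0 et"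
  note h1 = h[rule_format, OF et] and h2 = h[rule_format, OF test_fun_scale[OF et, of \<i>]]
  show "zr et = 0 & zm et = 0 & (ALL j. zs j et = 0)"
   using h1 h2 unfolding iz[OF et] by (blast intro: complex_zero_Re)
 qed simp
 also have "... \<longleftrightarrow> wr (q0 U) (%p. E1 p * q1 U p) & ws (q0 U) (%j p. E3 p * qS U j p) &
  (ALL et. test_fun r0 et --> (LINT p|N. E2 p * q0 U p * et p) = (LINT p|N. q2 U p * et p))"
 proof -
  have 1: "zr et = 0 \<longleftrightarrow> (LINT p|N. q0 U p * dr et p) = - (LINT p|N. E1 p * q1 U p * et p)" for et
   unfolding zr_def by (simp add: eq_neg_iff_add_eq_0)
  have 2: "zm et = 0 \<longleftrightarrow> (LINT p|N. E2 p * q0 U p * et p) = (LINT p|N. q2 U p * et p)" for et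
   unfolding zm_def by simp
  have alg: "x - y + z = 0 \<longleftrightarrow> x = - z + y" for x y z :: complex by (auto simp: algebra_simps eq_neg_iff_add_eq_0)
  have 3: "zs j et = 0 \<longleftrightarrow> (LINT p|N. q0 U p * dSt r0 et j p) = - (LINT p|N. E3 p * qS U j p * et p) + of_nat n * (LINT p|N. of_real (snd p $ j) * q0 U p * et p)" for j et
   unfolding zs_def by (rule alg)
  show ?thesis unfolding 1 2 3 wr_def ws_def by blast
 qed
 finally show ?thesis using U by blast
qed (simp add: perp_def)

end

section \<open>The maximal form domain\<close>

context exterior
begin

lemma norm_prod_sq: "(norm z)\<^sup>2 = (norm (fst z))\<^sup>2 + (norm (snd z))\<^sup>2"
 by (simp add: norm_prod_def)

lemma wr_scale: assumes "wr ph g" shows "wr (%p. c * ph p) (%p. c * g p)"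
 using assms unfolding wr_def mult.assoc integral_mult_right_zero by simp

lemma ws_scale: assumes "ws ph g" shows "ws (%p. c * ph p) (%j p. c * g j p)"
proof -
 have e: "x * (c * y) * z = c * (x * y * z)" for x y z by (simp add: mult_ac)
 show ?thesis
  unfolding ws_def
 proof (intro allI impI)
  fix j and et :: "real * (real^'d) => complex" assume et: "test_fun r0 et"
  note h = assms[unfolded ws_def, rule_format, OF et, of j]
  show "(LINT p|N. c * ph p * dSt r0 et j p) = - (LINT p|N. c * g j p * et p) + of_nat n * (LINT p|N. of_real (snd p $ j) * (c * ph p) * et p)"
   unfolding e mult.assoc[of c] integral_mult_right_zero h by (simp add: algebra_simps)
 qed
qed

lemma weak_unique:
 assumes "lint g" "lint g'" and e: "!!et. test_fun r0 et ==> (LINT p|N. g p * et p) = (LINT p|N. g' p * et p)"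
 shows "AE p in N. p : Omega r0 --> g p = g' p"
proof -
 have "AE p in N. p : Omega r0 --> g p + (-1) * g' p = 0"
 proof (rule fundamental_lemma[OF lint_add[OF assms(1) lint_scale[OF assms(2)]]])
  fix et :: "real * (real^'d) => complex" assume et: "test_fun r0 et"
  show "(LINT p|N. (g p + (-1) * g' p) * et p) = 0"
   using e[OF et] Bochner_Integration.integral_diff[OF lint_test_integrable[OF assms(1) et] lint_test_integrable[OF assms(2) et]]
   by (simp add: algebra_simps)
 qed
 then show ?thesis by eventually_elim simp
qed

lemma wr_unique:
 assumes "lint g" "lint g'" "wr ph g" "wr ph g'" shows "AE p in N. p : Omega r0 --> g p = g' p"
proof (rule weak_unique[OF assms(1,2)])
 fix et :: "real * (real^'d) => complex" assume et: "test_fun r0 et"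
 show "(LINT p|N. g p * et p) = (LINT p|N. g' p * et p)"
  using assms(3)[unfolded wr_def, rule_format, OF et] assms(4)[unfolded wr_def, rule_format, OF et] by simp
qed

lemma ws_unique:
 assumes "lint (g j)" "lint (g' j)" "ws ph g" "ws ph g'" shows "AE p in N. p : Omega r0 --> g j p = g' j p"
proof (rule weak_unique[OF assms(1,2)])
 fix et :: "real * (real^'d) => complex" assume et: "test_fun r0 et"
 show "(LINT p|N. g j p * et p) = (LINT p|N. g' j p * et p)"
  using assms(3)[unfolded ws_def, rule_format, OF et, of j] assms(4)[unfolded ws_def, rule_format, OF et, of j] by simp
qed

lemma E_nonzero: "E1 p ~= 0" "E3 p ~= 0"
 using r0 Fpos[of "fst p"] Gpos[of "fst p"] by (auto simp: E1_def E3_def ext_def)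

lemma graph_sqint: assumes "U : perp H KE"
 shows "sqint H U" "sqint H (q0 U)" "sqint H (q1 U)" "sqint H (q2 U)" "sqint H (qS U j)"
 using assms unfolding perp_KE sqint_graph_iff by auto

lemma graph_wr: "U : perp H KE ==> wr (q0 U) (%p. E1 p * q1 U p)"
 and graph_ws: "U : perp H KE ==> ws (q0 U) (%j p. E3 p * qS U j p)"
 unfolding perp_KE by blast+

lemma graph_lint: assumes U: "U : perp H KE"
 shows "lint (%p. E1 p * q1 U p)" "lint (%p. E3 p * qS U j p)" "lint (%p. E2 p * q0 U p)"
 unfolding E1_def E2_def E3_def by (intro lint_radial lint_of_sqint graph_sqint[OF U] cE)+

lemma graph_L2loc: assumes U: "U : perp H KE"
 shows "L2loc r0 (%p. E1 p * q1 U p)" "L2loc r0 (%p. E3 p * qS U j p)"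
 unfolding E1_def E3_def by (intro L2loc_radial graph_sqint[OF U] cE)+

lemma graph_mass: assumes U: "U : perp H KE" shows "AE p in N. p : Omega r0 --> q2 U p = E2 p * q0 U p"
 using U unfolding perp_KE by (intro weak_unique lint_of_sqint graph_lint[OF U] graph_sqint[OF U]) simp

lemma graph_gradient_unique:
 assumes "(%p. (u p, g p)) : perp H KE" "(%p. (u p, g' p)) : perp H KE" shows "AE p in H. g p = g' p"
 unfolding AE_H_iff
proof -
 have "AE p in N. p : Omega r0 --> E1 p * fst (g p) = E1 p * fst (g' p)"
  using wr_unique[OF graph_lint(1)[OF assms(1)] graph_lint(1)[OF assms(2)]] graph_wr[OF assms(1)] graph_wr[OF assms(2)] by simp
 moreover have "AE p in N. ALL j:UNIV. p : Omega r0 --> E3 p * snd (snd (g p)) $ j = E3 p * snd (snd (g' p)) $ j"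
  using ws_unique[OF graph_lint(2)[OF assms(1)] graph_lint(2)[OF assms(2)]] graph_ws[OF assms(1)] graph_ws[OF assms(2)]
  by (intro AE_finite_allI) simp_all
 ultimately show "AE p in N. p : Omega r0 --> g p = g' p"
  using graph_mass[OF assms(1)] graph_mass[OF assms(2)]
  by eventually_elim (simp add: prod_eq_iff vec_eq_iff E_nonzero)
qed

definition JJ :: "complex * complex * (complex^'d) => complex * complex * (complex^'d)" where
 "JJ x = (\<i> * fst x, \<i> * fst (snd x), \<chi> j. \<i> * snd (snd x) $ j)"

lemma imult_inner: "(\<i> * x) \<bullet> (\<i> * y) = x \<bullet> (y::complex)"
 by (simp add: inner_complex_def)

lemma JJ_inner: "JJ x \<bullet> JJ y = x \<bullet> y"
 by (simp only: JJ_def inner_prod_def inner_vec_def fst_conv snd_conv vec_lambda_beta imult_inner)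

lemma JJ_JJ: "JJ (JJ x) = - x"
 by (simp add: JJ_def prod_eq_iff vec_eq_iff)

lemma graph_J:
 assumes U: "U : perp H KE" shows "(%p. (\<i> * fst (U p), JJ (snd (U p)))) : perp H KE"
proof -
 have e: "x * (\<i> * y) = \<i> * (x * y)" "x * (\<i> * y) * z = \<i> * (x * y * z)" for x y z :: complex by (simp_all add: mult_ac)
 have "(LINT p|N. E2 p * (\<i> * q0 U p) * et p) = (LINT p|N. \<i> * q2 U p * et p)" if "test_fun r0 et" for et
  unfolding e mult.assoc[of \<i>] integral_mult_right_zero using U that unfolding perp_KE by (simp add: mult.assoc)
 then show ?thesis
  unfolding perp_KE using graph_sqint[OF U] wr_scale[OF graph_wr[OF U], of \<i>] ws_scale[OF graph_ws[OF U], of \<i>]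
  by (simp add: sqint_graph_iff JJ_def sqint_imult e)
qed

text \<open>The inverse factors cancel against \<open>E1\<close> and \<open>E3\<close>, so the weak
  derivatives prescribed by \<open>perp_KE\<close> are the classical ones.\<close>

definition test_graph :: "(real * (real^'d) => complex) => real * (real^'d) => complex * complex * complex * (complex^'d)" where
 "test_graph et = (%p. (et p, of_real (ext (%r. inverse (sqrt (G r / F r))) (fst p)) * dr et p, E2 p * et p,
  \<chi> j. of_real (ext (%r. inverse (r / sqrt (F r))) (fst p)) * dSt r0 et j p))"

lemma E_inverse:
 "E1 p * (of_real (ext (%r. inverse (sqrt (G r / F r))) (fst p)) * z) = z"
 "E3 p * (of_real (ext (%r. inverse (r / sqrt (F r))) (fst p)) * z) = z"
proof -
 have "ext (%r. sqrt (G r / F r)) s * ext (%r. inverse (sqrt (G r / F r))) s = 1"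
  "ext (%r. r / sqrt (F r)) s * ext (%r. inverse (r / sqrt (F r))) s = 1" for s
  using r0 Fpos[of s] Gpos[of s] by (auto simp: ext_def)
 then have "E1 p * of_real (ext (%r. inverse (sqrt (G r / F r))) (fst p)) = 1" "E3 p * of_real (ext (%r. inverse (r / sqrt (F r))) (fst p)) = 1"
  unfolding E1_def E3_def of_real_mult[symmetric] by simp_all
 then show "E1 p * (of_real (ext (%r. inverse (sqrt (G r / F r))) (fst p)) * z) = z"
  "E3 p * (of_real (ext (%r. inverse (r / sqrt (F r))) (fst p)) * z) = z"
  by (simp_all only: mult.assoc[symmetric] mult_1)
qed

lemma test_graph: assumes et: "test_fun r0 et" shows "test_graph et : perp H KE"
proof -
 have "sqint H (%p. of_real (ext (%r. inverse (sqrt (G r / F r))) (fst p)) * dr et p)"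
  by (rule sqint_strip[OF strip_bounded_radial[OF strip_bounded_test[OF test_fun_dr_test[OF et]] cE(4)]])
 moreover have "sqint H (%p. of_real (ext (%r. inverse (r / sqrt (F r))) (fst p)) * dSt r0 et j p)" for j
  by (rule sqint_strip[OF strip_bounded_radial[OF strip_bounded_test[OF test_fun_dSt[OF et]] cE(5)]])
 ultimately have "sqint H (test_graph et)"
  using sqint_strip[OF strip_bounded_test[OF et]] sqint_strip[OF strip_bounded_E(2)[OF et]]
  unfolding sqint_graph_iff by (simp add: test_graph_def)
 moreover have "wr (q0 (test_graph et)) (%p. E1 p * q1 (test_graph et) p)" "ws (q0 (test_graph et)) (%j p. E3 p * qS (test_graph et) j p)"
  using test_wr[OF et] test_ws[OF et] by (simp_all only: test_graph_def fst_conv snd_conv vec_lambda_beta E_inverse)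
 ultimately show ?thesis unfolding perp_KE by (simp add: test_graph_def)
qed

text \<open>Density of the test functions in \<open>H\<close>, the source of the
  \<open>dense\<close> axiom. Conjugated test functions turn the real inner product into the real
  part of an integral over \<open>N\<close>, and multiples by \<open>\<i>\<close> give the imaginary
  part.\<close>

lemma H_density_zero:
 assumes h: "sqint H h" and z: "!!et. test_fun r0 et ==> ip H h et = 0" shows "AE p in H. h p = 0"
proof -
 note [measurable] = sqint_H_borel[OF h]
 have l: "lint (%p. of_real (ext ca (fst p)) * h p)" by (rule lint_radial[OF lint_of_sqint[OF h] cca])
 have re: "Re (LINT p|N. of_real (ext ca (fst p)) * h p * et p) = 0" if et: "test_fun r0 et" for et
 proof -
  note [measurable] = test_fun_borel[OF et] test_fun_borel[OF test_fun_cnj[OF et]]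
  have "0 = (LINT p|N. wt p *\<^sub>R (h p \<bullet> cnj (et p)))"
   unfolding z[OF test_fun_cnj[OF et], symmetric, unfolded ip_def] by (rule integral_H) measurable
  also have "... = (LINT p|N. Re (of_real (ext ca (fst p)) * h p * et p))"
  proof (rule bochner_cong[OF refl])
   fix p show "wt p *\<^sub>R (h p \<bullet> cnj (et p)) = Re (of_real (ext ca (fst p)) * h p * et p)"
    using test_fun_Omega[OF et, of p] by (cases "p : Omega r0") (auto simp: wt_def inner_complex_def algebra_simps)
  qed
  also have "... = Re (LINT p|N. of_real (ext ca (fst p)) * h p * et p)"
   by (rule integral_Re[OF lint_test_integrable[OF l et]])
  finally show ?thesis by simp
 qed
 have "AE p in N. p : Omega r0 --> of_real (ext ca (fst p)) * h p = 0"
 proof (rule fundamental_lemma[OF l complex_zero_Re])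
  fix et :: "real * (real^'d) => complex" assume et: "test_fun r0 et"
  show "Re (LINT p|N. of_real (ext ca (fst p)) * h p * et p) = 0" by (rule re[OF et])
  have e: "x * (\<i> * y) = \<i> * (x * y)" for x y :: complex by (simp add: mult_ac)
  show "Re (\<i> * (LINT p|N. of_real (ext ca (fst p)) * h p * et p)) = 0"
   using re[OF test_fun_scale[OF et, of \<i>]] unfolding e integral_mult_right_zero .
 qed
 then show ?thesis unfolding AE_H_iff
 proof eventually_elim
  case (elim p)
  show ?case
  proof
   assume p: "p : Omega r0"
   then have "r0 < fst p" by (simp add: Omega_def mem_Times_iff)
   then show "h p = 0" using elim p ca_pos[of "fst p"] by simp
  qed
 qed
qed

lemma form_spaceI:
 assumes "ALL K:KK. sqint H K" "!!W. W : perp H KK ==> (%p. (\<i> * fst (W p), JJ (snd (W p)))) : perp H KK"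
  and t: "!!et. test_fun r0 et ==> test_graph et : perp H KK"
 shows "form_space H KK JJ"
proof
 fix h :: "real * (real^'d) => complex"
 assume h: "sqint H h" and z: "!!W. W : perp H KK ==> ip H h (%x. fst (W x)) = 0"
 show "AE x in H. h x = 0"
  using z[OF t] by (intro H_density_zero[OF h]) (simp add: test_graph_def)
qed (use assms JJ_inner JJ_JJ in auto)

lemma form_space_KE: "form_space H KE JJ"
 using KE_sqint graph_J test_graph by (rule form_spaceI)

lemma coef_E:
 assumes "r0 < r"
 shows "cb r * (norm (E1 (r, x)))\<^sup>2 = ca r" "cc r * (norm (E3 (r, x)))\<^sup>2 = ca r" "cd r = ca r * (norm (E2 (r, x)))\<^sup>2"
proof -
 have p: "0 < r" "0 < F r" "0 < G r" using r0 assms Fpos Gpos by auto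
 have s: "sqrt (F r / G r) * (G r / F r) = sqrt (G r / F r)" "sqrt (F r * G r) / F r = sqrt (G r / F r)"
  "sqrt (G r / F r) * F r = sqrt (F r * G r)"
  using p by (simp_all add: real_sqrt_divide real_sqrt_mult field_simps flip: power2_eq_square)
 have w: "r powr (real n - 2) * r\<^sup>2 = r powr real n" using p powr_add[of r "real n - 2" 2] by (simp add: powr_numeral)
 have e: "(norm (E1 (r, x)))\<^sup>2 = G r / F r" "(norm (E2 (r, x)))\<^sup>2 = m\<^sup>2 * F r" "(norm (E3 (r, x)))\<^sup>2 = r\<^sup>2 / F r"
  unfolding E1_def E2_def E3_def fst_conv ext_eq[OF assms] norm_of_real power2_abs
  using p by (simp_all add: power_divide power_mult_distrib)
 show "cb r * (norm (E1 (r, x)))\<^sup>2 = ca r"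
  unfolding e coef_a_def coef_b_def mult.assoc s(1) ..
 have "cc r * (norm (E3 (r, x)))\<^sup>2 = (r powr (real n - 2) * r\<^sup>2) * (sqrt (F r * G r) / F r)"
  unfolding e coef_c_def by simp
 then show "cc r * (norm (E3 (r, x)))\<^sup>2 = ca r" unfolding w s(2) coef_a_def .
 show "cd r = ca r * (norm (E2 (r, x)))\<^sup>2"
  unfolding e coef_a_def coef_d_def s(3)[symmetric] by (simp only: mult_ac)
qed

text \<open>\<open>form_b\<close> picks weak derivatives by \<open>SOME\<close>; by uniqueness they
  agree almost everywhere with the rescaled gradient components, so the choice does not influence
  the integral.\<close>

lemma graph_form_b:
 assumes U: "U : perp H KE"
 shows "form_b r0 F G m (q0 U) = ennreal (sqnorm H (%p. snd (U p)))" "H1loc r0 (q0 U)"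
proof -
 have q0: "q0 U : borel_measurable borel" by (rule sqint_H_borel[OF graph_sqint(2)[OF U]])
 define gr gS where "gr = (SOME g. weak_dr r0 (q0 U) g)" and "gS = (SOME g. weak_dS r0 (q0 U) g)"
 have wr1: "weak_dr r0 (q0 U) (%p. E1 p * q1 U p)"
  unfolding weak_dr_iff[OF q0] using graph_L2loc[OF U] graph_wr[OF U] by blast
 have ws1: "weak_dS r0 (q0 U) (%j p. E3 p * qS U j p)"
  unfolding weak_dS_iff[OF q0] using graph_L2loc[OF U] graph_ws[OF U] by blast
 have "L2loc r0 (%p. of_real (ext (%r. 1) (fst p)) * q0 U p)"
  by (rule L2loc_radial[OF graph_sqint(2)[OF U]]) (rule continuous_on_const)
 then have "L2loc r0 (q0 U)" by (simp add: ext_def)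
 then show "H1loc r0 (q0 U)" unfolding H1loc_def using wr1 ws1 by blast
 have gr: "L2loc r0 gr" "wr (q0 U) gr" using someI[of "weak_dr r0 (q0 U)", OF wr1] unfolding gr_def[symmetric] weak_dr_iff[OF q0] by auto
 have gS: "L2loc r0 (gS j)" "ws (q0 U) gS" for j using someI[of "weak_dS r0 (q0 U)", OF ws1] unfolding gS_def[symmetric] weak_dS_iff[OF q0] by auto
 have a1: "AE p in N. p : Omega r0 --> gr p = E1 p * q1 U p"
  by (rule wr_unique[OF L2loc_lint[OF gr(1)] graph_lint(1)[OF U] gr(2) graph_wr[OF U]])
 have a2: "AE p in N. ALL j:UNIV. p : Omega r0 --> gS j p = E3 p * qS U j p"
  using ws_unique[OF L2loc_lint[OF gS(1)] graph_lint(2)[OF U] gS(2) graph_ws[OF U]] by (intro AE_finite_allI) simp_all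
 note sg = sqint_snd[OF graph_sqint(1)[OF U]]
 note [measurable] = sqint_H_borel[OF sg]
 have "form_b r0 F G m (q0 U) = (\<integral>\<^sup>+p. ennreal (cb (fst p) * (norm (gr p))\<^sup>2 + cc (fst p) * (SUM j:UNIV. (norm (gS j p))\<^sup>2) + cd (fst p) * (norm (q0 U p))\<^sup>2) \<partial>B)"
  unfolding form_b_def Let_def gr_def gS_def n[symmetric] ..
 also have "... = (\<integral>\<^sup>+p. ennreal (wt p * (norm (snd (U p)))\<^sup>2) \<partial>B)"
 proof (rule nn_integral_cong_AE)
  show "AE p in B. ennreal (cb (fst p) * (norm (gr p))\<^sup>2 + cc (fst p) * (SUM j:UNIV. (norm (gS j p))\<^sup>2) + cd (fst p) * (norm (q0 U p))\<^sup>2) = ennreal (wt p * (norm (snd (U p)))\<^sup>2)"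
   unfolding AE_B_iff using a1 a2 graph_mass[OF U]
  proof eventually_elim
   case (elim p)
   show ?case
   proof
    assume p: "p : Omega r0"
    obtain r x where rx: "p = (r, x)" by (cases p)
    have h: "r0 < r" "norm x = 1" using p rx by (auto simp: Omega_def)
    note ce = coef_E[OF h(1), of x]
    have "cb r * (norm (gr p))\<^sup>2 = ca r * (norm (q1 U p))\<^sup>2" using elim(1) p ce(1) by (simp add: rx norm_mult power_mult_distrib)
    moreover have "cc r * (SUM j:UNIV. (norm (gS j p))\<^sup>2) = ca r * (SUM j:UNIV. (norm (qS U j p))\<^sup>2)"
    proof -
     have "cc r * (norm (gS j p))\<^sup>2 = ca r * (norm (qS U j p))\<^sup>2" for j
      using elim(2) p ce(2) by (simp add: rx norm_mult power_mult_distrib)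
     then show ?thesis unfolding sum_distrib_left by simp
    qed
    moreover have "cd r * (norm (q0 U p))\<^sup>2 = ca r * (norm (q2 U p))\<^sup>2" using elim(3) p ce(3) by (simp add: rx norm_mult power_mult_distrib)
    moreover have "(norm (snd (U p)))\<^sup>2 = (norm (q1 U p))\<^sup>2 + ((norm (q2 U p))\<^sup>2 + (SUM j:UNIV. (norm (qS U j p))\<^sup>2))"
     by (simp only: norm_prod_sq norm_vec_sq)
    ultimately show "ennreal (cb (fst p) * (norm (gr p))\<^sup>2 + cc (fst p) * (SUM j:UNIV. (norm (gS j p))\<^sup>2) + cd (fst p) * (norm (q0 U p))\<^sup>2) = ennreal (wt p * (norm (snd (U p)))\<^sup>2)"
     using wt_eq[OF h] rx by (simp add: algebra_simps)
   qed
  qed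
 qed
 also have "... = (\<integral>\<^sup>+p. ennreal (indicator (Omega r0) p) * ennreal (wt p * (norm (snd (U p)))\<^sup>2) \<partial>N)"
  unfolding B_eq using Omega_borel by (intro nn_integral_density) measurable
 also have "... = (\<integral>\<^sup>+p. ennreal (wt p * (norm (snd (U p)))\<^sup>2) \<partial>N)"
  by (intro nn_integral_cong) (auto simp: wt_zero indicator_def)
 also have "... = ennreal (LINT p|N. wt p *\<^sub>R (norm (snd (U p)))\<^sup>2)"
  using sqint_integrable[OF sg] wt_nonneg by (subst (asm) integrable_H_iff) (auto intro!: nn_integral_eq_integral)
 also have "(LINT p|N. wt p *\<^sub>R (norm (snd (U p)))\<^sup>2) = sqnorm H (%p. snd (U p))"
  unfolding sqnorm_def by (rule integral_H[symmetric]) measurable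
 finally show "form_b r0 F G m (q0 U) = ennreal (sqnorm H (%p. snd (U p)))" .
qed

text \<open>Testing \<open>u\<close> with itself shows that the energy of \<open>u\<close> is the
  pairing of \<open>v\<close> with \<open>u\<close>, at most half the sum of the squared norms. The
  constant 2 leaves ample room.\<close>

lemma form_op_energy:
 assumes uv: "(u, v) : form_op H (perp H KK)" and sub: "perp H KK \<subseteq> perp H KE"
 shows "u : energy_space r0 F G m" "energy_norm r0 F G m u <= 2 * sqrt ((Lnorm H u)\<^sup>2 + (Lnorm H v)\<^sup>2)"
proof -
 obtain g where g: "(%p. (u p, g p)) : perp H KK" "ALL W:perp H KK. ip H v (%p. fst (W p)) = ip H g (%p. snd (W p))" and s: "sqint H u" "sqint H v"
  by (rule form_opE[OF uv])
 have gE: "(%p. (u p, g p)) : perp H KE" using g(1) sub by blast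
 have sg: "sqint H g" using sqint_snd[OF graph_sqint(1)[OF gE]] by simp
 note fb = graph_form_b[OF gE, unfolded fst_conv snd_conv]
 show "u : energy_space r0 F G m" unfolding energy_space_def L2_iff_sqint using s(1) fb by simp
 have "ip H v u = sqnorm H g" using g(2)[rule_format, OF g(1)] by (simp add: ip_self)
 moreover have "2 * ip H v u <= sqnorm H u + sqnorm H v"
  using sqnorm_diff[OF s] sqnorm_nonneg[of H "%p. u p - v p"] by (simp add: ip_commute)
 ultimately have "sqnorm H u + sqnorm H g <= 4 * (sqnorm H u + sqnorm H v)"
  using sqnorm_nonneg[of H u] sqnorm_nonneg[of H v] by simp
 then have "sqrt (sqnorm H u + sqnorm H g) <= sqrt (4 * (sqnorm H u + sqnorm H v))" by (rule real_sqrt_le_mono)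
 also have "... = 2 * sqrt (sqnorm H u + sqnorm H v)" by (subst real_sqrt_mult) simp
 finally show "energy_norm r0 F G m u <= 2 * sqrt ((Lnorm H u)\<^sup>2 + (Lnorm H v)\<^sup>2)"
  unfolding energy_norm_def fb(1) Lnorm_eq by (simp add: sqnorm_nonneg)
qed

end

section \<open>The operator on test functions\<close>

lemma smooth1_power_sum: "smooth1 (%x. \<Sum>i\<le>k. c i * x ^ i)"
proof -
 have "(%x. \<Sum>i\<le>k. c i * x ^ i) = poly (\<Sum>i\<le>k. monom (c i) i)"
  by (simp add: fun_eq_iff poly_sum poly_monom)
 then show ?thesis using smooth1_poly by simp
qed

text \<open>Approximate the derivative uniformly by a polynomial and integrate from
  \<open>a\<close>; the mean value theorem controls the function itself.\<close>

lemma smooth1_C1_approx: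
 fixes g g' :: "real => real"
 assumes ab: "a < b" and g: "ALL x:{a..b}. (g has_real_derivative g' x) (at x)" and c: "continuous_on {a..b} g'" and e: "0 < e"
 shows "EX P. smooth1 P & (ALL x:{a..b}. \<bar>P x - g x\<bar> <= e * (b - a) & \<bar>deriv P x - g' x\<bar> <= e)"
proof -
 have "EX p. real_polynomial_function p & (ALL x:{a..b}. \<bar>g' x - p x\<bar> < e)"
  by (rule Stone_Weierstrass_real_polynomial_function[OF compact_Icc c e]) blast
 then obtain p where p: "real_polynomial_function p" and pe: "ALL x:{a..b}. \<bar>g' x - p x\<bar> < e" by (elim exE conjE)
 from p obtain k :: nat and al where pk: "p = (%x. \<Sum>i\<le>k. al i * x ^ i)" unfolding real_polynomial_function_iff_sum by (elim exE)
 define Q where "Q x = (\<Sum>i\<le>k. al i / real (Suc i) * x ^ Suc i)" for x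
 define P where "P x = Q x - Q a + g a" for x
 have Q: "(Q has_real_derivative p x) (at x)" for x
  unfolding Q_def[abs_def] pk
 proof (rule DERIV_sum)
  fix i
  have "((%x. al i / real (Suc i) * x ^ Suc i) has_real_derivative al i / real (Suc i) * (real (Suc i) * x ^ i)) (at x)"
   by (intro DERIV_cmult) (use DERIV_pow[of "Suc i" x] in simp)
  then show "((%x. al i / real (Suc i) * x ^ Suc i) has_real_derivative al i * x ^ i) (at x)" by simp
 qed
 have P: "(P has_real_derivative p x) (at x)" for x
  unfolding P_def[abs_def] using Q[of x] by (auto intro!: derivative_eq_intros)
 have "smooth1 P" using smooth1_primitive[OF P] smooth1_power_sum[of al k] by (simp add: pk)
 moreover have "\<bar>deriv P x - g' x\<bar> <= e" if "x : {a..b}" for x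
  using pe[rule_format, OF that] DERIV_imp_deriv[OF P[of x]] by simp
 moreover have "\<bar>P x - g x\<bar> <= e * (b - a)" if x: "x : {a..b}" for x
 proof (cases "x = a")
  case True
  then show ?thesis using e ab by (simp add: P_def)
 next
  case False
  then have ax: "a < x" using x by simp
  have "EX z>a. z < x & (P x - g x) - (P a - g a) = (x - a) * (p z - g' z)"
  proof (rule MVT2[OF ax])
   fix z assume "a <= z" "z <= x"
   then show "((%x. P x - g x) has_real_derivative p z - g' z) (at z)"
    using x by (intro DERIV_diff P g[rule_format]) auto
  qed
  then obtain z where z: "a < z" "z < x" and eq: "(P x - g x) - (P a - g a) = (x - a) * (p z - g' z)" by blast
  have "\<bar>P x - g x\<bar> = (x - a) * \<bar>p z - g' z\<bar>" using eq ax by (simp add: P_def abs_mult)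
  also have "... <= (b - a) * e"
  proof (rule mult_mono)
   show "\<bar>p z - g' z\<bar> <= e" using pe[rule_format, of z] z x by simp
  qed (use x ab in auto)
  finally show ?thesis by (simp add: mult.commute)
 qed
 ultimately show ?thesis by blast
qed

section \<open>Integration by parts with C^1 coefficients\<close>

context exterior
begin

lemma strip_limit:
 assumes h: "integrable N h" and h0: "ALL p. fst p ~: {a..b} --> h p = (0::complex)" and a: "r0 < a"
  and fb: "!!k. f k : borel_measurable borel" and g: "continuous_on {r0<..} g"
  and le: "!!k r. r : {a..b} ==> \<bar>f k r - g r\<bar> <= C * inverse (real (Suc k))"
 shows "(%k. LINT p|N. of_real (f k (fst p)) * h p) \<longlonglongrightarrow> (LINT p|N. of_real (ext g (fst p)) * h p)"
proof -
 obtain D where D: "D >= 0" "ALL r:{a..b}. \<bar>g r\<bar> <= D" using cont_bounded[OF g a] by blast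
 have hb: "h : borel_measurable borel" using borel_measurable_integrable[OF h] measurable_N_iff by blast
 note [measurable] = hb fst_compose_borel[OF fb] fst_compose_borel[OF ext_borel[OF g]]
 have C: "C * inverse (real (Suc k)) <= \<bar>C\<bar>" for k
 proof -
  have "C * inverse (real (Suc k)) <= \<bar>C\<bar> * inverse (real (Suc k))" by (intro mult_right_mono) auto
  also have "... <= \<bar>C\<bar> * 1" by (intro mult_left_mono) (auto simp: inverse_le_1_iff)
  finally show ?thesis by simp
 qed
 show ?thesis
 proof (rule integral_dominated_convergence[where w="%p. (D + \<bar>C\<bar>) * norm (h p)"])
  show "integrable N (%p. (D + \<bar>C\<bar>) * norm (h p))" using h by simp
  show "AE p in N. (%k. of_real (f k (fst p)) * h p) \<longlonglongrightarrow> of_real (ext g (fst p)) * h p"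
  proof (rule AE_I2)
   fix p
   show "(%k. of_real (f k (fst p)) * h p) \<longlonglongrightarrow> of_real (ext g (fst p)) * h p"
   proof (cases "fst p : {a..b}")
    case True
    have "(%k. f k (fst p) - g (fst p)) \<longlonglongrightarrow> 0"
    proof (rule Lim_null_comparison)
     show "\<forall>\<^sub>F k in sequentially. norm (f k (fst p) - g (fst p)) <= C * inverse (real (Suc k))"
      unfolding real_norm_def using le[OF True] by (intro always_eventually allI)
     show "(%k. C * inverse (real (Suc k))) \<longlonglongrightarrow> 0"
      using tendsto_mult_left[OF LIMSEQ_inverse_real_of_nat, of C] by (simp del: of_nat_Suc)
    qed
    then have "(%k. f k (fst p)) \<longlonglongrightarrow> g (fst p)" by (simp add: LIM_zero_iff)
    then show ?thesis using True a by (intro tendsto_intros) simp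
   next
    case False
    then show ?thesis using h0[rule_format, OF False] by simp
   qed
  qed
  show "AE p in N. norm (of_real (f k (fst p)) * h p) <= (D + \<bar>C\<bar>) * norm (h p)" for k
  proof (rule AE_I2)
   fix p
   show "norm (of_real (f k (fst p)) * h p) <= (D + \<bar>C\<bar>) * norm (h p)"
   proof (cases "fst p : {a..b}")
    case True
    have "\<bar>f k (fst p)\<bar> <= D + \<bar>C\<bar>" using le[OF True, of k] D(2)[rule_format, OF True] C[of k] by linarith
    then show ?thesis by (simp add: norm_mult mult_right_mono)
   next
    case False
    then show ?thesis using h0[rule_format, OF False] by simp
   qed
  qed
 qed measurable
qed

lemma C1_approx_sequence:
 assumes a: "r0 < a" "a < b" and be: "!!r. r0 < r ==> (be has_real_derivative be' r) (at r)" and c: "continuous_on {r0<..} be'"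
 shows "EX P. ALL k. smooth1 (P k) & (ALL r:{a..b}. \<bar>P k r - be r\<bar> <= (b - a) * inverse (real (Suc k)) & \<bar>deriv (P k) r - be' r\<bar> <= 1 * inverse (real (Suc k)))"
proof -
 have "ALL k. EX P. smooth1 P & (ALL r:{a..b}. \<bar>P r - be r\<bar> <= (b - a) * inverse (real (Suc k)) & \<bar>deriv P r - be' r\<bar> <= 1 * inverse (real (Suc k)))"
 proof
  fix k :: nat
  have 1: "ALL x:{a..b}. (be has_real_derivative be' x) (at x)" using a by (auto intro!: be)
  have 2: "continuous_on {a..b} be'" using c by (rule continuous_on_subset) (use a in auto)
  from smooth1_C1_approx[OF a(2) 1 2, of "inverse (real (Suc k))"]
  show "EX P. smooth1 P & (ALL r:{a..b}. \<bar>P r - be r\<bar> <= (b - a) * inverse (real (Suc k)) & \<bar>deriv P r - be' r\<bar> <= 1 * inverse (real (Suc k)))"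
   by (simp add: mult.commute)
 qed
 then show ?thesis by (rule choice)
qed

lemma common_strip:
 fixes ze et :: "real * (real^'d) => complex"
 assumes "test_fun r0 ze" "test_fun r0 et"
 shows "EX a b. r0 < a & a < b & (ALL p. fst p ~: {a..b} --> ze p = 0) & (ALL p. fst p ~: {a..b} --> et p = 0)"
proof -
 obtain a b where ab: "r0 < a" "a <= b" and z: "ALL p. fst p ~: {a..b} --> ze p = 0" using test_fun_supp_N[OF assms(1)] by blast
 obtain c d where cd: "r0 < c" "c <= d" and z': "ALL p. fst p ~: {c..d} --> et p = 0" using test_fun_supp_N[OF assms(2)] by blast
 have "ze p = 0 & et p = 0" if "fst p ~: {min a c..max b d + 1}" for p
 proof -
  have "fst p ~: {a..b}" "fst p ~: {c..d}"
   using that min.cobounded1[of a c] min.cobounded2[of a c] max.cobounded1[of b d] max.cobounded2[of b d]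
   by (simp_all only: atLeastAtMost_iff) argo+
  then show ?thesis using z z' by blast
 qed
 then show ?thesis using ab cd by (intro exI[of _ "min a c"] exI[of _ "max b d + 1"]) auto
qed

text \<open>The weak relation tested with \<open>be * ze\<close>, which is no test function as
  \<open>be\<close> is only C^1. Replace \<open>be\<close> by polynomials converging in C^1 on a
  strip containing the support, and pass to the limit in each integral.\<close>

lemma wr_radial:
 assumes ph: "lint ph" and g: "lint g" and w: "wr ph g" and ze: "test_fun r0 ze"
  and be: "!!r. r0 < r ==> (be has_real_derivative be' r) (at r)" and c: "continuous_on {r0<..} be'"
 shows "(LINT p|N. of_real (ext be' (fst p)) * (ph p * ze p)) + (LINT p|N. of_real (ext be (fst p)) * (ph p * dr ze p))
  = - (LINT p|N. of_real (ext be (fst p)) * (g p * ze p))"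
proof -
 have cbe: "continuous_on {r0<..} be" by (rule DERIV_continuous_on[where D=be']) (auto intro: has_field_derivative_at_within be)
 obtain a b where ab: "r0 < a" "a < b" and z: "ALL p. fst p ~: {a..b} --> ze p = 0" "ALL p. fst p ~: {a..b} --> dr ze p = 0"
  using common_strip[OF ze test_fun_dr_test[OF ze]] by blast
 from C1_approx_sequence[OF ab be c] obtain P where P': "ALL k. smooth1 (P k) & (ALL r:{a..b}. \<bar>P k r - be r\<bar> <= (b - a) * inverse (real (Suc k)) & \<bar>deriv (P k) r - be' r\<bar> <= 1 * inverse (real (Suc k)))"
  by blast
 have P: "smooth1 (P k)" for k using P' by blast
 have P1: "\<bar>P k r - be r\<bar> <= (b - a) * inverse (real (Suc k))" "\<bar>deriv (P k) r - be' r\<bar> <= 1 * inverse (real (Suc k))" if "r : {a..b}" for k r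
  using P' that by blast+
 have bm: "P k : borel_measurable borel" "deriv (P k) : borel_measurable borel" for k
  using smooth1_cont[OF P] smooth1_cont[OF smooth1_deriv[OF P]] by (auto intro: borel_measurable_continuous_onI)
 note i1 = lint_test_integrable[OF ph ze] and i2 = lint_test_integrable[OF ph test_fun_dr_test[OF ze]] and i3 = lint_test_integrable[OF g ze]
 have "(%k. LINT p|N. of_real (deriv (P k) (fst p)) * (ph p * ze p)) \<longlonglongrightarrow> (LINT p|N. of_real (ext be' (fst p)) * (ph p * ze p))"
  by (rule strip_limit[OF i1 _ ab(1) bm(2) c P1(2)]) (use z in simp_all)
 moreover have "(%k. LINT p|N. of_real (P k (fst p)) * (ph p * dr ze p)) \<longlonglongrightarrow> (LINT p|N. of_real (ext be (fst p)) * (ph p * dr ze p))"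
  by (rule strip_limit[OF i2 _ ab(1) bm(1) cbe P1(1)]) (use z in simp_all)
 ultimately have l1: "(%k. (LINT p|N. of_real (deriv (P k) (fst p)) * (ph p * ze p)) + (LINT p|N. of_real (P k (fst p)) * (ph p * dr ze p))) \<longlonglongrightarrow>
  (LINT p|N. of_real (ext be' (fst p)) * (ph p * ze p)) + (LINT p|N. of_real (ext be (fst p)) * (ph p * dr ze p))"
  by (rule tendsto_add)
 have l2: "(%k. - (LINT p|N. of_real (P k (fst p)) * (g p * ze p))) \<longlonglongrightarrow> - (LINT p|N. of_real (ext be (fst p)) * (g p * ze p))"
  by (intro tendsto_minus, rule strip_limit[OF i3 _ ab(1) bm(1) cbe P1(1)]) (use z in simp_all)
 have "(LINT p|N. of_real (deriv (P k) (fst p)) * (ph p * ze p)) + (LINT p|N. of_real (P k (fst p)) * (ph p * dr ze p)) = - (LINT p|N. of_real (P k (fst p)) * (g p * ze p))" for k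
 proof -
  have j1: "integrable N (%p. ph p * (of_real (deriv (P k) (fst p)) * ze p))" "integrable N (%p. ph p * (of_real (P k (fst p)) * dr ze p))"
   by (intro lint_test_integrable ph test_fun_smooth_mult ze test_fun_dr_test smooth1_deriv P)+
  have "(LINT p|N. ph p * (of_real (deriv (P k) (fst p)) * ze p)) + (LINT p|N. ph p * (of_real (P k (fst p)) * dr ze p)) = (LINT p|N. ph p * dr (%p. of_real (P k (fst p)) * ze p) p)"
   unfolding dr_radial_mult[OF ze P] distrib_left by (rule Bochner_Integration.integral_add[OF j1, symmetric])
  also have "... = - (LINT p|N. g p * (of_real (P k (fst p)) * ze p))"
   using w test_fun_smooth_mult[OF ze P] unfolding wr_def by blast
  finally show ?thesis by (simp add: mult_ac)
 qed
 from LIMSEQ_unique[OF l1 l2[folded this]] show ?thesis .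
qed

lemma ws_radial:
 assumes ph: "lint ph" and g: "lint (g j)" and w: "ws ph g" and ze: "test_fun r0 ze"
  and be: "!!r. r0 < r ==> (be has_real_derivative be' r) (at r)" and c: "continuous_on {r0<..} be'"
 shows "(LINT p|N. of_real (ext be (fst p)) * (ph p * dSt r0 ze j p))
  = - (LINT p|N. of_real (ext be (fst p)) * (g j p * ze p)) + of_nat n * (LINT p|N. of_real (ext be (fst p)) * (ph p * (of_real (snd p $ j) * ze p)))"
proof -
 have cbe: "continuous_on {r0<..} be" by (rule DERIV_continuous_on[where D=be']) (auto intro: has_field_derivative_at_within be)
 obtain a b where ab: "r0 < a" "a < b" and z: "ALL p. fst p ~: {a..b} --> ze p = 0" "ALL p. fst p ~: {a..b} --> dSt r0 ze j p = 0"
  using common_strip[OF ze test_fun_dSt[OF ze]] by blast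
 from C1_approx_sequence[OF ab be c] obtain P where P': "ALL k. smooth1 (P k) & (ALL r:{a..b}. \<bar>P k r - be r\<bar> <= (b - a) * inverse (real (Suc k)) & \<bar>deriv (P k) r - be' r\<bar> <= 1 * inverse (real (Suc k)))"
  by blast
 have P: "smooth1 (P k)" for k using P' by blast
 have P1: "\<bar>P k r - be r\<bar> <= (b - a) * inverse (real (Suc k))" if "r : {a..b}" for k r using P' that by blast
 have bm: "P k : borel_measurable borel" for k
  using smooth1_cont[OF P] by (auto intro: borel_measurable_continuous_onI)
 note i1 = lint_test_integrable[OF ph test_fun_dSt[OF ze]] and i2 = lint_test_integrable[OF ph test_fun_coord[OF ze]] and i3 = lint_test_integrable[OF g ze]
 have l1: "(%k. LINT p|N. of_real (P k (fst p)) * (ph p * dSt r0 ze j p)) \<longlonglongrightarrow> (LINT p|N. of_real (ext be (fst p)) * (ph p * dSt r0 ze j p))"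
  by (rule strip_limit[OF i1 _ ab(1) bm cbe P1]) (use z in simp_all)
 have l2: "(%k. - (LINT p|N. of_real (P k (fst p)) * (g j p * ze p)) + of_nat n * (LINT p|N. of_real (P k (fst p)) * (ph p * (of_real (snd p $ j) * ze p)))) \<longlonglongrightarrow>
   - (LINT p|N. of_real (ext be (fst p)) * (g j p * ze p)) + of_nat n * (LINT p|N. of_real (ext be (fst p)) * (ph p * (of_real (snd p $ j) * ze p)))"
  by (intro tendsto_add tendsto_minus tendsto_mult_left strip_limit[OF i3 _ ab(1) bm cbe P1] strip_limit[OF i2 _ ab(1) bm cbe P1]) (use z in simp_all)
 have "(LINT p|N. of_real (P k (fst p)) * (ph p * dSt r0 ze j p)) = - (LINT p|N. of_real (P k (fst p)) * (g j p * ze p)) + of_nat n * (LINT p|N. of_real (P k (fst p)) * (ph p * (of_real (snd p $ j) * ze p)))" for k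
 proof -
  have "(LINT p|N. ph p * dSt r0 (%p. of_real (P k (fst p)) * ze p) j p) = - (LINT p|N. g j p * (of_real (P k (fst p)) * ze p))
    + of_nat n * (LINT p|N. of_real (snd p $ j) * ph p * (of_real (P k (fst p)) * ze p))"
   using w test_fun_smooth_mult[OF ze P] unfolding ws_def by blast
  then show ?thesis unfolding dSt_radial_mult[OF ze P] by (simp add: mult_ac)
 qed
 from LIMSEQ_unique[OF l1 l2[folded this]] show ?thesis .
qed

definition cb' :: "real => real" where
 "cb' r = real n * r powr (real n - 1) * sqrt (F r / G r) + r powr real n * (inverse (sqrt (F r / G r)) / 2 * ((F1 r * G r - F r * G1 r) / (G r * G r)))"
definition cc' :: "real => real" where
 "cc' r = (real n - 2) * r powr (real n - 2 - 1) * sqrt (F r * G r) + r powr (real n - 2) * (inverse (sqrt (F r * G r)) / 2 * (F1 r * G r + G1 r * F r))"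

lemma dcb: assumes "r0 < r" shows "(cb has_real_derivative cb' r) (at r)"
proof -
 have p: "0 < r" "0 < F r" "0 < G r" using assms r0 Fpos Gpos by auto
 have 1: "((%s. sqrt (F s / G s)) has_real_derivative inverse (sqrt (F r / G r)) / 2 * ((F1 r * G r - F r * G1 r) / (G r * G r))) (at r)"
  using p by (intro DERIV_chain'[of "%s. F s / G s", OF DERIV_divide[OF dF[OF assms] dG[OF assms]] DERIV_real_sqrt]) auto
 show ?thesis unfolding coef_b_def[abs_def] cb'_def
  using DERIV_mult[OF has_real_derivative_powr[OF p(1)] 1, of "real n"] by (simp add: algebra_simps)
qed

lemma dcc: assumes "r0 < r" shows "(cc has_real_derivative cc' r) (at r)"
proof -
 have p: "0 < r" "0 < F r" "0 < G r" using assms r0 Fpos Gpos by auto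
 have 1: "((%s. sqrt (F s * G s)) has_real_derivative inverse (sqrt (F r * G r)) / 2 * (F1 r * G r + G1 r * F r)) (at r)"
  using p by (intro DERIV_chain'[of "%s. F s * G s", OF DERIV_mult[OF dF[OF assms] dG[OF assms]] DERIV_real_sqrt]) auto
 show ?thesis unfolding coef_c_def[abs_def] cc'_def
  using DERIV_mult[OF has_real_derivative_powr[OF p(1)] 1, of "real n - 2"] by (simp add: algebra_simps)
qed

lemma ccb': "continuous_on {r0<..} cb'" and ccc': "continuous_on {r0<..} cc'"
 unfolding cb'_def[abs_def] cc'_def[abs_def]
 using Fne Gne by (auto intro!: continuous_intros cF cG cF1 cG1 cpow)

lemma strip_bounded_add: assumes "strip_bounded f" "strip_bounded g" shows "strip_bounded (%p. f p + g p)"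
proof -
 obtain a b C where ab: "r0 < a" "0 <= C" and z: "ALL p. fst p ~: {a..b} --> f p = 0" and C: "ALL p. norm (f p) <= C"
  using assms(1) unfolding strip_bounded_def by blast
 obtain a' b' C' where ab': "r0 < a'" "0 <= C'" and z': "ALL p. fst p ~: {a'..b'} --> g p = 0" and C': "ALL p. norm (g p) <= C'"
  using assms(2) unfolding strip_bounded_def by blast
 have "norm (f p + g p) <= C + C'" for p using C[rule_format, of p] C'[rule_format, of p] norm_triangle_ineq[of "f p" "g p"] by linarith
 moreover have "f p + g p = 0" if "fst p ~: {min a a'..max b b'}" for p
  using z[rule_format, of p] z'[rule_format, of p] that by (auto simp: min_le_iff_disj le_max_iff_disj)
 moreover have "r0 < min a a'" "0 <= C + C'" using ab ab' by auto
 moreover have "(%p. f p + g p) : borel_measurable borel" using assms[THEN strip_bounded_borel] by measurable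
 ultimately show ?thesis unfolding strip_bounded_def by blast
qed

lemma strip_bounded_scale: assumes "strip_bounded f" shows "strip_bounded (%p. c * f p)"
proof -
 obtain a b C where ab: "r0 < a" "0 <= C" and z: "ALL p. fst p ~: {a..b} --> f p = 0" and C: "ALL p. norm (f p) <= C"
  using assms(1) unfolding strip_bounded_def by blast
 have "norm (c * f p) <= norm c * C" for p using C[rule_format, of p] by (simp add: norm_mult mult_left_mono)
 moreover have "ALL p. fst p ~: {a..b} --> c * f p = 0" using z by simp
 moreover have "0 <= norm c * C" using ab by simp
 moreover have "(%p. c * f p) : borel_measurable borel" using assms[THEN strip_bounded_borel] by measurable
 ultimately show ?thesis using ab(1) unfolding strip_bounded_def by blast
qed

lemma strip_bounded_sum: assumes "!!j. strip_bounded (f j)" shows "strip_bounded (%p. SUM j:(UNIV::'d set). f j p)"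
proof -
 have "strip_bounded (%p. SUM j:A. f j p)" if "finite A" for A :: "'d set"
  using that by induction (use assms strip_bounded_zero strip_bounded_add in auto)
 then show ?thesis by simp
qed

text \<open>The operator multiplied by its weight \<open>a\<close>, with the radial divergence
  expanded: the form in which it is paired over \<open>N\<close>.\<close>

definition Lop :: "(real * (real^'d) => complex) => real * (real^'d) => complex" where
 "Lop ze p = (-1) * (of_real (ext cb' (fst p)) * dr ze p) + ((-1) * (of_real (ext cb (fst p)) * dr (dr ze) p)
  + ((SUM j:UNIV. (-1) * (of_real (ext cc (fst p)) * dSt r0 (dSt r0 ze j) j p)) + of_real (ext cd (fst p)) * ze p))"

lemma strip_bounded_Lop: assumes ze: "test_fun r0 ze" shows "strip_bounded (Lop ze)"
 unfolding Lop_def[abs_def]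
 by (intro strip_bounded_add strip_bounded_scale strip_bounded_sum strip_bounded_radial strip_bounded_test test_fun_dr_test test_fun_dSt ze ccb' ccb ccc ccd)

lemma Lop_cnj: assumes ps: "test_fun r0 ps" shows "Lop (%p. cnj (ps p)) p = cnj (Lop ps p)"
proof -
 have d: "dr (%p. cnj (ps p)) = (%p. cnj (dr ps p))" "dSt r0 (%p. cnj (ps p)) j = (%p. cnj (dSt r0 ps j p))" for j
  using dr_cnj[OF ps] dSt_cnj[OF ps] by (auto simp: fun_eq_iff)
 show ?thesis
  unfolding Lop_def d dr_cnj[OF test_fun_dr_test[OF ps]] dSt_cnj[OF test_fun_dSt[OF ps]] by simp
qed

lemma A_op_Lop: assumes ps: "test_fun r0 ps" shows "A_op r0 F G m ps p = ia p * Lop ps p"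
proof (cases "p : Omega r0")
 case True
 obtain r x where p: "p = (r, x)" by (cases p)
 have h: "r0 < r" "norm x = 1" using True p by (auto simp: Omega_def)
 have pos: "0 < r" "0 < F r" "0 < G r" using h r0 Fpos Gpos by auto
 have 1: "r powr (- real n) * sqrt (F r / G r) = inverse (ca r)"
  using pos by (simp add: coef_a_def powr_minus real_sqrt_divide field_simps)
 have 2: "m\<^sup>2 * F r = inverse (ca r) * cd r"
 proof -
  have s: "sqrt (G r / F r) * F r = sqrt (F r * G r)"
   using pos by (simp add: real_sqrt_divide real_sqrt_mult field_simps flip: power2_eq_square)
  have "cd r = ca r * (m\<^sup>2 * F r)" unfolding coef_a_def coef_d_def s[symmetric] by (simp only: mult_ac)
  then show ?thesis using ca_pos[OF h(1)] by simp
 qed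
 have "((%s. complex_of_real (cb s)) has_vector_derivative of_real (cb' r)) (at r)"
  using dcb[OF h(1)] by (intro has_vector_derivative_of_real) (simp add: has_real_derivative_iff_has_vector_derivative)
 from vector_derivative_at[OF has_vector_derivative_mult[OF this test_fun_dr[OF test_fun_dr_test[OF ps]]]]
 have 3: "vector_derivative (%s. complex_of_real (cb s) * dr ps (s, x)) (at r) = of_real (cb r) * dr (dr ps) (r, x) + of_real (cb' r) * dr ps (r, x)" .
 have 4: "lapS ps (r, x) = (SUM j:UNIV. dSt r0 (dSt r0 ps j) j (r, x))"
  unfolding lapS_eq[OF ps h] using h by (simp add: dSt_def[OF test_fun_dSt[OF ps]])
 have "A_op r0 F G m ps p = - of_real (inverse (ca r)) * (of_real (cb r) * dr (dr ps) (r, x) + of_real (cb' r) * dr ps (r, x)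
   + of_real (cc r) * (SUM j:UNIV. dSt r0 (dSt r0 ps j) j (r, x))) + of_real (inverse (ca r) * cd r) * ps (r, x)"
  using True unfolding A_op_def p Let_def n[symmetric] fst_conv snd_conv coef_b_def[symmetric] coef_c_def[symmetric] 1 2 3 4 by simp
 also have "... = of_real (inverse (ca r)) * Lop ps p"
  unfolding Lop_def p fst_conv ext_eq[OF h(1)] of_real_mult sum_distrib_left[symmetric] by (simp add: algebra_simps del: of_real_inverse)
 finally show ?thesis unfolding ia_def p fst_conv ext_eq[OF h(1)] .
next
 case False
 have z: "f p = 0" if "test_fun r0 f" for f :: "real * (real^'d) => complex" using test_fun_Omega[OF that False] .
 have "Lop ps p = 0"
  unfolding Lop_def by (simp add: z[OF ps] z[OF test_fun_dr_test[OF ps]] z[OF test_fun_dr_test[OF test_fun_dr_test[OF ps]]] z[OF test_fun_dSt[OF test_fun_dSt[OF ps]]])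
 then show ?thesis using False by (simp add: A_op_def)
qed

lemma dSt_radial: assumes "test_fun r0 ze" shows "(SUM j:UNIV. of_real (snd p $ j) * dSt r0 ze j p) = 0"
proof (cases "r0 < fst p & norm (snd p) = 1")
 case True
 then show ?thesis using dS_radial[OF assms, of "fst p" "snd p"] by (simp add: dSt_def[OF assms] scaleR_conv_of_real)
next
 case False
 then have "dSt r0 ze j p = 0" for j by (auto simp: dSt_def[OF assms])
 then show ?thesis by simp
qed

text \<open>Each derivative is moved once onto \<open>W\<close>. The curvature terms produced on the
  sphere pair the coordinates with the tangential gradient of \<open>ze\<close> and cancel by
  \<open>dSt_radial\<close>.\<close>

lemma Lop_weak:
 assumes W: "W : perp H KE" and ze: "test_fun r0 ze"
 shows "(LINT p|N. q0 W p * Lop ze p) = (LINT p|N. of_real (ext cb (fst p)) * ((E1 p * q1 W p) * dr ze p))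
  + (SUM j:UNIV. LINT p|N. of_real (ext cc (fst p)) * ((E3 p * qS W j p) * dSt r0 ze j p))
  + (LINT p|N. of_real (ext cd (fst p)) * (q0 W p * ze p))"
proof -
 note l0 = lint_of_sqint[OF graph_sqint(2)[OF W]]
 have i: "integrable N (%p. of_real (ext be (fst p)) * (q0 W p * f p))" if "test_fun r0 f" "continuous_on {r0<..} be" for be f
  using lint_test_integrable[OF lint_radial[OF l0 that(2)] that(1)] by (simp add: mult.assoc)
 note dd = test_fun_dr_test[OF ze] test_fun_dr_test[OF test_fun_dr_test[OF ze]] test_fun_dSt[OF test_fun_dSt[OF ze]] test_fun_dSt[OF ze]
 have "(LINT p|N. q0 W p * Lop ze p) = (LINT p|N. (-1) * (of_real (ext cb' (fst p)) * (q0 W p * dr ze p)) + ((-1) * (of_real (ext cb (fst p)) * (q0 W p * dr (dr ze) p))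
  + ((SUM j:UNIV. (-1) * (of_real (ext cc (fst p)) * (q0 W p * dSt r0 (dSt r0 ze j) j p))) + of_real (ext cd (fst p)) * (q0 W p * ze p))))"
  unfolding Lop_def distrib_left sum_distrib_left by (simp only: mult_ac)
 also have "... = - (LINT p|N. of_real (ext cb' (fst p)) * (q0 W p * dr ze p)) + (- (LINT p|N. of_real (ext cb (fst p)) * (q0 W p * dr (dr ze) p))
  + ((SUM j:UNIV. - (LINT p|N. of_real (ext cc (fst p)) * (q0 W p * dSt r0 (dSt r0 ze j) j p))) + (LINT p|N. of_real (ext cd (fst p)) * (q0 W p * ze p))))"
  using i[OF dd(1) ccb'] i[OF dd(2) ccb] i[OF dd(3) ccc] i[OF ze ccd] by (simp add: Bochner_Integration.integral_sum)
 also have "(SUM j:UNIV. - (LINT p|N. of_real (ext cc (fst p)) * (q0 W p * dSt r0 (dSt r0 ze j) j p))) =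
  (SUM j:UNIV. (LINT p|N. of_real (ext cc (fst p)) * ((E3 p * qS W j p) * dSt r0 ze j p))
   - of_nat n * (LINT p|N. of_real (ext cc (fst p)) * (q0 W p * (of_real (snd p $ j) * dSt r0 ze j p))))"
 proof (rule sum.cong[OF refl])
  fix j
  show "- (LINT p|N. of_real (ext cc (fst p)) * (q0 W p * dSt r0 (dSt r0 ze j) j p)) = (LINT p|N. of_real (ext cc (fst p)) * ((E3 p * qS W j p) * dSt r0 ze j p))
   - of_nat n * (LINT p|N. of_real (ext cc (fst p)) * (q0 W p * (of_real (snd p $ j) * dSt r0 ze j p)))"
   using ws_radial[where be=cc and j=j and ze="dSt r0 ze j" and g="%j p. E3 p * qS W j p", OF l0 graph_lint(2)[OF W] graph_ws[OF W] dd(4) dcc ccc'] by simp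
 qed
 also have "... = (SUM j:UNIV. LINT p|N. of_real (ext cc (fst p)) * ((E3 p * qS W j p) * dSt r0 ze j p))"
 proof -
  have "(SUM j:UNIV. LINT p|N. of_real (ext cc (fst p)) * (q0 W p * (of_real (snd p $ j) * dSt r0 ze j p))) =
   (LINT p|N. (SUM j:UNIV. of_real (ext cc (fst p)) * (q0 W p * (of_real (snd p $ j) * dSt r0 ze j p))))"
   by (rule Bochner_Integration.integral_sum[symmetric]) (rule i[OF test_fun_coord[OF dd(4)] ccc])
  also have "... = 0" unfolding sum_distrib_left[symmetric] dSt_radial[OF ze] by simp
  finally show ?thesis by (simp add: sum_subtractf sum_distrib_left[symmetric])
 qed
 finally have eq: "(LINT p|N. q0 W p * Lop ze p) = - (LINT p|N. of_real (ext cb' (fst p)) * (q0 W p * dr ze p)) + (- (LINT p|N. of_real (ext cb (fst p)) * (q0 W p * dr (dr ze) p))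
  + ((SUM j:UNIV. LINT p|N. of_real (ext cc (fst p)) * ((E3 p * qS W j p) * dSt r0 ze j p)) + (LINT p|N. of_real (ext cd (fst p)) * (q0 W p * ze p))))" .
 have alg: "- x + (- y + (s + d)) = z + s + d" if "x + y = - z" for x y z s d :: complex
 proof -
  have "z = - (x + y)" unfolding that by simp
  then show ?thesis by simp
 qed
 show ?thesis
  unfolding eq by (rule alg[OF wr_radial[where be=cb, OF l0 graph_lint(1)[OF W] graph_wr[OF W] dd(1) dcb ccb']])
qed

text \<open>The pair of \<open>A_op\<close> and minus the gradient of \<open>ps\<close> is itself a
  kernel, built from the conjugate of \<open>ps\<close>; \<open>Lop_weak\<close> says that it is
  orthogonal to all of \<open>perp H KE\<close>, which is the form relation for
  \<open>A\<close>.\<close>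

lemma A_op_test:
 assumes W: "W : perp H KE" and ps: "test_fun r0 ps"
 shows "sqint H (A_op r0 F G m ps)" "ip H (A_op r0 F G m ps) (q0 W) = ip H (%p. snd (test_graph ps p)) (%p. snd (W p))"
proof -
 define ze where "ze = (%p. cnj (ps p))"
 have ze: "test_fun r0 ze" unfolding ze_def by (rule test_fun_cnj[OF ps])
 define b1 b2 bS where "b1 p = (-1) * (of_real (ext cb (fst p)) * (E1 p * dr ze p))"
  and "b2 p = (-1) * (of_real (ext ca (fst p)) * (E2 p * ze p))"
  and "bS j p = (-1) * (of_real (ext cc (fst p)) * (E3 p * dSt r0 ze j p))" for p j
 have s: "strip_bounded (Lop ze)" "strip_bounded b1" "strip_bounded b2" "ALL j. strip_bounded (bS j)"
  unfolding b1_def[abs_def] b2_def[abs_def] bS_def[abs_def]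
  by (rule strip_bounded_Lop[OF ze] strip_bounded_scale[OF strip_bounded_radial[OF strip_bounded_E(1)[OF test_fun_dr_test[OF ze]] ccb]]
   strip_bounded_scale[OF strip_bounded_radial[OF strip_bounded_E(2)[OF ze] cca]]
   allI[OF strip_bounded_scale[OF strip_bounded_radial[OF strip_bounded_E(3)[OF test_fun_dSt[OF ze]] ccc]]])+
 \<comment> \<open>\<open>kern\<close> divides by \<open>ca\<close>, so \<open>b1\<close> and
   \<open>bS\<close> reduce to minus the gradient components through
   \<open>cb * E1 = ca / E1\<close> and \<open>cc * E3 = ca / E3\<close>; in \<open>b2\<close> the
   factor \<open>ca\<close> simply cancels.\<close>
 have K: "kern (Lop ze) b1 b2 bS = (%p. (A_op r0 F G m ps p, - snd (test_graph ps p)))"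
 proof (rule HOL.ext)
  fix p :: "real * (real^'d)"
  obtain r x where p: "p = (r, x)" by (cases p)
  have A: "A_op r0 F G m ps p = ia p * cnj (Lop ze p)" unfolding A_op_Lop[OF ps] ze_def Lop_cnj[OF ps] by simp
  have d: "dr ze p = cnj (dr ps p)" "dSt r0 ze j p = cnj (dSt r0 ps j p)" "ze p = cnj (ps p)" for j
   using dr_cnj[OF ps] dSt_cnj[OF ps] by (auto simp: ze_def)
  show "kern (Lop ze) b1 b2 bS p = (A_op r0 F G m ps p, - snd (test_graph ps p))"
  proof (cases "r0 < r")
   case True
   have ca: "ca r ~= 0" using ca_pos[OF True] by simp
   define e1 e3 where "e1 = sqrt (G r / F r)" and "e3 = r / sqrt (F r)"
   have e: "e1 ~= 0" "e3 ~= 0" using True r0 Fpos[OF True] Gpos[OF True] by (auto simp: e1_def e3_def)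
   have c: "cb r * e1\<^sup>2 = ca r" "cc r * e3\<^sup>2 = ca r"
    using coef_E(1,2)[OF True, of x] True unfolding e1_def e3_def E1_def E3_def norm_of_real power2_abs by simp_all
   have "cb r * e1 = ca r * inverse e1" unfolding c(1)[symmetric] using e by (simp add: power2_eq_square)
   moreover have "cc r * e3 = ca r * inverse e3" unfolding c(2)[symmetric] using e by (simp add: power2_eq_square)
   ultimately have "inverse (ca r) * (cb r * e1) = inverse e1" "inverse (ca r) * (cc r * e3) = inverse e3"
    using ca by simp_all
   then have "complex_of_real (inverse (ca r)) * (of_real (cb r) * of_real e1) = of_real (inverse e1)"
    "complex_of_real (inverse (ca r)) * (of_real (cc r) * of_real e3) = of_real (inverse e3)" by (metis of_real_mult)+
   then have cz: "complex_of_real (inverse (ca r)) * (of_real (cb r) * (of_real e1 * z)) = of_real (inverse e1) * z"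
    "complex_of_real (inverse (ca r)) * (of_real (cc r) * (of_real e3 * z)) = of_real (inverse e3) * z"
    "complex_of_real (inverse (ca r)) * (of_real (ca r) * z) = z" for z
    using ca by (simp_all only: mult.assoc[symmetric]) (simp add: mult.assoc[symmetric])
   show ?thesis
    unfolding kern_def A
    using True cz by (simp add: p test_graph_def b1_def b2_def bS_def d[unfolded p] E1_def E2_def E3_def ia_def e1_def[symmetric] e3_def[symmetric] vec_eq_iff del: of_real_inverse inverse_divide)
  next
   case False
   then have "p ~: Omega r0" by (simp add: p Omega_def)
   then have z: "f p = 0" if "test_fun r0 f" for f :: "real * (real^'d) => complex" using test_fun_Omega[OF that] by blast
   show ?thesis unfolding kern_def A b1_def b2_def bS_def test_graph_def z[OF ps] z[OF ze] z[OF test_fun_dr_test[OF ps]] z[OF test_fun_dr_test[OF ze]]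
    z[OF test_fun_dSt[OF ps]] z[OF test_fun_dSt[OF ze]] by (simp add: vec_eq_iff)
  qed
 qed
 have sK: "sqint H (%p. (A_op r0 F G m ps p, - snd (test_graph ps p)))" using sqint_kern[OF s] unfolding K .
 then show sA: "sqint H (A_op r0 F G m ps)" using sqint_fst[OF sK] by simp
 note sW = graph_sqint[OF W]
 have "(LINT p|N. q0 W p * Lop ze p) + (LINT p|N. q1 W p * b1 p) + (LINT p|N. q2 W p * b2 p) + (SUM j:UNIV. LINT p|N. qS W j p * bS j p) = 0"
 proof -
  have 1: "(LINT p|N. q1 W p * b1 p) = - (LINT p|N. of_real (ext cb (fst p)) * ((E1 p * q1 W p) * dr ze p))"
   unfolding b1_def by (simp add: mult_ac)
  have 2: "(LINT p|N. qS W j p * bS j p) = - (LINT p|N. of_real (ext cc (fst p)) * ((E3 p * qS W j p) * dSt r0 ze j p))" for j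
   unfolding bS_def by (simp add: mult_ac)
  have "(LINT p|N. q2 W p * b2 p) = (LINT p|N. (-1) * (of_real (ext cd (fst p)) * (q0 W p * ze p)))"
  proof (rule integral_cong_AE)
   show "(%p. q2 W p * b2 p) : borel_measurable N"
    using sqint_H_borel[OF sW(4)] strip_bounded_borel[OF s(3)] by measurable
   show "(%p. (-1) * (of_real (ext cd (fst p)) * (q0 W p * ze p))) : borel_measurable N"
    using sqint_H_borel[OF sW(2)] test_fun_borel[OF ze] fst_compose_borel[OF ext_borel[OF ccd]] by measurable
   show "AE p in N. q2 W p * b2 p = (-1) * (of_real (ext cd (fst p)) * (q0 W p * ze p))"
    using graph_mass[OF W]
   proof eventually_elim
    case (elim p)
    show ?case
    proof (cases "p : Omega r0")
     case True
     then have r: "r0 < fst p" by (simp add: Omega_def mem_Times_iff)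
     have "complex_of_real (cd (fst p)) = of_real (ca (fst p)) * (E2 p * E2 p)"
      using coef_E(3)[OF r, of "snd p"] r by (simp add: E2_def power2_eq_square flip: of_real_mult)
     then show ?thesis using elim True r by (simp add: b2_def mult_ac)
    next
     case False
     then show ?thesis using test_fun_Omega[OF ze False] by (simp add: b2_def)
    qed
   qed
  qed
  then show ?thesis unfolding Lop_weak[OF W ze] 1 2 by (simp add: sum_negf)
 qed
 then have "0 = ip H W (%p. (A_op r0 F G m ps p, - snd (test_graph ps p)))"
  using ip_kern[OF sW(1) s] unfolding K by simp
 also have "... = ip H (q0 W) (A_op r0 F G m ps) + ip H (%p. snd (W p)) (%p. - snd (test_graph ps p))"
  using ip_pair[OF sW(1) sK] by simp
 also have "ip H (%p. snd (W p)) (%p. - snd (test_graph ps p)) = - ip H (%p. snd (W p)) (%p. snd (test_graph ps p))"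
  using ip_scale_right[of H _ "-1"] by simp
 finally show "ip H (A_op r0 F G m ps) (q0 W) = ip H (%p. snd (test_graph ps p)) (%p. snd (W p))"
  by (simp add: ip_commute)
qed

lemma A_op_extension:
 assumes KK: "form_space H KK JJ" and sub: "perp H KK \<subseteq> perp H KE" and t: "!!et. test_fun r0 et ==> test_graph et : perp H KK"
 shows "sa_extension_of_A r0 F G m (form_op H (perp H KK))"
 unfolding sa_extension_of_A_def
proof (intro conjI allI impI)
 interpret form_space H KK JJ by fact
 show "selfadjoint H (form_op H (perp H KK))" by (rule form_op_selfadjoint)
 fix ps :: "real * (real^'d) => complex" assume ps: "test_fun r0 ps"
 have g: "(%p. (ps p, snd (test_graph ps p))) = test_graph ps" by (simp add: test_graph_def)
 show "(ps, A_op r0 F G m ps) : form_op H (perp H KK)"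
 proof (rule form_opI)
  show "(%p. (ps p, snd (test_graph ps p))) : perp H KK" unfolding g by (rule t[OF ps])
  show "sqint H ps" by (rule sqint_strip[OF strip_bounded_test[OF ps]])
  show "sqint H (A_op r0 F G m ps)" by (rule A_op_test(1)[OF test_graph[OF ps] ps])
  show "ip H (A_op r0 F G m ps) (q0 W) = ip H (%p. snd (test_graph ps p)) (%p. snd (W p))" if "W : perp H KK" for W
   using A_op_test(2)[OF _ ps] that sub by blast
 qed
qed

end

section \<open>Uniqueness for infinite travel time\<close>

lemma word_fun_le_1: "norm x = 1 ==> \<bar>word_fun w x\<bar> <= 1"
proof (induction w)
 case (Cons j w)
 then show ?case using component_le_norm_cart[of x j] by (simp add: word_fun_Cons abs_mult mult_le_one)
qed (simp add: word_fun_def)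

lemma low_moment:
 fixes z :: "real^'d::finite => complex"
 assumes q: "q : low k" and z: "integrable sphere_measure z"
  and 0: "ALL w. length w < k --> (LINT x|sphere_measure. word_fun w x *\<^sub>R z x) = 0"
 shows "integrable sphere_measure (%x. q x *\<^sub>R z x)" "(LINT x|sphere_measure. q x *\<^sub>R z x) = 0"
proof -
 obtain L where L: "q = (%x. \<Sum>(c, w)\<leftarrow>L. c * word_fun w x)" "ALL (c, w):set L. length w < k"
  using q unfolding low_def by blast
 have "integrable sphere_measure (%x. (\<Sum>(c, w)\<leftarrow>L. c * word_fun w x) *\<^sub>R z x) & (LINT x|sphere_measure. (\<Sum>(c, w)\<leftarrow>L. c * word_fun w x) *\<^sub>R z x) = 0"
  using L(2)
 proof (induction L)
  case (Cons cw L)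
  obtain c w where cw: "cw = (c, w)" by (cases cw)
  have i: "integrable sphere_measure (%x. c *\<^sub>R (word_fun w x *\<^sub>R z x))"
   by (intro integrable_scaleR_right sphere_cont_mult_integrable z word_fun_continuous)
  have "(LINT x|sphere_measure. c *\<^sub>R (word_fun w x *\<^sub>R z x)) = 0"
   unfolding Bochner_Integration.integral_scaleR_right using 0[rule_format, of w] Cons.prems by (simp add: cw)
  moreover have "integrable sphere_measure (%x. (\<Sum>(c, w)\<leftarrow>L. c * word_fun w x) *\<^sub>R z x)" "(LINT x|sphere_measure. (\<Sum>(c, w)\<leftarrow>L. c * word_fun w x) *\<^sub>R z x) = 0"
   using Cons by auto
  ultimately show ?case using i by (simp add: cw scaleR_left_distrib scaleR_scaleR[symmetric] del: scaleR_scaleR)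
 qed simp
 then show "integrable sphere_measure (%x. q x *\<^sub>R z x)" "(LINT x|sphere_measure. q x *\<^sub>R z x) = 0"
  unfolding L(1) by auto
qed

context exterior
begin

text \<open>The radial part of \<open>a (A + 1)\<close> on monomials of degree \<open>k\<close>,
  modulo lower degree: \<open>k (k + CARD('d) - 2)\<close> comes from the sphere, the summand
  \<open>ca\<close> from the shift by 1.\<close>

definition mode_op :: "nat => (real => real) => real => real" where
 "mode_op k th r = (cd r + ca r + real k * (real k + real CARD('d) - 2) * cc r) * th r - cb r * deriv (deriv th) r - cb' r * deriv th r"

lemma slice_borel: assumes "y : borel_measurable borel" shows "(%x::real^'d. y (r, x)) : borel_measurable borel"
 by (rule measurable_compose[OF _ assms]) (auto intro!: borel_measurable_continuous_onI continuous_intros)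

lemma mode_pointwise:
 fixes w :: "'d list"
 assumes th: "ctest r0 th" and h: "r0 < r" "norm x = 1"
  and q: "lapS (sep_fun th (word_fun w)) (r, x) = of_real (th r * (q x - real (length w) * (real (length w) + real CARD('d) - 2) * word_fun w x))"
 shows "Lop (sep_fun th (word_fun w)) (r, x) + of_real (ca r) * sep_fun th (word_fun w) (r, x) =
  of_real (mode_op (length w) th r * word_fun w x - cc r * th r * q x)"
proof -
 note s = ctest_smooth1[OF th]
 have t: "test_fun r0 (sep_fun th (word_fun w))" by (rule test_fun_sep[OF th])
 have 2: "dr (dr (sep_fun th (word_fun w))) (r, x) = of_real (deriv (deriv th) r * word_fun w x)"
 proof -
  have "(%s. dr (sep_fun th (word_fun w)) (s, x)) = (%s. sep_fun (deriv th) (word_fun w) (s, x))"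
   using h(2) by (auto simp: fun_eq_iff dr_sep_fun[OF s h(2)] sep_fun_unit)
  then have "dr (dr (sep_fun th (word_fun w))) (r, x) = dr (sep_fun (deriv th) (word_fun w)) (r, x)" by (simp add: dr_def)
  then show ?thesis using dr_sep_fun[OF smooth1_deriv[OF s] h(2)] by simp
 qed
 have 3: "(SUM j:UNIV. dSt r0 (dSt r0 (sep_fun th (word_fun w)) j) j (r, x)) = lapS (sep_fun th (word_fun w)) (r, x)"
  unfolding lapS_eq[OF t h] using h by (simp add: dSt_def[OF test_fun_dSt[OF t]])
 have "Lop (sep_fun th (word_fun w)) (r, x) = of_real (- (cb' r * (deriv th r * word_fun w x)) - cb r * (deriv (deriv th) r * word_fun w x)
   - cc r * (th r * (q x - real (length w) * (real (length w) + real CARD('d) - 2) * word_fun w x)) + cd r * (th r * word_fun w x))"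
  unfolding Lop_def fst_conv ext_eq[OF h(1)] sum_distrib_left[symmetric] 2 3 q dr_sep_fun[OF s h(2)] sep_fun_unit[OF h(2)]
  by (simp only: of_real_add of_real_diff of_real_minus of_real_mult) (simp add: algebra_simps)
 then have "Lop (sep_fun th (word_fun w)) (r, x) + of_real (ca r) * sep_fun th (word_fun w) (r, x) =
  of_real (- (cb' r * (deriv th r * word_fun w x)) - cb r * (deriv (deriv th) r * word_fun w x)
   - cc r * (th r * (q x - real (length w) * (real (length w) + real CARD('d) - 2) * word_fun w x)) + cd r * (th r * word_fun w x) + ca r * (th r * word_fun w x))"
  unfolding sep_fun_unit[OF h(2)] by simp
 also have "... = of_real (mode_op (length w) th r * word_fun w x - cc r * th r * q x)"
  by (intro arg_cong[where f=of_real]) (simp add: mode_op_def algebra_simps)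
 finally show ?thesis .
qed

text \<open>Tested with a radial function times a monomial, the equation involves the moment for
  \<open>w\<close> and moments of lower degree. The latter vanish by assumption, so a single radial
  equation remains.\<close>

lemma mode_weak:
 assumes l: "lint y" and z: "!!ps. test_fun r0 ps ==> (LINT p|N. y p * (Lop ps p + of_real (ext ca (fst p)) * ps p)) = 0"
  and low0: "!!w'. length w' < length w ==> AE r in lborel. r0 < r --> mom y w' r = 0" and th: "ctest r0 th"
 shows "integrable lborel (%r. mode_op (length w) th r *\<^sub>R mom y w r)" "(LINT r|lborel. mode_op (length w) th r *\<^sub>R mom y w r) = 0"
proof -
 define ps where "ps = sep_fun th (word_fun w)"
 have t: "test_fun r0 ps" unfolding ps_def by (rule test_fun_sep[OF th])
 define g where "g p = Lop ps p + of_real (ext ca (fst p)) * ps p" for p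
 have sg: "strip_bounded g" unfolding g_def[abs_def]
  by (intro strip_bounded_add strip_bounded_Lop t strip_bounded_radial[OF strip_bounded_test[OF t]] cca)
 have i: "integrable N (%(r, x). y (r, x) * g (r, x))" using lint_strip_integrable[OF l sg] by (simp add: case_prod_beta')
 have "EX q:low (length w). ALL th r x. norm x = 1 --> lapS (sep_fun th (word_fun w)) (r, x) =
   of_real (th r * (q x - real (length w) * (real (length w) + real CARD('d) - 2) * word_fun w x))"
 proof (rule lapS_word[of w])
  fix q :: "real^'d => real"
  assume "q : low (length w)" and e: "!!th r x. norm x = 1 ==> lapS (sep_fun th (word_fun w)) (r, x) =
   of_real (th r * (q x - real (length w) * (real (length w) + real CARD('d) - 2) * word_fun w x))"
  then show ?thesis by (intro bexI[of _ q] allI impI e)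
 qed
 then obtain q where q1: "q : low (length w)" and q2: "ALL th r x. norm x = 1 --> lapS (sep_fun th (word_fun w)) (r, x) =
   of_real (th r * (q x - real (length w) * (real (length w) + real CARD('d) - 2) * word_fun w x))" by (elim bexE)
 note q = q1 q2[rule_format]
 have "AE r in lborel. ALL w':(UNIV::'d list set). length w' < length w --> r0 < r --> mom y w' r = 0"
  using low0 by (subst AE_ball_countable[OF countable_words]) (auto intro: AE_I2)
 moreover have "AE r in lborel. r0 < r --> integrable sphere_measure (%x. y (r, x))"
 proof (rule Omega_exhaust_AE)
  fix k show "AE r in lborel. r : {r0 + 1 / real (Suc k)..r0 + real (Suc k)} --> integrable sphere_measure (%x. y (r, x))"
   by (rule strip_moments(2)[OF l]) simp
 qed
 ultimately have AE: "AE r in lborel. (LINT x|sphere_measure. y (r, x) * g (r, x)) = mode_op (length w) th r *\<^sub>R mom y w r"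
 proof eventually_elim
  case (elim r)
  show ?case
  proof (cases "r0 < r")
   case True
   have iy: "integrable sphere_measure (%x. y (r, x))" using elim(2) True by blast
   have m0: "ALL w'. length w' < length w --> (LINT x|sphere_measure. word_fun w' x *\<^sub>R y (r, x)) = 0"
    using elim(1) True unfolding mom_def by blast
   note lq = low_moment[OF q(1) iy m0]
   have iw: "integrable sphere_measure (%x. mode_op (length w) th r *\<^sub>R (word_fun w x *\<^sub>R y (r, x)))"
    by (intro integrable_scaleR_right sphere_cont_mult_integrable iy word_fun_continuous)
   have iq: "integrable sphere_measure (%x. (cc r * th r) *\<^sub>R (q x *\<^sub>R y (r, x)))" by (intro integrable_scaleR_right lq(1))
   have "(LINT x|sphere_measure. y (r, x) * g (r, x)) = (LINT x|sphere_measure. mode_op (length w) th r *\<^sub>R (word_fun w x *\<^sub>R y (r, x)) - (cc r * th r) *\<^sub>R (q x *\<^sub>R y (r, x)))"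
   proof (rule integral_cong_AE)
    show "(%x. y (r, x) * g (r, x)) : borel_measurable sphere_measure"
     using slice_borel[OF lint_borel[OF l], of r] slice_borel[OF strip_bounded_borel[OF sg], of r] by measurable
    show "(%x. mode_op (length w) th r *\<^sub>R (word_fun w x *\<^sub>R y (r, x)) - (cc r * th r) *\<^sub>R (q x *\<^sub>R y (r, x))) : borel_measurable sphere_measure"
     by (rule borel_measurable_diff[OF borel_measurable_integrable[OF iw] borel_measurable_integrable[OF iq]])
    show "AE x in sphere_measure. y (r, x) * g (r, x) = mode_op (length w) th r *\<^sub>R (word_fun w x *\<^sub>R y (r, x)) - (cc r * th r) *\<^sub>R (q x *\<^sub>R y (r, x))"
     using AE_sphere_norm
    proof eventually_elim
     case (elim x)
     have geq: "g (r, x) = of_real (mode_op (length w) th r * word_fun w x - cc r * th r * q x)"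
      unfolding g_def ps_def fst_conv ext_eq[OF True] by (rule mode_pointwise[of th r x w q, OF th True elim q(2)[OF elim, of th r]])
     show ?case unfolding geq scaleR_conv_of_real of_real_diff of_real_mult by (simp only: algebra_simps)
    qed
   qed
   also have "... = mode_op (length w) th r *\<^sub>R mom y w r"
    unfolding Bochner_Integration.integral_diff[OF iw iq] Bochner_Integration.integral_scaleR_right lq(2) mom_def by simp
   finally show ?thesis .
  next
   case False
   have "g (r, x) = 0" for x using strip_bounded_left[OF sg, of "(r, x)"] False by simp
   moreover have "th r = 0" "deriv th r = 0" "deriv (deriv th) r = 0"
    using False ctest_left[OF th] ctest_left[OF ctest_deriv[OF th]] ctest_left[OF ctest_deriv[OF ctest_deriv[OF th]]] by auto
   ultimately show ?thesis by (simp add: mode_op_def)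
  qed
 qed
 have i': "integrable lborel (%r. LINT x|sphere_measure. y (r, x) * g (r, x))" using P.integrable_fst[OF i] by simp
 have bm: "(%r. mode_op (length w) th r *\<^sub>R mom y w r) : borel_measurable lborel"
 proof -
  have "(%r. (ext cd r + ext ca r + real (length w) * (real (length w) + real CARD('d) - 2) * ext cc r) * th r - ext cb r * deriv (deriv th) r - ext cb' r * deriv th r) : borel_measurable borel"
   using ext_borel[OF ccd] ext_borel[OF cca] ext_borel[OF ccc] ext_borel[OF ccb] ext_borel[OF ccb']
    borel_ctest[OF th] borel_ctest[OF ctest_deriv[OF th]] borel_ctest[OF ctest_deriv[OF ctest_deriv[OF th]]] by measurable
  also have "(%r. (ext cd r + ext ca r + real (length w) * (real (length w) + real CARD('d) - 2) * ext cc r) * th r - ext cb r * deriv (deriv th) r - ext cb' r * deriv th r) = mode_op (length w) th"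
  proof
   fix r
   have "~ r0 < r ==> th r = 0 & deriv th r = 0 & deriv (deriv th) r = 0"
    using ctest_left[OF th] ctest_left[OF ctest_deriv[OF th]] ctest_left[OF ctest_deriv[OF ctest_deriv[OF th]]] by auto
   then show "(ext cd r + ext ca r + real (length w) * (real (length w) + real CARD('d) - 2) * ext cc r) * th r - ext cb r * deriv (deriv th) r - ext cb' r * deriv th r = mode_op (length w) th r"
    by (cases "r0 < r") (simp_all add: mode_op_def)
  qed
  finally show ?thesis using mom_borel[OF l, of w] by measurable
 qed
 show "integrable lborel (%r. mode_op (length w) th r *\<^sub>R mom y w r)"
  using i' AE bm by (subst integrable_cong_AE[symmetric, OF borel_measurable_integrable[OF i']]) auto
 have "(LINT r|lborel. mode_op (length w) th r *\<^sub>R mom y w r) = (LINT r|lborel. LINT x|sphere_measure. y (r, x) * g (r, x))"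
  using AE borel_measurable_integrable[OF i'] bm by (intro integral_cong_AE) auto
 also have "... = (LINT p|N. y p * g p)" using P.integral_fst'[OF lint_strip_integrable[OF l sg]] by simp
 also have "... = 0" unfolding g_def by (rule z[OF t])
 finally show "(LINT r|lborel. mode_op (length w) th r *\<^sub>R mom y w r) = 0" .
qed

text \<open>Cauchy-Schwarz on the sphere. The added 1 makes the factor visibly nonzero, so that the
  right side is infinite when its integral is.\<close>

lemma mom_square_bound:
 assumes y: "y : borel_measurable borel"
 shows "ennreal ((norm (mom y w r))\<^sup>2) <= ennreal (measure sphere_measure (UNIV :: (real^'d) set) + 1) * (\<integral>\<^sup>+x. ennreal ((norm (y (r, x)))\<^sup>2) \<partial>sphere_measure)"
proof (cases "(\<integral>\<^sup>+x. ennreal ((norm (y (r, x)))\<^sup>2) \<partial>sphere_measure) < \<infinity>")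
 case False
 then have "(\<integral>\<^sup>+x. ennreal ((norm (y (r, x)))\<^sup>2) \<partial>sphere_measure) = \<infinity>" by (simp add: less_top[symmetric])
 moreover have "ennreal (measure sphere_measure (UNIV :: (real^'d) set) + 1) ~= 0" by (simp add: add_nonneg_pos)
 ultimately show ?thesis by (simp add: ennreal_mult_top)
next
 case True
 note [measurable] = slice_borel[OF y, of r]
 have i2: "integrable sphere_measure (%x. (norm (y (r, x)))\<^sup>2)" using True by (intro integrableI_bounded) auto
 have s1: "sqint sphere_measure (%x. norm (y (r, x)))" unfolding sqint_def using i2 by auto
 have s2: "sqint sphere_measure (%x::real^'d. 1::real)" unfolding sqint_def by simp
 have i1: "integrable sphere_measure (%x. norm (y (r, x)))" using sqint_inner[OF s1 s2] by simp
 have iw: "integrable sphere_measure (%x. word_fun w x *\<^sub>R y (r, x))"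
  by (rule sphere_cont_mult_integrable[OF _ word_fun_continuous]) (use i1 in \<open>simp add: integrable_norm_iff\<close>)
 have "norm (mom y w r) <= (LINT x|sphere_measure. norm (word_fun w x *\<^sub>R y (r, x)))"
  unfolding mom_def by (rule integral_norm_bound)
 also have "... <= (LINT x|sphere_measure. norm (y (r, x)))"
 proof (rule integral_mono_AE[OF integrable_norm[OF iw] i1])
  show "AE x in sphere_measure. norm (word_fun w x *\<^sub>R y (r, x)) <= norm (y (r, x))"
   using AE_sphere_norm
  proof eventually_elim
   case (elim x)
   show ?case using word_fun_le_1[OF elim, of w] by (simp add: mult_left_le_one_le)
  qed
 qed
 finally have "(norm (mom y w r))\<^sup>2 <= (ip sphere_measure (%x. norm (y (r, x))) (%x. 1))\<^sup>2"
  unfolding ip_def by (intro power_mono) simp_all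
 also have "... <= (LINT x|sphere_measure. (norm (y (r, x)))\<^sup>2) * measure sphere_measure (UNIV :: (real^'d) set)"
  using ip_Cauchy_Schwarz[OF s1 s2] by (simp add: sqnorm_def)
 also have "... <= (measure sphere_measure (UNIV :: (real^'d) set) + 1) * (LINT x|sphere_measure. (norm (y (r, x)))\<^sup>2)"
  by (simp add: algebra_simps)
 finally show ?thesis
  unfolding nn_integral_eq_integral[OF i2 AE_I2[OF zero_le_power2]]
  by (subst ennreal_mult[symmetric]) (auto intro!: ennreal_leI)
qed

lemma mom_weighted:
 assumes y: "sqint H y"
 shows "(\<integral>\<^sup>+r. indicator {r0<..} r * ennreal (ca r * (norm (mom y w r))\<^sup>2) \<partial>lborel) < \<infinity>"
proof -
 define M where "M = measure sphere_measure (UNIV :: (real^'d) set) + 1"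
 note [measurable] = sqint_H_borel[OF y]
 have "(\<integral>\<^sup>+r. indicator {r0<..} r * ennreal (ca r * (norm (mom y w r))\<^sup>2) \<partial>lborel) <=
  (\<integral>\<^sup>+r. ennreal M * (\<integral>\<^sup>+x. ennreal (wt (r, x) * (norm (y (r, x)))\<^sup>2) \<partial>sphere_measure) \<partial>lborel)"
 proof (rule nn_integral_mono)
  fix r
  show "indicator {r0<..} r * ennreal (ca r * (norm (mom y w r))\<^sup>2) <= ennreal M * (\<integral>\<^sup>+x. ennreal (wt (r, x) * (norm (y (r, x)))\<^sup>2) \<partial>sphere_measure)"
  proof (cases "r0 < r")
   case True
   note [measurable] = slice_borel[OF sqint_H_borel[OF y], of r]
   have c: "0 <= ca r" using ca_pos[OF True] by simp
   have "ennreal (ca r * (norm (mom y w r))\<^sup>2) = ennreal (ca r) * ennreal ((norm (mom y w r))\<^sup>2)" using c by (simp add: ennreal_mult)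
   also have "... <= ennreal (ca r) * (ennreal M * (\<integral>\<^sup>+x. ennreal ((norm (y (r, x)))\<^sup>2) \<partial>sphere_measure))"
    unfolding M_def by (intro mult_left_mono mom_square_bound sqint_H_borel[OF y]) simp
   also have "... = ennreal M * (\<integral>\<^sup>+x. ennreal (ca r) * ennreal ((norm (y (r, x)))\<^sup>2) \<partial>sphere_measure)"
    by (subst nn_integral_cmult) (auto simp: mult_ac)
   also have "(\<integral>\<^sup>+x. ennreal (ca r) * ennreal ((norm (y (r, x)))\<^sup>2) \<partial>sphere_measure) = (\<integral>\<^sup>+x. ennreal (wt (r, x) * (norm (y (r, x)))\<^sup>2) \<partial>sphere_measure)"
   proof (rule nn_integral_cong_AE, use AE_sphere_norm in eventually_elim)
    fix x :: "real^'d" assume "norm x = 1"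
    then show "ennreal (ca r) * ennreal ((norm (y (r, x)))\<^sup>2) = ennreal (wt (r, x) * (norm (y (r, x)))\<^sup>2)"
     using wt_eq[OF True] c by (simp add: ennreal_mult)
   qed
   finally show ?thesis using True by simp
  qed simp
 qed
 also have "... = ennreal M * (\<integral>\<^sup>+r. \<integral>\<^sup>+x. ennreal (wt (r, x) * (norm (y (r, x)))\<^sup>2) \<partial>sphere_measure \<partial>lborel)"
  by (intro nn_integral_cmult P.M2.borel_measurable_nn_integral_fst[where f="%p. ennreal (wt p * (norm (y p))\<^sup>2)"]) measurable
 also have "(\<integral>\<^sup>+r. \<integral>\<^sup>+x. ennreal (wt (r, x) * (norm (y (r, x)))\<^sup>2) \<partial>sphere_measure \<partial>lborel) = (\<integral>\<^sup>+p. ennreal (wt p * (norm (y p))\<^sup>2) \<partial>N)"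
  by (rule P.M2.nn_integral_fst[where f="%p. ennreal (wt p * (norm (y p))\<^sup>2)"]) measurable
 also have "ennreal M * ... < \<infinity>" using sqint_H_nn[OF y] by (simp add: ennreal_mult_less_top)
 finally show ?thesis .
qed

text \<open>The weight is \<open>r^n\<close> times the integrand of the travel time, and
  \<open>r^n\<close> is bounded below by \<open>r0^n\<close>.\<close>

lemma inf_at_horizon:
 assumes T: "!!r. r0 < r ==> (\<integral>\<^sup>+ s. indicator {r0<..r} s * ennreal (sqrt (G s / F s)) \<partial>lborel) = \<infinity>" and r: "r0 < r"
 shows "(\<integral>\<^sup>+ s. indicator {r0<..r} s * ennreal (ca s) \<partial>lborel) = \<infinity>"
proof -
 note [measurable] = ext_borel[OF cE(1)]
 have p: "0 < r0 powr real n" using r0 by simp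
 have "\<infinity> = ennreal (r0 powr real n) * (\<integral>\<^sup>+ s. indicator {r0<..r} s * ennreal (ext (%s. sqrt (G s / F s)) s) \<partial>lborel)"
 proof -
  have "(\<integral>\<^sup>+ s. indicator {r0<..r} s * ennreal (ext (%s. sqrt (G s / F s)) s) \<partial>lborel) = (\<integral>\<^sup>+ s. indicator {r0<..r} s * ennreal (sqrt (G s / F s)) \<partial>lborel)"
   by (rule nn_integral_cong) (simp add: indicator_def)
  then show ?thesis using T[OF r] p by (simp add: ennreal_mult_top)
 qed
 also have "... = (\<integral>\<^sup>+ s. ennreal (r0 powr real n) * (indicator {r0<..r} s * ennreal (ext (%s. sqrt (G s / F s)) s)) \<partial>lborel)"
  by (rule nn_integral_cmult[symmetric]) measurable
 also have "... <= (\<integral>\<^sup>+ s. indicator {r0<..r} s * ennreal (ca s) \<partial>lborel)"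
 proof (rule nn_integral_mono)
  fix s
  show "ennreal (r0 powr real n) * (indicator {r0<..r} s * ennreal (ext (%s. sqrt (G s / F s)) s)) <= indicator {r0<..r} s * ennreal (ca s)"
  proof (cases "s : {r0<..r}")
   case True
   then have s: "r0 < s" by simp
   have q: "0 <= sqrt (G s / F s)" using Gpos[OF s] Fpos[OF s] by simp
   have "r0 powr real n * sqrt (G s / F s) <= ca s"
    unfolding coef_a_def using s r0 q by (intro mult_right_mono powr_mono2) auto
   then show ?thesis using True s q p by (simp add: ennreal_mult[symmetric] ennreal_leI del: real_sqrt_ge_zero)
  qed simp
 qed
 finally show ?thesis by (simp add: top_unique)
qed

text \<open>By asymptotic flatness the quotient under the root tends to 1, so the weight eventually
  exceeds a positive constant.\<close>

lemma inf_at_infinity: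
 assumes "(F \<longlongrightarrow> 1) at_top" "(G \<longlongrightarrow> 1) at_top" and r: "r0 < r"
 shows "(\<integral>\<^sup>+ s. indicator {r..} s * ennreal (ca s) \<partial>lborel) = \<infinity>"
proof -
 have "((%s. sqrt (G s / F s)) \<longlongrightarrow> sqrt (1 / 1)) at_top" by (intro tendsto_intros assms) simp
 then have "eventually (%s. 1/2 < sqrt (G s / F s)) at_top" by (rule order_tendstoD) simp
 then obtain R where R: "!!s. R <= s ==> 1/2 < sqrt (G s / F s)" unfolding eventually_at_top_linorder by blast
 have p: "0 < r0 powr real n" using r0 by simp
 have inf: "emeasure lborel {max R r..} = \<infinity>"
 proof (rule ccontr)
  assume "emeasure lborel {max R r..} ~= \<infinity>"
  then obtain c where c: "0 <= c" "emeasure lborel {max R r..} = ennreal c" by (cases "emeasure lborel {max R r..}") auto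
  have "emeasure lborel {max R r..max R r + (c + 1)} <= emeasure lborel {max R r..}" by (rule emeasure_mono) auto
  then have "ennreal (c + 1) <= ennreal c" using c by simp
  then show False using c(1) by (simp add: ennreal_le_iff)
 qed
 have "\<infinity> = (\<integral>\<^sup>+ s. ennreal (r0 powr real n / 2) * indicator {max R r..} s \<partial>lborel)"
  using inf p by (subst nn_integral_cmult_indicator) (auto simp: ennreal_mult_top)
 also have "... <= (\<integral>\<^sup>+ s. indicator {r..} s * ennreal (ca s) \<partial>lborel)"
 proof (rule nn_integral_mono)
  fix s
  show "ennreal (r0 powr real n / 2) * indicator {max R r..} s <= indicator {r..} s * ennreal (ca s)"
  proof (cases "s : {max R r..}")
   case True
   then have s: "R <= s" "r <= s" "r0 < s" using r by auto
   have "r0 powr real n * (1/2) <= ca s"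
    unfolding coef_a_def using s r0 R[OF s(1)] by (intro mult_mono powr_mono2) auto
   then show ?thesis using True s by (simp add: ennreal_leI)
  qed simp
 qed
 finally show ?thesis by (simp add: top_unique)
qed

lemma modes_vanish:
 assumes T: "!!r. r0 < r ==> (\<integral>\<^sup>+ s. indicator {r0<..r} s * ennreal (sqrt (G s / F s)) \<partial>lborel) = \<infinity>"
  and lim: "(F \<longlongrightarrow> 1) at_top" "(G \<longlongrightarrow> 1) at_top"
  and y: "sqint H y" and z: "!!ps. test_fun r0 ps ==> (LINT p|N. y p * (Lop ps p + of_real (ext ca (fst p)) * ps p)) = 0"
 shows "AE r in lborel. r0 < r --> mom y w r = 0"
proof (induction "length w" arbitrary: w rule: less_induct)
 case less
 note l = lint_of_sqint[OF y]
 define ka where "ka r = cd r + ca r + real (length w) * (real (length w) + real CARD('d) - 2) * cc r" for r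
 have low0: "AE r in lborel. r0 < r --> mom y w' r = 0" if "length w' < length w" for w' using less[OF that] .
 note mw = mode_weak[OF l z low0]
 have cka: "continuous_on {r0<..} ka" unfolding ka_def by (intro continuous_intros ccd cca ccc)
 have dim2: "0 <= real (length w) * (real (length w) + real CARD('d) - 2)" using dim by (intro mult_nonneg_nonneg) auto
 have ka0: "0 <= ka r" if "r0 < r" for r
  using cd_nonneg[OF that] ca_pos[OF that] mult_nonneg_nonneg[OF dim2, of "cc r"] cc_pos[OF that] by (simp add: ka_def)
 \<comment> \<open>The equation for the moments has real coefficients, so it passes to real and
   imaginary parts, to which the real-valued uniqueness result applies.\<close>
 have ode: "AE r in lborel. r0 < r --> L (mom y w r) = 0"
  if L: "bounded_linear L" and Lle: "!!z. \<bar>L z\<bar> <= norm z" for L :: "complex => real"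
 proof (rule weak_ode_zero[where b=cb and b'=cb' and ka=ka and w=ca])
  show "(%r. L (mom y w r)) : borel_measurable borel"
   by (rule measurable_compose[OF mom_borel[OF l] borel_measurable_continuous_onI[OF linear_continuous_on[OF L]]])
  have "(\<integral>\<^sup>+ r. indicator {r0<..} r * ennreal (ca r * (L (mom y w r))\<^sup>2) \<partial>lborel) <= (\<integral>\<^sup>+ r. indicator {r0<..} r * ennreal (ca r * (norm (mom y w r))\<^sup>2) \<partial>lborel)"
  proof (rule nn_integral_mono)
   fix r
   have "(L (mom y w r))\<^sup>2 <= (norm (mom y w r))\<^sup>2" using power_mono[OF Lle[of "mom y w r"] abs_ge_zero, of 2] by simp
   then show "indicator {r0<..} r * ennreal (ca r * (L (mom y w r))\<^sup>2) <= indicator {r0<..} r * ennreal (ca r * (norm (mom y w r))\<^sup>2)"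
    using ca_pos[of r] by (cases "r0 < r") (auto intro!: ennreal_leI mult_left_mono)
  qed
  then show "(\<integral>\<^sup>+ r. indicator {r0<..} r * ennreal (ca r * (L (mom y w r))\<^sup>2) \<partial>lborel) < \<infinity>"
   using mom_weighted[OF y, of w] by (rule le_less_trans)
  fix f assume f: "ctest r0 f"
  have "(LINT r|lborel. L (mode_op (length w) f r *\<^sub>R mom y w r)) = 0"
   using integral_bounded_linear[OF L mw(1)[OF _ _ f]] mw(2)[OF _ _ f] linear_0[OF bounded_linear.linear[OF L]] by simp
  moreover have "L (mode_op (length w) f r *\<^sub>R mom y w r) = L (mom y w r) * (ka r * f r - cb r * deriv (deriv f) r - cb' r * deriv f r)" for r
   unfolding linear_scale[OF bounded_linear.linear[OF L]] mode_op_def ka_def by simp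
  ultimately show "(LINT r|lborel. L (mom y w r) * (ka r * f r - cb r * deriv (deriv f) r - cb' r * deriv f r)) = 0" by simp
 qed (use dcb cb_pos ccb' cka ka0 cca ca_pos inf_at_horizon[OF T] inf_at_infinity[OF lim] in auto)
 show ?case
  using ode[OF bounded_linear_Re abs_Re_le_cmod] ode[OF bounded_linear_Im abs_Im_le_cmod]
  by eventually_elim (simp add: complex_eq_iff)
qed

text \<open>Conjugating \<open>z\<close> turns orthogonality to the range of \<open>A + 1\<close>
  into a bilinear weak equation over \<open>N\<close>, as needed for the moments.\<close>

lemma deficiency_zero:
 assumes T: "!!r. r0 < r ==> (\<integral>\<^sup>+ s. indicator {r0<..r} s * ennreal (sqrt (G s / F s)) \<partial>lborel) = \<infinity>"
  and lim: "(F \<longlongrightarrow> 1) at_top" "(G \<longlongrightarrow> 1) at_top"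
  and zH: "sqint H z" and z: "!!ps. test_fun r0 ps ==> Linner H (%p. A_op r0 F G m ps p + ps p) z = 0"
 shows "AE p in H. z p = 0"
proof -
 define y where "y p = cnj (z p)" for p
 have y: "sqint H y" unfolding y_def[abs_def] by (rule sqint_cnj[OF zH])
 have w: "(LINT p|N. y p * (Lop ps p + of_real (ext ca (fst p)) * ps p)) = 0" if ps: "test_fun r0 ps" for ps
 proof -
  note [measurable] = sqint_H_borel[OF zH] sqint_H_borel[OF y] test_fun_borel[OF ps] strip_bounded_borel[OF strip_bounded_Lop[OF ps]]
   sqint_H_borel[OF A_op_test(1)[OF test_graph[OF ps] ps]] fst_compose_borel[OF ext_borel[OF cca]]
  have "0 = (LINT p|N. wt p *\<^sub>R ((A_op r0 F G m ps p + ps p) * cnj (z p)))"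
   unfolding z[OF ps, symmetric] Linner_def by (rule integral_H) measurable
  also have "... = (LINT p|N. y p * (Lop ps p + of_real (ext ca (fst p)) * ps p))"
  proof (rule integral_cong_AE)
   show "AE p in N. wt p *\<^sub>R ((A_op r0 F G m ps p + ps p) * cnj (z p)) = y p * (Lop ps p + of_real (ext ca (fst p)) * ps p)"
    using AE_N_unit
   proof eventually_elim
    case (elim p)
    show ?case
    proof (cases "r0 < fst p")
     case True
     have "wt p = ca (fst p)" using wt_eq[OF True elim] by simp
     moreover have "of_real (ca (fst p)) * A_op r0 F G m ps p = Lop ps p"
      unfolding A_op_Lop[OF ps] ia_def using True ca_pos[OF True] by simp
     ultimately show ?thesis using True by (simp add: y_def scaleR_conv_of_real algebra_simps)
    next
     case False
     then have "Lop ps p = 0" "ps p = 0" "wt p = 0"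
      using strip_bounded_left[OF strip_bounded_Lop[OF ps], of p] strip_bounded_left[OF strip_bounded_test[OF ps], of p]
      by (auto simp: wt_def Omega_def indicator_def mem_Times_iff)
     then show ?thesis by simp
    qed
   qed
  qed measurable
  finally show ?thesis by simp
 qed
 have "AE p in N. p : Omega r0 --> y p = 0"
  by (rule moments_zero_AE[OF lint_of_sqint[OF y] modes_vanish[OF T lim y w]])
 then show ?thesis unfolding AE_H_iff y_def by simp
qed

text \<open>For a pair in \<open>S\<close> solve \<open>(T + 1) w = u + v\<close>. Both
  \<open>S\<close> and \<open>T\<close> extend \<open>A\<close>, so \<open>u - w\<close> is
  orthogonal to the range of \<open>A + 1\<close> and vanishes. Thus \<open>S\<close> is contained
  in \<open>T\<close>, and taking adjoints reverses the inclusion.\<close>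

lemma extension_unique:
 assumes T: "!!r. r0 < r ==> (\<integral>\<^sup>+ s. indicator {r0<..r} s * ennreal (sqrt (G s / F s)) \<partial>lborel) = \<infinity>"
  and lim: "(F \<longlongrightarrow> 1) at_top" "(G \<longlongrightarrow> 1) at_top" and E: "sa_extension_of_A r0 F G m S"
 shows "S = form_op H (perp H KE)"
proof -
 interpret form_space H KE JJ by (rule form_space_KE)
 have SS: "adjoint_rel H S = S" and AS: "!!ps. test_fun r0 ps ==> (ps, A_op r0 F G m ps) : S"
  using E unfolding sa_extension_of_A_def selfadjoint_def by blast+
 have "sa_extension_of_A r0 F G m (form_op H (perp H KE))" by (rule A_op_extension[OF form_space_KE order_refl test_graph])
 then have TT: "adjoint_rel H T = T" and AT: "!!ps. test_fun r0 ps ==> (ps, A_op r0 F G m ps) : T"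
  unfolding sa_extension_of_A_def selfadjoint_def by blast+
 have sub: "S \<subseteq> T"
 proof (rule subrelI)
  fix u v assume uv: "(u, v) : S"
  then have "(u, v) : adjoint_rel H S" unfolding SS .
  then have s: "sqint H u" "sqint H v" and a: "ALL (f, g):S. Linner H g u = Linner H f v"
   unfolding adjoint_rel_def L2_iff_sqint by auto
  obtain w where w: "(w, %p. (u p + v p) - w p) : T" by (rule form_op_range[OF sqint_add[OF s]])
  obtain g where sw: "sqint H w" by (rule form_opE[OF w])
  have "AE p in H. u p - w p = 0"
  proof (rule deficiency_zero[OF T lim sqint_diff[OF s(1) sw]])
   fix ps :: "real * (real^'d) => complex" assume ps: "test_fun r0 ps"
   define A where "A = A_op r0 F G m ps"
   have sA: "sqint H A" unfolding A_def by (rule A_op_test(1)[OF test_graph[OF ps] ps])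
   have sps: "sqint H ps" by (rule sqint_strip[OF strip_bounded_test[OF ps]])
   have e1: "Linner H A u = Linner H ps v" using a AS[OF ps] unfolding A_def by blast
   have e2: "Linner H A w = Linner H ps (%p. (u p + v p) - w p)" unfolding A_def by (rule form_op_symmetric[OF AT[OF ps] w])
   note i = sqint_mult[OF sA sqint_cnj[OF s(1)]] sqint_mult[OF sA sqint_cnj[OF sw]] sqint_mult[OF sps sqint_cnj[OF s(1)]]
    sqint_mult[OF sps sqint_cnj[OF s(2)]] sqint_mult[OF sps sqint_cnj[OF sw]]
   have "Linner H (%p. A p + ps p) (%p. u p - w p) = (Linner H A u - Linner H A w) + (Linner H ps u - Linner H ps w)"
    unfolding Linner_def using i by (simp add: algebra_simps)
   also have "... = 0" unfolding e1 e2 unfolding Linner_def using i by (simp add: algebra_simps)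
   finally show "Linner H (%p. A_op r0 F G m ps p + ps p) (%p. u p - w p) = 0" unfolding A_def .
  qed
  then have "AE p in H. w p = u p" "AE p in H. (u p + v p) - w p = v p" by (eventually_elim, simp)+
  then show "(u, v) : T" by (rule form_op_AE[OF w s])
 qed
 moreover have "T \<subseteq> S"
 proof -
  have "adjoint_rel H T \<subseteq> adjoint_rel H S" using sub unfolding adjoint_rel_def by blast
  then show ?thesis unfolding TT SS .
 qed
 ultimately show ?thesis by blast
qed

end

section \<open>A second extension for finite travel time\<close>

lemma smooth1_cutoff: "EX th a b. smooth1 th & c < a & a < b & (ALL x<=a. th x = 1) & (ALL x>=b. th x = 0)"
proof -
 obtain f where f: "ctest c f" "(LINT x|lborel. f x) = 1" using ctest_unit by blast
 obtain a b where ab: "c < a" "a < b" "ALL x. x ~: {a<..<b} --> f x = 0" using ctest_supp[OF f(1)] by blast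
 from ctest_antiderivative[OF f(1) ab(2,3)] f(2)
 obtain h where h: "smooth1 h" "ALL x<=a. h x = 0" "ALL x>=b. h x = 1" by auto
 have "smooth1 (%x. 1 + (-1) * h x)" by (intro smooth1_add smooth1_mult smooth1_const h)
 then show ?thesis using h ab by (intro exI[of _ "%x. 1 + (-1) * h x"] exI[of _ a] exI[of _ b]) auto
qed

lemma measure_sphere_pos: "0 < measure (sphere_measure :: (real^'d::finite) measure) UNIV"
proof -
 have "emeasure (sphere_measure :: (real^'d) measure) UNIV = (\<integral>\<^sup>+x. 1 \<partial>(sphere_measure :: (real^'d) measure))" by simp
 also have "... = of_nat CARD('d) * (\<integral>\<^sup>+x. indicator (cball 0 1) x * 1 \<partial>(lborel :: (real^'d) measure))"
  by (rule nn_integral_sphere) simp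
 also have "... = of_nat CARD('d) * ennreal (measure lborel (cball (0::real^'d) 1))"
  using emeasure_lborel_cball_finite[of "0::real^'d" 1] by (simp add: emeasure_eq_ennreal_measure)
 finally have "emeasure (sphere_measure :: (real^'d) measure) UNIV = of_nat CARD('d) * ennreal (measure lborel (cball (0::real^'d) 1))" .
 moreover have "0 < measure lborel (cball (0::real^'d) 1)" using content_cball_pos[of 1 "0::real^'d"] by simp
 ultimately have "emeasure (sphere_measure :: (real^'d) measure) UNIV ~= 0" by simp
 then show ?thesis by (simp add: measure_def enn2real_positive_iff less_top[symmetric] zero_less_iff_neq_zero sphere.emeasure_finite[simplified])
qed

context exterior
begin

text \<open>Between \<open>r1\<close> and \<open>b\<close> the integrand is continuous, hence
  bounded, so finiteness does not depend on the endpoint. The summand 1 gives room for integrands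
  that are merely bounded near the horizon, such as the mass term.\<close>

lemma finite_time:
 assumes r1: "r0 < r1" and fin: "(\<integral>\<^sup>+ s. indicator {r0<..r1} s * ennreal (sqrt (G s / F s)) \<partial>lborel) < \<infinity>"
 shows "(\<integral>\<^sup>+ s. indicator {r0<..b} s * ennreal (1 + ext (%s. sqrt (G s / F s)) s) \<partial>lborel) < \<infinity>"
proof -
 note [measurable] = ext_borel[OF cE(1)]
 obtain C where C: "C >= 0" "ALL s:{r1..b}. \<bar>sqrt (G s / F s)\<bar> <= C" using cont_bounded[OF cE(1) r1] by blast
 have "(\<integral>\<^sup>+ s. indicator {r0<..b} s * ennreal (1 + ext (%s. sqrt (G s / F s)) s) \<partial>lborel) <=
  (\<integral>\<^sup>+ s. ennreal (1 + C) * indicator {r0..b} s + indicator {r0<..r1} s * ennreal (ext (%s. sqrt (G s / F s)) s) \<partial>lborel)"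
 proof (rule nn_integral_mono)
  fix s
  show "indicator {r0<..b} s * ennreal (1 + ext (%s. sqrt (G s / F s)) s) <= ennreal (1 + C) * indicator {r0..b} s + indicator {r0<..r1} s * ennreal (ext (%s. sqrt (G s / F s)) s)"
  proof (cases "r0 < s & s <= b")
   case True
   have q: "0 <= sqrt (G s / F s)" using True Gpos[of s] Fpos[of s] by simp
   show ?thesis
   proof (cases "s <= r1")
    case s: True
    have "ennreal (1 + sqrt (G s / F s)) <= ennreal (1 + C + sqrt (G s / F s))" using C(1) by (intro ennreal_leI) simp
    also have "... = ennreal (1 + C) + ennreal (sqrt (G s / F s))" using C(1) q by (intro ennreal_plus) auto
    finally show ?thesis using True s by simp
   next
    case False
    then have "sqrt (G s / F s) <= C" using C(2)[rule_format, of s] True by auto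
    then show ?thesis using True False by (simp add: ennreal_leI)
   qed
  qed auto
 qed
 also have "... = (\<integral>\<^sup>+ s. ennreal (1 + C) * indicator {r0..b} s \<partial>lborel) + (\<integral>\<^sup>+ s. indicator {r0<..r1} s * ennreal (ext (%s. sqrt (G s / F s)) s) \<partial>lborel)"
  by (rule nn_integral_add) measurable
 also have "(\<integral>\<^sup>+ s. indicator {r0<..r1} s * ennreal (ext (%s. sqrt (G s / F s)) s) \<partial>lborel) = (\<integral>\<^sup>+ s. indicator {r0<..r1} s * ennreal (sqrt (G s / F s)) \<partial>lborel)"
  by (rule nn_integral_cong) (simp add: indicator_def)
 also have "(\<integral>\<^sup>+ s. ennreal (1 + C) * indicator {r0..b} s \<partial>lborel) + ... < \<infinity>"
  using fin emeasure_lborel_Icc_eq[of r0 b] by (simp add: nn_integral_cmult_indicator ennreal_mult_less_top)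
 finally show ?thesis .
qed

lemma radial_sqint:
 assumes rh: "rh : borel_measurable borel" and C: "0 <= C"
  and le: "!!r. r0 < r ==> ca r * (rh r)\<^sup>2 <= C * (indicator {r0<..b} r * (1 + sqrt (G r / F r)))"
  and fin: "(\<integral>\<^sup>+ s. indicator {r0<..b} s * ennreal (1 + ext (%s. sqrt (G s / F s)) s) \<partial>lborel) < \<infinity>"
 shows "sqint H (%p. complex_of_real (rh (fst p)))"
proof (rule sqint_HI)
 show "(%p::real * (real^'d). complex_of_real (rh (fst p))) : borel_measurable borel" using fst_compose_borel[OF rh] by measurable
 define h where "h r = ennreal C * (indicator {r0<..b} r * ennreal (1 + ext (%s. sqrt (G s / F s)) r))" for r
 have hb [measurable]: "h : borel_measurable borel" unfolding h_def using ext_borel[OF cE(1)] by measurable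
 have "(\<integral>\<^sup>+p. ennreal (wt p * (norm (complex_of_real (rh (fst p))))\<^sup>2) \<partial>N) <= (\<integral>\<^sup>+p. h (fst p) \<partial>N)"
 proof (rule nn_integral_mono)
  fix p :: "real * (real^'d)"
  show "ennreal (wt p * (norm (complex_of_real (rh (fst p))))\<^sup>2) <= h (fst p)"
  proof (cases "p : Omega r0")
   case True
   then have r: "r0 < fst p" by (simp add: Omega_def mem_Times_iff)
   have q: "0 <= sqrt (G (fst p) / F (fst p))" using Gpos[OF r] Fpos[OF r] by simp
   have "wt p * (norm (complex_of_real (rh (fst p))))\<^sup>2 <= C * (indicator {r0<..b} (fst p) * (1 + sqrt (G (fst p) / F (fst p))))"
    using le[OF r] True r by (simp add: wt_def)
   then have "ennreal (wt p * (norm (complex_of_real (rh (fst p))))\<^sup>2) <= ennreal (C * (indicator {r0<..b} (fst p) * (1 + sqrt (G (fst p) / F (fst p)))))"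
    by (rule ennreal_leI)
   also have "... = h (fst p)" unfolding h_def using C q r by (cases "fst p <= b") (simp_all add: ennreal_mult)
   finally show ?thesis .
  qed (simp add: wt_zero)
 qed
 also have "... = (\<integral>\<^sup>+r. \<integral>\<^sup>+x. h r \<partial>(sphere_measure :: (real^'d) measure) \<partial>lborel)"
  using P.M2.nn_integral_fst[where f="%p. h (fst p)"] fst_compose_borel[of h] by simp
 also have "... = (\<integral>\<^sup>+r. h r \<partial>lborel) * emeasure (sphere_measure :: (real^'d) measure) UNIV"
  by (simp add: nn_integral_multc)
 also have "... < \<infinity>"
 proof -
  have "(\<integral>\<^sup>+r. h r \<partial>lborel) = ennreal C * (\<integral>\<^sup>+ s. indicator {r0<..b} s * ennreal (1 + ext (%s. sqrt (G s / F s)) s) \<partial>lborel)"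
   unfolding h_def using ext_borel[OF cE(1)] by (intro nn_integral_cmult) measurable
  also have "... < \<infinity>" using fin by (simp add: ennreal_mult_less_top)
  finally have "(\<integral>\<^sup>+r. h r \<partial>lborel) ~= top" by (simp add: less_top)
  moreover have "emeasure (sphere_measure :: (real^'d) measure) UNIV ~= top" using sphere.emeasure_finite[of UNIV] by simp
  ultimately show ?thesis by (simp add: ennreal_mult_eq_top_iff less_top[symmetric])
 qed
 finally show "(\<integral>\<^sup>+p. ennreal (wt p * (norm (complex_of_real (rh (fst p))))\<^sup>2) \<partial>N) < \<infinity>" .
qed

text \<open>\<open>Kl\<close> represents the real part of the flux functional and
  \<open>J' Kl\<close> supplies the imaginary part; adding both keeps the domain stable under
  \<open>\<i>\<close>. Finite travel time puts \<open>Kl\<close> and the cutoff into the Hilbert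
  space, and bounded \<open>F G\<close> does so for its mass component.\<close>

lemma second_extension:
 assumes r1: "r0 < r1" and fin: "(\<integral>\<^sup>+ s. indicator {r0<..r1} s * ennreal (sqrt (G s / F s)) \<partial>lborel) < \<infinity>"
  and FG: "!!b. EX K. ALL r. r0 < r & r <= b --> F r * G r <= K"
 shows "EX KK. form_space H KK JJ & perp H KK \<subseteq> perp H KE & (ALL et. test_fun r0 et --> test_graph et : perp H KK)
  & form_op H (perp H KK) ~= form_op H (perp H KE)"
proof -
 obtain th a b where th: "smooth1 th" and ab: "r0 < a" "a < b" and one: "ALL x<=a. th x = 1" and zero: "ALL x>=b. th x = 0"
  using smooth1_cutoff by blast
 obtain K where K: "ALL r. r0 < r & r <= b --> F r * G r <= K" using FG by blast
 note fin' = finite_time[OF r1 fin, of b]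
 have [measurable]: "th : borel_measurable borel" by (rule borel_measurable_continuous_onI[OF smooth1_cont[OF th]])
 have [measurable]: "deriv th : borel_measurable borel" by (rule borel_measurable_continuous_onI[OF smooth1_cont[OF smooth1_deriv[OF th]]])
 obtain D0 where "ALL x:{a..b}. \<bar>th x\<bar> <= D0" using cont_on_compact_bound[OF smooth1_cont[OF th]] by blast
 then have "\<bar>th x\<bar> <= max D0 1" for x
  using one[rule_format, of x] zero[rule_format, of x] by (cases "x <= a"; cases "b <= x") (auto simp: le_max_iff_disj)
 then obtain D where D: "!!x. \<bar>th x\<bar> <= D" by blast
 have D0: "0 <= D" using D[of 0] by linarith
 have D2: "(th x)\<^sup>2 <= D\<^sup>2" for x using power_mono[OF D[of x] abs_ge_zero, of 2] by simp
 have d0: "deriv th x = 0" if "x ~: {a..b}" for x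
 proof (cases "x < a")
  case True
  have "((%x. 1) has_real_derivative 0) (at x)" by simp
  then have "(th has_real_derivative 0) (at x)"
   by (rule has_field_derivative_transform_within_open[of _ _ _ "{..<a}"]) (use True one in auto)
  then show ?thesis by (rule DERIV_imp_deriv)
 next
  case False
  have "((%x. 0) has_real_derivative 0) (at x)" by simp
  then have "(th has_real_derivative 0) (at x)"
   by (rule has_field_derivative_transform_within_open[of _ _ _ "{b<..}"]) (use False that zero in auto)
  then show ?thesis by (rule DERIV_imp_deriv)
 qed
 define th' where "th' p = complex_of_real (deriv th (fst p))" for p :: "real * (real^'d)"
 define \<Theta> where "\<Theta> p = complex_of_real (th (fst p))" for p :: "real * (real^'d)"
 have s': "strip_bounded th'"
 proof -
  obtain C where C: "ALL x:{a..b}. \<bar>deriv th x\<bar> <= C" using cont_on_compact_bound[OF smooth1_cont[OF smooth1_deriv[OF th]]] by blast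
  have "norm (th' p) <= \<bar>C\<bar>" for p using C d0[of "fst p"] by (cases "fst p : {a..b}") (auto simp: th'_def intro: order_trans[OF _ abs_ge_self])
  moreover have "th' : borel_measurable borel" unfolding th'_def[abs_def] using fst_compose_borel[of "deriv th"] by measurable
  moreover have "ALL p. fst p ~: {a..b} --> th' p = 0" using d0 by (simp add: th'_def)
  ultimately show ?thesis unfolding strip_bounded_def using ab(1) abs_ge_zero by blast
 qed
 have pw: "r powr real n <= b powr real n" if "r0 < r" "r <= b" for r using that r0 by (intro powr_mono2) auto
 have sc: "sqint H \<Theta>"
  unfolding \<Theta>_def[abs_def]
 proof (rule radial_sqint[OF _ _ _ fin'])
  fix r assume r: "r0 < r"
  have q: "0 <= sqrt (G r / F r)" using Gpos[OF r] Fpos[OF r] by simp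
  show "ca r * (th r)\<^sup>2 <= (b powr real n * D\<^sup>2) * (indicator {r0<..b} r * (1 + sqrt (G r / F r)))"
  proof (cases "r <= b")
   case True
   have "(r powr real n * (th r)\<^sup>2) * sqrt (G r / F r) <= (b powr real n * D\<^sup>2) * (1 + sqrt (G r / F r))"
    using pw[OF r True] D2[of r] q by (intro mult_mono) auto
   then show ?thesis using True r by (simp add: coef_a_def mult_ac)
  next
   case False then show ?thesis using zero by simp
  qed
 qed (auto simp: D0)
 \<comment> \<open>The weighted square is the mass coefficient \<open>d\<close> times the squared
   cutoff; \<open>d\<close> contains the root of \<open>F G\<close>, which the bound
   \<open>K\<close> controls down to the horizon.\<close>
 have se: "sqint H (%p. E2 p * \<Theta> p)"
 proof -
  have "sqint H (%p. complex_of_real (ext (%r. m * sqrt (F r)) (fst p) * th (fst p)))"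
  proof (rule radial_sqint[where rh="%r. ext (%r. m * sqrt (F r)) r * th r", OF _ _ _ fin'])
   show "(%r. ext (%r. m * sqrt (F r)) r * th r) : borel_measurable borel" using ext_borel[OF cE(2)] by measurable
   fix r assume r: "r0 < r"
   have q: "0 <= sqrt (G r / F r)" using Gpos[OF r] Fpos[OF r] by simp
   have e2: "ca r * (m * sqrt (F r))\<^sup>2 = cd r" using coef_E(3)[OF r, of 0] r unfolding E2_def norm_of_real power2_abs by simp
   show "ca r * (ext (%r. m * sqrt (F r)) r * th r)\<^sup>2 <= (m\<^sup>2 * b powr real n * sqrt \<bar>K\<bar> * D\<^sup>2) * (indicator {r0<..b} r * (1 + sqrt (G r / F r)))"
   proof (cases "r <= b")
    case True
    have "F r * G r <= \<bar>K\<bar>" using K r True abs_ge_self[of K] by (meson order_trans)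
    then have "(m\<^sup>2 * r powr real n * sqrt (F r * G r) * (th r)\<^sup>2) * 1 <= (m\<^sup>2 * b powr real n * sqrt \<bar>K\<bar> * D\<^sup>2) * (1 + sqrt (G r / F r))"
     using pw[OF r True] D2[of r] q Fpos[OF r] Gpos[OF r] by (intro mult_mono mult_nonneg_nonneg real_sqrt_le_mono) auto
    moreover have "ca r * (ext (%r. m * sqrt (F r)) r * th r)\<^sup>2 = m\<^sup>2 * r powr real n * sqrt (F r * G r) * (th r)\<^sup>2"
     using e2 r unfolding coef_d_def by (simp add: power_mult_distrib mult.assoc[symmetric])
    ultimately show ?thesis using True r by simp
   next
    case False then show ?thesis using zero by simp
   qed
  qed simp
  then show ?thesis by (simp add: E2_def \<Theta>_def)
 qed
 \<comment> \<open>The weighted square is \<open>r^(-n)\<close> times the travel-time integrand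
   times the squared cutoff: this is where the flux is bounded because the travel time is
   finite.\<close>
 have sk: "sqint H (%p. ia p * (E1 p * \<Theta> p))"
 proof -
  have "sqint H (%p. complex_of_real (ext (%r. inverse (ca r)) (fst p) * (ext (%r. sqrt (G r / F r)) (fst p) * th (fst p))))"
  proof (rule radial_sqint[where rh="%r. ext (%r. inverse (ca r)) r * (ext (%r. sqrt (G r / F r)) r * th r)", OF _ _ _ fin'])
   show "(%r. ext (%r. inverse (ca r)) r * (ext (%r. sqrt (G r / F r)) r * th r)) : borel_measurable borel"
    using ext_borel[OF cE(1)] ext_borel[OF cia] by measurable
   fix r assume r: "r0 < r"
   define q where "q = sqrt (G r / F r)"
   have q: "0 < q" using Gpos[OF r] Fpos[OF r] by (simp add: q_def)
   have p: "0 < r powr real n" "0 < r0 powr real n" using r r0 by auto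
   have "ca r * (ext (%r. inverse (ca r)) r * (ext (%r. sqrt (G r / F r)) r * th r))\<^sup>2 = inverse (r powr real n) * q * (th r)\<^sup>2"
    using r q p unfolding coef_a_def by (simp add: q_def[symmetric] field_simps power2_eq_square)
   also have "... <= (inverse (r0 powr real n) * D\<^sup>2) * (indicator {r0<..b} r * (1 + sqrt (G r / F r)))"
   proof (cases "r <= b")
    case True
    have "inverse (r powr real n) <= inverse (r0 powr real n)" using r r0 p by (intro le_imp_inverse_le powr_mono2) auto
    then have "(inverse (r powr real n) * (th r)\<^sup>2) * q <= (inverse (r0 powr real n) * D\<^sup>2) * (1 + q)"
     using D2[of r] q p by (intro mult_mono) auto
    then show ?thesis using True r by (simp add: q_def mult_ac)
   next
    case False then show ?thesis using zero by simp
   qed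
   finally show "ca r * (ext (%r. inverse (ca r)) r * (ext (%r. sqrt (G r / F r)) r * th r))\<^sup>2 <=
    (inverse (r0 powr real n) * D\<^sup>2) * (indicator {r0<..b} r * (1 + sqrt (G r / F r)))" .
  qed simp
  then show ?thesis by (simp add: ia_def E1_def \<Theta>_def)
 qed
 define X :: "real * (real^'d) => complex * complex * complex * (complex^'d)" where
  "X = (%p. (\<Theta> p, of_real (ext (%r. inverse (sqrt (G r / F r))) (fst p)) * th' p, E2 p * \<Theta> p, 0))"
 \<comment> \<open>Pairing with a graph yields the real part of
   \<open>th' u + \<Theta> E1 q1\<close>, the radial derivative of the cutoff times
   \<open>u\<close>.\<close>
 define Kl :: "real * (real^'d) => complex * complex * complex * (complex^'d)" where
  "Kl = (%p. (ia p * th' p, ia p * (E1 p * \<Theta> p), 0, 0))"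
 define J' where "J' U = (%p. (\<i> * fst (U p), JJ (snd (U p))))" for U :: "real * (real^'d) => complex * complex * complex * (complex^'d)"
 define KK where "KK = KE \<union> {Kl, J' Kl}"
 have sX: "sqint H X"
  unfolding sqint_graph_iff X_def using sc se sqint_strip[OF strip_bounded_radial[OF s' cE(4)]] by (simp add: sqint_zero)
 have sKl: "sqint H Kl"
  unfolding sqint_graph_iff Kl_def using sk sqint_strip[OF strip_bounded_radial[OF s' cia]] by (simp add: sqint_zero ia_def)
 have sJ: "sqint H (J' U)" if "sqint H U" for U
  using that unfolding sqint_graph_iff J'_def JJ_def by (simp add: sqint_imult)
 have J_iso: "ip H (J' U) (J' V) = ip H U V" for U V
  unfolding ip_def by (rule bochner_cong[OF refl]) (simp only: J'_def inner_prod_def fst_conv snd_conv imult_inner JJ_inner[unfolded inner_prod_def])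
 have JJ2: "J' (J' U) = (%p. - U p)" for U
  by (auto simp: J'_def JJ_JJ fun_eq_iff prod_eq_iff)
 have t0: "ip H (test_graph et) Kl = 0" if et: "test_fun r0 et" for et
 proof -
  note t = test_fun_smooth_mult[OF et th]
  note [measurable] = sqint_H_borel[OF graph_sqint(1)[OF test_graph[OF et]]] sqint_H_borel[OF sKl] test_fun_borel[OF test_fun_dr_test[OF t]]
  have "ip H (test_graph et) Kl = (LINT p|N. wt p *\<^sub>R (test_graph et p \<bullet> Kl p))" unfolding ip_def by (rule integral_H) measurable
  also have "... = (LINT p|N. Re (dr (%p. of_real (th (fst p)) * et p) p))"
  proof (rule integral_cong_AE)
   show "AE p in N. wt p *\<^sub>R (test_graph et p \<bullet> Kl p) = Re (dr (%p. of_real (th (fst p)) * et p) p)"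
    using AE_N_unit
   proof eventually_elim
    case (elim p)
    show ?case
    proof (cases "r0 < fst p")
     case True
     have w: "wt p = ca (fst p)" using wt_eq[OF True elim] by simp
     have q: "sqrt (G (fst p) / F (fst p)) ~= 0" using Gpos[OF True] Fpos[OF True] by simp
     have c: "x \<bullet> complex_of_real t = t * Re x" for x :: complex and t
      by (simp add: inner_complex_def)
     have c': "Re (complex_of_real s * x) = s * Re x" for s x by simp
     have "test_graph et p \<bullet> Kl p = inverse (ca (fst p)) * (deriv th (fst p) * Re (et p) + th (fst p) * Re (dr et p))"
      using True q unfolding test_graph_def Kl_def ia_def E1_def \<Theta>_def th'_def inner_prod_def fst_conv snd_conv ext_eq[OF True] inner_zero_right of_real_mult[symmetric] c c'
      by (simp add: distrib_left)
     then show ?thesis using ca_pos[OF True] by (simp add: w dr_radial_mult[OF et th])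
    next
     case False
     then have "wt p = 0" by (simp add: wt_def Omega_def indicator_def mem_Times_iff)
     moreover have "dr (%p. of_real (th (fst p)) * et p) p = 0" using strip_bounded_left[OF strip_bounded_test[OF test_fun_dr_test[OF t]]] False by simp
     ultimately show ?thesis by simp
    qed
   qed
  qed measurable
  also have "... = Re (LINT p|N. dr (%p. of_real (th (fst p)) * et p) p)"
   by (rule integral_Re[OF test_fun_integrable_N[OF test_fun_dr_test[OF t]]])
  finally show ?thesis using test_dr_integral_0[OF t] by simp
 qed
 have neg: "ip H U (%p. - V p) = - ip H U V" for U V :: "real * (real^'d) => complex * complex * complex * (complex^'d)"
  using ip_scale_right[of H U "-1" V] by simp
 have swap: "ip H (J' U) V = - ip H U (J' V)" for U V
 proof -
  have "ip H (J' U) (J' (J' V)) = ip H U (J' V)" by (rule J_iso)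
  then show ?thesis unfolding JJ2 neg by simp
 qed
 have perpKK: "U : perp H KK \<longleftrightarrow> U : perp H KE & ip H U Kl = 0 & ip H U (J' Kl) = 0" for U
  unfolding perp_def KK_def by blast
 have tg: "test_graph et : perp H KK" if et: "test_fun r0 et" for et
 proof -
  have "J' (test_graph et) = test_graph (%p. \<i> * et p)"
   unfolding J'_def test_graph_def JJ_def by (simp add: fun_eq_iff dr_scale[OF et] dSt_scale[OF et] vec_eq_iff mult_ac)
  then have "ip H (test_graph et) (J' Kl) = 0" using swap[of "test_graph et" Kl] t0[OF test_fun_scale[OF et, of \<i>]] by simp
  then show ?thesis unfolding perpKK using test_graph[OF et] t0[OF et] by blast
 qed
 have fs: "form_space H KK JJ"
 proof (rule form_spaceI[OF _ _ tg])
  show "ALL K:KK. sqint H K" unfolding KK_def using KE_sqint sKl sJ[OF sKl] by blast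
  fix W assume W: "W : perp H KK"
  have "J' W : perp H KE" using graph_J[of W] W unfolding perpKK J'_def by blast
  moreover have "ip H (J' W) Kl = 0" "ip H (J' W) (J' Kl) = 0" using W swap[of W Kl] J_iso[of W Kl] unfolding perpKK by auto
  ultimately show "(%p. (\<i> * fst (W p), JJ (snd (W p)))) : perp H KK" unfolding perpKK J'_def by blast
 qed
 have XE: "X : perp H KE"
 proof -
  have "wr \<Theta> th'"
   unfolding wr_def
  proof (intro allI impI)
   fix et :: "real * (real^'d) => complex" assume et: "test_fun r0 et"
   note t = test_fun_smooth_mult[OF et th]
   have i: "integrable N (%p. th' p * et p)" "integrable N (%p. \<Theta> p * dr et p)"
    unfolding th'_def \<Theta>_def by (intro test_fun_integrable_N test_fun_smooth_mult et th smooth1_deriv test_fun_dr_test)+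
   have e: "dr (%p. of_real (th (fst p)) * et p) = (%p. th' p * et p + \<Theta> p * dr et p)"
    by (simp add: fun_eq_iff dr_radial_mult[OF et th] th'_def \<Theta>_def)
   have "(LINT p|N. th' p * et p) + (LINT p|N. \<Theta> p * dr et p) = 0"
    using test_dr_integral_0[OF t] Bochner_Integration.integral_add[OF i] unfolding e by simp
   then show "(LINT p|N. \<Theta> p * dr et p) = - (LINT p|N. th' p * et p)" by (simp add: add_eq_0_iff)
  qed
  moreover have "ws \<Theta> (%j p. 0)"
   unfolding ws_def
  proof (intro allI impI)
   fix j and et :: "real * (real^'d) => complex" assume et: "test_fun r0 et"
   have "(LINT p|N. \<Theta> p * dSt r0 et j p) = of_nat n * (LINT p|N. of_real (snd p $ j) * (\<Theta> p * et p))"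
    using test_dSt_integral[OF test_fun_smooth_mult[OF et th], of j] unfolding dSt_radial_mult[OF et th] \<Theta>_def .
   then show "(LINT p|N. \<Theta> p * dSt r0 et j p) = - (LINT p|N. 0 * et p) + of_nat n * (LINT p|N. of_real (snd p $ j) * \<Theta> p * et p)"
    by (simp add: mult.assoc)
  qed
  ultimately show ?thesis
   unfolding perp_KE using sX by (simp only: X_def fst_conv snd_conv E_inverse zero_index mult_zero_right) simp
 qed
 \<comment> \<open>For the cutoff itself the integrand is the derivative of the squared cutoff,
   which falls from 1 to 0 between \<open>a\<close> and \<open>b\<close>; the pairing is minus the
   area of the sphere.\<close>
 have XK: "ip H X Kl ~= 0"
 proof -
  note [measurable] = sqint_H_borel[OF sX] sqint_H_borel[OF sKl]
  define h where "h r = 2 * th r * deriv th r" for r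
  have hb [measurable]: "h : borel_measurable borel" unfolding h_def by measurable
  have hc: "continuous_on {a..b} h" unfolding h_def by (intro continuous_intros smooth1_cont th smooth1_deriv)
  obtain C where C: "ALL x:{a..b}. \<bar>h x\<bar> <= C" using cont_on_compact_bound[OF hc] by blast
  have h0: "h r = 0" if "r ~: {a..b}" for r using d0[OF that] by (simp add: h_def)
  have i: "integrable N (%p. h (fst p))"
  proof (rule bochner_bound)
   show "integrable N (%p. C * indicator {a..b} (fst p))" using strip_integrable by (rule integrable_mult_right)
   show "(%p. h (fst p)) : borel_measurable N" using fst_compose_borel[OF hb] by measurable
   show "AE p in N. norm (h (fst p)) <= norm (C * indicator {a..b} (fst p))"
   proof (rule AE_I2)
    fix p show "norm (h (fst p)) <= norm (C * indicator {a..b} (fst p))"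
     using C h0[of "fst p"] by (cases "fst p : {a..b}") (auto intro: order_trans[OF _ abs_ge_self])
   qed
  qed
  have "ip H X Kl = (LINT p|N. wt p *\<^sub>R (X p \<bullet> Kl p))" unfolding ip_def by (rule integral_H) measurable
  also have "... = (LINT p|N. h (fst p))"
  proof (rule integral_cong_AE)
   show "(%p. h (fst p)) : borel_measurable N" using fst_compose_borel[OF hb] by measurable
   show "AE p in N. wt p *\<^sub>R (X p \<bullet> Kl p) = h (fst p)"
    using AE_N_unit
   proof eventually_elim
    case (elim p)
    show ?case
    proof (cases "r0 < fst p")
     case True
     have w: "wt p = ca (fst p)" using wt_eq[OF True elim] by simp
     have q: "sqrt (G (fst p) / F (fst p)) ~= 0" using Gpos[OF True] Fpos[OF True] by simp
     have c: "complex_of_real s \<bullet> of_real t = s * t" for s t by (simp add: inner_complex_def)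
     have "X p \<bullet> Kl p = inverse (ca (fst p)) * h (fst p)"
      using True q unfolding X_def Kl_def ia_def E1_def \<Theta>_def th'_def inner_prod_def fst_conv snd_conv ext_eq[OF True] inner_zero_right of_real_mult[symmetric] c
      by (simp add: h_def)
     then show ?thesis using ca_pos[OF True] by (simp add: w)
    next
     case False
     then have "wt p = 0" "fst p ~: {a..b}" using ab(1) by (auto simp: wt_def Omega_def indicator_def mem_Times_iff)
     then show ?thesis using h0 by simp
    qed
   qed
  qed measurable
  also have "... = (LINT r|lborel. LINT x|(sphere_measure :: (real^'d) measure). h r)" using P.integral_fst'[OF i] by simp
  also have "... = measure (sphere_measure :: (real^'d) measure) UNIV * (LINT r|lborel. h r)" by simp
  also have "(LINT r|lborel. h r) = (LINT r|lborel. indicator {a..b} r *\<^sub>R h r)"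
   by (rule bochner_cong[OF refl]) (use h0 in \<open>auto simp: indicator_def\<close>)
  also have "... = (th b)\<^sup>2 - (th a)\<^sup>2"
  proof (rule integral_FTC_Icc[OF _ _ hc])
   show "a <= b" using ab by simp
   show "((%r. (th r)\<^sup>2) has_vector_derivative h r) (at r within {a..b})" for r
    unfolding h_def has_real_derivative_iff_has_vector_derivative[symmetric]
    by (rule has_field_derivative_at_within) (use smooth1_has_deriv[OF th, of r] in \<open>auto intro!: derivative_eq_intros\<close>)
  qed
  also have "... = -1" using one[rule_format, of a] zero[rule_format, of b] by simp
  finally show ?thesis using measure_sphere_pos[where 'd='d] by simp
 qed
 have sub: "perp H KK \<subseteq> perp H KE" using perpKK by blast
 have "form_op H (perp H KK) ~= form_op H (perp H KE)"
 proof
  assume eq: "form_op H (perp H KK) = form_op H (perp H KE)"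
  have "perp H KE \<subseteq> perp H KK"
   by (rule form_op_inj[OF fs form_space_KE sub _ eq]) (rule graph_gradient_unique)
  then have "X : perp H KK" using XE by blast
  then show False using XK unfolding perpKK by blast
 qed
 then show ?thesis using fs sub tg by blast
qed

end

text \<open>Since \<open>-p\<^sub>r \<le> \<rho>\<close>, the radial and the temporal Einstein equation give \<open>(FG)' \<ge> 0\<close>.\<close>
lemma DEC_FG_mono:
 assumes n: "0 < n" and r: "0 < r" and FG: "0 < F r" "0 < G r" and DEC: "\<bar>p_rad n \<Lambda> F F1 G r\<bar> <= rho n \<Lambda> G G1 r"
 shows "0 <= F1 r * G r + G1 r * F r"
proof -
 have "- p_rad n \<Lambda> F F1 G r <= rho n \<Lambda> G G1 r" using DEC by linarith
 then have "0 <= (einstein_rr n F F1 G r - einstein_tt n G G1 r) / (8 * pi)"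
  unfolding p_rad_def rho_def by (simp add: field_simps)
 then have "0 <= einstein_rr n F F1 G r - einstein_tt n G G1 r" using pi_gt_zero by (simp only: zero_le_divide_iff) linarith
 also have "... = (real n / 2) * (F1 r / F r / (G r * r) + G1 r / G r / (G r * r))"
 proof -
  have "k * (f - y * z / w) - - k * (y * z / w + h) = k * (f + h)" for k f h y z w :: real
   by (simp add: algebra_simps)
  from this[of "real n / 2" "2 * (F1 r / (2 * F r)) / (G r * r)" "real n - 1" "1 - 1 / G r" "r\<^sup>2" "2 * (G1 r / (2 * G r)) / (G r * r)"]
  show ?thesis unfolding einstein_rr_def einstein_tt_def by simp
 qed
 also have "... = real n / (2 * F r * G r * G r * r) * (F1 r * G r + G1 r * F r)"
  using r FG by (simp add: field_simps)
 finally have "0 <= real n / (2 * F r * G r * G r * r) * (F1 r * G r + G1 r * F r)" .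
 moreover have "0 < real n / (2 * F r * G r * G r * r)" using n r FG by simp
 ultimately show ?thesis using zero_le_mult_iff[of "real n / (2 * F r * G r * G r * r)" "F1 r * G r + G1 r * F r"] by linarith
qed

context exterior
begin

lemma FG_bounded:
 assumes "!!r. r0 < r ==> 0 <= F1 r * G r + G1 r * F r"
 shows "EX K. ALL r. r0 < r & r <= b --> F r * G r <= K"
proof (intro exI allI impI)
 fix r assume r: "r0 < r & r <= b"
 show "F r * G r <= F b * G b"
 proof (rule DERIV_nonneg_imp_nondecreasing[where f="%r. F r * G r"])
  fix x assume "r <= x" "x <= b"
  then have x: "r0 < x" using r by simp
  show "EX y. ((%r. F r * G r) has_real_derivative y) (at x) & 0 <= y"
   using DERIV_mult[OF dF[OF x] dG[OF x]] assms[OF x] by blast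
 qed (use r in simp)
qed

lemma form_op_quasi:
 assumes "perp H KK \<subseteq> perp H KE"
 shows "fst ` form_op H (perp H KK) \<subseteq> energy_space r0 F G m &
  (EX C. ALL (u, v):form_op H (perp H KK). energy_norm r0 F G m u <= C * sqrt ((Lnorm H u)\<^sup>2 + (Lnorm H v)\<^sup>2))"
proof
 show "fst ` form_op H (perp H KK) \<subseteq> energy_space r0 F G m"
  using form_op_energy(1)[OF _ assms] by auto
 show "EX C. ALL (u, v):form_op H (perp H KK). energy_norm r0 F G m u <= C * sqrt ((Lnorm H u)\<^sup>2 + (Lnorm H v)\<^sup>2)"
  using form_op_energy(2)[OF _ assms] by (intro exI[of _ 2]) auto
qed

text \<open>One second extension settles both uniqueness notions, because it has its domain in the
  energy space with the same norm bound. Conversely, when only one extension exists, it is the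
  maximal form operator, which meets the energy condition.\<close>

lemma equivalence:
 assumes lim: "(F \<longlongrightarrow> 1) at_top" "(G \<longlongrightarrow> 1) at_top" and FG: "!!r. r0 < r ==> 0 <= F1 r * G r + G1 r * F r"
 shows "((ALL r>r0. (\<integral>\<^sup>+ s. indicator {r0<..r} s * ennreal (sqrt (G s / F s)) \<partial>lborel) = \<infinity>)
      \<longleftrightarrow> quasi_ess_selfadjoint_A TYPE('d) r0 F G m)
   & (quasi_ess_selfadjoint_A TYPE('d) r0 F G m \<longleftrightarrow> ess_selfadjoint_A TYPE('d) r0 F G m)"
proof -
 let ?Q = "%S :: ((real * (real^'d) => complex) \<times> (real * (real^'d) => complex)) set. fst ` S \<subseteq> energy_space r0 F G m &
  (EX C. ALL (u, v):S. energy_norm r0 F G m u <= C * sqrt ((Lnorm H u)\<^sup>2 + (Lnorm H v)\<^sup>2))"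
 define S0 where "S0 = form_op H (perp H KE)"
 have S0: "sa_extension_of_A r0 F G m S0" "?Q S0"
  unfolding S0_def by (rule A_op_extension[OF form_space_KE order_refl test_graph], assumption, rule form_op_quasi[OF order_refl])
 show ?thesis
 proof (cases "ALL r>r0. (\<integral>\<^sup>+ s. indicator {r0<..r} s * ennreal (sqrt (G s / F s)) \<partial>lborel) = \<infinity>")
  case True
  then have u: "S = S0" if "sa_extension_of_A r0 F G m S" for S
   unfolding S0_def using that by (intro extension_unique[OF _ lim]) auto
  have "quasi_ess_selfadjoint_A TYPE('d) r0 F G m"
   unfolding quasi_ess_selfadjoint_A_def
  proof (rule ex1I)
   show "sa_extension_of_A r0 F G m S0 & ?Q S0" using S0 by (rule conjI)
  qed (rule u, erule conjunct1)
  moreover have "ess_selfadjoint_A TYPE('d) r0 F G m"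
   unfolding ess_selfadjoint_A_def by (rule ex1I[where P="sa_extension_of_A r0 F G m", OF S0(1) u])
  ultimately show ?thesis using True by blast
 next
  case False
  then obtain r1 where r1: "r0 < r1" "(\<integral>\<^sup>+ s. indicator {r0<..r1} s * ennreal (sqrt (G s / F s)) \<partial>lborel) < \<infinity>"
   by (auto simp: less_top[symmetric])
  obtain KK where KK: "form_space H KK JJ" "perp H KK \<subseteq> perp H KE"
   and t: "ALL et. test_fun r0 et --> test_graph et : perp H KK" and ne: "form_op H (perp H KK) ~= form_op H (perp H KE)"
   using second_extension[OF r1 FG_bounded[OF FG]] by blast
  define S1 where "S1 = form_op H (perp H KK)"
  have S1: "sa_extension_of_A r0 F G m S1" "?Q S1" "S1 ~= S0"
   unfolding S1_def S0_def by (rule A_op_extension[OF KK t[rule_format]], assumption, rule form_op_quasi[OF KK(2)], rule ne)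
  have two: "~ (EX! S. R S)" if "R S0" "R S1" for R
   using that S1(3) by (auto simp: Ex1_def)
  have "~ quasi_ess_selfadjoint_A TYPE('d) r0 F G m"
   unfolding quasi_ess_selfadjoint_A_def by (rule two[OF conjI[OF S0] conjI[OF S1(1,2)]])
  moreover have "~ ess_selfadjoint_A TYPE('d) r0 F G m"
   unfolding ess_selfadjoint_A_def by (rule two[OF S0(1) S1(1)])
  ultimately show ?thesis using False by blast
 qed
qed

end

theorem theorem5p5:
  fixes r0 \<Lambda> m :: real and F F1 F2 G G1 :: "real \<Rightarrow> real"
  assumes dim: "CARD('d::finite) \<ge> 2"
    and r0: "0 < r0"
    and pos: "\<forall>r>r0. 0 < F r \<and> 0 < G r"
    and dF: "\<forall>r>r0. (F has_real_derivative F1 r) (at r)"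
    and dF1: "\<forall>r>r0. (F1 has_real_derivative F2 r) (at r)"
    and cF2: "continuous_on {r0<..} F2"
    and dG: "\<forall>r>r0. (G has_real_derivative G1 r) (at r)"
    and cG1: "continuous_on {r0<..} G1"
    and limF: "(F \<longlongrightarrow> 1) at_top"
    and limG: "(G \<longlongrightarrow> 1) at_top"
    and DEC: "\<forall>r>r0. \<bar>p_rad (CARD('d) - 1) \<Lambda> F F1 G r\<bar> \<le> rho (CARD('d) - 1) \<Lambda> G G1 r \<and>
                     \<bar>p_ang (CARD('d) - 1) \<Lambda> F F1 F2 G G1 r\<bar> \<le> rho (CARD('d) - 1) \<Lambda> G G1 r"
    and m: "m \<ge> 0"
  shows "((\<forall>r>r0. (\<integral>\<^sup>+ s. indicator {r0<..r} s * ennreal (sqrt (G s / F s)) \<partial>lborel) = \<infinity>)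
            \<longleftrightarrow> quasi_ess_selfadjoint_A TYPE('d) r0 F G m)
       \<and> (quasi_ess_selfadjoint_A TYPE('d) r0 F G m \<longleftrightarrow> ess_selfadjoint_A TYPE('d) r0 F G m)"
proof -
  have "continuous_on {r0<..} F1"
    by (rule DERIV_continuous_on[where D=F2]) (use dF1 in \<open>auto intro: has_field_derivative_at_within\<close>)
  then interpret exterior r0 m F F1 G G1 "CARD('d) - 1" "TYPE('d)"
    using dim r0 pos dF dG cG1 m by unfold_locales auto
  show ?thesis
  proof (rule equivalence[OF limF limG])
    fix r assume r: "r0 < r"
    show "0 \<le> F1 r * G r + G1 r * F r"
      by (rule DEC_FG_mono[of "CARD('d) - 1" r F G \<Lambda>]) (use dim r0 r pos DEC in auto)
  qed
qed

end
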